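(* Let $(W,\lambda)$ be a Liouville domain and let $H\in\mathcal H(W,\lambda)$ be autonomous. For any $n\in\mathbb N$, $$\Big(\min_W\tau_{\lambda,H}\Big)\,h_{\rm top}\big(\varphi^1_{(\alpha_H)_n}\big)\le h_{\rm top}(\varphi^1_H)\le\Big(\max_W\tau_{\lambda,H}\Big)\,h_{\rm top}\big(\varphi^1_{(\alpha_H)_n}\big).$$ Moreover, if $h_{\rm top}(\varphi^1_{\lambda|_{\partial W}})>0$, then $h_{\rm top}(\varphi^1_{(\alpha_H)_n})>0$ for every $n\in\mathbb N$.
   Context: A Liouville domain $(W,\lambda)$ is a compact exact symplectic manifold with boundary (symplectic form $d\lambda$) whose Liouville vector field $Y_\lambda$, defined by $\iota_{Y_\lambda}d\lambda=\lambda$, is outward transverse to $\partial W$. For $H:W\to\mathbb R$ smooth and autonomous, $X_H$ is defined by $\iota_{X_H}d\lambda=dH$, $\tau_{\lambda,H}=\lambda(X_H)+H$, and $H\in\mathcal H(W,\lambda)$ means $H|_{\partial W}\equiv0$ and $\tau_{\lambda,H}>0$ on $W$. $\varphi^1_H:W\to W$ is the time-1 map of the Hamiltonian flow. Iterated tubes: for $n\ge1$, $$(W_H)_n=\Big\{(w,z_1,\dots,z_n)\in W\times\mathbb C^n\ \Big|\ \pi\sum_{i=1}^n|z_i|^2\le H(w)\Big\},\qquad\lambda_n=\lambda+\frac12\sum_{i=1}^nr_i^2\,d\theta_i,$$ where $z_i=r_ie^{\sqrt{-1}\theta_i}$; this is a Liouville domain, and $(\alpha_H)_n:=\lambda_n|_{\partial(W_H)_n}$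 is the induced contact form on its boundary. For a contact form $\alpha$, $\varphi^1_\alpha$ denotes the time-1 map of its Reeb flow. $h_{\rm top}$ is topological entropy. *)

theory Defs
  imports "HOL-Analysis.Analysis"
begin

section \<open>Smooth maps on subsets of Euclidean space\<close>

primrec C_diff :: "nat \<Rightarrow> 'e::euclidean_space set \<Rightarrow> ('e \<Rightarrow> 'f::real_normed_vector) \<Rightarrow> bool" where
  "C_diff 0 U f \<longleftrightarrow> continuous_on U f"
| "C_diff (Suc k) U f \<longleftrightarrow>
     f differentiable_on U \<and> (\<forall>v. C_diff k U (\<lambda>x. frechet_derivative f (at x) v))"

definition smooth_on :: "'e::euclidean_space set \<Rightarrow> ('e \<Rightarrow> 'f::real_normed_vector) \<Rightarrow> bool" where
  "smooth_on S f \<longleftrightarrow>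
     (\<forall>x\<in>S. \<exists>U g. open U \<and> x \<in> U \<and> (\<forall>k. C_diff k U g) \<and> (\<forall>y\<in>S \<inter> U. g y = f y))"


section \<open>Smooth manifolds with boundary\<close>

text \<open>The atlas is a family indexed by \<open>idx\<close>. The chart \<open>i\<close> is a homeomorphism from the open
  set \<open>cdom i\<close> onto a relatively open subset of the half-space of all \<open>x\<close> with \<open>0 \<le> x \<bullet> nu\<close>; it is
  meaningless outside \<open>cdom i\<close>. Since \<open>nu\<close> is nonzero and points inward, a tangent vector \<open>v\<close> at
  a boundary point is tangent to the boundary iff \<open>v \<bullet> nu = 0\<close>, and outward transverse iff
  \<open>v \<bullet> nu < 0\<close>.\<close>

record ('a, 'i, 'e) mfd =
  topo :: "'a topology"
  idx :: "'i set"
  cdom :: "'i \<Rightarrow> 'a set"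
  chart :: "'i \<Rightarrow> 'a \<Rightarrow> 'e"
  nu :: 'e

definition points :: "('a, 'i, 'e) mfd \<Rightarrow> 'a set" where
  "points M = topspace (topo M)"

definition halfspace :: "'e::euclidean_space \<Rightarrow> 'e set" where
  "halfspace b = {x. 0 \<le> x \<bullet> b}"

definition coords :: "('a, 'i, 'e) mfd \<Rightarrow> 'i \<Rightarrow> 'e set" where
  "coords M i = chart M i ` cdom M i"

definition param :: "('a, 'i, 'e) mfd \<Rightarrow> 'i \<Rightarrow> 'e \<Rightarrow> 'a" where
  "param M i = inv_into (cdom M i) (chart M i)"

definition smooth_manifold :: "('a, 'i, 'e::euclidean_space) mfd \<Rightarrow> bool" where
  "smooth_manifold M \<longleftrightarrow>
     Hausdorff_space (topo M) \<and> second_countable (topo M) \<and> nu M \<noteq> 0 \<and>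
     (\<Union>i\<in>idx M. cdom M i) = points M \<and>
     (\<forall>i\<in>idx M. openin (topo M) (cdom M i) \<and>
        openin (top_of_set (halfspace (nu M))) (coords M i) \<and>
        homeomorphic_map (subtopology (topo M) (cdom M i)) (top_of_set (coords M i)) (chart M i)) \<and>
     (\<forall>i\<in>idx M. \<forall>j\<in>idx M.
        smooth_on (chart M i ` (cdom M i \<inter> cdom M j)) (chart M j \<circ> param M i))"

definition boundary :: "('a, 'i, 'e::euclidean_space) mfd \<Rightarrow> 'a set" where
  "boundary M = {p \<in> points M. \<exists>i\<in>idx M. p \<in> cdom M i \<and> chart M i p \<bullet> nu M = 0}"

definition chart_at :: "('a, 'i, 'e) mfd \<Rightarrow> 'a \<Rightarrow> 'i" where
  "chart_at M p = (SOME i. i \<in> idx M \<and> p \<in> cdom M i)"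

definition smooth_fun :: "('a, 'i, 'e::euclidean_space) mfd \<Rightarrow> ('a \<Rightarrow> real) \<Rightarrow> bool" where
  "smooth_fun M f \<longleftrightarrow> (\<forall>i\<in>idx M. smooth_on (coords M i) (f \<circ> param M i))"


section \<open>One-forms, vector fields and flows\<close>

text \<open>Forms and vector fields are given by their local expressions: \<open>lam i x u\<close> is the value at the
  point with coordinates \<open>x\<close> in chart \<open>i\<close> on the tangent vector with components \<open>u\<close>.\<close>

type_synonym ('i, 'e) form1 = "'i \<Rightarrow> 'e \<Rightarrow> 'e \<Rightarrow> real"
type_synonym ('i, 'e) vfield = "'i \<Rightarrow> 'e \<Rightarrow> 'e"

definition one_form :: "('a, 'i, 'e::euclidean_space) mfd \<Rightarrow> ('i, 'e) form1 \<Rightarrow> bool" where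
  "one_form M lam \<longleftrightarrow>
     (\<forall>i\<in>idx M. (\<forall>x\<in>coords M i. linear (lam i x)) \<and>
                 (\<forall>u. smooth_on (coords M i) (\<lambda>x. lam i x u))) \<and>
     (\<forall>i\<in>idx M. \<forall>j\<in>idx M. \<forall>p\<in>cdom M i \<inter> cdom M j. \<forall>u.
        lam i (chart M i p) u =
        lam j (chart M j p)
          (frechet_derivative (chart M j \<circ> param M i)
             (at (chart M i p) within chart M i ` (cdom M i \<inter> cdom M j)) u))"

definition dform :: "('a, 'i, 'e::euclidean_space) mfd \<Rightarrow> ('i, 'e) form1 \<Rightarrow> 'i \<Rightarrow> 'e \<Rightarrow> 'e \<Rightarrow> 'e \<Rightarrow> real"
  where
  "dform M lam i x u v =
     frechet_derivative (\<lambda>y. lam i y v) (at x within coords M i) u -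
     frechet_derivative (\<lambda>y. lam i y u) (at x within coords M i) v"

definition integral_curve ::
    "('a, 'i, 'e::euclidean_space) mfd \<Rightarrow> ('i, 'e) vfield \<Rightarrow> 'a set \<Rightarrow> (real \<Rightarrow> 'a) \<Rightarrow> bool" where
  "integral_curve M X S c \<longleftrightarrow>
     continuous_map euclideanreal (subtopology (topo M) S) c \<and>
     (\<forall>t. \<forall>i\<in>idx M. c t \<in> cdom M i \<longrightarrow>
        ((chart M i \<circ> c) has_vector_derivative X i (chart M i (c t))) (at t))"

text \<open>The flow of \<open>X\<close> on \<open>S\<close>, for \<open>X\<close> tangent to \<open>S\<close>. It is used with \<open>S\<close> the whole manifold
  and with \<open>S\<close> its boundary.\<close>

definition flow_map ::
    "('a, 'i, 'e::euclidean_space) mfd \<Rightarrow> ('i, 'e) vfield \<Rightarrow> 'a set \<Rightarrow> real \<Rightarrow> 'a \<Rightarrow> 'a" where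
  "flow_map M X S t p = (THE q. \<exists>c. integral_curve M X S c \<and> c 0 = p \<and> c t = q)"


section \<open>Liouville domains, Hamiltonian flows and Reeb flows\<close>

definition liouville_field :: "('a, 'i, 'e::euclidean_space) mfd \<Rightarrow> ('i, 'e) form1 \<Rightarrow> ('i, 'e) vfield"
  where
  "liouville_field M lam i x = (THE v. \<forall>u. dform M lam i x v u = lam i x u)"

definition liouville_domain :: "('a, 'i, 'e::euclidean_space) mfd \<Rightarrow> ('i, 'e) form1 \<Rightarrow> bool" where
  "liouville_domain M lam \<longleftrightarrow>
     smooth_manifold M \<and> compact_space (topo M) \<and> one_form M lam \<and>
     (\<forall>i\<in>idx M. \<forall>x\<in>coords M i. \<forall>u. (\<forall>v. dform M lam i x u v = 0) \<longrightarrow> u = 0) \<and>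
     (\<forall>i\<in>idx M. \<forall>x\<in>coords M i. x \<bullet> nu M = 0 \<longrightarrow> liouville_field M lam i x \<bullet> nu M < 0)"

definition ham_field ::
    "('a, 'i, 'e::euclidean_space) mfd \<Rightarrow> ('i, 'e) form1 \<Rightarrow> ('a \<Rightarrow> real) \<Rightarrow> ('i, 'e) vfield" where
  "ham_field M lam H i x =
     (THE v. \<forall>u. dform M lam i x v u =
                 frechet_derivative (H \<circ> param M i) (at x within coords M i) u)"

definition ham_time1 ::
    "('a, 'i, 'e::euclidean_space) mfd \<Rightarrow> ('i, 'e) form1 \<Rightarrow> ('a \<Rightarrow> real) \<Rightarrow> 'a \<Rightarrow> 'a" where
  "ham_time1 M lam H = flow_map M (ham_field M lam H) (points M) 1"

text \<open>The value at \<open>p\<close> does not depend on the chart.\<close>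

definition tau ::
    "('a, 'i, 'e::euclidean_space) mfd \<Rightarrow> ('i, 'e) form1 \<Rightarrow> ('a \<Rightarrow> real) \<Rightarrow> 'a \<Rightarrow> real" where
  "tau M lam H p =
     (let i = chart_at M p; x = chart M i p in lam i x (ham_field M lam H i x) + H p)"

definition admissible ::
    "('a, 'i, 'e::euclidean_space) mfd \<Rightarrow> ('i, 'e) form1 \<Rightarrow> ('a \<Rightarrow> real) \<Rightarrow> bool" where
  "admissible M lam H \<longleftrightarrow>
     smooth_fun M H \<and> (\<forall>p\<in>boundary M. H p = 0) \<and> (\<forall>p\<in>points M. tau M lam H p > 0)"

text \<open>The Reeb vector field of the contact form on the boundary obtained by restricting \<open>lam\<close>. The
  differential of the restricted form is the restriction of the differential.\<close>

definition reeb_field :: "('a, 'i, 'e::euclidean_space) mfd \<Rightarrow> ('i, 'e) form1 \<Rightarrow> ('i, 'e) vfield" where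
  "reeb_field M lam i x =
     (THE v. v \<bullet> nu M = 0 \<and> lam i x v = 1 \<and> (\<forall>u. u \<bullet> nu M = 0 \<longrightarrow> dform M lam i x v u = 0))"

definition reeb_time1 :: "('a, 'i, 'e::euclidean_space) mfd \<Rightarrow> ('i, 'e) form1 \<Rightarrow> 'a \<Rightarrow> 'a" where
  "reeb_time1 M lam = flow_map M (reeb_field M lam) (boundary M) 1"


section \<open>Topological entropy\<close>

text \<open>Entropy of a continuous self-map of a compact space, by open covers (Adler, Konheim and
  McAndrew). The upper limit is a limit, by subadditivity.\<close>

definition open_cover :: "'a topology \<Rightarrow> 'a set set \<Rightarrow> bool" where
  "open_cover X \<U> \<longleftrightarrow> (\<forall>U\<in>\<U>. openin X U) \<and> \<Union>\<U> = topspace X"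

definition cover_number :: "'a topology \<Rightarrow> 'a set set \<Rightarrow> nat" where
  "cover_number X \<U> = (LEAST k. \<exists>\<V>\<subseteq>\<U>. finite \<V> \<and> card \<V> = k \<and> \<Union>\<V> = topspace X)"

definition dynamical_join :: "'a topology \<Rightarrow> ('a \<Rightarrow> 'a) \<Rightarrow> 'a set set \<Rightarrow> nat \<Rightarrow> 'a set set" where
  "dynamical_join X f \<U> n = {{x \<in> topspace X. \<forall>k<n. (f ^^ k) x \<in> s k} | s. \<forall>k<n. s k \<in> \<U>}"

definition top_entropy :: "'a topology \<Rightarrow> ('a \<Rightarrow> 'a) \<Rightarrow> ereal" where
  "top_entropy X f =
     (SUP \<U>\<in>{\<U>. open_cover X \<U>}.
        limsup (\<lambda>n. ereal (ln (real (cover_number X (dynamical_join X f \<U> n))) / real n)))"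

definition reeb_entropy :: "('a, 'i, 'e::euclidean_space) mfd \<Rightarrow> ('i, 'e) form1 \<Rightarrow> ereal" where
  "reeb_entropy M lam = top_entropy (subtopology (topo M) (boundary M)) (reeb_time1 M lam)"

definition ham_entropy ::
    "('a, 'i, 'e::euclidean_space) mfd \<Rightarrow> ('i, 'e) form1 \<Rightarrow> ('a \<Rightarrow> real) \<Rightarrow> ereal" where
  "ham_entropy M lam H = top_entropy (topo M) (ham_time1 M lam H)"


section \<open>Iterated tubes\<close>

definition times_Cn ::
    "('a, 'i, 'e::euclidean_space) mfd \<Rightarrow> ('a \<times> (complex^'n::finite), 'i, 'e \<times> (complex^'n)) mfd" where
  "times_Cn M =
     \<lparr> topo = prod_topology (topo M) euclidean,
       idx = idx M,
       cdom = (\<lambda>i. cdom M i \<times> UNIV),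
       chart = (\<lambda>i (p, z). (chart M i p, z)),
       nu = (nu M, 0) \<rparr>"

text \<open>In each complex factor \<open>r\<^sup>2 d\<theta> = x dy - y dx\<close>, whose value at \<open>z\<close> on the vector \<open>w\<close> is
  the imaginary part of \<open>cnj z * w\<close>.\<close>

definition times_Cn_form ::
    "('i, 'e::euclidean_space) form1 \<Rightarrow> ('i, 'e \<times> (complex^'n::finite)) form1" where
  "times_Cn_form lam i = (\<lambda>(x, z) (u, w). lam i x u + (1/2) * (\<Sum>k\<in>UNIV. Im (cnj (z $ k) * (w $ k))))"

text \<open>The structure of manifold with boundary induced on a domain \<open>S\<close> of full dimension in \<open>M\<close>. Its
  charts are all pairs \<open>(U, f)\<close> with \<open>f\<close> a homeomorphism from the open subset \<open>U\<close> of \<open>S\<close> onto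
  a relatively open subset of the half-space, such that \<open>f\<close> and its inverse are smooth with respect
  to the charts of \<open>M\<close>. The set \<open>S\<close> may touch \<open>boundary M\<close>; the boundary of \<open>S\<close> is the one given by these charts.\<close>

definition induced_charts ::
    "('a, 'i, 'e::euclidean_space) mfd \<Rightarrow> 'a set \<Rightarrow> ('a set \<times> ('a \<Rightarrow> 'e)) set" where
  "induced_charts M S =
     {(U, f). openin (subtopology (topo M) S) U \<and>
        openin (top_of_set (halfspace (nu M))) (f ` U) \<and>
        homeomorphic_map (subtopology (topo M) U) (top_of_set (f ` U)) f \<and>
        (\<forall>i\<in>idx M. smooth_on (chart M i ` (U \<inter> cdom M i)) (f \<circ> param M i) \<and>
                    smooth_on (f ` (U \<inter> cdom M i)) (chart M i \<circ> inv_into U f))}"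

definition induced_domain ::
    "('a, 'i, 'e::euclidean_space) mfd \<Rightarrow> 'a set \<Rightarrow> ('a, 'a set \<times> ('a \<Rightarrow> 'e), 'e) mfd" where
  "induced_domain M S =
     \<lparr> topo = subtopology (topo M) S, idx = induced_charts M S, cdom = fst, chart = snd, nu = nu M \<rparr>"

definition induced_form ::
    "('a, 'i, 'e::euclidean_space) mfd \<Rightarrow> ('i, 'e) form1 \<Rightarrow> ('a set \<times> ('a \<Rightarrow> 'e), 'e) form1" where
  "induced_form M lam = (\<lambda>(U, f) x u.
     let p = inv_into U f x; i = chart_at M p in
     lam i (chart M i p)
       (frechet_derivative (chart M i \<circ> inv_into U f) (at x within f ` (U \<inter> cdom M i)) u))"

definition tube_set :: "('a, 'i, 'e) mfd \<Rightarrow> ('a \<Rightarrow> real) \<Rightarrow> ('a \<times> (complex^'n::finite)) set" where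
  "tube_set W H = {(w, z). w \<in> points W \<and> pi * (\<Sum>k\<in>UNIV. (cmod (z $ k))\<^sup>2) \<le> H w}"

text \<open>The number of complex coordinates is \<open>CARD('n)\<close>.\<close>

definition tube ::
    "'n itself \<Rightarrow> ('a, 'i, 'e::euclidean_space) mfd \<Rightarrow> ('a \<Rightarrow> real) \<Rightarrow>
     ('a \<times> (complex^'n::finite),
      ('a \<times> (complex^'n)) set \<times> ('a \<times> (complex^'n) \<Rightarrow> 'e \<times> (complex^'n)),
      'e \<times> (complex^'n)) mfd" where
  "tube _ W H = induced_domain (times_Cn W) (tube_set W H)"

definition tube_form ::
    "'n itself \<Rightarrow> ('a, 'i, 'e::euclidean_space) mfd \<Rightarrow> ('i, 'e) form1 \<Rightarrow>
     (('a \<times> (complex^'n::finite)) set \<times> ('a \<times> (complex^'n) \<Rightarrow> 'e \<times> (complex^'n)),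
      'e \<times> (complex^'n)) form1" where
  "tube_form _ W lam = induced_form (times_Cn W) (times_Cn_form lam)"

end

theory Submission imports Defs begin


text \<open>On the boundary of a Liouville domain \<open>dH\<close> is a multiple of the conormal, so \<open>X_H\<close> is a multiple of the Reeb field,
  the factor being \<open>tau\<close>. The same applies to \<open>F = H - pi |z|^2\<close> on the tube \<open>F \<ge> 0\<close>, because
  \<open>lambda_n (X_F) = tau - F\<close>: on the boundary \<open>F = 0\<close> the Reeb field is \<open>X_F / tau\<close>. The flow of \<open>X_F\<close> is the
  product of the flow of \<open>X_H\<close> with the rotation of \<open>z\<close> by \<open>2 pi t\<close>. So its time-one map fixes \<open>z\<close>, and its entropy
  on \<open>F = 0\<close>, which projects onto \<open>W\<close>, is that of the time-one map of \<open>X_H\<close>. The two inequalities compare the entropies of a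
  flow and of its time change by \<open>tau\<close>. For the last claim, the boundary of \<open>W\<close> is invariant under \<open>X_H\<close> and
  carries the time-changed Reeb flow, so positive Reeb entropy there forces positive entropy of \<open>X_H\<close>.\<close>

section \<open>Calculus of \<open>C_diff\<close> and \<open>smooth_on\<close>\<close>

text \<open>Both time-one maps come from \<open>flow_map\<close>, a definite description, so
  existence and uniqueness of integral curves through every point must be established on a manifold
  with boundary. For \<open>X_H\<close> this is done in charts, with a field that is only shown to
  be locally Lipschitz; its tangency to the boundary keeps solutions in the half-space. For the Reeb
  fields both properties are inherited: any Reeb curve, run with another clock, is an orbit of
  \<open>X_H\<close> or of its product with a rotation.

  The positivity of \<open>tau\<close> acts through one observation: where \<open>dH\<close>
  vanishes, \<open>X_H\<close> vanishes and \<open>tau = H\<close>. Hence a minimum of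
  \<open>H\<close> off the boundary is positive, \<open>H\<close> vanishes exactly on the boundary,
  and 0 is a regular value of \<open>H\<close> and of \<open>F\<close>.

  The delicate points of the tube lie over the boundary of \<open>W\<close>, where the tube touches
  the boundary of the product. Its charts are arbitrary pairs \<open>(U, f)\<close>, so it has to be
  proved that their hyperplane is exactly \<open>F = 0\<close> and that a chart exists at every such
  point, including those where \<open>F\<close> is defined on one side only.\<close>

lemma frechet_derivative_eqI:
  "(f has_derivative f') (at x) \<Longrightarrow> frechet_derivative f (at x) = f'"
  using frechet_derivative_at by metis

lemma frechet_derivative_cong_open:
  assumes "open U" "x \<in> U" "\<And>y. y \<in> U \<Longrightarrow> f y = g y"
  shows "frechet_derivative f (at x) = frechet_derivative g (at x)"
proof -
  have "(f has_derivative D) (at x) \<longleftrightarrow> (g has_derivative D) (at x)" for D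
    using has_derivative_transform_within_open[OF _ assms(1,2)] assms(3) by metis
  then show ?thesis by (simp add: frechet_derivative_def)
qed

text \<open>The recursion differentiates with \<open>at x\<close>, which sees a full neighbourhood
  of \<open>x\<close>. For open \<open>U\<close> these derivatives depend only on the values on
  \<open>U\<close>, and the induction passes to them.\<close>

lemma C_diff_cong:
  assumes "open U" "\<And>y. y \<in> U \<Longrightarrow> f y = g y"
  shows "C_diff k U f \<longleftrightarrow> C_diff k U g"
  using assms(2)
proof (induction k arbitrary: f g)
  case 0
  then show ?case by (auto intro: continuous_on_cong[THEN iffD1, rotated -1])
next
  case (Suc k)
  have "f differentiable_on U \<longleftrightarrow> g differentiable_on U"
    using Suc.prems by (auto simp: differentiable_on_def intro: differentiable_transform_within[where d=1])
  moreover have "C_diff k U (\<lambda>x. frechet_derivative f (at x) v) \<longleftrightarrow>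
      C_diff k U (\<lambda>x. frechet_derivative g (at x) v)" for v
    by (rule Suc.IH) (simp add: frechet_derivative_cong_open[OF assms(1) _ Suc.prems])
  ultimately show ?case by simp
qed

lemma C_diff_subset: "C_diff k U f \<Longrightarrow> V \<subseteq> U \<Longrightarrow> C_diff k V f"
  by (induction k arbitrary: f) (auto intro: continuous_on_subset differentiable_on_subset)

lemma C_diff_pred: "C_diff (Suc k) U f \<Longrightarrow> C_diff k U f"
  by (induction k arbitrary: f) (auto intro: differentiable_imp_continuous_on)

lemma C_diff_continuous_on: "C_diff k U f \<Longrightarrow> continuous_on U f"
  by (cases k) (auto intro: differentiable_imp_continuous_on)

lemma C_diff_has_derivative:
  "C_diff (Suc k) U f \<Longrightarrow> open U \<Longrightarrow> x \<in> U \<Longrightarrow> (f has_derivative frechet_derivative f (at x)) (at x)"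
  by (simp add: differentiable_on_eq_differentiable_at frechet_derivative_works)

text \<open>Lets the closure lemmas below work with an explicit formula for the derivative in place
  of the \<open>SOME\<close> inside \<open>frechet_derivative\<close>.\<close>

lemma C_diff_SucI:
  assumes U: "open U" and D: "\<And>x. x \<in> U \<Longrightarrow> (f has_derivative f' x) (at x)"
    and k: "\<And>v. C_diff k U (\<lambda>x. f' x v)"
  shows "C_diff (Suc k) U f"
proof -
  have "f differentiable_on U"
    using D by (meson differentiable_at_withinI differentiable_def differentiable_on_def)
  moreover have "C_diff k U (\<lambda>x. frechet_derivative f (at x) v)" for v
    using C_diff_cong[OF U, of "\<lambda>x. frechet_derivative f (at x) v" "\<lambda>x. f' x v"] k
      frechet_derivative_eqI[OF D] by simp
  ultimately show ?thesis by simp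
qed

lemma C_diff_const: "open U \<Longrightarrow> C_diff k U (\<lambda>x. c)"
proof (induction k arbitrary: c)
  case (Suc k)
  then show ?case by (intro C_diff_SucI[where f'="\<lambda>_ _. 0"]) auto
qed simp

lemma C_diff_bounded_linear: "bounded_linear L \<Longrightarrow> open U \<Longrightarrow> C_diff k U L"
proof (cases k)
  case (Suc j)
  assume "bounded_linear L" "open U"
  then show ?thesis unfolding Suc
    by (intro C_diff_SucI[where f'="\<lambda>_. L"] bounded_linear_imp_has_derivative C_diff_const)
qed (simp add: linear_continuous_on)

lemma C_diff_add:
  "open U \<Longrightarrow> C_diff k U f \<Longrightarrow> C_diff k U g \<Longrightarrow> C_diff k U (\<lambda>x. f x + g x)"
proof (induction k arbitrary: f g)
  case 0
  then show ?case by (auto intro: continuous_on_add)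
next
  case (Suc k)
  show ?case
    by (rule C_diff_SucI[OF Suc.prems(1), where f'="\<lambda>x v. frechet_derivative f (at x) v + frechet_derivative g (at x) v"])
      (use Suc in \<open>auto intro!: has_derivative_add C_diff_has_derivative simp del: C_diff.simps\<close>,
       use Suc in auto)
qed

lemma C_diff_sum:
  "open U \<Longrightarrow> (\<And>i. i \<in> I \<Longrightarrow> C_diff k U (f i)) \<Longrightarrow> C_diff k U (\<lambda>x. \<Sum>i\<in>I. f i x)"
  by (induction I rule: infinite_finite_induct) (auto intro: C_diff_const C_diff_add)

lemma C_diff_linear_comp:
  assumes "bounded_linear L"
  shows "open U \<Longrightarrow> C_diff k U f \<Longrightarrow> C_diff k U (\<lambda>x. L (f x))"
proof (induction k arbitrary: f)
  case 0
  then show ?case using assms by (auto intro: bounded_linear.continuous_on)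
next
  case (Suc k)
  show ?case
    by (rule C_diff_SucI[OF Suc.prems(1), where f'="\<lambda>x v. L (frechet_derivative f (at x) v)"])
      (use Suc in \<open>auto intro!: bounded_linear.has_derivative[OF assms] C_diff_has_derivative simp del: C_diff.simps\<close>,
       use Suc in auto)
qed

lemma C_diff_scaleR:
  fixes a :: "'e::euclidean_space \<Rightarrow> real"
  shows "open U \<Longrightarrow> C_diff k U a \<Longrightarrow> C_diff k U f \<Longrightarrow> C_diff k U (\<lambda>x. a x *\<^sub>R f x)"
proof (induction k arbitrary: a f)
  case 0
  then show ?case by (auto intro: continuous_on_scaleR)
next
  case (Suc k)
  show ?case
  proof (rule C_diff_SucI[OF Suc.prems(1), where f'="\<lambda>x v. a x *\<^sub>R frechet_derivative f (at x) v + frechet_derivative a (at x) v *\<^sub>R f x"])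
    fix x assume "x \<in> U"
    then show "((\<lambda>x. a x *\<^sub>R f x) has_derivative
       (\<lambda>v. a x *\<^sub>R frechet_derivative f (at x) v + frechet_derivative a (at x) v *\<^sub>R f x)) (at x)"
      using Suc.prems by (intro has_derivative_scaleR C_diff_has_derivative)
  next
    fix v
    show "C_diff k U (\<lambda>x. a x *\<^sub>R frechet_derivative f (at x) v + frechet_derivative a (at x) v *\<^sub>R f x)"
      using Suc.prems C_diff_pred[OF Suc.prems(2)] C_diff_pred[OF Suc.prems(3)]
      by (intro C_diff_add Suc.IH) auto
  qed
qed

lemma C_diff_compose:
  fixes g :: "'d::euclidean_space \<Rightarrow> 'e::euclidean_space"
  assumes "open U" "open V" "g ` U \<subseteq> V"
  shows "C_diff k V f \<Longrightarrow> C_diff k U g \<Longrightarrow> C_diff k U (\<lambda>x. f (g x))"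
proof (induction k arbitrary: f)
  case 0
  then show ?case using assms(3) by (auto intro: continuous_on_compose2)
next
  case (Suc k)
  let ?Df = "\<lambda>y. frechet_derivative f (at y)" and ?Dg = "\<lambda>x. frechet_derivative g (at x)"
  show ?case
  \<comment> \<open>In the chain rule the derivative of \<open>f\<close> is applied to a vector that
    moves with \<open>x\<close>, whereas the induction hypothesis speaks about fixed directions.
    Expanding in \<open>Basis\<close> leaves fixed directions \<open>b\<close> with coefficients
    that depend on \<open>x\<close>.\<close>
  proof (rule C_diff_SucI[OF assms(1), where f'="\<lambda>x v. \<Sum>b\<in>Basis. (?Dg x v \<bullet> b) *\<^sub>R ?Df (g x) b"])
    fix x assume x: "x \<in> U"
    then have gx: "g x \<in> V" using assms(3) by auto
    have Dg: "(g has_derivative ?Dg x) (at x)" and Df: "(f has_derivative ?Df (g x)) (at (g x))"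
      using C_diff_has_derivative Suc.prems assms x gx by blast+
    have "linear (?Df (g x))"
      using Df has_derivative_linear by blast
    then have "?Df (g x) (?Dg x v) = (\<Sum>b\<in>Basis. (?Dg x v \<bullet> b) *\<^sub>R ?Df (g x) b)" for v
      by (subst euclidean_representation[of "?Dg x v", symmetric]) (simp add: linear_sum linear_cmul)
    then show "((\<lambda>x. f (g x)) has_derivative (\<lambda>v. \<Sum>b\<in>Basis. (?Dg x v \<bullet> b) *\<^sub>R ?Df (g x) b)) (at x)"
      using has_derivative_compose[OF Dg Df] by simp
  next
    fix v
    show "C_diff k U (\<lambda>x. \<Sum>b\<in>Basis. (?Dg x v \<bullet> b) *\<^sub>R ?Df (g x) b)"
      using Suc.prems C_diff_pred[OF Suc.prems(2)] assms
      by (intro C_diff_sum C_diff_scaleR Suc.IH C_diff_linear_comp[OF bounded_linear_inner_left]) auto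
  qed
qed

lemma C_diff_inverse:
  fixes a :: "'e::euclidean_space \<Rightarrow> real"
  assumes "open U" "\<And>x. x \<in> U \<Longrightarrow> a x \<noteq> 0"
  shows "C_diff k U a \<Longrightarrow> C_diff k U (\<lambda>x. inverse (a x))"
proof (induction k)
  case 0
  then show ?case using assms by (auto intro: continuous_on_inverse)
next
  case (Suc k)
  show ?case
  \<comment> \<open>The derivative is again built from the inverse itself and the derivative of
    \<open>a\<close>, so level \<open>k\<close> of the claim yields level
    \<open>Suc k\<close>.\<close>
  proof (rule C_diff_SucI[OF assms(1), where f'="\<lambda>x v. -1 *\<^sub>R (inverse (a x) *\<^sub>R (frechet_derivative a (at x) v *\<^sub>R inverse (a x)))"])
    fix x assume "x \<in> U"
    then show "((\<lambda>x. inverse (a x)) has_derivative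
       (\<lambda>v. -1 *\<^sub>R (inverse (a x) *\<^sub>R (frechet_derivative a (at x) v *\<^sub>R inverse (a x))))) (at x)"
      using Deriv.has_derivative_inverse[OF _ C_diff_has_derivative[OF Suc.prems assms(1)], of x] assms
      by (auto simp: mult.assoc)
  next
    fix v
    show "C_diff k U (\<lambda>x. -1 *\<^sub>R (inverse (a x) *\<^sub>R (frechet_derivative a (at x) v *\<^sub>R inverse (a x))))"
      using Suc C_diff_pred[OF Suc.prems] assms by (intro C_diff_scaleR C_diff_const) auto
  qed
qed

lemma C_diff_Pair:
  assumes "open U" "C_diff k U f" "C_diff k U g"
  shows "C_diff k U (\<lambda>x. (f x, g x))"
proof -
  have *: "bounded_linear (\<lambda>u. (u, 0))" "bounded_linear (\<lambda>u. (0, u))"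
    by (auto intro!: bounded_linear_Pair bounded_linear_zero bounded_linear_ident)
  have "C_diff k U (\<lambda>x. (f x, 0) + (0, g x))"
    using assms C_diff_linear_comp[OF *(1)] C_diff_linear_comp[OF *(2)]
    by (intro C_diff_add) auto
  then show ?thesis by simp
qed

section \<open>Smooth maps on arbitrary subsets, handled through local extensions\<close>

lemma smooth_onI_open: "open U \<Longrightarrow> (\<And>k. C_diff k U f) \<Longrightarrow> smooth_on U f"
  unfolding smooth_on_def by blast

lemma smooth_onD:
  assumes "smooth_on S f" "x \<in> S"
  shows "\<exists>U g. open U \<and> x \<in> U \<and> (\<forall>k. C_diff k U g) \<and> (\<forall>y\<in>S. y \<in> U \<longrightarrow> g y = f y)"
  using assms unfolding smooth_on_def Ball_def Int_iff imp_conjL by simp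

lemma smooth_on_subset: "smooth_on S f \<Longrightarrow> T \<subseteq> S \<Longrightarrow> smooth_on T f"
  unfolding smooth_on_def by (intro ballI) (drule bspec, erule subsetD, assumption, elim exE conjE, intro exI conjI, auto)

lemma smooth_on_cong: "(\<And>x. x \<in> S \<Longrightarrow> f x = g x) \<Longrightarrow> smooth_on S f \<longleftrightarrow> smooth_on S g"
  unfolding smooth_on_def by simp

lemma smooth_on_bounded_linear: "bounded_linear L \<Longrightarrow> smooth_on S L"
  by (rule smooth_on_subset[OF smooth_onI_open[of UNIV]]) (auto intro: C_diff_bounded_linear)

lemma smooth_on_const: "smooth_on S (\<lambda>x. c)"
  by (rule smooth_on_subset[OF smooth_onI_open[of UNIV]]) (auto intro: C_diff_const)

lemma smooth_on_binop:
  fixes f :: "'e::euclidean_space \<Rightarrow> 'f::real_normed_vector" and g :: "'e \<Rightarrow> 'g::real_normed_vector"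
    and op :: "'f \<Rightarrow> 'g \<Rightarrow> 'h::real_normed_vector"
  assumes "smooth_on S f" "smooth_on S g"
    and op: "\<And>(U :: 'e set) k f' g'. open U \<Longrightarrow> C_diff k U f' \<Longrightarrow> C_diff k U g' \<Longrightarrow> C_diff k U (\<lambda>x. op (f' x) (g' x))"
  shows "smooth_on S (\<lambda>x. op (f x) (g x))"
  unfolding smooth_on_def
proof
  fix x assume x: "x \<in> S"
  obtain U f' where U: "open U" "x \<in> U" "\<And>k. C_diff k U f'" "\<And>y. y \<in> S \<Longrightarrow> y \<in> U \<Longrightarrow> f' y = f y"
    using smooth_onD[OF assms(1) x] by blast
  obtain V g' where V: "open V" "x \<in> V" "\<And>k. C_diff k V g'" "\<And>y. y \<in> S \<Longrightarrow> y \<in> V \<Longrightarrow> g' y = g y"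
    using smooth_onD[OF assms(2) x] by blast
  show "\<exists>U h. open U \<and> x \<in> U \<and> (\<forall>k. C_diff k U h) \<and> (\<forall>y\<in>S \<inter> U. h y = op (f y) (g y))"
  proof (intro exI conjI allI)
    show "open (U \<inter> V)" "x \<in> U \<inter> V" using U V by auto
    show "C_diff k (U \<inter> V) (\<lambda>x. op (f' x) (g' x))" for k
      using U V by (intro op) (auto intro: C_diff_subset)
    show "\<forall>y\<in>S \<inter> (U \<inter> V). op (f' y) (g' y) = op (f y) (g y)" using U V by simp
  qed
qed

lemma smooth_on_add: "smooth_on S f \<Longrightarrow> smooth_on S g \<Longrightarrow> smooth_on S (\<lambda>x. f x + g x)"
  by (rule smooth_on_binop) (auto intro: C_diff_add)

lemma smooth_on_scaleR:
  fixes a :: "'e::euclidean_space \<Rightarrow> real"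
  shows "smooth_on S a \<Longrightarrow> smooth_on S f \<Longrightarrow> smooth_on S (\<lambda>x. a x *\<^sub>R f x)"
  by (rule smooth_on_binop) (auto intro: C_diff_scaleR)

lemma smooth_on_Pair: "smooth_on S f \<Longrightarrow> smooth_on S g \<Longrightarrow> smooth_on S (\<lambda>x. (f x, g x))"
  by (rule smooth_on_binop) (auto intro: C_diff_Pair)

lemma smooth_on_sum: "(\<And>i. i \<in> I \<Longrightarrow> smooth_on S (f i)) \<Longrightarrow> smooth_on S (\<lambda>x. \<Sum>i\<in>I. f i x)"
  by (induction I rule: infinite_finite_induct) (auto intro: smooth_on_const smooth_on_add)

lemma smooth_on_compose:
  fixes g :: "'d::euclidean_space \<Rightarrow> 'e::euclidean_space"
  assumes f: "smooth_on T f" and g: "smooth_on S g" and "g ` S \<subseteq> T"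
  shows "smooth_on S (\<lambda>x. f (g x))"
  unfolding smooth_on_def
proof
  fix x assume x: "x \<in> S"
  then have gx: "g x \<in> T" using assms(3) by auto
  obtain U g' where U: "open U" "x \<in> U" "\<And>k. C_diff k U g'" "\<And>y. y \<in> S \<Longrightarrow> y \<in> U \<Longrightarrow> g' y = g y"
    using smooth_onD[OF g x] by blast
  obtain V f' where V: "open V" "g x \<in> V" "\<And>k. C_diff k V f'" "\<And>y. y \<in> T \<Longrightarrow> y \<in> V \<Longrightarrow> f' y = f y"
    using smooth_onD[OF f gx] by blast
  \<comment> \<open>Although \<open>g\<close> maps \<open>S\<close> into \<open>T\<close>, its
    extension \<open>g'\<close> may leave \<open>V\<close>; its domain is therefore cut down to the
    preimage of \<open>V\<close>.\<close>
  let ?W = "U \<inter> g' -` V"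
  have W: "open ?W"
    using continuous_open_preimage[OF C_diff_continuous_on[OF U(3)] U(1) V(1)] by simp
  have "C_diff k ?W (\<lambda>x. f' (g' x))" for k
    by (rule C_diff_compose[OF W V(1)]) (use V(3) U(3) in \<open>auto intro: C_diff_subset\<close>)
  then show "\<exists>U h. open U \<and> x \<in> U \<and> (\<forall>k. C_diff k U h) \<and> (\<forall>y\<in>S \<inter> U. h y = f (g y))"
    using W U V x assms(3) by (intro exI[of _ ?W] exI[of _ "\<lambda>x. f' (g' x)"]) auto
qed

lemma smooth_on_continuous_on: "smooth_on S f \<Longrightarrow> continuous_on S f"
  unfolding continuous_on_eq_continuous_within
proof
  fix x assume f: "smooth_on S f" and x: "x \<in> S"
  obtain U g where U: "open U" "x \<in> U" "\<And>k. C_diff k U g" "\<And>y. y \<in> S \<Longrightarrow> y \<in> U \<Longrightarrow> g y = f y"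
    using smooth_onD[OF f x] by blast
  have "continuous (at x within S) g"
    using C_diff_continuous_on[OF U(3)] U(1,2)
    by (simp add: continuous_on_eq_continuous_at continuous_at_imp_continuous_at_within)
  note G = this
  obtain d where d: "d > 0" "ball x d \<subseteq> U" using openE[OF U(1,2)] by metis
  show "continuous (at x within S) f"
  proof (rule continuous_transform_within[OF G d(1) x])
    fix y assume "y \<in> S" "dist y x < d"
    then show "g y = f y" using d U(4)[of y] by (auto simp: dist_commute)
  qed
qed


section \<open>Relatively open subsets of a half-space\<close>

definition hs_open :: "'e::euclidean_space \<Rightarrow> 'e set \<Rightarrow> bool" where
  "hs_open b S \<longleftrightarrow> b \<noteq> 0 \<and> openin (top_of_set (halfspace b)) S"

lemma hs_open_ball:
  assumes "hs_open b S" "x \<in> S"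
  obtains r where "r > 0" "ball x r \<inter> halfspace b \<subseteq> S"
  using assms unfolding hs_open_def openin_contains_ball by metis

lemma hs_open_halfspace: "hs_open b S \<Longrightarrow> S \<subseteq> halfspace b"
  unfolding hs_open_def using openin_imp_subset by blast

text \<open>At a point of the hyperplane only one sign of \<open>d\<close> may keep
  \<open>x + d *\<^sub>R i\<close> in the half-space. One sign for each direction is enough to make
  derivatives within \<open>S\<close> unique.\<close>

lemma hs_open_approach:
  assumes "hs_open b S" "x \<in> S" "e > 0"
  shows "\<exists>d. 0 < \<bar>d\<bar> \<and> \<bar>d\<bar> < e \<and> x + d *\<^sub>R i \<in> S"
proof -
  obtain r where r: "r > 0" "ball x r \<inter> halfspace b \<subseteq> S"
    using hs_open_ball[OF assms(1,2)] .
  define s :: real where "s = (if 0 \<le> i \<bullet> b then 1 else -1)"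
  define d where "d = s * min (e/2) (r / (2 * (norm i + 1)))"
  have abs: "\<bar>d\<bar> = min (e/2) (r / (2 * (norm i + 1)))"
    using r assms(3) by (auto simp: d_def s_def abs_mult add_nonneg_pos)
  have "\<bar>d\<bar> * norm i \<le> r / (2 * (norm i + 1)) * norm i"
    unfolding abs by (intro mult_right_mono) auto
  also have "\<dots> < r"
  proof -
    have "norm i / (norm i + 1) \<le> 1" by (simp add: divide_le_eq_1 add_nonneg_pos)
    then have "r / (2 * (norm i + 1)) * norm i \<le> r / 2"
      using r mult_left_mono[of "norm i / (norm i + 1)" 1 "r / 2"] by (simp add: mult.commute)
    then show ?thesis using r by linarith
  qed
  finally have "x + d *\<^sub>R i \<in> ball x r" by (simp add: dist_norm)
  moreover have "0 \<le> d * (i \<bullet> b)"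
  proof (cases "0 \<le> i \<bullet> b")
    case True
    then show ?thesis using r assms(3) by (auto simp: d_def s_def)
  next
    case False
    then have "d \<le> 0" using r assms(3) by (auto simp: d_def s_def)
    then show ?thesis using False by (simp add: mult_nonpos_nonpos)
  qed
  moreover have "x \<in> halfspace b" using hs_open_halfspace assms by blast
  ultimately have "x + d *\<^sub>R i \<in> S"
    using r by (auto simp: halfspace_def inner_add_left)
  moreover have "0 < \<bar>d\<bar>" "\<bar>d\<bar> < e" unfolding abs using r assms(3) by (auto simp: add_nonneg_pos)
  ultimately show ?thesis by blast
qed

lemma hs_open_deriv_unique:
  fixes f :: "'e::euclidean_space \<Rightarrow> 'f::real_normed_vector"
  assumes "hs_open b S" "x \<in> S"
    "(f has_derivative f') (at x within S)" "(f has_derivative f'') (at x within S)"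
  shows "f' = f''"
  by (rule frechet_derivative_unique_within[OF assms(3,4)]) (rule hs_open_approach[OF assms(1,2)])

lemma hs_open_frechet_eqI:
  fixes f :: "'e::euclidean_space \<Rightarrow> 'f::real_normed_vector"
  assumes "hs_open b S" "x \<in> S" "(f has_derivative f') (at x within S)"
  shows "frechet_derivative f (at x within S) = f'"
  using hs_open_deriv_unique[OF assms(1,2) _ assms(3)] assms(3)
  by (metis differentiable_def frechet_derivative_works)

text \<open>Since derivatives within \<open>S\<close> are unique, they coincide with those of any
  smooth extension. One-sided questions thereby become questions about a function on an open
  set.\<close>

lemma hs_open_extension:
  fixes f :: "'e::euclidean_space \<Rightarrow> 'f::real_normed_vector"
  assumes S: "hs_open b S" and f: "smooth_on S f" and x: "x \<in> S"
  obtains U g where "open U" "x \<in> U" "\<And>k. C_diff k U g" "\<And>y. y \<in> S \<Longrightarrow> y \<in> U \<Longrightarrow> g y = f y"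
    "\<And>y. y \<in> S \<Longrightarrow> y \<in> U \<Longrightarrow> (f has_derivative frechet_derivative g (at y)) (at y within S)"
    "\<And>y. y \<in> S \<Longrightarrow> y \<in> U \<Longrightarrow> frechet_derivative f (at y within S) = frechet_derivative g (at y)"
proof -
  obtain U g where U: "open U" "x \<in> U" "\<And>k. C_diff k U g" "\<And>y. y \<in> S \<Longrightarrow> y \<in> U \<Longrightarrow> g y = f y"
    using smooth_onD[OF f x] by blast
  have D: "(f has_derivative frechet_derivative g (at y)) (at y within S)" if "y \<in> S" "y \<in> U" for y
  proof -
    have "(g has_derivative frechet_derivative g (at y)) (at y within S)"
      using C_diff_has_derivative[OF U(3) U(1) that(2)] has_derivative_at_withinI by blast
    note G = this
    obtain d where d: "d > 0" "ball y d \<subseteq> U" using openE[OF U(1) \<open>y \<in> U\<close>] by metis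
    show ?thesis
    proof (rule has_derivative_transform_within[OF G d(1) \<open>y \<in> S\<close>])
      fix z assume "z \<in> S" "dist z y < d"
      then show "g z = f z" using d U(4)[of z] by (auto simp: dist_commute)
    qed
  qed
  show ?thesis
    by (rule that[OF U D hs_open_frechet_eqI[OF S _ D]])
qed

lemma hs_open_has_derivative:
  fixes f :: "'e::euclidean_space \<Rightarrow> 'f::real_normed_vector"
  assumes "hs_open b S" "smooth_on S f" "x \<in> S"
  shows "(f has_derivative frechet_derivative f (at x within S)) (at x within S)"
  using hs_open_extension[OF assms] assms(3) by metis

lemma hs_open_frechet_Int:
  fixes f :: "'e::euclidean_space \<Rightarrow> 'f::real_normed_vector"
  assumes "hs_open b S" "hs_open b T" "T \<subseteq> S" "smooth_on S f" "x \<in> T"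
  shows "frechet_derivative f (at x within T) = frechet_derivative f (at x within S)"
  using hs_open_has_derivative[OF assms(1,4), of x] assms
  by (intro hs_open_frechet_eqI[OF assms(2)]) (auto intro: has_derivative_subset)

lemma smooth_on_frechet:
  fixes f :: "'e::euclidean_space \<Rightarrow> 'f::real_normed_vector"
  assumes "hs_open b S" "smooth_on S f"
  shows "smooth_on S (\<lambda>x. frechet_derivative f (at x within S) v)"
  unfolding smooth_on_def
proof
  fix x assume x: "x \<in> S"
  obtain U g where U: "open U" "x \<in> U" "\<And>k. C_diff k U g"
    "\<And>y. y \<in> S \<Longrightarrow> y \<in> U \<Longrightarrow> frechet_derivative f (at y within S) = frechet_derivative g (at y)"
    using hs_open_extension[OF assms x] by metis
  moreover have "C_diff k U (\<lambda>y. frechet_derivative g (at y) v)" for k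
    using U(3)[of "Suc k"] by simp
  ultimately show "\<exists>U h. open U \<and> x \<in> U \<and> (\<forall>k. C_diff k U h) \<and>
      (\<forall>y\<in>S \<inter> U. h y = frechet_derivative f (at y within S) v)"
    by (intro exI[of _ U] exI[of _ "\<lambda>y. frechet_derivative g (at y) v"]) auto
qed

section \<open>Local Lipschitz bounds\<close>

lemma C_diff_lipschitz:
  fixes g :: "'e::euclidean_space \<Rightarrow> 'f::real_normed_vector"
  assumes U: "open U" "x \<in> U" and g: "C_diff (Suc 0) U g"
  shows "\<exists>r>0. \<exists>L\<ge>0. \<forall>y\<in>ball x r. \<forall>z\<in>ball x r. norm (g y - g z) \<le> L * norm (y - z)"
proof -
  let ?D = "\<lambda>y. frechet_derivative g (at y)"
  \<comment> \<open>The norms of the partial derivatives add up to a continuous bound for the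
    operator norm. Near \<open>x\<close> it stays below \<open>h x + 1\<close>, which becomes the
    Lipschitz constant.\<close>
  define h where "h y = (\<Sum>b\<in>Basis. norm (?D y b))" for y
  have "continuous_on U h"
    unfolding h_def using g by (intro continuous_intros) auto
  then have "isCont h x" using U continuous_on_eq_continuous_at by blast
  then obtain d where d: "d > 0" "\<And>y. dist y x < d \<Longrightarrow> dist (h y) (h x) < 1"
    using zero_less_one unfolding continuous_at_eps_delta by metis
  obtain e where e: "e > 0" "ball x e \<subseteq> U" using openE[OF U(1,2)] by metis
  define r where "r = min d e"
  have "norm (g y - g z) \<le> (h x + 1) * norm (y - z)" if "y \<in> ball x r" "z \<in> ball x r" for y z
  proof (rule differentiable_bound[of "ball x r" g ?D])
    fix w assume w: "w \<in> ball x r"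
    then have D: "(g has_derivative ?D w) (at w)"
      using C_diff_has_derivative[OF g U(1)] e by (auto simp: r_def subset_eq)
    then show "(g has_derivative ?D w) (at w within ball x r)" by (rule has_derivative_at_withinI)
    have "norm (?D w v) \<le> (h x + 1) * norm v" for v
    proof -
      have "?D w v = (\<Sum>b\<in>Basis. (v \<bullet> b) *\<^sub>R ?D w b)"
        using has_derivative_linear[OF D]
        by (subst euclidean_representation[of v, symmetric]) (simp add: linear_sum linear_cmul)
      also have "norm \<dots> \<le> (\<Sum>b\<in>Basis. norm v * norm (?D w b))"
        by (rule sum_norm_le) (simp add: Basis_le_norm mult_right_mono)
      also have "\<dots> = norm v * h w" by (simp add: h_def sum_distrib_left)
      also have "\<dots> \<le> norm v * (h x + 1)"
        using d(2)[of w] w by (intro mult_left_mono) (auto simp: r_def dist_commute dist_real_def)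
      finally show ?thesis by (simp add: mult.commute)
    qed
    then show "onorm (?D w) \<le> h x + 1" by (rule onorm_le)
  qed (use that in auto)
  moreover have "h x + 1 \<ge> 0" unfolding h_def by (simp add: sum_nonneg add_nonneg_nonneg)
  moreover have "r > 0" using d e by (simp add: r_def)
  ultimately show ?thesis by blast
qed

text \<open>The regularity at which Hamiltonian fields are kept: it passes through the solution of a
  linear system with varying coefficients, and it suffices for existence, uniqueness and continuous
  dependence of integral curves.\<close>

definition loc_lip :: "'e::euclidean_space set \<Rightarrow> ('e \<Rightarrow> 'f::real_normed_vector) \<Rightarrow> bool" where
  "loc_lip S f \<longleftrightarrow> (\<forall>x\<in>S. \<exists>r>0. \<exists>L\<ge>0. \<forall>y\<in>S \<inter> ball x r. \<forall>z\<in>S \<inter> ball x r.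
      norm (f y - f z) \<le> L * norm (y - z))"

lemma smooth_on_loc_lip:
  assumes "smooth_on S f"
  shows "loc_lip S f"
  unfolding loc_lip_def
proof
  fix x assume x: "x \<in> S"
  obtain U g where U: "open U" "x \<in> U" "\<And>k. C_diff k U g" "\<And>y. y \<in> S \<Longrightarrow> y \<in> U \<Longrightarrow> g y = f y"
    using smooth_onD[OF assms x] by blast
  obtain r L where r: "r > 0" "L \<ge> 0" "\<And>y z. y\<in>ball x r \<Longrightarrow> z\<in>ball x r \<Longrightarrow> norm (g y - g z) \<le> L * norm (y - z)"
    using C_diff_lipschitz[OF U(1,2) U(3)] by blast
  obtain e where e: "e > 0" "ball x e \<subseteq> U" using openE[OF U(1,2)] by metis
  have "norm (f y - f z) \<le> L * norm (y - z)" if "y \<in> S \<inter> ball x (min r e)" "z \<in> S \<inter> ball x (min r e)" for y z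
    using r(3)[of y z] U(4)[of y] U(4)[of z] that e by (auto simp: subset_eq)
  then show "\<exists>r>0. \<exists>L\<ge>0. \<forall>y\<in>S \<inter> ball x r. \<forall>z\<in>S \<inter> ball x r. norm (f y - f z) \<le> L * norm (y - z)"
    using r(1,2) e(1) by (metis min_less_iff_conj)
qed

section \<open>Symmetry of second derivatives and naturality of the exterior derivative\<close>

lemma second_difference:
  fixes g :: "'e::euclidean_space \<Rightarrow> real"
  assumes U: "open U" and g: "C_diff 2 U g" and t: "t > 0"
    and sub: "\<And>p q. 0 \<le> p \<Longrightarrow> p \<le> t \<Longrightarrow> 0 \<le> q \<Longrightarrow> q \<le> t \<Longrightarrow> x + p *\<^sub>R u + q *\<^sub>R v \<in> U"
  shows "\<exists>p q. 0 < p \<and> p < t \<and> 0 < q \<and> q < t \<and>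
    g (x + t *\<^sub>R u + t *\<^sub>R v) - g (x + t *\<^sub>R u) - g (x + t *\<^sub>R v) + g x =
    t * (t * frechet_derivative (\<lambda>y. frechet_derivative g (at y) u) (at (x + p *\<^sub>R u + q *\<^sub>R v)) v)"
proof -
  let ?D = "\<lambda>y. frechet_derivative g (at y)"
  have g1: "C_diff (Suc 0) U g" and g2: "C_diff (Suc 0) U (\<lambda>y. ?D y w)" for w
    using g C_diff_pred[of "Suc 0"] by (auto simp: numeral_2_eq_2)
  let ?\<phi> = "\<lambda>s. g (x + s *\<^sub>R u + t *\<^sub>R v) - g (x + s *\<^sub>R u)"
  have der: "((\<lambda>s. g (x + s *\<^sub>R u + q *\<^sub>R v)) has_real_derivative ?D (x + s *\<^sub>R u + q *\<^sub>R v) u) (at s)"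
    if "0 \<le> s" "s \<le> t" "0 \<le> q" "q \<le> t" for s q
  proof -
    have G: "(g has_derivative ?D (x + s *\<^sub>R u + q *\<^sub>R v)) (at (x + s *\<^sub>R u + q *\<^sub>R v))"
      using C_diff_has_derivative[OF g1 U sub] that by simp
    have "((\<lambda>s. x + s *\<^sub>R u + q *\<^sub>R v) has_derivative (\<lambda>r. r *\<^sub>R u)) (at s)"
      by (auto intro!: derivative_eq_intros)
    from has_derivative_compose[OF this G] show ?thesis
      using linear_cmul[OF has_derivative_linear[OF G]]
      by (simp add: has_field_derivative_def mult_commute_abs)
  qed
  have "\<exists>p>0. p < t \<and> ?\<phi> t - ?\<phi> 0 = (t - 0) * (?D (x + p *\<^sub>R u + t *\<^sub>R v) u - ?D (x + p *\<^sub>R u) u)"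
  proof (rule MVT2[OF t])
    fix s assume "0 \<le> s" "s \<le> t"
    then show "(?\<phi> has_real_derivative (?D (x + s *\<^sub>R u + t *\<^sub>R v) u - ?D (x + s *\<^sub>R u) u)) (at s)"
      using der[of s t] der[of s 0] t by (intro DERIV_diff) auto
  qed
  then obtain p where p: "0 < p" "p < t"
    and eq1: "?\<phi> t - ?\<phi> 0 = t * (?D (x + p *\<^sub>R u + t *\<^sub>R v) u - ?D (x + p *\<^sub>R u) u)" by auto
  let ?\<psi> = "\<lambda>s. ?D (x + p *\<^sub>R u + s *\<^sub>R v) u"
  let ?DD = "\<lambda>y. frechet_derivative (\<lambda>y. ?D y u) (at y)"
  have "\<exists>q>0. q < t \<and> ?\<psi> t - ?\<psi> 0 = (t - 0) * ?DD (x + p *\<^sub>R u + q *\<^sub>R v) v"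
  proof (rule MVT2[OF t])
    fix s assume s: "0 \<le> s" "s \<le> t"
    have G: "((\<lambda>y. ?D y u) has_derivative ?DD (x + p *\<^sub>R u + s *\<^sub>R v)) (at (x + p *\<^sub>R u + s *\<^sub>R v))"
      using C_diff_has_derivative[OF g2 U sub] s p by simp
    have "((\<lambda>s. x + p *\<^sub>R u + s *\<^sub>R v) has_derivative (\<lambda>r. r *\<^sub>R v)) (at s)"
      by (auto intro!: derivative_eq_intros)
    from has_derivative_compose[OF this G]
    show "(?\<psi> has_real_derivative ?DD (x + p *\<^sub>R u + s *\<^sub>R v) v) (at s)"
      using linear_cmul[OF has_derivative_linear[OF G]]
      by (simp add: has_field_derivative_def mult_commute_abs)
  qed
  then obtain q where q: "0 < q" "q < t" "?\<psi> t - ?\<psi> 0 = t * ?DD (x + p *\<^sub>R u + q *\<^sub>R v) v" by auto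
  then show ?thesis using p eq1 by (intro exI[of _ p] exI[of _ q]) (auto simp: algebra_simps)
qed

text \<open>The second difference over a small parallelogram does not depend on the order of
  \<open>u\<close> and \<open>v\<close>, and by \<open>second_difference\<close> it is
  \<open>t * t\<close> times either mixed derivative at some nearby point. Continuity then forces
  the two values at \<open>x\<close> to coincide.\<close>

lemma symmetric_second_derivative_real:
  fixes g :: "'e::euclidean_space \<Rightarrow> real"
  assumes U: "open U" "x \<in> U" and g: "C_diff 2 U g"
  shows "frechet_derivative (\<lambda>y. frechet_derivative g (at y) u) (at x) v =
         frechet_derivative (\<lambda>y. frechet_derivative g (at y) v) (at x) u"
proof (rule ccontr)
  let ?A = "\<lambda>y. frechet_derivative (\<lambda>y. frechet_derivative g (at y) u) (at y) v"
  let ?B = "\<lambda>y. frechet_derivative (\<lambda>y. frechet_derivative g (at y) v) (at y) u"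
  assume ne: "?A x \<noteq> ?B x"
  define e where "e = \<bar>?A x - ?B x\<bar> / 2"
  have e: "e > 0" using ne by (simp add: e_def)
  have "continuous_on U ?A" "continuous_on U ?B" using g by (auto simp: numeral_2_eq_2)
  then have "isCont ?A x" "isCont ?B x" using U continuous_on_eq_continuous_at by blast+
  then obtain d1 d2 where d: "d1 > 0" "\<And>y. dist y x < d1 \<Longrightarrow> dist (?A y) (?A x) < e"
    "d2 > 0" "\<And>y. dist y x < d2 \<Longrightarrow> dist (?B y) (?B x) < e"
    using e unfolding continuous_at_eps_delta by metis
  obtain d3 where d3: "d3 > 0" "ball x d3 \<subseteq> U" using openE[OF U(1,2)] by metis
  define d where "d = min d1 (min d2 d3)"
  \<comment> \<open>With this side the parallelogram stays within \<open>d / 2\<close> of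
    \<open>x\<close>; the summand 1 keeps the denominator positive when \<open>u\<close> and
    \<open>v\<close> vanish.\<close>
  define t where "t = d / (2 * (norm u + norm v + 1))"
  have pos: "d > 0" "norm u + norm v + 1 > 0" using d d3 by (auto simp: d_def add_nonneg_pos)
  then have t: "t > 0" unfolding t_def by (intro divide_pos_pos) auto
  have tN: "t * (norm u + norm v + 1) = d / 2"
  proof -
    have "d / (2 * N) * N = d / 2" if "N > 0" for N :: real using that by simp
    from this[OF pos(2)] show ?thesis unfolding t_def .
  qed
  have near: "dist (x + p *\<^sub>R u + q *\<^sub>R v) x < d" if "0 \<le> p" "p \<le> t" "0 \<le> q" "q \<le> t" for p q
  proof -
    have "dist (x + p *\<^sub>R u + q *\<^sub>R v) x = norm (p *\<^sub>R u + q *\<^sub>R v)"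
      by (simp add: dist_norm add.assoc)
    also have "\<dots> \<le> p * norm u + q * norm v"
      using that by (metis abs_of_nonneg norm_scaleR norm_triangle_ineq)
    also have "\<dots> \<le> t * norm u + t * norm v" using that by (intro add_mono mult_right_mono) auto
    also have "\<dots> \<le> t * (norm u + norm v + 1)" using t by (simp add: algebra_simps)
    also have "\<dots> = d / 2" by (rule tN)
    finally show ?thesis using pos by simp
  qed
  have sub: "x + p *\<^sub>R u + q *\<^sub>R v \<in> U" if "0 \<le> p" "p \<le> t" "0 \<le> q" "q \<le> t" for p q
    using near[OF that] d3 by (auto simp: d_def dist_commute subset_eq)
  have sub': "x + p *\<^sub>R v + q *\<^sub>R u \<in> U" if "0 \<le> p" "p \<le> t" "0 \<le> q" "q \<le> t" for p q
    using sub[OF that(3,4,1,2)] by (simp add: algebra_simps)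
  obtain p q where 1: "0 < p" "p < t" "0 < q" "q < t"
    "g (x + t *\<^sub>R u + t *\<^sub>R v) - g (x + t *\<^sub>R u) - g (x + t *\<^sub>R v) + g x = t * (t * ?A (x + p *\<^sub>R u + q *\<^sub>R v))"
    using second_difference[OF U(1) g t sub] by auto
  obtain p' q' where 2: "0 < p'" "p' < t" "0 < q'" "q' < t"
    "g (x + t *\<^sub>R v + t *\<^sub>R u) - g (x + t *\<^sub>R v) - g (x + t *\<^sub>R u) + g x = t * (t * ?B (x + p' *\<^sub>R v + q' *\<^sub>R u))"
    using second_difference[OF U(1) g t sub'] by auto
  have "g (x + t *\<^sub>R u + t *\<^sub>R v) - g (x + t *\<^sub>R u) - g (x + t *\<^sub>R v) + g x =
    g (x + t *\<^sub>R v + t *\<^sub>R u) - g (x + t *\<^sub>R v) - g (x + t *\<^sub>R u) + g x"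
    by (simp add: algebra_simps)
  then have "?A (x + p *\<^sub>R u + q *\<^sub>R v) = ?B (x + q' *\<^sub>R u + p' *\<^sub>R v)"
    using 1(5) 2(5) t by (simp add: algebra_simps)
  moreover have "dist (?A (x + p *\<^sub>R u + q *\<^sub>R v)) (?A x) < e"
    using near[of p q] 1 by (intro d(2)) (auto simp: d_def)
  moreover have "dist (?B (x + q' *\<^sub>R u + p' *\<^sub>R v)) (?B x) < e"
    using near[of q' p'] 2 by (intro d(4)) (auto simp: d_def)
  moreover have False if "a = b" "\<bar>a - c\<bar> < \<bar>c - d\<bar> / 2" "\<bar>b - d\<bar> < \<bar>c - d\<bar> / 2" for a b c d :: real
    using that by (auto simp: abs_if split: if_splits)
  ultimately show False unfolding e_def dist_real_def by blast
qed

lemma frechet_derivative_linear_comp: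
  assumes "bounded_linear L" "f differentiable (at x)"
  shows "frechet_derivative (\<lambda>y. L (f y)) (at x) v = L (frechet_derivative f (at x) v)"
  using frechet_derivative_eqI[OF bounded_linear.has_derivative[OF assms(1)]] assms(2)
  by (metis frechet_derivative_works)

lemma symmetric_second_derivative:
  fixes g :: "'e::euclidean_space \<Rightarrow> 'f::euclidean_space"
  assumes U: "open U" "x \<in> U" and g: "C_diff 2 U g"
  shows "frechet_derivative (\<lambda>y. frechet_derivative g (at y) u) (at x) v =
         frechet_derivative (\<lambda>y. frechet_derivative g (at y) v) (at x) u"
proof (rule euclidean_eqI)
  fix b :: 'f
  let ?gb = "\<lambda>y. g y \<bullet> b"
  have bl: "bounded_linear (\<lambda>y::'f. y \<bullet> b)" by (rule bounded_linear_inner_left)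
  have dg: "g differentiable (at y)" if "y \<in> U" for y
    using g that U by (simp add: numeral_2_eq_2 differentiable_on_eq_differentiable_at)
  have dd: "(\<lambda>y. frechet_derivative g (at y) w) differentiable (at x)" for w
    using g U by (simp add: numeral_2_eq_2 differentiable_on_eq_differentiable_at)
  have *: "frechet_derivative (\<lambda>y. frechet_derivative ?gb (at y) w) (at x) w'
      = frechet_derivative (\<lambda>y. frechet_derivative g (at y) w) (at x) w' \<bullet> b" for w w'
  proof -
    have "frechet_derivative (\<lambda>y. frechet_derivative ?gb (at y) w) (at x) =
      frechet_derivative (\<lambda>y. frechet_derivative g (at y) w \<bullet> b) (at x)"
      by (rule frechet_derivative_cong_open[OF U]) (simp add: frechet_derivative_linear_comp[OF bl dg])
    then show ?thesis by (simp add: frechet_derivative_linear_comp[OF bl dd])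
  qed
  show "frechet_derivative (\<lambda>y. frechet_derivative g (at y) u) (at x) v \<bullet> b =
        frechet_derivative (\<lambda>y. frechet_derivative g (at y) v) (at x) u \<bullet> b"
    using symmetric_second_derivative_real[OF U C_diff_linear_comp[OF bl U(1) g], of u v]
    by (simp add: *)
qed

lemma hs_open_symmetric:
  fixes g :: "'e::euclidean_space \<Rightarrow> 'f::euclidean_space"
  assumes S: "hs_open b S" and g: "smooth_on S g" and x: "x \<in> S"
  shows "frechet_derivative (\<lambda>y. frechet_derivative g (at y within S) u) (at x within S) v =
         frechet_derivative (\<lambda>y. frechet_derivative g (at y within S) v) (at x within S) u"
proof -
  obtain U h where U: "open U" "x \<in> U" "\<And>k. C_diff k U h"
    "\<And>y. y \<in> S \<Longrightarrow> y \<in> U \<Longrightarrow> frechet_derivative g (at y within S) = frechet_derivative h (at y)"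
    using hs_open_extension[OF S g x] by metis
  have "frechet_derivative (\<lambda>y. frechet_derivative g (at y within S) w) (at x within S) =
      frechet_derivative (\<lambda>y. frechet_derivative h (at y) w) (at x)" for w
  proof (rule hs_open_frechet_eqI[OF S x])
    have "C_diff (Suc 0) U (\<lambda>y. frechet_derivative h (at y) w)" using U(3)[of "Suc (Suc 0)"] by simp
    from C_diff_has_derivative[OF this U(1,2)]
    have "((\<lambda>y. frechet_derivative h (at y) w) has_derivative
        frechet_derivative (\<lambda>y. frechet_derivative h (at y) w) (at x)) (at x within S)"
      by (rule has_derivative_at_withinI)
    note G = this
    obtain d where d: "d > 0" "ball x d \<subseteq> U" using openE[OF U(1,2)] by metis
    show "((\<lambda>y. frechet_derivative g (at y within S) w) has_derivative
        frechet_derivative (\<lambda>y. frechet_derivative h (at y) w) (at x)) (at x within S)"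
    proof (rule has_derivative_transform_within[OF G d(1) x])
      fix z assume "z \<in> S" "dist z x < d"
      then show "frechet_derivative h (at z) w = frechet_derivative g (at z within S) w"
        using d U(4)[of z] by (auto simp: dist_commute)
    qed
  qed
  then show ?thesis using symmetric_second_derivative[OF U(1,2) U(3), of u v] by simp
qed

text \<open>The exterior derivative commutes with pullback. Differentiating \<open>\<nu> y w\<close>
  gives one term with the second derivative of \<open>g\<close>, which is symmetric and cancels in
  the difference, and one term in which only the form is differentiated.\<close>

lemma dform_pullback:
  fixes g :: "'e::euclidean_space \<Rightarrow> 'f::euclidean_space"
  assumes S: "hs_open b S" and T: "hs_open c T" and g: "smooth_on S g" "g ` S \<subseteq> T" and x: "x \<in> S"
    and lin: "\<And>y. y \<in> T \<Longrightarrow> linear (\<mu> y)" and sm: "\<And>u. smooth_on T (\<lambda>y. \<mu> y u)"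
    and \<nu>: "\<And>y u. y \<in> S \<Longrightarrow> \<nu> y u = (\<mu> (g y) (frechet_derivative g (at y within S) u) :: real)"
  defines "A \<equiv> frechet_derivative g (at x within S)"
  shows "frechet_derivative (\<lambda>y. \<nu> y v) (at x within S) u - frechet_derivative (\<lambda>y. \<nu> y u) (at x within S) v
    = frechet_derivative (\<lambda>y. \<mu> y (A v)) (at (g x) within T) (A u) -
      frechet_derivative (\<lambda>y. \<mu> y (A u)) (at (g x) within T) (A v)"
proof -
  have gx: "g x \<in> T" using g x by auto
  let ?D = "\<lambda>y. frechet_derivative g (at y within S)"
  let ?DD = "\<lambda>w. frechet_derivative (\<lambda>y. ?D y w) (at x within S)"
  let ?M = "\<lambda>w. frechet_derivative (\<lambda>y. \<mu> y w) (at (g x) within T)"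
  have Dg: "(g has_derivative A) (at x within S)"
    unfolding A_def by (rule hs_open_has_derivative[OF S g(1) x])
  have DM: "((\<lambda>y. \<mu> y w) has_derivative ?M w) (at (g x) within T)" for w
    by (rule hs_open_has_derivative[OF T sm gx])
  \<comment> \<open>In the pullback both the base point and the vector argument of
    \<open>\<mu>\<close> move. The expansion in \<open>Basis\<close> separates them, so that the
    product rule applies.\<close>
  have exp: "\<mu> y w = (\<Sum>b\<in>Basis. (w \<bullet> b) * \<mu> y b)" if "y \<in> T" for y w
  proof -
    have "\<mu> y w = \<mu> y (\<Sum>b\<in>Basis. (w \<bullet> b) *\<^sub>R b)" by (simp only: euclidean_representation)
    also have "\<dots> = (\<Sum>b\<in>Basis. (w \<bullet> b) * \<mu> y b)"
      by (simp only: linear_sum[OF lin[OF that]] linear_cmul[OF lin[OF that]] real_scaleR_def)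
    finally show ?thesis .
  qed
  have Mlin: "?M w z = (\<Sum>b\<in>Basis. (w \<bullet> b) * ?M b z)" for w z
  proof -
    have "((\<lambda>y. \<Sum>b\<in>Basis. (w \<bullet> b) * \<mu> y b) has_derivative (\<lambda>z. \<Sum>b\<in>Basis. (w \<bullet> b) * ?M b z)) (at (g x) within T)"
      by (intro has_derivative_sum has_derivative_mult_right DM)
    note G = this
    have "((\<lambda>y. \<mu> y w) has_derivative (\<lambda>z. \<Sum>b\<in>Basis. (w \<bullet> b) * ?M b z)) (at (g x) within T)"
      by (rule has_derivative_transform_within[OF G zero_less_one gx exp[symmetric]])
    from fun_cong[OF hs_open_frechet_eqI[OF T gx this], of z] show ?thesis .
  qed
  have D\<nu>: "((\<lambda>y. \<nu> y w) has_derivative (\<lambda>z. \<mu> (g x) (?DD w z) + ?M (A w) (A z))) (at x within S)" for w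
  proof -
    have "((\<lambda>y. ?D y w) has_derivative ?DD w) (at x within S)"
      by (rule hs_open_has_derivative[OF S smooth_on_frechet[OF S g(1)] x])
    then have 1: "((\<lambda>y. ?D y w \<bullet> b) has_derivative (\<lambda>z. ?DD w z \<bullet> b)) (at x within S)" for b
      by (rule has_derivative_inner_left)
    have 2: "((\<lambda>y. \<mu> (g y) b) has_derivative (\<lambda>z. ?M b (A z))) (at x within S)" for b
      by (rule has_derivative_in_compose[OF Dg has_derivative_subset[OF DM g(2)]])
    have "((\<lambda>y. \<Sum>b\<in>Basis. (?D y w \<bullet> b) * \<mu> (g y) b) has_derivative
       (\<lambda>z. \<Sum>b\<in>Basis. (?D x w \<bullet> b) * ?M b (A z) + (?DD w z \<bullet> b) * \<mu> (g x) b)) (at x within S)"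
      by (intro has_derivative_sum has_derivative_mult 1 2)
    note G = this
    have "((\<lambda>y. \<nu> y w) has_derivative
       (\<lambda>z. \<Sum>b\<in>Basis. (?D x w \<bullet> b) * ?M b (A z) + (?DD w z \<bullet> b) * \<mu> (g x) b)) (at x within S)"
    proof (rule has_derivative_transform_within[OF G zero_less_one x])
      fix y assume "y \<in> S"
      then show "(\<Sum>b\<in>Basis. (?D y w \<bullet> b) * \<mu> (g y) b) = \<nu> y w"
        using exp[of "g y" "?D y w"] g(2) \<nu>[of y w] by (metis image_subset_iff)
    qed
    moreover have "(\<Sum>b\<in>Basis. (?D x w \<bullet> b) * ?M b (A z) + (?DD w z \<bullet> b) * \<mu> (g x) b) =
        \<mu> (g x) (?DD w z) + ?M (A w) (A z)" for z
      unfolding exp[OF gx, of "?DD w z"] Mlin[of "A w" "A z"] sum.distrib by (simp add: A_def)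
    ultimately show ?thesis by simp
  qed
  have "frechet_derivative (\<lambda>y. \<nu> y w) (at x within S) z = \<mu> (g x) (?DD w z) + ?M (A w) (A z)" for w z
    by (simp only: hs_open_frechet_eqI[OF S x D\<nu>])
  moreover have "?DD v u = ?DD u v" by (rule hs_open_symmetric[OF S g(1) x])
  ultimately show ?thesis by simp
qed


section \<open>Counting members of open covers\<close>

text \<open>Any finite cover that refines \<open>\<W>\<close> bounds the count. The pieces
  \<open>C i\<close> are arbitrary sets, which later permits pieces cut out by symbolic
  codes.\<close>

lemma cover_number_le:
  assumes "finite I" and cov: "topspace X \<subseteq> (\<Union>i\<in>I. C i)"
    and sub: "\<And>i. i \<in> I \<Longrightarrow> \<exists>W\<in>\<W>. C i \<subseteq> W" and top: "\<And>W. W \<in> \<W> \<Longrightarrow> W \<subseteq> topspace X"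
  shows "cover_number X \<W> \<le> card I"
proof -
  obtain w where w: "\<And>i. i \<in> I \<Longrightarrow> w i \<in> \<W> \<and> C i \<subseteq> w i" using sub by metis
  have "\<Union>(w ` I) = topspace X"
  proof
    show "\<Union>(w ` I) \<subseteq> topspace X" using w top by blast
    show "topspace X \<subseteq> \<Union>(w ` I)" using cov w by blast
  qed
  then have "cover_number X \<W> \<le> card (w ` I)"
    unfolding cover_number_def using w assms(1) by (intro Least_le exI[of _ "w ` I"]) auto
  also have "\<dots> \<le> card I" using assms(1) by (rule card_image_le)
  finally show ?thesis .
qed

text \<open>The \<open>LEAST\<close> in \<open>cover_number\<close> is meaningful once some finite
  subcover exists; \<open>\<V>\<close> is such a witness.\<close>

lemma cover_number_attained:
  assumes "finite \<V>" "\<V> \<subseteq> \<W>" "\<Union>\<V> = topspace X"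
  shows "\<exists>\<V>\<subseteq>\<W>. finite \<V> \<and> card \<V> = cover_number X \<W> \<and> \<Union>\<V> = topspace X"
proof -
  have "\<exists>k. \<exists>\<V>\<subseteq>\<W>. finite \<V> \<and> card \<V> = k \<and> \<Union>\<V> = topspace X" using assms by auto
  from LeastI_ex[OF this] show ?thesis unfolding cover_number_def .
qed

lemma funpow_closed: "(\<And>x. x \<in> S \<Longrightarrow> f x \<in> S) \<Longrightarrow> x \<in> S \<Longrightarrow> (f ^^ k) x \<in> S"
  by (induction k) auto

lemma dynamical_joinI:
  assumes "C \<subseteq> topspace X" and "\<And>k. k < n \<Longrightarrow> \<exists>U\<in>\<U>. \<forall>x\<in>C. (f ^^ k) x \<in> U"
  shows "\<exists>W\<in>dynamical_join X f \<U> n. C \<subseteq> W"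
proof -
  obtain s where s: "\<And>k. k < n \<Longrightarrow> s k \<in> \<U> \<and> (\<forall>x\<in>C. (f ^^ k) x \<in> s k)"
    using assms(2) by metis
  then have "{x \<in> topspace X. \<forall>k<n. (f ^^ k) x \<in> s k} \<in> dynamical_join X f \<U> n"
    unfolding dynamical_join_def by blast
  moreover have "C \<subseteq> {x \<in> topspace X. \<forall>k<n. (f ^^ k) x \<in> s k}" using assms(1) s by auto
  ultimately show ?thesis by blast
qed

lemma dynamical_joinD:
  assumes "W \<in> dynamical_join X f \<U> n" "k < n"
  shows "\<exists>U\<in>\<U>. \<forall>x\<in>W. (f ^^ k) x \<in> U"
  using assms unfolding dynamical_join_def by blast

lemma dynamical_join_subset: "W \<in> dynamical_join X f \<U> n \<Longrightarrow> W \<subseteq> topspace X"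
  unfolding dynamical_join_def by blast

lemma join_minimal_subcover:
  assumes X: "compact_space X" and f: "\<And>x. x \<in> topspace X \<Longrightarrow> f x \<in> topspace X"
    and U: "open_cover X \<U>"
  obtains \<V> where "\<V> \<subseteq> dynamical_join X f \<U> n" "finite \<V>" "\<Union>\<V> = topspace X"
    "card \<V> = cover_number X (dynamical_join X f \<U> n)"
proof -
  obtain \<F> where F: "finite \<F>" "\<F> \<subseteq> \<U>" "\<Union>\<F> = topspace X"
    using X U unfolding compact_space open_cover_def by metis
  \<comment> \<open>Compactness is applied once, to \<open>\<U>\<close>. The itineraries of length
    \<open>n\<close> through a finite subcover then form a finite subcover of the join.\<close>
  let ?J = "(\<lambda>s. {x \<in> topspace X. \<forall>k<n. (f ^^ k) x \<in> s k}) ` (PiE {..<n} (\<lambda>_. \<F>))"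
  have "finite ?J" using F(1) by (intro finite_imageI finite_PiE) auto
  moreover have "?J \<subseteq> dynamical_join X f \<U> n"
  proof (rule image_subsetI)
    fix s assume "s \<in> PiE {..<n} (\<lambda>_. \<F>)"
    then have "\<forall>k<n. s k \<in> \<U>" using F(2) by (auto simp: PiE_def Pi_def)
    then show "{x \<in> topspace X. \<forall>k<n. (f ^^ k) x \<in> s k} \<in> dynamical_join X f \<U> n"
      unfolding dynamical_join_def by blast
  qed
  moreover have "\<Union>?J = topspace X"
  proof
    show "topspace X \<subseteq> \<Union>?J"
    proof
      fix x assume x: "x \<in> topspace X"
      have "\<exists>U\<in>\<F>. (f ^^ k) x \<in> U" for k
        using funpow_closed[where f=f and k=k, OF f x] F(3) by blast
      then obtain s where s: "\<And>k. s k \<in> \<F> \<and> (f ^^ k) x \<in> s k" by metis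
      have R: "restrict s {..<n} \<in> PiE {..<n} (\<lambda>_. \<F>)" using s by auto
      have "x \<in> {x \<in> topspace X. \<forall>k<n. (f ^^ k) x \<in> restrict s {..<n} k}" using s x by auto
      then show "x \<in> \<Union>?J" by (rule UnionI[OF imageI[OF R]])
    qed
  qed auto
  ultimately have "\<exists>\<V>\<subseteq>dynamical_join X f \<U> n. finite \<V> \<and>
      card \<V> = cover_number X (dynamical_join X f \<U> n) \<and> \<Union>\<V> = topspace X"
    by (rule cover_number_attained)
  then show ?thesis using that by blast
qed

text \<open>Arithmetic behind all entropy comparisons: \<open>m\<close> stretches time by the factor
  \<open>M\<close>, and \<open>Q\<close> is an overhead whose exponential rate \<alpha> is added to
  the result. The additive errors \<beta> and \<kappa> disappear after division by
  \<open>n\<close>.\<close>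

lemma limsup_count:
  fixes a b Q m :: "nat \<Rightarrow> nat"
  assumes "M > 0" "c \<ge> 0" "\<alpha> \<ge> 0" "\<beta> \<ge> 0" "\<kappa> \<ge> 0"
    and lim: "limsup (\<lambda>n. ereal (ln (real (b n)) / real n)) < ereal c"
    and ab: "\<And>n. a n \<le> Q n * b (m n)" and Q: "\<And>n. 1 \<le> Q n" "\<And>n. ln (real (Q n)) \<le> \<alpha> * real n + \<beta>"
    and m: "\<And>n. M * real n \<le> real (m n)" "\<And>n. real (m n) \<le> M * real n + \<kappa>"
  shows "limsup (\<lambda>n. ereal (ln (real (a n)) / real n)) \<le> ereal (\<alpha> + M * c)"
proof -
  from Limsup_lessD[OF lim] obtain m0 where m0: "\<And>k. k \<ge> m0 \<Longrightarrow> ln (real (b k)) / real k < c"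
    unfolding eventually_sequentially by auto
  define g where "g n = (\<alpha> + M * c) + (\<beta> + c * \<kappa>) / real n" for n :: nat
  \<comment> \<open>The threshold makes \<open>M * n\<close> at least \<open>m0 + 1\<close>, so that
    the bound for \<open>b\<close> holds at the time \<open>m n\<close>, which is moreover
    positive.\<close>
  have "ln (real (a n)) / real n \<le> g n" if n: "n \<ge> nat \<lceil>(real m0 + 1) / M\<rceil> + 1" for n
  proof -
    have n0: "real n > 0" using n by auto
    have "(real m0 + 1) / M \<le> real n" using n by linarith
    then have "real m0 + 1 \<le> M * real n" using \<open>M > 0\<close> by (simp add: field_simps)
    then have mn: "m n \<ge> m0" "real (m n) > 0" using m(1)[of n] by linarith+
    have lb: "ln (real (b (m n))) \<le> c * real (m n)"
      using m0[OF mn(1)] mn(2) by (simp add: field_simps)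
    also have "\<dots> \<le> c * (M * real n + \<kappa>)" using m(2) \<open>c \<ge> 0\<close> by (intro mult_left_mono) auto
    finally have lb: "ln (real (b (m n))) \<le> c * (M * real n + \<kappa>)" .
    have "ln (real (a n)) \<le> (\<alpha> * real n + \<beta>) + c * (M * real n + \<kappa>)"
    \<comment> \<open>Here \<open>ln 0 = 0\<close>, so a vanishing count meets the bound because the
      right-hand side is nonnegative. Otherwise \<open>b (m n)\<close> is positive as well and the
      logarithm splits.\<close>
    proof (cases "a n = 0")
      case True
      then show ?thesis using assms(1-5) by simp
    next
      case False
      then have b0: "b (m n) > 0" using ab[of n] by (auto intro: ccontr)
      have "ln (real (a n)) \<le> ln (real (Q n) * real (b (m n)))"
        using ab[of n] False Q(1)[of n] b0 by (subst ln_le_cancel_iff) (auto simp flip: of_nat_mult)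
      also have "\<dots> = ln (real (Q n)) + ln (real (b (m n)))"
        using Q(1)[of n] b0 by (subst ln_mult) auto
      finally show ?thesis using Q(2)[of n] lb by linarith
    qed
    then have "ln (real (a n)) / real n \<le> ((\<alpha> * real n + \<beta>) + c * (M * real n + \<kappa>)) / real n"
      using n0 by (intro divide_right_mono) auto
    also have "\<dots> = g n" using n0 by (simp add: g_def field_simps)
    finally show ?thesis .
  qed
  then have "eventually (\<lambda>n. ereal (ln (real (a n)) / real n) \<le> ereal (g n)) sequentially"
    unfolding eventually_sequentially by auto
  then have "limsup (\<lambda>n. ereal (ln (real (a n)) / real n)) \<le> limsup (\<lambda>n. ereal (g n))"
    by (rule Limsup_mono)
  also have "limsup (\<lambda>n. ereal (g n)) = ereal (\<alpha> + M * c)"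
  proof (rule lim_imp_Limsup)
    have "g \<longlonglongrightarrow> (\<alpha> + M * c) + 0"
      unfolding g_def by (intro tendsto_add tendsto_const lim_const_over_n)
    then show "(\<lambda>n. ereal (g n)) \<longlonglongrightarrow> ereal (\<alpha> + M * c)" by simp
  qed simp
  finally show ?thesis .
qed

section \<open>Entropy under comparison of covers, factor maps and restriction\<close>

lemma top_entropy_nonneg: "0 \<le> top_entropy X f"
proof -
  have "0 \<le> limsup (\<lambda>n. ereal (ln (real (cover_number X (dynamical_join X f {topspace X} n))) / real n))"
  proof (rule le_Limsup)
    have "0 \<le> ln (real k) / real n" for k n :: nat by (cases "k = 0") auto
    then show "\<forall>\<^sub>F n in sequentially. 0 \<le> ereal (ln (real (cover_number X (dynamical_join X f {topspace X} n))) / real n)"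
      by simp
  qed simp
  also have "\<dots> \<le> top_entropy X f"
    unfolding top_entropy_def by (rule SUP_upper) (auto simp: open_cover_def)
  finally show ?thesis .
qed

lemma top_entropy_empty:
  assumes "topspace X = {}"
  shows "top_entropy X f = 0"
proof -
  have "cover_number X \<W> = 0" for \<W>
    unfolding cover_number_def by (rule Least_eq_0) (use assms in auto)
  then have "top_entropy X f \<le> 0"
    unfolding top_entropy_def by (intro SUP_least) (simp add: zero_ereal_def[symmetric] Limsup_const)
  then show ?thesis using top_entropy_nonneg[of X f] by simp
qed

text \<open>Needed because \<open>flow_map\<close> is identified with a concrete flow only on the
  points of the space; invariance under \<open>g\<close> carries the agreement over to all
  iterates.\<close>

lemma top_entropy_cong:
  assumes "\<And>x. x \<in> topspace X \<Longrightarrow> f x = g x" and g: "\<And>x. x \<in> topspace X \<Longrightarrow> g x \<in> topspace X"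
  shows "top_entropy X f = top_entropy X g"
proof -
  have "(f ^^ k) x = (g ^^ k) x" if "x \<in> topspace X" for k x
    using that funpow_closed[OF g] by (induction k) (auto simp: assms(1))
  then have "{x \<in> topspace X. \<forall>k<n. (f ^^ k) x \<in> s k} = {x \<in> topspace X. \<forall>k<n. (g ^^ k) x \<in> s k}"
    for s :: "nat \<Rightarrow> 'a set" and n
    by auto
  then have "dynamical_join X f \<U> n = dynamical_join X g \<U> n" for \<U> n
    unfolding dynamical_join_def by presburger
  then show ?thesis unfolding top_entropy_def by simp
qed

text \<open>The cover \<open>\<W>\<close> and the overhead \<open>Q\<close> may depend on \<alpha>.
  Since every positive \<alpha> is allowed, an overhead of arbitrarily small exponential rate costs
  nothing in the limit.\<close>

lemma top_entropy_compare:
  assumes M: "M > 0"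
    and cmp: "\<And>\<U> \<alpha>. open_cover Y \<U> \<Longrightarrow> \<alpha> > 0 \<Longrightarrow>
      \<exists>\<W> \<beta> \<kappa> Q m. open_cover X \<W> \<and> \<beta> \<ge> 0 \<and> \<kappa> \<ge> 0 \<and> (\<forall>n.
        cover_number Y (dynamical_join Y g \<U> n) \<le> Q n * cover_number X (dynamical_join X f \<W> (m n)) \<and>
        1 \<le> Q n \<and> ln (real (Q n)) \<le> \<alpha> * real n + \<beta> \<and> M * real n \<le> real (m n) \<and> real (m n) \<le> M * real n + \<kappa>)"
  shows "top_entropy Y g \<le> ereal M * top_entropy X f"
proof (cases "top_entropy X f")
  case (real h)
  then have h0: "h \<ge> 0" using top_entropy_nonneg[of X f] by simp
  have "limsup (\<lambda>n. ereal (ln (real (cover_number Y (dynamical_join Y g \<U> n))) / real n)) \<le> ereal (M * h)"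
    if U: "open_cover Y \<U>" for \<U>
  proof (rule ereal_le_epsilon2)
    fix e :: real assume e: "e > 0"
    \<comment> \<open>The tolerance is split evenly: half for the rate of \<open>Q\<close>, half for
      the gap between \<open>h\<close> and \<open>c\<close>, which gets multiplied by
      \<open>M\<close>.\<close>
    define \<alpha> where "\<alpha> = e / 2"
    define c where "c = h + e / (2 * M)"
    have \<alpha>: "\<alpha> > 0" and c: "c > h" "M * c + \<alpha> = M * h + e"
      using e M by (auto simp: \<alpha>_def c_def field_simps)
    obtain \<W> \<beta> \<kappa> Q m where W: "open_cover X \<W>" "\<beta> \<ge> 0" "\<kappa> \<ge> 0"
      and n: "\<forall>n. cover_number Y (dynamical_join Y g \<U> n) \<le> Q n * cover_number X (dynamical_join X f \<W> (m n)) \<and>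
        1 \<le> Q n \<and> ln (real (Q n)) \<le> \<alpha> * real n + \<beta> \<and> M * real n \<le> real (m n) \<and> real (m n) \<le> M * real n + \<kappa>"
      using cmp[OF U \<alpha>] by (elim exE conjE) (rule that)
    have "limsup (\<lambda>n. ereal (ln (real (cover_number X (dynamical_join X f \<W> n))) / real n)) \<le> top_entropy X f"
      unfolding top_entropy_def by (rule SUP_upper) (use W in simp)
    also have "\<dots> < ereal c" using real c by simp
    finally have lim: "limsup (\<lambda>n. ereal (ln (real (cover_number X (dynamical_join X f \<W> n))) / real n)) < ereal c" .
    have "limsup (\<lambda>n. ereal (ln (real (cover_number Y (dynamical_join Y g \<U> n))) / real n)) \<le> ereal (\<alpha> + M * c)"
      by (rule limsup_count[where Q=Q and m=m, OF M _ _ W(2,3) lim]) (use n c(1) h0 \<alpha> in auto)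
    also have "\<dots> = ereal (M * h) + ereal e" using c by simp
    finally show "limsup (\<lambda>n. ereal (ln (real (cover_number Y (dynamical_join Y g \<U> n))) / real n)) \<le> ereal (M * h) + ereal e" .
  qed
  then show ?thesis unfolding real top_entropy_def[of Y] by (intro SUP_least) auto
next
  case PInf
  then show ?thesis using M by simp
next
  case MInf
  then show ?thesis using top_entropy_nonneg[of X f] by simp
qed

lemma top_entropy_compare1:
  assumes "\<And>\<U>. open_cover Y \<U> \<Longrightarrow> \<exists>\<W> q. open_cover X \<W> \<and> 1 \<le> q \<and>
     (\<forall>n. cover_number Y (dynamical_join Y g \<U> n) \<le> q * cover_number X (dynamical_join X f \<W> n))"
  shows "top_entropy Y g \<le> top_entropy X f"
proof -
  have "top_entropy Y g \<le> ereal 1 * top_entropy X f"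
  proof (rule top_entropy_compare)
    fix \<U> \<alpha> assume "open_cover Y \<U>" "\<alpha> > (0::real)"
    then obtain \<W> q where "open_cover X \<W>" "1 \<le> q"
      "\<forall>n. cover_number Y (dynamical_join Y g \<U> n) \<le> q * cover_number X (dynamical_join X f \<W> n)"
      using assms by blast
    then show "\<exists>\<W> \<beta> \<kappa> Q m. open_cover X \<W> \<and> \<beta> \<ge> 0 \<and> \<kappa> \<ge> 0 \<and> (\<forall>n.
        cover_number Y (dynamical_join Y g \<U> n) \<le> Q n * cover_number X (dynamical_join X f \<W> (m n)) \<and>
        1 \<le> Q n \<and> ln (real (Q n)) \<le> \<alpha> * real n + \<beta> \<and> 1 * real n \<le> real (m n) \<and> real (m n) \<le> 1 * real n + \<kappa>)"
      using \<open>\<alpha> > 0\<close>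
      by (intro exI[of _ \<W>] exI[of _ "ln (real q)"] exI[of _ 0] exI[of _ "\<lambda>_. q"] exI[of _ "\<lambda>n. n"]) auto
  qed simp
  then show ?thesis by (simp add: one_ereal_def[symmetric])
qed

text \<open>A cover of \<open>Y\<close> is pulled back to \<open>X\<close>. The images under
  \<open>p\<close> of a minimal subcover of the pulled-back join cover \<open>Y\<close> by
  surjectivity and refine the join there.\<close>

lemma top_entropy_factor:
  assumes X: "compact_space X" and p: "continuous_map X Y p" "p ` topspace X = topspace Y"
    and f: "\<And>x. x \<in> topspace X \<Longrightarrow> f x \<in> topspace X"
    and pf: "\<And>x. x \<in> topspace X \<Longrightarrow> p (f x) = g (p x)"
  shows "top_entropy Y g \<le> top_entropy X f"
proof (rule top_entropy_compare1)
  fix \<U> assume U: "open_cover Y \<U>"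
  define \<W> where "\<W> = (\<lambda>U. {x \<in> topspace X. p x \<in> U}) ` \<U>"
  have pk: "p ((f ^^ k) x) = (g ^^ k) (p x)" if "x \<in> topspace X" for x k
    using that funpow_closed[OF f] by (induction k) (auto simp: pf)
  have W: "open_cover X \<W>"
    unfolding open_cover_def
  proof (intro conjI ballI)
    fix W assume "W \<in> \<W>"
    then show "openin X W"
      using U openin_continuous_map_preimage[OF p(1)] unfolding open_cover_def \<W>_def by auto
  next
    have "\<exists>U\<in>\<U>. p x \<in> U" if "x \<in> topspace X" for x
      using U that p(2) unfolding open_cover_def by (metis Union_iff imageI)
    then show "\<Union>\<W> = topspace X" unfolding \<W>_def by blast
  qed
  have "cover_number Y (dynamical_join Y g \<U> n) \<le> 1 * cover_number X (dynamical_join X f \<W> n)" for n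
  proof -
    obtain \<V> where V: "\<V> \<subseteq> dynamical_join X f \<W> n" "finite \<V>" "\<Union>\<V> = topspace X"
      "card \<V> = cover_number X (dynamical_join X f \<W> n)"
      by (rule join_minimal_subcover[OF X f W])
    have "cover_number Y (dynamical_join Y g \<U> n) \<le> card \<V>"
    proof (rule cover_number_le[where C="\<lambda>B. p ` B"])
      show "topspace Y \<subseteq> (\<Union>B\<in>\<V>. p ` B)" unfolding p(2)[symmetric] V(3)[symmetric] by blast
      fix B assume B: "B \<in> \<V>"
      show "\<exists>W\<in>dynamical_join Y g \<U> n. p ` B \<subseteq> W"
      proof (rule dynamical_joinI)
        show "p ` B \<subseteq> topspace Y" using B V(3) p(2) by blast
        fix k assume k: "k < n"
        obtain W where "W \<in> \<W>" "\<forall>x\<in>B. (f ^^ k) x \<in> W"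
          using dynamical_joinD[OF _ k] B V(1) by blast
        then obtain U where "U \<in> \<U>" "\<forall>x\<in>B. p ((f ^^ k) x) \<in> U" unfolding \<W>_def by blast
        moreover have "B \<subseteq> topspace X" using B V(3) by blast
        ultimately show "\<exists>U\<in>\<U>. \<forall>x\<in>p ` B. (g ^^ k) x \<in> U" using pk[THEN sym] by (intro bexI[of _ U]) (auto simp: subset_iff)
      qed
    qed (rule V(2), erule dynamical_join_subset)
    then show ?thesis using V by simp
  qed
  then show "\<exists>\<W> q. open_cover X \<W> \<and> 1 \<le> q \<and>
     (\<forall>n. cover_number Y (dynamical_join Y g \<U> n) \<le> q * cover_number X (dynamical_join X f \<W> n))"
    using W by blast
qed

text \<open>When \<open>Z\<close> is a point this is the inequality for the restriction to a closed invariant subset.\<close>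

lemma top_entropy_fibre_identity:
  assumes X: "compact_space X" and D: "compactin Z D" and S: "closedin (prod_topology X Z) S" "S \<subseteq> UNIV \<times> D"
    and f: "\<And>x. x \<in> topspace X \<Longrightarrow> f x \<in> topspace X"
    and g: "\<And>x z. (x, z) \<in> S \<Longrightarrow> g (x, z) = (f x, z) \<and> (f x, z) \<in> S"
  shows "top_entropy (subtopology (prod_topology X Z) S) g \<le> top_entropy X f"
proof (cases "S = {}")
  case True
  then show ?thesis using top_entropy_nonneg by (simp add: top_entropy_empty)
next
  case False
  let ?Y = "subtopology (prod_topology X Z) S"
  have SX: "S \<subseteq> topspace X \<times> topspace Z" using closedin_subset[OF S(1)] by simp
  then have topY: "topspace ?Y = S" by auto
  show ?thesis
  proof (rule top_entropy_compare1)
    fix \<U> assume U: "open_cover ?Y \<U>"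
    then have U0: "\<U> \<noteq> {}" using False topY unfolding open_cover_def by auto
    have box: "\<exists>A B. openin X A \<and> openin Z B \<and> x \<in> A \<and> z \<in> B \<and> (\<exists>U\<in>\<U>. (A \<times> B) \<inter> S \<subseteq> U)"
      if xz: "x \<in> topspace X" "z \<in> topspace Z" for x z
    proof (cases "(x, z) \<in> S")
      case True
      then obtain U where U1: "U \<in> \<U>" "(x, z) \<in> U" "openin ?Y U" using U topY unfolding open_cover_def by blast
      then obtain O' where O': "openin (prod_topology X Z) O'" "U = O' \<inter> S" unfolding openin_subtopology by blast
      have xO: "(x, z) \<in> O'" using U1(2) O'(2) by blast
      obtain A B where "openin X A" "openin Z B" "x \<in> A" "z \<in> B" and AB: "A \<times> B \<subseteq> O'"
        using O'(1)[unfolded openin_prod_topology_alt, rule_format, OF xO] by blast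
      moreover have "(A \<times> B) \<inter> S \<subseteq> U" unfolding O'(2) using AB by blast
      ultimately show ?thesis using U1(1) by (intro exI[of _ A] exI[of _ B] conjI bexI[of _ U])
    next
      \<comment> \<open>Off the closed set \<open>S\<close> a box can be chosen that misses
        \<open>S\<close> altogether, so its empty trace lies in any member of
        \<open>\<U>\<close>.\<close>
      case F: False
      have "openin (prod_topology X Z) (topspace X \<times> topspace Z - S)" using S(1) unfolding closedin_def by simp
      moreover have "(x, z) \<in> topspace X \<times> topspace Z - S" using F xz by simp
      ultimately obtain A B where "openin X A" "openin Z B" "x \<in> A" "z \<in> B" and AB: "A \<times> B \<subseteq> topspace X \<times> topspace Z - S"
        unfolding openin_prod_topology_alt by meson
      moreover obtain U where "U \<in> \<U>" using U0 by blast
      moreover have "(A \<times> B) \<inter> S \<subseteq> U" using AB by blast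
      ultimately show ?thesis by (intro exI[of _ A] exI[of _ B] conjI bexI[of _ U])
    qed
    \<comment> \<open>Tube lemma: compactness of \<open>D\<close> yields one neighbourhood of
      \<open>x\<close> that works with finitely many fibre sets covering \<open>D\<close>.\<close>
    have "\<exists>A \<B>. openin X A \<and> x \<in> A \<and> finite \<B> \<and> D \<subseteq> \<Union>\<B> \<and> (\<forall>B\<in>\<B>. \<exists>U\<in>\<U>. (A \<times> B) \<inter> S \<subseteq> U)"
      if x: "x \<in> topspace X" for x
    proof -
      have DZ: "D \<subseteq> topspace Z" using D compactin_subset_topspace by blast
      have "\<forall>z\<in>D. \<exists>A B. openin X A \<and> openin Z B \<and> x \<in> A \<and> z \<in> B \<and> (\<exists>U\<in>\<U>. (A \<times> B) \<inter> S \<subseteq> U)"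
        using box[OF x] DZ by blast
      then obtain A B where AB: "\<And>z. z \<in> D \<Longrightarrow> openin X (A z) \<and> openin Z (B z) \<and> x \<in> A z \<and> z \<in> B z \<and> (\<exists>U\<in>\<U>. (A z \<times> B z) \<inter> S \<subseteq> U)"
        by metis
      have "\<exists>\<F>. finite \<F> \<and> \<F> \<subseteq> B ` D \<and> D \<subseteq> \<Union>\<F>"
        by (rule compactinD[OF D]) (use AB in auto)
      then obtain D' where D': "finite D'" "D' \<subseteq> D" "D \<subseteq> \<Union>(B ` D')" by (metis finite_subset_image)
      define A' where "A' = topspace X \<inter> (\<Inter>z\<in>D'. A z)"
      have "openin X A'"
      proof (cases "D' = {}")
        case False
        then have "openin X (\<Inter>z\<in>D'. A z)" using D' AB by (intro openin_INT2) auto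
        then show ?thesis unfolding A'_def by (intro openin_Int) auto
      qed (simp add: A'_def)
      moreover have "x \<in> A'" using x AB D' unfolding A'_def by blast
      moreover have "\<forall>B'\<in>B ` D'. \<exists>U\<in>\<U>. (A' \<times> B') \<inter> S \<subseteq> U"
      proof
        fix B' assume "B' \<in> B ` D'"
        then obtain z where z: "z \<in> D'" "B' = B z" by blast
        then obtain U where "U \<in> \<U>" "(A z \<times> B z) \<inter> S \<subseteq> U" using AB D' by blast
        moreover have "A' \<subseteq> A z" using z unfolding A'_def by blast
        ultimately show "\<exists>U\<in>\<U>. (A' \<times> B') \<inter> S \<subseteq> U" using z by blast
      qed
      ultimately show ?thesis using D' by blast
    qed
    then obtain A \<B> where AB: "\<And>x. x \<in> topspace X \<Longrightarrow> openin X (A x) \<and> x \<in> A x \<and> finite (\<B> x) \<and> D \<subseteq> \<Union>(\<B> x) \<and> (\<forall>B\<in>\<B> x. \<exists>U\<in>\<U>. (A x \<times> B) \<inter> S \<subseteq> U)"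
      by metis
    have "\<exists>\<F>. finite \<F> \<and> \<F> \<subseteq> A ` topspace X \<and> topspace X \<subseteq> \<Union>\<F>"
      using X unfolding compact_space_def by (rule compactinD) (use AB in auto)
    then obtain P where P: "finite P" "P \<subseteq> topspace X" "topspace X \<subseteq> \<Union>(A ` P)" by (metis finite_subset_image)
    define \<W> where "\<W> = A ` P"
    have W: "open_cover X \<W>"
      unfolding open_cover_def
    proof
      show 1: "\<forall>W\<in>\<W>. openin X W" using AB P(2) unfolding \<W>_def by blast
      have "\<Union>\<W> \<subseteq> topspace X" using 1 openin_subset by (intro Union_least) blast
      then show "\<Union>\<W> = topspace X" using P(3) unfolding \<W>_def by (intro equalityI)
    qed
    \<comment> \<open>The fibre coordinate never moves. Hence one choice of a fibre set containing
      it for each \<open>p\<close> in \<open>P\<close>, made once, serves at all times, and the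
      number of such choices does not depend on \<open>n\<close>.\<close>
    define Sig where "Sig = PiE P \<B>"
    define q where "q = max 1 (card Sig)"
    have "cover_number ?Y (dynamical_join ?Y g \<U> n) \<le> q * cover_number X (dynamical_join X f \<W> n)" for n
    proof -
      obtain \<V> where V: "\<V> \<subseteq> dynamical_join X f \<W> n" "finite \<V>" "\<Union>\<V> = topspace X"
        "card \<V> = cover_number X (dynamical_join X f \<W> n)"
        by (rule join_minimal_subcover[OF X f W])
      have gk: "(g ^^ k) (x, z) = ((f ^^ k) x, z) \<and> ((f ^^ k) x, z) \<in> S" if "(x, z) \<in> S" for x z k
        by (induction k) (use that g in auto)
      have "cover_number ?Y (dynamical_join ?Y g \<U> n) \<le> card (\<V> \<times> Sig)"
      proof (rule cover_number_le[where C="\<lambda>(B, s). {(x, z) \<in> S. x \<in> B \<and> (\<forall>p\<in>P. z \<in> s p)}"])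
        show "finite (\<V> \<times> Sig)" unfolding Sig_def using V P AB by (intro finite_cartesian_product finite_PiE) auto
        show "topspace ?Y \<subseteq> (\<Union>i\<in>\<V> \<times> Sig. case i of (B, s) \<Rightarrow> {(x, z) \<in> S. x \<in> B \<and> (\<forall>p\<in>P. z \<in> s p)})"
        proof
          fix y assume "y \<in> topspace ?Y"
          then obtain x z where y: "y = (x, z)" "(x, z) \<in> S" using topY by (cases y) auto
          then have "z \<in> D" "x \<in> topspace X" using S(2) SX by auto
          then obtain B where B: "B \<in> \<V>" "x \<in> B" unfolding V(3)[symmetric] by blast
          have "\<exists>b\<in>\<B> p. z \<in> b" if "p \<in> P" for p
          proof -
            have "D \<subseteq> \<Union>(\<B> p)" using AB P(2) that by blast
            then show ?thesis using \<open>z \<in> D\<close> by blast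
          qed
          then obtain s where s: "\<And>p. p \<in> P \<Longrightarrow> s p \<in> \<B> p \<and> z \<in> s p" by metis
          have "restrict s P \<in> Sig" unfolding Sig_def using s by auto
          moreover have "\<forall>p\<in>P. z \<in> restrict s P p" using s by auto
          ultimately show "y \<in> (\<Union>i\<in>\<V> \<times> Sig. case i of (B, s) \<Rightarrow> {(x, z) \<in> S. x \<in> B \<and> (\<forall>p\<in>P. z \<in> s p)})"
            using B y by (intro UN_I[of "(B, restrict s P)"]) auto
        qed
        fix i assume "i \<in> \<V> \<times> Sig"
        then obtain B s where i: "i = (B, s)" "B \<in> \<V>" "s \<in> Sig" by blast
        show "\<exists>W\<in>dynamical_join ?Y g \<U> n. (case i of (B, s) \<Rightarrow> {(x, z) \<in> S. x \<in> B \<and> (\<forall>p\<in>P. z \<in> s p)}) \<subseteq> W"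
          unfolding i(1) prod.case
        proof (rule dynamical_joinI)
          show "{(x, z) \<in> S. x \<in> B \<and> (\<forall>p\<in>P. z \<in> s p)} \<subseteq> topspace ?Y" using topY by auto
          fix k assume k: "k < n"
          obtain p where p: "p \<in> P" "\<forall>x\<in>B. (f ^^ k) x \<in> A p"
            using dynamical_joinD[OF _ k] i(2) V(1) unfolding \<W>_def by blast
          have "s p \<in> \<B> p" using i(3) p(1) unfolding Sig_def by auto
          then obtain U where "U \<in> \<U>" "(A p \<times> s p) \<inter> S \<subseteq> U" using AB P p by blast
          then show "\<exists>U\<in>\<U>. \<forall>y\<in>{(x, z) \<in> S. x \<in> B \<and> (\<forall>p\<in>P. z \<in> s p)}. (g ^^ k) y \<in> U"
            using gk p by (intro bexI[of _ U]) auto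
        qed
      qed (erule dynamical_join_subset)
      also have "\<dots> \<le> q * cover_number X (dynamical_join X f \<W> n)"
        using V(4) by (simp add: q_def card_cartesian_product mult.commute)
      finally show ?thesis .
    qed
    moreover have "1 \<le> q" by (simp add: q_def)
    ultimately show "\<exists>\<W> q. open_cover X \<W> \<and> 1 \<le> q \<and>
      (\<forall>n. cover_number ?Y (dynamical_join ?Y g \<U> n) \<le> q * cover_number X (dynamical_join X f \<W> n))"
      using W by blast
  qed
qed

lemma top_entropy_closed_subset:
  assumes X: "compact_space X" and S: "closedin X S"
    and f: "\<And>x. x \<in> topspace X \<Longrightarrow> f x \<in> topspace X" "\<And>x. x \<in> S \<Longrightarrow> f x \<in> S"
  shows "top_entropy (subtopology X S) f \<le> top_entropy X f"
proof -
  \<comment> \<open>The subset is regarded as fibred over the single point 0 of the real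
    line.\<close>
  let ?Z = "euclidean :: real topology"
  let ?Y = "subtopology (prod_topology X ?Z) (S \<times> {0})"
  have "top_entropy (subtopology X S) f \<le> top_entropy ?Y (\<lambda>(x, z). (f x, z))"
  proof (rule top_entropy_factor[where p=fst])
    show "compact_space ?Y"
      using compact_space_prod_topology closedin_compact_space[OF X S]
      by (simp add: compact_space_subtopology compactin_Times)
    show "continuous_map ?Y (subtopology X S) fst"
      by (auto simp: continuous_map_in_subtopology intro: continuous_map_from_subtopology continuous_map_fst)
    show "fst ` topspace ?Y = topspace (subtopology X S)" by force
  qed (use f in auto)
  also have "\<dots> \<le> top_entropy X f"
    by (rule top_entropy_fibre_identity[where D="{0}", OF X])
      (use f S in \<open>auto simp: closedin_prod_Times_iff\<close>)
  finally show ?thesis .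
qed


section \<open>Entropy of reparametrized flows\<close>

text \<open>Compactness of the time interval turns neighbourhoods that depend on \<open>s\<close>
  into a single one. Stating it for a monotone property \<open>P\<close> covers conditions that
  compare two points of \<open>W\<close>.\<close>

lemma real_interval_nhd:
  fixes P :: "real \<Rightarrow> 'a set \<Rightarrow> bool"
  assumes x: "x \<in> topspace X"
    and mono: "\<And>s W W'. P s W \<Longrightarrow> W' \<subseteq> W \<Longrightarrow> P s W'"
    and loc: "\<And>s. 0 \<le> s \<Longrightarrow> s \<le> K \<Longrightarrow> \<exists>I W. open I \<and> s \<in> I \<and> openin X W \<and> x \<in> W \<and> (\<forall>s'\<in>I. P s' W)"
  shows "\<exists>W. openin X W \<and> x \<in> W \<and> (\<forall>s. 0 \<le> s \<longrightarrow> s \<le> K \<longrightarrow> P s W)"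
proof -
  obtain I W where IW: "\<And>s. s \<in> {0..K} \<Longrightarrow> open (I s) \<and> s \<in> I s \<and> openin X (W s) \<and> x \<in> W s \<and> (\<forall>s'\<in>I s. P s' (W s))"
    using loc unfolding atLeastAtMost_iff by metis
  have "{0..K} \<subseteq> (\<Union>s\<in>{0..K}. I s)" using IW by blast
  then obtain C where C: "C \<subseteq> {0..K}" "finite C" "{0..K} \<subseteq> (\<Union>s\<in>C. I s)"
    using compactE_image[OF compact_Icc, of "{0..K}" I] IW by metis
  define W' where "W' = topspace X \<inter> (\<Inter>s\<in>C. W s)"
  have "openin X W'"
  proof (cases "C = {}")
    case False
    have "openin X (\<Inter>s\<in>C. W s)" using C IW False by (intro openin_INT2) auto
    then show ?thesis unfolding W'_def by (intro openin_Int) auto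
  qed (simp add: W'_def)
  moreover have "x \<in> W'" using x C IW unfolding W'_def by blast
  moreover have "P s W'" if "0 \<le> s" "s \<le> K" for s
  proof -
    have "s \<in> {0..K}" using that by simp
    then obtain c where c: "c \<in> C" "s \<in> I c" using C(3) by blast
    have "W' \<subseteq> W c" using c unfolding W'_def by blast
    then show ?thesis using mono IW c C(1) by blast
  qed
  ultimately show ?thesis by blast
qed

lemma product_nhd:
  assumes "continuous_map (prod_topology X Y) Z f" "openin Z U" "x \<in> topspace X" "y \<in> topspace Y" "f (x, y) \<in> U"
  shows "\<exists>A B. openin X A \<and> openin Y B \<and> x \<in> A \<and> y \<in> B \<and> (\<forall>a\<in>A. \<forall>b\<in>B. f (a, b) \<in> U)"
proof -
  have "openin (prod_topology X Y) {p \<in> topspace (prod_topology X Y). f p \<in> U}"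
    using assms(1,2) by (rule openin_continuous_map_preimage)
  moreover have "(x, y) \<in> {p \<in> topspace (prod_topology X Y). f p \<in> U}" using assms by simp
  ultimately obtain A B where "openin X A" "openin Y B" "x \<in> A" "y \<in> B"
    and AB: "A \<times> B \<subseteq> {p \<in> topspace (prod_topology X Y). f p \<in> U}"
    unfolding openin_prod_topology_alt by meson
  then show ?thesis by (intro exI[of _ A] exI[of _ B]) auto
qed

text \<open>The floor of \<open>a / e\<close> is the symbol that records a clock drift
  \<open>a\<close>. A change of drift by at most \<open>e\<close> moves it by at most one unit,
  hence three possible increments per block.\<close>

lemma floor_diff_cases:
  fixes a b e :: real
  assumes "e > 0" "\<bar>a - b\<bar> \<le> e"
  shows "\<lfloor>a / e\<rfloor> - \<lfloor>b / e\<rfloor> \<in> {-1, 0, 1}"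
proof -
  have "\<bar>a / e - b / e\<bar> \<le> 1"
    using assms by (simp add: diff_divide_distrib[symmetric] divide_le_eq_1)
  then have "\<bar>\<lfloor>a / e\<rfloor> - \<lfloor>b / e\<rfloor>\<bar> \<le> 1" by linarith
  then show ?thesis by auto
qed

lemma floor_eq_close:
  fixes a b e :: real
  assumes "e > 0" "\<lfloor>a / e\<rfloor> = \<lfloor>b / e\<rfloor>"
  shows "\<bar>a - b\<bar> \<le> e"
proof -
  have "\<bar>a / e - b / e\<bar> \<le> 1" using assms(2) by linarith
  then show ?thesis using assms(1) by (simp add: diff_divide_distrib[symmetric] divide_le_eq_1)
qed

text \<open>If two orbits of \<open>\<psi>\<close> stay close for a long time, their clocks \<open>T\<close> can only drift apart slowly.
  Recording the drift once per block of length \<open>K\<close>, up to a fixed error, takes one of three symbols per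
  block. Hence a \<open>\<psi>\<close>-Bowen set splits into \<open>3 ^ (time / K)\<close> pieces on which the clocks agree up to
  a fixed error, and these are contained in \<open>\<phi>\<close>-Bowen sets. The factor disappears as \<open>K\<close> grows.\<close>

lemma reparam_entropy_le:
  fixes \<phi> \<psi> :: "real \<Rightarrow> 'a \<Rightarrow> 'a" and T :: "real \<Rightarrow> 'a \<Rightarrow> real"
  assumes X: "compact_space X"
    and \<phi>: "continuous_map (prod_topology euclideanreal X) X (\<lambda>(t, x). \<phi> t x)"
      "\<And>x. x \<in> topspace X \<Longrightarrow> \<phi> 0 x = x" "\<And>s t x. x \<in> topspace X \<Longrightarrow> \<phi> (s + t) x = \<phi> s (\<phi> t x)"
    and \<psi>: "continuous_map (prod_topology euclideanreal X) X (\<lambda>(t, x). \<psi> t x)"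
      "\<And>x. x \<in> topspace X \<Longrightarrow> \<psi> 0 x = x" "\<And>s t x. x \<in> topspace X \<Longrightarrow> \<psi> (s + t) x = \<psi> s (\<psi> t x)"
    and T: "continuous_map (prod_topology euclideanreal X) euclideanreal (\<lambda>(t, x). T t x)"
      "\<And>s t x. x \<in> topspace X \<Longrightarrow> T (s + t) x = T s (\<psi> t x) + T t x"
    and conj: "\<And>s x. x \<in> topspace X \<Longrightarrow> \<phi> (T s x) x = \<psi> s x"
    and M: "M > 0" and growth: "\<And>s x. x \<in> topspace X \<Longrightarrow> 0 \<le> s \<Longrightarrow> s \<le> M * T s x"
  shows "top_entropy X (\<phi> 1) \<le> ereal M * top_entropy X (\<psi> 1)"
proof (cases "topspace X = {}")
  case True
  then show ?thesis by (simp add: top_entropy_empty)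
next
  case ne: False
  have \<phi>X: "\<phi> t x \<in> topspace X" and \<psi>X: "\<psi> t x \<in> topspace X" if "x \<in> topspace X" for t x
    using continuous_map_image_subset_topspace[OF \<phi>(1)] continuous_map_image_subset_topspace[OF \<psi>(1)] that by auto
  have \<phi>k: "(\<phi> 1 ^^ k) x = \<phi> (real k) x" and \<psi>k: "(\<psi> 1 ^^ k) x = \<psi> (real k) x" if x: "x \<in> topspace X" for k x
    using \<phi>(2)[OF x] \<phi>(3)[OF x, of 1] \<psi>(2)[OF x] \<psi>(3)[OF x, of 1] by (induction k) simp_all
  have T0: "T 0 x = 0" if "x \<in> topspace X" for x
    using T(2)[OF that, of 0 0] \<psi>(2)[OF that] by simp
  show ?thesis
  proof (rule top_entropy_compare[OF M])
    fix \<U> and \<alpha> :: real assume U: "open_cover X \<U>" and \<alpha>: "\<alpha> > 0"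
    have U0: "\<U> \<noteq> {}" using ne U unfolding open_cover_def by (metis Sup_empty)
    \<comment> \<open>Up to the \<phi>-time \<open>n\<close> there are about
      \<open>M * n / K\<close> blocks with three symbols each. This \<open>K\<close> brings the
      resulting rate \<open>M * ln 3 / K\<close> below \<alpha>.\<close>
    define K :: nat where "K = nat \<lceil>M * ln 3 / \<alpha>\<rceil> + 1"
    have K: "K > 0" "M * ln 3 / real K \<le> \<alpha>"
    proof -
      have "M * ln 3 / \<alpha> \<le> real K" unfolding K_def by linarith
      then show "M * ln 3 / real K \<le> \<alpha>" using \<alpha> by (simp add: K_def field_simps)
    qed (simp add: K_def)
    let ?good = "\<lambda>e V. \<exists>U\<in>\<U>. \<forall>r. \<bar>r\<bar> \<le> e \<longrightarrow> \<phi> r ` V \<subseteq> U"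
    have "\<exists>e V. e > 0 \<and> openin X V \<and> x \<in> V \<and> ?good e V" if x: "x \<in> topspace X" for x
    proof -
      obtain U where U1: "U \<in> \<U>" "x \<in> U" "openin X U" using U x unfolding open_cover_def by blast
      obtain A B where AB: "open A" "openin X B" "0 \<in> A" "x \<in> B" "\<forall>a\<in>A. \<forall>b\<in>B. \<phi> a b \<in> U"
        using product_nhd[OF \<phi>(1) U1(3), of 0 x] x U1(2) \<phi>(2)[OF x] by auto
      obtain e where e: "e > 0" "cball 0 e \<subseteq> A" using AB(1,3) open_contains_cball by blast
      have "r \<in> A" if "\<bar>r\<bar> \<le> e" for r using e(2) that by (auto simp: subset_iff)
      then have "\<forall>r. \<bar>r\<bar> \<le> e \<longrightarrow> \<phi> r ` B \<subseteq> U" using AB(5) by blast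
      then show ?thesis using e(1) AB(2,4) U1(1) by blast
    qed
    then obtain e0 V0 where eV: "\<And>x. x \<in> topspace X \<Longrightarrow> e0 x > 0 \<and> openin X (V0 x) \<and> x \<in> V0 x \<and> ?good (e0 x) (V0 x)"
      by metis
    have "\<exists>\<F>. finite \<F> \<and> \<F> \<subseteq> V0 ` topspace X \<and> topspace X \<subseteq> \<Union>\<F>"
      using X unfolding compact_space_def by (rule compactinD) (use eV in auto)
    then obtain P where P: "finite P" "P \<subseteq> topspace X" "topspace X \<subseteq> \<Union>(V0 ` P)" by (metis finite_subset_image)
    have P0: "P \<noteq> {}" using P(3) ne by auto
    define \<epsilon> where "\<epsilon> = Min (e0 ` P)"
    have \<epsilon>0: "\<epsilon> > 0" unfolding \<epsilon>_def using P(1,2) P0 eV by (subst Min_gr_iff) auto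
    have \<epsilon>: "?good \<epsilon> (V0 p)" if p: "p \<in> P" for p
    proof -
      have "\<epsilon> \<le> e0 p" unfolding \<epsilon>_def using P(1) p by simp
      moreover obtain U where "U \<in> \<U>" "\<forall>r. \<bar>r\<bar> \<le> e0 p \<longrightarrow> \<phi> r ` V0 p \<subseteq> U" using eV p P(2) by blast
      ultimately show ?thesis by (intro bexI[of _ U]) auto
    qed
    \<comment> \<open>Two errors of size \<eta> will add up to \<epsilon>: the rounding of the drift
      recorded at the start of a block, and the drift accumulated inside the block since
      then.\<close>
    define \<eta> where "\<eta> = \<epsilon> / 2"
    have \<eta>: "\<eta> > 0" using \<epsilon>0 by (simp add: \<eta>_def)
    let ?ok = "\<lambda>s W. (\<exists>p\<in>P. \<psi> s ` W \<subseteq> V0 p) \<and> (\<forall>x\<in>W. \<forall>y\<in>W. \<bar>T s x - T s y\<bar> \<le> \<eta>)"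
    have "\<exists>W. openin X W \<and> x \<in> W \<and> (\<forall>s. 0 \<le> s \<longrightarrow> s \<le> real K \<longrightarrow> ?ok s W)" if x: "x \<in> topspace X" for x
    proof (rule real_interval_nhd[OF x])
      fix s W W' assume "?ok s W" "W' \<subseteq> W"
      then show "?ok s W'" by (meson image_mono subset_iff subset_trans)
    next
      fix s :: real
      obtain p where p: "p \<in> P" "\<psi> s x \<in> V0 p" using P(3) \<psi>X[OF x] by blast
      have op: "openin X (V0 p)" using eV p(1) P(2) by blast
      obtain A B where AB: "open A" "openin X B" "s \<in> A" "x \<in> B" "\<forall>a\<in>A. \<forall>b\<in>B. \<psi> a b \<in> V0 p"
        using product_nhd[OF \<psi>(1) op, of s x] x p(2) by auto
      obtain A' B' where AB': "open A'" "openin X B'" "s \<in> A'" "x \<in> B'" "\<forall>a\<in>A'. \<forall>b\<in>B'. T a b \<in> ball (T s x) (\<eta> / 2)"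
        using product_nhd[OF T(1), of "ball (T s x) (\<eta> / 2)" s x] x \<eta> by auto
      have "?ok a (B \<inter> B')" if a: "a \<in> A \<inter> A'" for a
      proof
        show "\<exists>p\<in>P. \<psi> a ` (B \<inter> B') \<subseteq> V0 p" using a AB(5) p(1) by blast
        show "\<forall>x\<in>B \<inter> B'. \<forall>y\<in>B \<inter> B'. \<bar>T a x - T a y\<bar> \<le> \<eta>"
        proof (intro ballI)
          fix y z assume "y \<in> B \<inter> B'" "z \<in> B \<inter> B'"
          then have "\<bar>T s x - T a y\<bar> < \<eta> / 2" "\<bar>T s x - T a z\<bar> < \<eta> / 2"
            using AB'(5) a by (auto simp: dist_real_def)
          then show "\<bar>T a y - T a z\<bar> \<le> \<eta>" by linarith
        qed
      qed
      then show "\<exists>I W. open I \<and> s \<in> I \<and> openin X W \<and> x \<in> W \<and> (\<forall>s'\<in>I. ?ok s' W)"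
        using AB(1-4) AB'(1-4) by (intro exI[of _ "A \<inter> A'"] exI[of _ "B \<inter> B'"]) auto
    qed
    then obtain N0 where N0: "\<And>x. x \<in> topspace X \<Longrightarrow> openin X (N0 x) \<and> x \<in> N0 x \<and> (\<forall>s. 0 \<le> s \<longrightarrow> s \<le> real K \<longrightarrow> ?ok s (N0 x))"
      by metis
    define \<W> where "\<W> = N0 ` topspace X"
    have W: "open_cover X \<W>"
      unfolding open_cover_def
    proof
      show 1: "\<forall>W\<in>\<W>. openin X W" using N0 unfolding \<W>_def by blast
      have "\<Union>\<W> \<subseteq> topspace X" using 1 openin_subset by (intro Union_least) blast
      moreover have "topspace X \<subseteq> \<Union>\<W>" unfolding \<W>_def using N0 by blast
      ultimately show "\<Union>\<W> = topspace X" by (intro equalityI)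
    qed
    have Wok: "?ok s W" if "W \<in> \<W>" "0 \<le> s" "s \<le> real K" for s W
      using N0 that unfolding \<W>_def by blast
    \<comment> \<open>By \<open>growth\<close> the clock of every point reads at least
      \<open>n\<close> after the \<psi>-time \<open>M * n\<close>, so \<open>N n\<close> blocks of
      length \<open>K\<close> suffice.\<close>
    define N where "N n = nat \<lceil>M * real n / real K\<rceil>" for n :: nat
    have N1: "M * real n \<le> real (K * N n)" and N2: "real (N n) \<le> M * real n / real K + 1" for n
    proof -
      have "M * real n / real K \<le> real (N n)" unfolding N_def by linarith
      then show "M * real n \<le> real (K * N n)" using K(1) by (simp add: field_simps)
      have "M * real n / real K \<ge> 0" using M by simp
      then show "real (N n) \<le> M * real n / real K + 1" unfolding N_def by linarith
    qed
    have cnt: "cover_number X (dynamical_join X (\<phi> 1) \<U> n) \<le> 3 ^ N n * cover_number X (dynamical_join X (\<psi> 1) \<W> (K * N n))" for n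
    proof -
      obtain \<V> where V: "\<V> \<subseteq> dynamical_join X (\<psi> 1) \<W> (K * N n)" "finite \<V>" "\<Union>\<V> = topspace X"
        "card \<V> = cover_number X (dynamical_join X (\<psi> 1) \<W> (K * N n))"
        by (rule join_minimal_subcover[OF X \<psi>X W])
      \<comment> \<open>Drift is measured against one reference orbit in each Bowen set
        \<open>B\<close>. The absolute readings are unbounded, but the code relative to
        \<open>c B\<close> changes by at most one unit per block, and only these changes are stored
        in \<open>st\<close>.\<close>
      define c where "c B = (SOME x. x \<in> B)" for B :: "'a set"
      define code where "code B y j = \<lfloor>(T (real j * real K) y - T (real j * real K) (c B)) / \<eta>\<rfloor>" for B y j
      define st where "st B y = restrict (\<lambda>j. code B y (Suc j) - code B y j) {..<N n}" for B y
      let ?E = "PiE {..<N n} (\<lambda>_. {-1, 0, 1 :: int})"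
      have cB: "c B \<in> B" if "y \<in> B" for y B unfolding c_def using that by (rule someI)
      have blk: "\<exists>W\<in>\<W>. \<forall>x\<in>B. \<psi> (real j * real K) x \<in> W" if B: "B \<in> \<V>" and j: "j < N n" for B j
      proof -
        have "B \<in> dynamical_join X (\<psi> 1) \<W> (K * N n)" using B V(1) by blast
        moreover have "j * K < K * N n" using j K(1) by (simp add: mult.commute)
        ultimately obtain W where "W \<in> \<W>" "\<forall>x\<in>B. (\<psi> 1 ^^ (j * K)) x \<in> W" using dynamical_joinD by blast
        moreover have "B \<subseteq> topspace X" using B V(3) by blast
        ultimately show ?thesis using \<psi>k[of _ "j * K"] by (intro bexI[of _ W]) (auto simp: subset_iff)
      qed
      have stE: "st B y \<in> ?E" if B: "B \<in> \<V>" and y: "y \<in> B" for B y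
      proof -
        have yX: "y \<in> topspace X" "c B \<in> topspace X" using B y cB V(3) by blast+
        have "code B y (Suc j) - code B y j \<in> {-1, 0, 1}" if j: "j < N n" for j
        proof -
          obtain W where W': "W \<in> \<W>" "\<forall>x\<in>B. \<psi> (real j * real K) x \<in> W" using blk[OF B j] by blast
          have "real (Suc j) * real K = real K + real j * real K" by (simp add: algebra_simps)
          then have "(T (real (Suc j) * real K) y - T (real (Suc j) * real K) (c B)) - (T (real j * real K) y - T (real j * real K) (c B))
            = T (real K) (\<psi> (real j * real K) y) - T (real K) (\<psi> (real j * real K) (c B))"
            using T(2)[OF yX(1), of "real K" "real j * real K"] T(2)[OF yX(2), of "real K" "real j * real K"] by simp
          moreover have "\<bar>T (real K) (\<psi> (real j * real K) y) - T (real K) (\<psi> (real j * real K) (c B))\<bar> \<le> \<eta>"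
            using Wok[OF W'(1), of "real K"] W'(2) y cB[OF y] by simp
          ultimately show ?thesis unfolding code_def by (intro floor_diff_cases[OF \<eta>]) simp
        qed
        then show ?thesis unfolding st_def by auto
      qed
      \<comment> \<open>All clocks start at 0, so equal increments give equal codes at every
        block.\<close>
      have code_eq: "code B y j = code B y' j"
        if B: "B \<in> \<V>" "y \<in> B" "y' \<in> B" and st: "st B y = st B y'" and j: "j \<le> N n" for B y y' j
        using j
      proof (induction j)
        case 0
        have "y \<in> topspace X" "y' \<in> topspace X" "c B \<in> topspace X" using B cB V(3) by blast+
        then show ?case by (simp add: code_def T0)
      next
        case (Suc j)
        have "st B y j = st B y' j" using st by simp
        then show ?case using Suc unfolding st_def by simp
      qed
      have "cover_number X (dynamical_join X (\<phi> 1) \<U> n) \<le> card (\<V> \<times> ?E)"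
      proof (rule cover_number_le[where C="\<lambda>(B, e). {y \<in> B. st B y = e}"])
        show "finite (\<V> \<times> ?E)" using V(2) by (intro finite_cartesian_product finite_PiE) auto
        show "topspace X \<subseteq> (\<Union>i\<in>\<V> \<times> ?E. case i of (B, e) \<Rightarrow> {y \<in> B. st B y = e})"
        proof
          fix y assume "y \<in> topspace X"
          then obtain B where "B \<in> \<V>" "y \<in> B" using V(3) by blast
          then show "y \<in> (\<Union>i\<in>\<V> \<times> ?E. case i of (B, e) \<Rightarrow> {y \<in> B. st B y = e})"
            using stE by (intro UN_I[of "(B, st B y)"]) auto
        qed
        fix i assume "i \<in> \<V> \<times> ?E"
        then obtain B e where i: "i = (B, e)" "B \<in> \<V>" by blast
        define C where "C = {y \<in> B. st B y = e}"
        have CX: "C \<subseteq> topspace X" using i V(3) unfolding C_def by blast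
        have "\<exists>W\<in>dynamical_join X (\<phi> 1) \<U> n. C \<subseteq> W"
        proof (rule dynamical_joinI[OF CX])
          fix k assume k: "k < n"
          show "\<exists>U\<in>\<U>. \<forall>x\<in>C. (\<phi> 1 ^^ k) x \<in> U"
          proof (cases "C = {}")
            case True
            then show ?thesis using U0 by blast
          next
            case False
            then obtain y0 where y0: "y0 \<in> C" by blast
            then have y0X: "y0 \<in> topspace X" using CX by blast
            have "continuous_map euclideanreal euclideanreal ((\<lambda>(t, x). T t x) \<circ> (\<lambda>t. (t, y0)))"
              by (rule continuous_map_compose[OF _ T(1)]) (use y0X in \<open>simp add: continuous_map_pairedI\<close>)
            then have cT: "continuous_on UNIV (\<lambda>t. T t y0)" by (simp add: o_def)
            \<comment> \<open>\<open>s\<close> is the \<psi>-time at which the clock of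
              \<open>y0\<close> reads \<open>k\<close>. At this same \<open>s\<close> the other
              clocks in the piece \<open>C\<close> read \<open>k\<close> up to \<epsilon>, so a
              short \<phi>-move corrects them.\<close>
            have "\<exists>s\<ge>0. s \<le> M * real k \<and> T s y0 = real k"
            proof (rule IVT')
              show "T 0 y0 \<le> real k" using T0[OF y0X] by simp
              show "real k \<le> T (M * real k) y0" using growth[OF y0X, of "M * real k"] M by simp
              show "0 \<le> M * real k" using M by simp
              show "continuous_on {0..M * real k} (\<lambda>t. T t y0)" using cT by (rule continuous_on_subset) simp
            qed
            then obtain s where s: "0 \<le> s" "s \<le> M * real k" "T s y0 = real k" by blast
            have "M * real k < M * real n" using k M by simp
            then have sK: "s < real K * real (N n)" using s(2) N1[of n] by simp
            define j where "j = nat \<lfloor>s / real K\<rfloor>"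
            define s' where "s' = s - real j * real K"
            have jr: "real j = of_int \<lfloor>s / real K\<rfloor>" unfolding j_def using s(1) K(1) by simp
            have "real j \<le> s / real K" "s / real K < real j + 1" unfolding jr by linarith+
            then have s': "0 \<le> s'" "s' \<le> real K" using K(1) by (auto simp: s'_def field_simps)
            have "real j * real K < real (N n) * real K" using s'(1) sK by (simp add: s'_def mult.commute)
            then have j: "j < N n" using K(1) by simp
            have ss: "s = s' + real j * real K" by (simp add: s'_def)
            obtain W where W': "W \<in> \<W>" "\<forall>x\<in>B. \<psi> (real j * real K) x \<in> W" using blk[OF i(2) j] by blast
            obtain p where p: "p \<in> P" "\<psi> s' ` W \<subseteq> V0 p" using Wok[OF W'(1) s'] by blast
            obtain U where U1: "U \<in> \<U>" "\<forall>r. \<bar>r\<bar> \<le> \<epsilon> \<longrightarrow> \<phi> r ` V0 p \<subseteq> U" using \<epsilon>[OF p(1)] by blast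
            have "(\<phi> 1 ^^ k) y \<in> U" if y: "y \<in> C" for y
            proof -
              have yX: "y \<in> topspace X" using y CX by blast
              have yB: "y \<in> B" "y0 \<in> B" "st B y = st B y0" using y y0 unfolding C_def by auto
              have "code B y j = code B y0 j" using code_eq[OF i(2) yB] j by simp
              then have "\<bar>(T (real j * real K) y - T (real j * real K) (c B)) - (T (real j * real K) y0 - T (real j * real K) (c B))\<bar> \<le> \<eta>"
                unfolding code_def by (rule floor_eq_close[OF \<eta>])
              moreover have "\<bar>T s' (\<psi> (real j * real K) y) - T s' (\<psi> (real j * real K) y0)\<bar> \<le> \<eta>"
                using Wok[OF W'(1) s'] W'(2) yB by blast
              moreover have "T s y = T s' (\<psi> (real j * real K) y) + T (real j * real K) y"
                "T s y0 = T s' (\<psi> (real j * real K) y0) + T (real j * real K) y0"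
                unfolding ss using T(2) yX y0X by blast+
              ultimately have d: "\<bar>T s y0 - T s y\<bar> \<le> \<epsilon>" unfolding \<eta>_def by linarith
              have "\<psi> s y = \<psi> s' (\<psi> (real j * real K) y)" unfolding ss using \<psi>(3)[OF yX] by blast
              then have "\<psi> s y \<in> V0 p" using p(2) W'(2) yB(1) by auto
              then have "\<phi> (real k - T s y) (\<psi> s y) \<in> U" using U1(2) d s(3) by (simp add: image_subset_iff)
              moreover have "(\<phi> 1 ^^ k) y = \<phi> (real k - T s y) (\<psi> s y)"
                using \<phi>k[OF yX, of k] \<phi>(3)[OF yX, of "real k - T s y" "T s y"] conj[OF yX, of s] by simp
              ultimately show ?thesis by simp
            qed
            then show ?thesis using U1(1) by blast
          qed
        qed
        then show "\<exists>W\<in>dynamical_join X (\<phi> 1) \<U> n. (case i of (B, e) \<Rightarrow> {y \<in> B. st B y = e}) \<subseteq> W"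
          unfolding i(1) C_def by simp
      qed (erule dynamical_join_subset)
      also have "card (\<V> \<times> ?E) = 3 ^ N n * cover_number X (dynamical_join X (\<psi> 1) \<W> (K * N n))"
        using V(4) by (simp add: card_cartesian_product card_PiE numeral_3_eq_3)
      finally show ?thesis .
    qed
    have lnQ: "ln (real ((3::nat) ^ N n)) \<le> \<alpha> * real n + ln 3" for n
    proof -
      have "ln (real ((3::nat) ^ N n)) = real (N n) * ln 3" by (simp add: ln_realpow)
      also have "\<dots> \<le> (M * real n / real K + 1) * ln 3" by (intro mult_right_mono N2) simp
      also have "\<dots> = (M * ln 3 / real K) * real n + ln 3" by (simp add: algebra_simps)
      also have "\<dots> \<le> \<alpha> * real n + ln 3" using K(2) by (intro add_right_mono mult_right_mono) auto
      finally show ?thesis .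
    qed
    have N3: "real (K * N n) \<le> M * real n + real K" for n
      using N2[of n] K(1) by (simp add: field_simps)
    show "\<exists>\<W> \<beta> \<kappa> Q m. open_cover X \<W> \<and> \<beta> \<ge> 0 \<and> \<kappa> \<ge> 0 \<and> (\<forall>n.
        cover_number X (dynamical_join X (\<phi> 1) \<U> n) \<le> Q n * cover_number X (dynamical_join X (\<psi> 1) \<W> (m n)) \<and>
        1 \<le> Q n \<and> ln (real (Q n)) \<le> \<alpha> * real n + \<beta> \<and> M * real n \<le> real (m n) \<and> real (m n) \<le> M * real n + \<kappa>)"
      using W cnt lnQ N1 N3
      by (intro exI[of _ \<W>] exI[of _ "ln 3"] exI[of _ "real K"] exI[of _ "\<lambda>n. 3 ^ N n"] exI[of _ "\<lambda>n. K * N n"]) simp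
  qed
qed


section \<open>Time changes of flows\<close>

text \<open>An integral over an empty interval is 0, so the difference of the two integrals is the
  integral from 0 to \<open>s\<close> for either sign of \<open>s\<close>.\<close>

lemma antiderivative_real:
  fixes f :: "real \<Rightarrow> real"
  assumes "continuous_on UNIV f"
  shows "((\<lambda>s. integral {0..s} f - integral {s..0} f) has_real_derivative f s) (at s)"
proof -
  \<comment> \<open>A base point to the left of both 0 and \<open>s\<close>; the margin 1 places
    them in the interior, where the one-sided derivative is a full one.\<close>
  define a where "a = min 0 s - 1"
  define b where "b = max 0 s + 1"
  have s: "s \<in> {a<..<b}" "0 \<in> {a<..<b}" by (auto simp: a_def b_def)
  have cont: "continuous_on S f" for S using assms continuous_on_subset by blast
  have int: "f integrable_on {c..d}" for c d by (rule integrable_continuous_interval[OF cont])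
  have "((\<lambda>t. integral {a..t} f) has_real_derivative f s) (at s within {a..b})"
    by (rule integral_has_real_derivative[OF cont]) (use s in auto)
  moreover have "at s within {a..b} = at s" using s(1) by (intro at_within_interior) simp
  ultimately have "((\<lambda>t. integral {a..t} f) has_real_derivative f s) (at s)" by metis
  then have "((\<lambda>t. integral {a..t} f - integral {a..0} f) has_real_derivative f s - 0) (at s)"
    by (intro DERIV_diff DERIV_const)
  then have "((\<lambda>t. integral {a..t} f - integral {a..0} f) has_real_derivative f s) (at s)" by simp
  then show ?thesis
  proof (rule has_field_derivative_transform_within_open[of _ _ _ "{a<..<b}"])
    fix t assume t: "t \<in> {a<..<b}"
    show "integral {a..t} f - integral {a..0} f = integral {0..t} f - integral {t..0} f"
    proof (cases "0 \<le> t")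
      case True
      have "integral {a..0} f + integral {0..t} f = integral {a..t} f"
        using s(2) by (intro Henstock_Kurzweil_Integration.integral_combine[OF _ True int]) simp
      moreover have "integral {t..0} f = 0" using True by (cases "t = 0") simp_all
      ultimately show ?thesis by simp
    next
      case False
      have "integral {a..t} f + integral {t..0} f = integral {a..0} f"
        using t False by (intro Henstock_Kurzweil_Integration.integral_combine[OF _ _ int]) simp_all
      then show ?thesis using False by simp
    qed
  qed (use s in auto)
qed

lemma continuous_map_realI:
  fixes f :: "'a \<Rightarrow> real"
  assumes "\<And>x e. x \<in> topspace X \<Longrightarrow> e > 0 \<Longrightarrow> \<exists>U. openin X U \<and> x \<in> U \<and> (\<forall>y\<in>U. \<bar>f y - f x\<bar> < e)"
  shows "continuous_map X euclideanreal f"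
proof -
  have "continuous_map X Met_TC.mtopology f"
    unfolding Met_TC.continuous_map_to_metric
  proof (intro ballI allI impI)
    fix x and e :: real assume "x \<in> topspace X" "e > 0"
    from assms[OF this] obtain U where "openin X U" "x \<in> U" "\<forall>y\<in>U. \<bar>f y - f x\<bar> < e" by blast
    then show "\<exists>U. openin X U \<and> x \<in> U \<and> (\<forall>y\<in>U. f y \<in> Met_TC.mball (f x) e)"
      by (intro exI[of _ U]) (auto simp: dist_real_def abs_minus_commute)
  qed
  then show ?thesis by simp
qed

lemma continuous_map_flow_orbit:
  assumes "continuous_map (prod_topology euclideanreal X) Y (\<lambda>(t, x). f t x)" "x \<in> topspace X"
  shows "continuous_map euclideanreal Y (\<lambda>t. f t x)"
proof -
  have "continuous_map euclideanreal Y ((\<lambda>(t, x). f t x) \<circ> (\<lambda>t. (t, x)))"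
    by (rule continuous_map_compose[OF _ assms(1)]) (use assms(2) in \<open>simp add: continuous_map_pairedI\<close>)
  then show ?thesis by (simp add: o_def)
qed

lemma continuous_map_flow_fix:
  assumes "continuous_map (prod_topology euclideanreal X) Y (\<lambda>(t, x). f t x)"
  shows "continuous_map X Y (f t)"
proof -
  have "continuous_map X Y ((\<lambda>(t, x). f t x) \<circ> (\<lambda>x. (t, x)))"
    by (rule continuous_map_compose[OF _ assms]) (simp add: continuous_map_pairedI)
  then show ?thesis by (simp add: o_def)
qed

text \<open>\<open>speed\<close> is the rate of the new clock along orbits of \<open>flow\<close>,
  so the generator of \<open>changed\<close> is that of \<open>flow\<close> divided by
  \<open>speed\<close>. In the application \<open>speed\<close> is \<open>tau\<close>, and
  \<open>changed\<close> is the Reeb flow.\<close>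

locale time_change =
  fixes X :: "'a topology" and flow :: "real \<Rightarrow> 'a \<Rightarrow> 'a" and speed :: "'a \<Rightarrow> real" and m M :: real
  assumes compact: "compact_space X"
    and flow_cont: "continuous_map (prod_topology euclideanreal X) X (\<lambda>(t, x). flow t x)"
    and flow_0: "x \<in> topspace X \<Longrightarrow> flow 0 x = x"
    and flow_add: "x \<in> topspace X \<Longrightarrow> flow (s + t) x = flow s (flow t x)"
    and speed_cont: "continuous_map X euclideanreal speed"
    and m_pos: "0 < m"
    and M_pos: "0 < M"
    and speed_bounds: "x \<in> topspace X \<Longrightarrow> m \<le> speed x" "x \<in> topspace X \<Longrightarrow> speed x \<le> M"
begin

definition clock :: "real \<Rightarrow> 'a \<Rightarrow> real" where
  "clock s x = integral {0..s} (\<lambda>u. speed (flow u x)) - integral {s..0} (\<lambda>u. speed (flow u x))"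

definition inv_clock :: "real \<Rightarrow> 'a \<Rightarrow> real" where
  "inv_clock t x = (THE s. clock s x = t)"

definition changed :: "real \<Rightarrow> 'a \<Rightarrow> 'a" where
  "changed t x = flow (inv_clock t x) x"

lemma flow_in: "x \<in> topspace X \<Longrightarrow> flow t x \<in> topspace X"
  using continuous_map_image_subset_topspace[OF flow_cont] by auto

lemma speed_flow_cont: "continuous_map (prod_topology euclideanreal X) euclideanreal (\<lambda>(t, x). speed (flow t x))"
  using continuous_map_compose[OF flow_cont speed_cont] by (simp add: o_def case_prod_unfold)

lemma clock_deriv: "x \<in> topspace X \<Longrightarrow> ((\<lambda>s. clock s x) has_real_derivative speed (flow s x)) (at s)"
  unfolding clock_def
  by (rule antiderivative_real) (use continuous_map_flow_orbit[OF speed_flow_cont] in simp)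

lemma clock_0: "clock 0 x = 0"
  by (simp add: clock_def)

lemma clock_diff:
  assumes x: "x \<in> topspace X" and "s \<le> s'"
  shows "m * (s' - s) \<le> clock s' x - clock s x" "clock s' x - clock s x \<le> M * (s' - s)"
proof -
  have "m * (s' - s) \<le> clock s' x - clock s x \<and> clock s' x - clock s x \<le> M * (s' - s)"
  proof (cases "s = s'")
    case False
    then have "s < s'" using assms by simp
    then obtain u where "clock s' x - clock s x = (s' - s) * speed (flow u x)"
      using MVT2[of s s' "\<lambda>s. clock s x" "\<lambda>u. speed (flow u x)"] clock_deriv[OF x] by blast
    then show ?thesis
      using speed_bounds[OF flow_in[OF x], of u] \<open>s < s'\<close> by (simp add: mult.commute mult_left_mono)
  qed simp
  then show "m * (s' - s) \<le> clock s' x - clock s x" "clock s' x - clock s x \<le> M * (s' - s)" by auto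
qed

lemma clock_diff_abs:
  assumes x: "x \<in> topspace X"
  shows "m * \<bar>s' - s\<bar> \<le> \<bar>clock s' x - clock s x\<bar>" "\<bar>clock s' x - clock s x\<bar> \<le> M * \<bar>s' - s\<bar>"
proof -
  have "m * \<bar>s' - s\<bar> \<le> \<bar>clock s' x - clock s x\<bar> \<and> \<bar>clock s' x - clock s x\<bar> \<le> M * \<bar>s' - s\<bar>"
  proof (cases "s \<le> s'")
    case True
    then have "0 \<le> m * (s' - s)" using m_pos by simp
    then show ?thesis using clock_diff[OF x True] True by auto
  next
    case False
    then have "0 \<le> m * (s - s')" using m_pos by simp
    then show ?thesis using clock_diff[OF x, of s' s] False by auto
  qed
  then show "m * \<bar>s' - s\<bar> \<le> \<bar>clock s' x - clock s x\<bar>" "\<bar>clock s' x - clock s x\<bar> \<le> M * \<bar>s' - s\<bar>" by auto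
qed

lemma clock_inj:
  assumes x: "x \<in> topspace X" and eq: "clock s x = clock s' x"
  shows "s = s'"
proof -
  have "m * \<bar>s' - s\<bar> \<le> 0" using clock_diff_abs(1)[OF x, of s' s] eq by simp
  then show ?thesis using m_pos by (simp add: mult_le_0_iff)
qed

lemma clock_surj:
  assumes x: "x \<in> topspace X"
  shows "\<exists>s. clock s x = t"
proof -
  define b where "b = \<bar>t\<bar> / m"
  have b: "0 \<le> b" "m * b = \<bar>t\<bar>" using m_pos by (auto simp: b_def)
  have "\<exists>s\<ge>-b. s \<le> b \<and> clock s x = t"
  proof (rule IVT')
    show "clock (-b) x \<le> t" using clock_diff(1)[OF x, of "-b" 0] b clock_0 by simp
    show "t \<le> clock b x" using clock_diff(1)[OF x, of 0 b] b clock_0 by simp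
    show "continuous_on {-b..b} (\<lambda>s. clock s x)"
      using clock_deriv[OF x] by (intro continuous_at_imp_continuous_on) (auto intro: DERIV_isCont)
  qed (use b in simp)
  then show ?thesis by blast
qed

lemma inv_clock_eqI: "x \<in> topspace X \<Longrightarrow> clock s x = t \<Longrightarrow> inv_clock t x = s"
  unfolding inv_clock_def using clock_inj by (intro the_equality) auto

lemma clock_inv_clock: "x \<in> topspace X \<Longrightarrow> clock (inv_clock t x) x = t"
  using clock_surj inv_clock_eqI by metis

lemma inv_clock_0: "x \<in> topspace X \<Longrightarrow> inv_clock 0 x = 0"
  by (rule inv_clock_eqI) (auto simp: clock_0)

text \<open>As functions of \<open>s\<close> both sides have the derivative
  \<open>speed (flow (s + t) x)\<close> and agree at \<open>s = 0\<close>.\<close>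

lemma clock_add:
  assumes x: "x \<in> topspace X"
  shows "clock (s + t) x = clock s (flow t x) + clock t x"
proof -
  let ?f = "\<lambda>s. clock (s + t) x - clock s (flow t x)"
  have "(?f has_real_derivative 0) (at s)" for s
  proof -
    have "((\<lambda>s. clock (s + t) x) has_real_derivative speed (flow (s + t) x)) (at s)"
      using clock_deriv[OF x, of "s + t"] unfolding DERIV_shift .
    moreover have "((\<lambda>s. clock s (flow t x)) has_real_derivative speed (flow s (flow t x))) (at s)"
      by (rule clock_deriv[OF flow_in[OF x]])
    ultimately have "(?f has_real_derivative speed (flow (s + t) x) - speed (flow s (flow t x))) (at s)"
      by (rule DERIV_diff)
    then show ?thesis using flow_add[OF x] by simp
  qed
  then have "?f s = ?f 0" by (intro DERIV_isconst_all) auto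
  then show ?thesis by (simp add: clock_0)
qed

text \<open>On a bounded range of times the speeds along nearby orbits are uniformly close, which
  bounds the difference of their clocks; the dependence on time is Lipschitz with constant
  \<open>M\<close>.\<close>

lemma clock_cont: "continuous_map (prod_topology euclideanreal X) euclideanreal (\<lambda>(t, x). clock t x)"
proof (rule continuous_map_realI, clarsimp)
  fix s :: real and x and e :: real assume x: "x \<in> topspace X" and e: "e > 0"
  \<comment> \<open>The extra unit leaves room for the times \<open>t\<close> near \<open>s\<close>;
    correspondingly \<open>r\<close> is at most 1.\<close>
  define B where "B = \<bar>s\<bar> + 1"
  define d where "d = e / (2 * B)"
  have B: "B > 0" by (simp add: B_def)
  then have d: "d > 0" "d * B = e / 2" using e by (simp_all add: d_def)
  \<comment> \<open>\<open>real_interval_nhd\<close> runs over nonnegative times; negative ones are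
    reached through the sign \<open>sg\<close>.\<close>
  let ?P = "\<lambda>sg u W. \<forall>y\<in>W. \<bar>speed (flow (sg * u) y) - speed (flow (sg * u) x)\<bar> \<le> d"
  have nhd: "\<exists>W. openin X W \<and> x \<in> W \<and> (\<forall>u. 0 \<le> u \<longrightarrow> u \<le> B \<longrightarrow> ?P sg u W)" if sg: "sg = 1 \<or> sg = -1" for sg :: real
  proof (rule real_interval_nhd[OF x])
    fix u W W' assume "?P sg u W" "W' \<subseteq> W"
    then show "?P sg u W'" by blast
  next
    fix u :: real
    let ?U = "ball (speed (flow (sg * u) x)) (d / 2)"
    obtain A C where AC: "open A" "openin X C" "sg * u \<in> A" "x \<in> C" "\<forall>a\<in>A. \<forall>b\<in>C. speed (flow a b) \<in> ?U"
      using product_nhd[OF speed_flow_cont, of ?U "sg * u" x] x d by auto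
    have sgA: "open ((\<lambda>u. sg * u) -` A)"
      using AC(1) by (intro open_vimage continuous_intros)
    have "?P sg v C" if v: "sg * v \<in> A" for v
    proof
      fix y assume "y \<in> C"
      then have "\<bar>speed (flow (sg * u) x) - speed (flow (sg * v) y)\<bar> < d / 2"
        "\<bar>speed (flow (sg * u) x) - speed (flow (sg * v) x)\<bar> < d / 2"
        using AC(4,5) v by (auto simp: dist_real_def)
      then show "\<bar>speed (flow (sg * v) y) - speed (flow (sg * v) x)\<bar> \<le> d" by linarith
    qed
    then show "\<exists>I W. open I \<and> u \<in> I \<and> openin X W \<and> x \<in> W \<and> (\<forall>s'\<in>I. ?P sg s' W)"
      using AC sgA by (intro exI[of _ "(\<lambda>u. sg * u) -` A"] exI[of _ C]) auto
  qed
  obtain W1 where W1: "openin X W1" "x \<in> W1" "\<And>u. 0 \<le> u \<Longrightarrow> u \<le> B \<Longrightarrow> ?P 1 u W1"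
    using nhd[of 1] by blast
  obtain W2 where W2: "openin X W2" "x \<in> W2" "\<And>u. 0 \<le> u \<Longrightarrow> u \<le> B \<Longrightarrow> ?P (-1) u W2"
    using nhd[of "-1"] by blast
  have near: "\<bar>clock t y - clock t x\<bar> \<le> d * B" if y: "y \<in> W1 \<inter> W2" and t: "\<bar>t\<bar> \<le> B" for y t
  proof -
    have yX: "y \<in> topspace X" using y W1(1) openin_subset by blast
    have bd: "\<bar>speed (flow u y) - speed (flow u x)\<bar> \<le> d" if "\<bar>u\<bar> \<le> B" for u
      using W1(3)[of u] W2(3)[of "-u"] that y by (cases "0 \<le> u") auto
    let ?g = "\<lambda>t. clock t y - clock t x"
    have der: "(?g has_real_derivative speed (flow u y) - speed (flow u x)) (at u)" for u
      by (intro DERIV_diff clock_deriv yX x)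
    have "norm (?g t - ?g 0) \<le> d * norm (t - 0)"
    proof (rule field_differentiable_bound[of "{-B..B}" ?g "\<lambda>u. speed (flow u y) - speed (flow u x)"])
      show "(?g has_field_derivative speed (flow u y) - speed (flow u x)) (at u within {-B..B})" for u
        using der has_field_derivative_at_within by blast
    qed (use bd t B in auto)
    also have "\<dots> \<le> d * B" using t d by (intro mult_left_mono) auto
    finally show ?thesis by (simp add: clock_0)
  qed
  define r where "r = min 1 (e / (2 * M))"
  have r: "r > 0" "M * r \<le> e / 2"
  proof -
    show "r > 0" using e M_pos by (simp add: r_def)
    have "M * r \<le> M * (e / (2 * M))" using M_pos by (intro mult_left_mono) (auto simp: r_def)
    then show "M * r \<le> e / 2" using M_pos by simp
  qed
  have "\<bar>clock t y - clock s x\<bar> < e" if "t \<in> ball s r" "y \<in> W1 \<inter> W2" for t y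
  proof -
    have ts: "\<bar>t - s\<bar> < r" using that(1) by (simp add: dist_real_def abs_minus_commute)
    then have "\<bar>t\<bar> \<le> B" using r_def B_def by auto
    then have "\<bar>clock t y - clock t x\<bar> \<le> e / 2" using near that(2) d by simp
    moreover have "\<bar>clock t x - clock s x\<bar> < e / 2"
    proof -
      have "\<bar>clock t x - clock s x\<bar> \<le> M * \<bar>t - s\<bar>" by (rule clock_diff_abs(2)[OF x])
      also have "\<dots> < M * r" using ts M_pos by simp
      finally show ?thesis using r by simp
    qed
    ultimately show ?thesis by linarith
  qed
  then show "\<exists>U. openin (prod_topology euclideanreal X) U \<and> (s, x) \<in> U \<and> (\<forall>y\<in>U. \<bar>(case y of (t, x) \<Rightarrow> clock t x) - clock s x\<bar> < e)"
    using W1 W2 r by (intro exI[of _ "ball s r \<times> (W1 \<inter> W2)"]) (auto simp: openin_prod_Times_iff)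
qed

text \<open>Clocks advance at least at the rate \<open>m\<close>, so an error in a clock reading is
  an error in time divided by at most \<open>m\<close>. Continuity of the clock at the one fixed
  time \<open>s\<close> is then enough.\<close>

lemma inv_clock_cont: "continuous_map (prod_topology euclideanreal X) euclideanreal (\<lambda>(t, x). inv_clock t x)"
proof (rule continuous_map_realI, clarsimp)
  fix t :: real and x and e :: real assume x: "x \<in> topspace X" and e: "e > 0"
  define s where "s = inv_clock t x"
  have cs: "clock s x = t" unfolding s_def by (rule clock_inv_clock[OF x])
  have "continuous_map X euclideanreal (clock s)" by (rule continuous_map_flow_fix[OF clock_cont])
  then have "openin X {y \<in> topspace X. clock s y \<in> ball t (m * e / 2)}"
    by (rule openin_continuous_map_preimage) simp
  moreover have "\<bar>inv_clock t' y - s\<bar> < e" if t': "t' \<in> ball t (m * e / 2)" and y: "y \<in> topspace X" "clock s y \<in> ball t (m * e / 2)" for t' y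
  proof -
    have "m * \<bar>inv_clock t' y - s\<bar> \<le> \<bar>clock (inv_clock t' y) y - clock s y\<bar>" by (rule clock_diff_abs(1)[OF y(1)])
    also have "\<dots> = \<bar>t' - clock s y\<bar>" using clock_inv_clock[OF y(1)] by simp
    also have "\<dots> < m * e"
    proof -
      have "\<bar>t - t'\<bar> < m * e / 2" "\<bar>t - clock s y\<bar> < m * e / 2" using t' y(2) by (simp_all add: dist_real_def)
      then show ?thesis by linarith
    qed
    finally show ?thesis using m_pos by simp
  qed
  ultimately show "\<exists>U. openin (prod_topology euclideanreal X) U \<and> (t, x) \<in> U \<and> (\<forall>y\<in>U. \<bar>(case y of (t, x) \<Rightarrow> inv_clock t x) - inv_clock t x\<bar> < e)"
    using x cs e m_pos unfolding s_def[symmetric]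
    by (intro exI[of _ "ball t (m * e / 2) \<times> {y \<in> topspace X. clock s y \<in> ball t (m * e / 2)}"])
      (auto simp: openin_prod_Times_iff)
qed

lemma inv_clock_deriv:
  assumes x: "x \<in> topspace X"
  shows "((\<lambda>t. inv_clock t x) has_real_derivative inverse (speed (changed t x))) (at t)"
proof (rule DERIV_inverse_function[where f="\<lambda>s. clock s x" and a="t - 1" and b="t + 1"])
  show "((\<lambda>s. clock s x) has_real_derivative speed (changed t x)) (at (inv_clock t x))"
    unfolding changed_def by (rule clock_deriv[OF x])
  show "speed (changed t x) \<noteq> 0"
    using speed_bounds(1)[OF flow_in[OF x]] m_pos unfolding changed_def by (metis less_le_trans less_irrefl)
  show "isCont (\<lambda>t. inv_clock t x) t"
    using continuous_map_flow_orbit[OF inv_clock_cont x] by (simp add: continuous_on_eq_continuous_at)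
qed (auto simp: clock_inv_clock[OF x])

text \<open>The right-hand side is only continuous in \<open>s\<close>. Uniqueness comes from
  composing with the clock: along any solution \<open>clock (s t) x\<close> has derivative 1. This
  identifies arbitrary Reeb curves later on.\<close>

lemma inv_clock_unique:
  assumes x: "x \<in> topspace X" and "s 0 = 0"
    and der: "\<And>t. (s has_real_derivative inverse (speed (flow (s t) x))) (at t)"
  shows "s t = inv_clock t x"
proof -
  let ?f = "\<lambda>t. clock (s t) x - t"
  have "(?f has_real_derivative 0) (at t)" for t
  proof -
    have "((\<lambda>t. clock (s t) x) has_real_derivative speed (flow (s t) x) * inverse (speed (flow (s t) x))) (at t)"
      by (rule DERIV_chain2[OF clock_deriv[OF x] der])
    moreover have "speed (flow (s t) x) \<noteq> 0"
      using speed_bounds(1)[OF flow_in[OF x]] m_pos by (metis less_le_trans less_irrefl)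
    ultimately have "((\<lambda>t. clock (s t) x) has_real_derivative 1) (at t)" by simp
    then have "(?f has_real_derivative 1 - 1) (at t)" by (intro DERIV_diff DERIV_ident)
    then show ?thesis by simp
  qed
  then have "?f t = ?f 0" by (intro DERIV_isconst_all) auto
  then have "clock (s t) x = t" using assms(2) by (simp add: clock_0)
  from inv_clock_eqI[OF x this] show ?thesis ..
qed

lemma changed_in: "x \<in> topspace X \<Longrightarrow> changed t x \<in> topspace X"
  unfolding changed_def by (rule flow_in)

lemma changed_0: "x \<in> topspace X \<Longrightarrow> changed 0 x = x"
  by (simp add: changed_def inv_clock_0 flow_0)

lemma inv_clock_add:
  assumes x: "x \<in> topspace X"
  shows "inv_clock (s + t) x = inv_clock s (changed t x) + inv_clock t x"
  using clock_add[OF x, of "inv_clock s (changed t x)" "inv_clock t x"] clock_inv_clock[OF x, of t]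
    clock_inv_clock[OF changed_in[OF x], of s t]
  by (intro inv_clock_eqI[OF x]) (simp add: changed_def)

lemma changed_add: "x \<in> topspace X \<Longrightarrow> changed (s + t) x = changed s (changed t x)"
  unfolding changed_def[of "s + t"] inv_clock_add by (subst flow_add) (auto simp: changed_def)

lemma changed_cont: "continuous_map (prod_topology euclideanreal X) X (\<lambda>(t, x). changed t x)"
proof -
  have "continuous_map (prod_topology euclideanreal X) (prod_topology euclideanreal X) (\<lambda>(t, x). (inv_clock t x, x))"
    using inv_clock_cont continuous_map_snd[of euclideanreal X]
    by (simp add: continuous_map_pairwise o_def case_prod_unfold)
  from continuous_map_compose[OF this flow_cont] show ?thesis
    by (simp add: o_def case_prod_unfold changed_def)
qed

text \<open>Here \<open>flow\<close> plays the role of \<open>\<psi>\<close> in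
  \<open>reparam_entropy_le\<close>: its time \<open>s\<close> is at most
  \<open>clock s x / m\<close>. The other inequality exchanges the flows and uses
  \<open>inv_clock\<close>, which advances at least at the rate \<open>1 / M\<close>.\<close>

theorem entropy_changed_le: "ereal m * top_entropy X (changed 1) \<le> top_entropy X (flow 1)"
proof -
  have "top_entropy X (changed 1) \<le> ereal (1 / m) * top_entropy X (flow 1)"
  proof (rule reparam_entropy_le[where T=clock])
    fix s :: real and x assume x: "x \<in> topspace X"
    show "changed (clock s x) x = flow s x" unfolding changed_def using inv_clock_eqI[OF x] by simp
    assume "0 \<le> s"
    then have "m * s \<le> clock s x" using clock_diff(1)[OF x, of 0 s] clock_0 by simp
    then show "s \<le> 1 / m * clock s x" using m_pos by (simp add: field_simps)
  qed (use compact changed_cont changed_0 changed_add flow_cont flow_0 flow_add clock_cont clock_add m_pos in auto)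
  then have "ereal m * top_entropy X (changed 1) \<le> ereal m * (ereal (1 / m) * top_entropy X (flow 1))"
    using m_pos by (intro ereal_mult_left_mono) auto
  also have "\<dots> = top_entropy X (flow 1)"
    using m_pos by (simp add: mult.assoc[symmetric] one_ereal_def[symmetric])
  finally show ?thesis .
qed

theorem entropy_le_changed: "top_entropy X (flow 1) \<le> ereal M * top_entropy X (changed 1)"
proof (rule reparam_entropy_le[where T=inv_clock])
  fix s :: real and x assume x: "x \<in> topspace X"
  assume "0 \<le> s"
  define r where "r = inv_clock s x"
  have c: "clock r x = s" unfolding r_def by (rule clock_inv_clock[OF x])
  have "s \<le> M * r"
  proof (cases "0 \<le> r")
    case True
    then show ?thesis using clock_diff(2)[OF x True] c clock_0 by simp
  next
    case False
    then have "m * (0 - r) \<le> - s" using clock_diff(1)[OF x, of r 0] c clock_0 by simp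
    moreover have "m * (0 - r) > 0" using False m_pos by (intro mult_pos_pos) auto
    ultimately show ?thesis using \<open>0 \<le> s\<close> by simp
  qed
  then show "s \<le> M * inv_clock s x" by (simp add: r_def)
qed (use compact changed_cont changed_0 changed_add flow_cont flow_0 flow_add inv_clock_cont inv_clock_add M_pos changed_def in auto)

end


section \<open>Ordinary differential equations in a half-space\<close>

lemma norm_vector_bound:
  fixes w :: "real \<Rightarrow> 'e::real_normed_vector"
  assumes S: "convex S" "s \<in> S" "t \<in> S"
    and der: "\<And>t. t \<in> S \<Longrightarrow> (w has_vector_derivative dw t) (at t within S)"
    and bd: "\<And>t. t \<in> S \<Longrightarrow> norm (dw t) \<le> B"
  shows "norm (w t - w s) \<le> B * \<bar>t - s\<bar>"
proof -
  have "norm (w t - w s) \<le> B * norm (t - s)"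
  proof (rule differentiable_bound[OF S(1) _ _ S(3,2)])
    fix x assume x: "x \<in> S"
    show "(w has_derivative (\<lambda>h. h *\<^sub>R dw x)) (at x within S)"
      using der[OF x] by (simp add: has_vector_derivative_def)
    show "onorm (\<lambda>h. h *\<^sub>R dw x) \<le> B"
    proof (rule onorm_le)
      fix h :: real
      have "norm (dw x) * \<bar>h\<bar> \<le> B * \<bar>h\<bar>" using bd[OF x] by (rule mult_right_mono) simp
      then show "norm (h *\<^sub>R dw x) \<le> B * norm h" by (simp add: mult.commute)
    qed
  qed
  then show ?thesis by simp
qed

text \<open>On so short an interval the maximum \<open>D\<close> of the distance satisfies
  \<open>D <= norm (u c - v c) + D / 2\<close>. Besides continuous dependence this yields
  uniqueness, as the case of equal values at \<open>c\<close>.\<close>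

lemma ode_dependence:
  fixes u v :: "real \<Rightarrow> 'e::real_normed_vector"
  assumes L: "0 \<le> L" "a * L \<le> 1/2" and a: "0 \<le> a"
    and u: "\<And>t. \<bar>t - c\<bar> \<le> a \<Longrightarrow> (u has_vector_derivative du t) (at t)"
    and v: "\<And>t. \<bar>t - c\<bar> \<le> a \<Longrightarrow> (v has_vector_derivative dv t) (at t)"
    and lip: "\<And>t. \<bar>t - c\<bar> \<le> a \<Longrightarrow> norm (du t - dv t) \<le> L * norm (u t - v t)"
    and t: "\<bar>t - c\<bar> \<le> a"
  shows "norm (u t - v t) \<le> 2 * norm (u c - v c)"
proof -
  define S where "S = {c - a..c + a}"
  have inS: "s \<in> S \<longleftrightarrow> \<bar>s - c\<bar> \<le> a" for s by (auto simp: S_def)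
  define w where "w s = u s - v s" for s
  have dw: "(w has_vector_derivative (du s - dv s)) (at s)" if "s \<in> S" for s
    unfolding w_def using that u v by (intro has_vector_derivative_diff) (auto simp: inS)
  then have "continuous_on S w"
    by (intro continuous_at_imp_continuous_on) (auto dest: has_vector_derivative_continuous)
  then have "continuous_on S (\<lambda>s. norm (w s))" by (intro continuous_on_norm)
  moreover have "compact S" "S \<noteq> {}" using a by (auto simp: S_def)
  ultimately obtain s0 where s0: "s0 \<in> S" "\<And>s. s \<in> S \<Longrightarrow> norm (w s) \<le> norm (w s0)"
    using continuous_attains_sup[of S "\<lambda>s. norm (w s)"] by blast
  let ?D = "norm (w s0)"
  have "norm (w s0 - w c) \<le> (L * ?D) * \<bar>s0 - c\<bar>"
  proof (rule norm_vector_bound[of S])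
    show "convex S" "c \<in> S" using a by (auto simp: S_def)
    fix s assume s: "s \<in> S"
    show "(w has_vector_derivative (du s - dv s)) (at s within S)"
      using dw[OF s] by (rule has_vector_derivative_at_within)
    have "norm (du s - dv s) \<le> L * norm (w s)" using lip s by (simp add: inS w_def)
    also have "\<dots> \<le> L * ?D" using s0(2)[OF s] L by (intro mult_left_mono)
    finally show "norm (du s - dv s) \<le> L * ?D" .
  qed (rule s0)
  also have "\<dots> \<le> (L * ?D) * a" using s0(1) L by (intro mult_left_mono) (auto simp: inS)
  also have "\<dots> = (a * L) * ?D" by (simp add: mult.commute mult.left_commute)
  also have "\<dots> \<le> 1/2 * ?D" using L by (intro mult_right_mono) auto
  finally have "?D \<le> 2 * norm (w c)" using norm_triangle_ineq2[of "w s0" "w c"] by linarith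
  then show ?thesis using s0(2)[of t] t by (simp add: inS w_def)
qed

lemma picard_local:
  fixes F :: "'e::euclidean_space \<Rightarrow> 'e"
  assumes L: "0 \<le> L" "\<And>x y. norm (F x - F y) \<le> L * norm (x - y)"
    and h: "0 < h" "3 * h * L \<le> 1/2"
  shows "\<exists>u. u 0 = x \<and> (\<forall>t. \<bar>t\<bar> < h \<longrightarrow> (u has_vector_derivative F (u t)) (at t))"
proof -
  have contF: "continuous_on S F" for S
  proof (rule continuous_on_subset[OF _ subset_UNIV])
    have "L-lipschitz_on UNIV F" using L by (intro lipschitz_onI) (auto simp: dist_norm)
    then show "continuous_on UNIV F" by (rule lipschitz_on_continuous_on)
  qed
  \<comment> \<open>Time is clamped to \<open>[-h, h]\<close> so that the Picard operator acts on
    bounded continuous functions on the whole line, a complete space; inside the interval the clamp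
    is the identity.\<close>
  define cl :: "real \<Rightarrow> real" where "cl t = max (-h) (min h t)" for t
  have cl: "cl t \<in> {-h..h}" for t using h by (auto simp: cl_def)
  \<comment> \<open>Both integrals start at \<open>-h\<close>, so one formula serves both signs of
    \<open>t\<close>. Their lengths are at most \<open>2 * h\<close> and \<open>h\<close>, whence
    the factor 3 in the bound on \<open>h\<close>.\<close>
  define G where "G v t = x + (integral {-h..cl t} (\<lambda>s. F (v s)) - integral {-h..0} (\<lambda>s. F (v s)))" for v t
  have contFv: "continuous_on S (\<lambda>s. F (apply_bcontfun v s))" for S and v :: "real \<Rightarrow>\<^sub>C 'e"
    by (rule continuous_on_compose2[OF contF[of UNIV]]) auto
  have int: "(\<lambda>s. F (apply_bcontfun v s)) integrable_on {a..b}" for a b :: real and v :: "real \<Rightarrow>\<^sub>C 'e"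
    by (rule integrable_continuous_real[OF contFv])
  have G: "G (apply_bcontfun v) \<in> bcontfun" for v :: "real \<Rightarrow>\<^sub>C 'e"
  proof -
    let ?I = "\<lambda>t. integral {-h..t} (\<lambda>s. F (apply_bcontfun v s))"
    have I: "continuous_on {-h..h} ?I" by (rule indefinite_integral_continuous_1[OF int])
    have "continuous_on UNIV (\<lambda>t. ?I (cl t))"
      by (rule continuous_on_compose2[OF I]) (use cl in \<open>auto simp: cl_def intro!: continuous_intros\<close>)
    then have 1: "continuous_on UNIV (G (apply_bcontfun v))"
      unfolding G_def by (intro continuous_intros)
    have "bounded (?I ` {-h..h})" using I by (intro compact_imp_bounded compact_continuous_image) auto
    then have "bounded ((\<lambda>t. ?I (cl t)) ` UNIV)" by (rule bounded_subset) (use cl in auto)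
    then obtain B where B: "\<And>t. norm (?I (cl t)) \<le> B" unfolding bounded_iff by auto
    have "bounded (range (G (apply_bcontfun v)))"
      unfolding bounded_iff
    proof (intro exI ballI)
      fix y assume "y \<in> range (G (apply_bcontfun v))"
      then obtain t where y: "y = x + (?I (cl t) - ?I 0)" unfolding G_def by auto
      have "norm y \<le> norm x + (norm (?I (cl t)) + norm (?I 0))"
        unfolding y by (rule order_trans[OF norm_triangle_ineq add_left_mono[OF norm_triangle_ineq4]])
      then show "norm y \<le> norm x + (B + norm (?I 0))" using B[of t] by linarith
    qed
    then show ?thesis using 1 by (simp add: bcontfun_def)
  qed
  define \<Phi> where "\<Phi> v = Bcontfun (G (apply_bcontfun v))" for v
  have \<Phi>: "apply_bcontfun (\<Phi> v) = G (apply_bcontfun v)" for v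
    unfolding \<Phi>_def by (rule Bcontfun_inverse[OF G])
  have "\<exists>!v. \<Phi> v = v"
  proof (rule banach_fix_type[of "1/2"], simp, simp, intro allI)
    fix v w :: "real \<Rightarrow>\<^sub>C 'e"
    let ?d = "dist v w"
    show "dist (\<Phi> v) (\<Phi> w) \<le> 1 / 2 * ?d"
    proof (rule dist_bound)
      fix t
      let ?f = "\<lambda>s. F (apply_bcontfun v s) - F (apply_bcontfun w s)"
      have fb: "norm (?f s) \<le> L * ?d" for s
        using L(2)[of "apply_bcontfun v s" "apply_bcontfun w s"] dist_bounded[of v s w] L(1)
        using mult_left_mono[OF dist_bounded[of v s w] L(1)] by (simp add: dist_norm)
      have ib: "norm (integral {-h..b} ?f) \<le> (L * ?d) * (b - (-h))" if "b \<in> {-h..h}" for b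
        using that fb by (intro integral_bound continuous_intros contFv) auto
      have eq: "G (apply_bcontfun v) t - G (apply_bcontfun w) t = integral {-h..cl t} ?f - integral {-h..0} ?f"
        unfolding G_def by (simp add: Henstock_Kurzweil_Integration.integral_diff[OF int int])
      have Ld: "0 \<le> L * ?d" using L by simp
      have "norm (G (apply_bcontfun v) t - G (apply_bcontfun w) t) \<le> (L * ?d) * (cl t - (-h)) + (L * ?d) * (0 - (-h))"
        unfolding eq using ib[OF cl[of t]] ib[of 0] h by (intro order_trans[OF norm_triangle_ineq4 add_mono]) auto
      also have "\<dots> \<le> (L * ?d) * (2 * h) + (L * ?d) * h"
        using cl[of t] Ld by (intro add_mono mult_left_mono) auto
      also have "\<dots> = (3 * h * L) * ?d" by (simp add: algebra_simps)
      also have "\<dots> \<le> 1/2 * ?d" using h by (intro mult_right_mono) auto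
      finally show "dist (apply_bcontfun (\<Phi> v) t) (apply_bcontfun (\<Phi> w) t) \<le> 1/2 * ?d"
        by (simp add: \<Phi> dist_norm)
    qed
  qed
  then obtain v where "\<Phi> v = v" by blast
  then have v: "apply_bcontfun v = G (apply_bcontfun v)" using \<Phi> by metis
  define u where "u = apply_bcontfun v"
  have ut: "u t = x + (integral {-h..cl t} (\<lambda>s. F (u s)) - integral {-h..0} (\<lambda>s. F (u s)))" for t
    using fun_cong[OF v, of t] unfolding u_def G_def .
  have "u 0 = x" using ut[of 0] h by (simp add: cl_def)
  moreover have "(u has_vector_derivative F (u t)) (at t)" if t: "\<bar>t\<bar> < h" for t
  proof -
    have "((\<lambda>t. integral {-h..t} (\<lambda>s. F (u s))) has_vector_derivative F (u t)) (at t within {-h..h})"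
      by (rule integral_has_vector_derivative) (use t contFv in \<open>auto simp: u_def\<close>)
    moreover have "at t within {-h..h} = at t" using t by (intro at_within_interior) auto
    ultimately have "((\<lambda>t. integral {-h..t} (\<lambda>s. F (u s))) has_vector_derivative F (u t)) (at t)" by metis
    then have "((\<lambda>t. x + (integral {-h..t} (\<lambda>s. F (u s)) - integral {-h..0} (\<lambda>s. F (u s)))) has_vector_derivative 0 + (F (u t) - 0)) (at t)"
      by (intro has_vector_derivative_add has_vector_derivative_diff has_vector_derivative_const)
    then have D: "((\<lambda>t. x + (integral {-h..t} (\<lambda>s. F (u s)) - integral {-h..0} (\<lambda>s. F (u s)))) has_vector_derivative F (u t)) (at t)"
      by simp
    show ?thesis
    proof (rule has_vector_derivative_transform_within_open[OF D, of "{-h<..<h}"])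
      fix s assume s: "s \<in> {-h<..<h}"
      then have "cl s = s" by (auto simp: cl_def)
      then show "x + (integral {-h..s} (\<lambda>s. F (u s)) - integral {-h..0} (\<lambda>s. F (u s))) = u s"
        using ut[of s] by simp
    qed (use t in auto)
  qed
  ultimately show ?thesis by blast
qed

section \<open>Invariance of the half-space under tangent fields\<close>

lemma min_zero_sq_deriv: "((\<lambda>s::real. (min s 0)\<^sup>2) has_real_derivative 2 * min s 0) (at s)"
proof -
  consider "s > 0" | "s < 0" | "s = 0" by linarith
  then show ?thesis
  proof cases
    case 1
    have "((\<lambda>s::real. 0) has_real_derivative 2 * min s 0) (at s)" using 1 by simp
    then show ?thesis
      by (rule has_field_derivative_transform_within_open[of _ _ _ "{0<..}"]) (use 1 in auto)
  next
    case 2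
    have "((\<lambda>s::real. s\<^sup>2) has_real_derivative 2 * min s 0) (at s)"
      using 2 by (auto intro!: derivative_eq_intros)
    then show ?thesis
      by (rule has_field_derivative_transform_within_open[of _ _ _ "{..<0}"]) (use 2 in auto)
  next
    case 3
    have "((\<lambda>h::real. (min h 0)\<^sup>2 / h) \<longlongrightarrow> 0) (at 0)"
    proof (rule tendsto_0_le[where f="\<lambda>h::real. h" and K=1])
      show "((\<lambda>h::real. h) \<longlongrightarrow> 0) (at 0)" by (rule tendsto_ident_at)
      show "\<forall>\<^sub>F h::real in at 0. norm ((min h 0)\<^sup>2 / h) \<le> norm h * 1"
        by (rule always_eventually) (auto simp: min_def power2_eq_square)
    qed
    then show ?thesis using 3 by (simp add: DERIV_def)
  qed
qed

text \<open>If the projection lay strictly above the hyperplane, the segment from it to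
  \<open>y\<close> would cross the hyperplane inside the ball, at a point of \<open>K\<close> closer
  to \<open>y\<close>.\<close>

lemma closest_point_halfball:
  fixes x0 :: "'e::euclidean_space"
  assumes x0: "x0 \<in> halfspace b" and y: "y \<in> cball x0 r" "y \<bullet> b < 0"
  defines "K \<equiv> cball x0 r \<inter> halfspace b"
  shows "closest_point K y \<bullet> b = 0"
proof (rule ccontr)
  let ?p = "closest_point K y"
  have hs: "halfspace b = {x. b \<bullet> x \<ge> 0}" by (auto simp: halfspace_def inner_commute)
  have K: "closed K" "K \<noteq> {}"
  proof -
    show "closed K" unfolding K_def hs by (intro closed_Int closed_cball closed_halfspace_ge)
    have "0 \<le> r" using y(1) by (meson dist_not_less_zero mem_cball not_le order_trans zero_le_dist)
    then have "x0 \<in> K" unfolding K_def using x0 by simp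
    then show "K \<noteq> {}" by blast
  qed
  then have p: "?p \<in> K" using closest_point_in_set by blast
  assume "?p \<bullet> b \<noteq> 0"
  then have pb: "?p \<bullet> b > 0" using p by (auto simp: K_def halfspace_def)
  define \<theta> where "\<theta> = (?p \<bullet> b) / (?p \<bullet> b - y \<bullet> b)"
  have den: "?p \<bullet> b - y \<bullet> b > 0" using pb y by linarith
  then have \<theta>: "0 < \<theta>" "\<theta> \<le> 1" using pb y by (auto simp: \<theta>_def divide_le_eq_1)
  define z where "z = (1 - \<theta>) *\<^sub>R ?p + \<theta> *\<^sub>R y"
  have "z \<bullet> b = (?p \<bullet> b) - \<theta> * (?p \<bullet> b - y \<bullet> b)"
    by (simp add: z_def inner_add_left inner_diff_left algebra_simps)
  also have "\<dots> = 0" using den by (simp add: \<theta>_def)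
  finally have "z \<in> halfspace b" by (simp add: halfspace_def)
  moreover have "z \<in> cball x0 r"
    unfolding z_def by (rule convexD[OF convex_cball]) (use p y \<theta> in \<open>auto simp: K_def\<close>)
  ultimately have zK: "z \<in> K" by (simp add: K_def)
  have "y - z = (1 - \<theta>) *\<^sub>R (y - ?p)" by (simp add: z_def algebra_simps)
  then have "dist y z = (1 - \<theta>) * dist y ?p" using \<theta> by (simp add: dist_norm)
  moreover have "dist y ?p > 0" using pb y by auto
  moreover from this have "(1 - \<theta>) * dist y ?p < 1 * dist y ?p" using \<theta> by (intro mult_strict_right_mono) auto
  ultimately have "dist y z < dist y ?p" by simp
  then show False using closest_point_le[OF K(1) zK, of y] by simp
qed

text \<open>Composing \<open>X\<close> with the projection to a half-ball gives a Lipschitz field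
  \<open>F\<close> on the whole space. Below the hyperplane, within the ball, its values come from
  hyperplane points, where \<open>X\<close> is tangent; solutions of \<open>F\<close> therefore
  never leave the half-space and solve the original equation.\<close>

lemma halfspace_local_flow:
  fixes X :: "'e::euclidean_space \<Rightarrow> 'e"
  assumes S: "hs_open b S" and lip: "loc_lip S X"
    and tang: "\<forall>x\<in>S. x \<bullet> b = 0 \<longrightarrow> X x \<bullet> b = 0" and x0: "x0 \<in> S"
  shows "\<exists>r L h. 0 < r \<and> 0 < h \<and> 0 \<le> L \<and> h * L \<le> 1/2 \<and>
    (\<forall>y\<in>S \<inter> ball x0 r. \<forall>z\<in>S \<inter> ball x0 r. norm (X y - X z) \<le> L * norm (y - z)) \<and>
    (\<forall>x\<in>S \<inter> ball x0 (r/2). \<exists>u. u 0 = x \<and>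
      (\<forall>t. \<bar>t\<bar> < h \<longrightarrow> u t \<in> S \<inter> ball x0 r \<and> (u has_vector_derivative X (u t)) (at t)))"
proof -
  obtain r0 L where r0: "r0 > 0" "L \<ge> 0"
    "\<And>y z. y \<in> S \<inter> ball x0 r0 \<Longrightarrow> z \<in> S \<inter> ball x0 r0 \<Longrightarrow> norm (X y - X z) \<le> L * norm (y - z)"
    using lip x0 unfolding loc_lip_def by meson
  obtain r1 where r1: "r1 > 0" "ball x0 r1 \<inter> halfspace b \<subseteq> S" using hs_open_ball[OF S x0] by blast
  define r where "r = min r0 r1 / 2"
  have r: "r > 0" "r < r0" "r < r1" using r0(1) r1(1) by (auto simp: r_def)
  have x0h: "x0 \<in> halfspace b" using hs_open_halfspace[OF S] x0 by blast
  have hs: "halfspace b = {x. b \<bullet> x \<ge> 0}" by (auto simp: halfspace_def inner_commute)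
  define K where "K = cball x0 r \<inter> halfspace b"
  have K: "closed K" "convex K" "x0 \<in> K"
    unfolding K_def hs using x0h[unfolded hs] r
    by (auto intro!: closed_Int closed_halfspace_ge convex_Int convex_halfspace_ge)
  then have Kne: "K \<noteq> {}" by blast
  have KS: "K \<subseteq> S \<inter> ball x0 r0" using r1(2) r by (auto simp: K_def)
  define F where "F y = X (closest_point K y)" for y
  have cpK: "closest_point K y \<in> K" for y using closest_point_in_set[OF K(1) Kne] .
  have F: "norm (F y - F z) \<le> L * norm (y - z)" for y z
  proof -
    have "norm (F y - F z) \<le> L * norm (closest_point K y - closest_point K z)"
      unfolding F_def by (intro r0(3) subsetD[OF KS cpK])
    also have "\<dots> \<le> L * norm (y - z)"
      using closest_point_lipschitz[OF K(2,1) Kne, of y z] r0(2) by (intro mult_left_mono) (auto simp: dist_norm)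
    finally show ?thesis .
  qed
  define B where "B = norm (X x0) + L * r"
  have B: "norm (F y) \<le> B" "B \<ge> 0" for y
  proof -
    have "norm (F y - X x0) \<le> L * norm (closest_point K y - x0)"
      unfolding F_def by (intro r0(3) subsetD[OF KS cpK] subsetD[OF KS K(3)])
    also have "\<dots> \<le> L * r" using cpK[of y] r0(2) by (intro mult_left_mono) (auto simp: K_def dist_norm norm_minus_commute)
    finally show "norm (F y) \<le> B" using norm_triangle_ineq2[of "F y" "X x0"] by (simp add: B_def)
    show "B \<ge> 0" using r0(2) r(1) by (simp add: B_def)
  qed
  \<comment> \<open>The first bound gives \<open>3 * h * L <= 1/2\<close> for the Picard iteration;
    the second keeps a solution of speed at most \<open>B\<close> within \<open>r / 4\<close> of its
    start, hence inside the ball of radius \<open>r\<close>.\<close>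
  define h where "h = min (1 / (6 * (L + 1))) (r / (4 * (B + 1)))"
  have h0: "h > 0" using r0(2) r(1) B(2) by (simp add: h_def add_nonneg_pos)
  have h6: "h * (6 * (L + 1)) \<le> 1"
  proof -
    have "h \<le> 1 / (6 * (L + 1))" by (simp add: h_def)
    moreover have "6 * (L + 1) > 0" using r0(2) by simp
    ultimately show ?thesis by (metis pos_le_divide_eq)
  qed
  have h4: "h * (4 * (B + 1)) \<le> r"
  proof -
    have "h \<le> r / (4 * (B + 1))" by (simp add: h_def)
    moreover have "4 * (B + 1) > 0" using B(2) by simp
    ultimately show ?thesis by (metis pos_le_divide_eq)
  qed
  have hL: "3 * h * L \<le> 1/2" "h * L \<le> 1/2" "B * h \<le> r / 4"
    using h6 h4 h0 r0(2) mult_nonneg_nonneg[of h L] by (simp_all add: algebra_simps)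
  have "\<exists>u. u 0 = x \<and> (\<forall>t. \<bar>t\<bar> < h \<longrightarrow> u t \<in> S \<inter> ball x0 r \<and> (u has_vector_derivative X (u t)) (at t))"
    if x: "x \<in> S \<inter> ball x0 (r/2)" for x
  proof -
    obtain u where u: "u 0 = x" "\<And>t. \<bar>t\<bar> < h \<Longrightarrow> (u has_vector_derivative F (u t)) (at t)"
      using picard_local[OF r0(2) F h0 hL(1)] by metis
    have ball: "u t \<in> ball x0 r" if t: "\<bar>t\<bar> < h" for t
    proof -
      have "norm (u t - u 0) \<le> B * \<bar>t - 0\<bar>"
        by (rule norm_vector_bound[of "{-h<..<h}" 0 t u "\<lambda>t. F (u t)" B])
          (use t B(1) h0 in \<open>auto intro!: has_vector_derivative_at_within u(2)\<close>)
      also have "\<dots> \<le> B * h" using t B(2) by (intro mult_left_mono) auto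
      finally have "dist x (u t) \<le> r / 4" using hL(3) u(1) by (simp add: dist_norm norm_minus_commute)
      then have "dist x0 (u t) < r" using x dist_triangle[of x0 "u t" x] r(1) by simp
      then show ?thesis by simp
    qed
    \<comment> \<open>This continuously differentiable penalty vanishes exactly on the half-space.
      Its derivative contains the factor \<open>F (u t) \<bullet> b\<close>, which is 0 whenever
      \<open>u t\<close> is below the hyperplane, so the penalty keeps its initial value 0.\<close>
    have der0: "((\<lambda>t. (min (u t \<bullet> b) 0)\<^sup>2) has_real_derivative 0) (at t within {-h<..<h})" if t: "\<bar>t\<bar> < h" for t
    proof -
      have "((\<lambda>t. u t \<bullet> b) has_real_derivative F (u t) \<bullet> b) (at t)"
        using bounded_linear.has_vector_derivative[OF bounded_linear_inner_left u(2)[OF t], of b]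
        by (simp add: has_real_derivative_iff_has_vector_derivative)
      from DERIV_chain2[OF min_zero_sq_deriv this]
      have d: "((\<lambda>t. (min (u t \<bullet> b) 0)\<^sup>2) has_real_derivative 2 * min (u t \<bullet> b) 0 * (F (u t) \<bullet> b)) (at t)" .
      have "2 * min (u t \<bullet> b) 0 * (F (u t) \<bullet> b) = 0"
      proof (cases "u t \<bullet> b < 0")
        case True
        have "u t \<in> cball x0 r" using ball[OF t] by simp
        then have "closest_point K (u t) \<bullet> b = 0" unfolding K_def by (rule closest_point_halfball[OF x0h _ True])
        then have "F (u t) \<bullet> b = 0" unfolding F_def using tang cpK KS by blast
        then show ?thesis by simp
      qed simp
      then show ?thesis using d has_field_derivative_at_within by metis
    qed
    have nonneg: "0 \<le> u t \<bullet> b" if t: "\<bar>t\<bar> < h" for t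
    proof -
      have "\<exists>c. \<forall>t\<in>{-h<..<h}. (min (u t \<bullet> b) 0)\<^sup>2 = c"
        by (rule has_field_derivative_zero_constant) (use der0 in auto)
      then obtain c where c: "\<forall>t\<in>{-h<..<h}. (min (u t \<bullet> b) 0)\<^sup>2 = c" by blast
      have "x \<in> halfspace b" using x hs_open_halfspace[OF S] by blast
      then have "(min (u 0 \<bullet> b) 0)\<^sup>2 = 0" using u(1) by (simp add: halfspace_def)
      then have "(min (u t \<bullet> b) 0)\<^sup>2 = 0" using bspec[OF c, of 0] bspec[OF c, of t] t h0 by (simp add: abs_less_iff)
      then show ?thesis by simp
    qed
    have "u t \<in> S \<inter> ball x0 r \<and> (u has_vector_derivative X (u t)) (at t)" if t: "\<bar>t\<bar> < h" for t
    proof -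
      have uK: "u t \<in> K" using ball[OF t] nonneg[OF t] by (simp add: K_def halfspace_def)
      then have "F (u t) = X (u t)" by (simp add: F_def closest_point_self)
      then show ?thesis using u(2)[OF t] uK KS ball[OF t] by auto
    qed
    then show ?thesis using u(1) by blast
  qed
  moreover have "norm (X y - X z) \<le> L * norm (y - z)" if "y \<in> S \<inter> ball x0 r" "z \<in> S \<inter> ball x0 r" for y z
    using that r(2) by (intro r0(3)) auto
  ultimately show ?thesis using r(1) h0 r0(2) hL(2) by (intro exI[of _ r] exI[of _ L] exI[of _ h]) blast
qed


section \<open>Charts and integral curves\<close>

text \<open>Stated for a bare topology so that it covers three kinds of charts: those of
  \<open>W\<close>, the product charts, and the induced charts of the tube.\<close>

definition hchart :: "'a topology \<Rightarrow> 'e::euclidean_space \<Rightarrow> 'a set \<Rightarrow> ('a \<Rightarrow> 'e) \<Rightarrow> bool" where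
  "hchart T b D f \<longleftrightarrow> openin T D \<and> hs_open b (f ` D) \<and>
     homeomorphic_map (subtopology T D) (top_of_set (f ` D)) f"

lemma hchart_openin: "hchart T b D f \<Longrightarrow> openin T D"
  and hchart_hs_open: "hchart T b D f \<Longrightarrow> hs_open b (f ` D)"
  by (simp_all add: hchart_def)

lemma hchart_subset: "hchart T b D f \<Longrightarrow> D \<subseteq> topspace T"
  using hchart_openin openin_subset by blast

lemma hchart_inj: "hchart T b D f \<Longrightarrow> inj_on f D"
  using homeomorphic_imp_injective_map[of "subtopology T D" _ f] hchart_subset[of T b D f]
  by (auto simp: hchart_def Int_absorb1)

lemma hchart_cont: "hchart T b D f \<Longrightarrow> continuous_map (subtopology T D) (top_of_set (f ` D)) f"
  by (simp add: hchart_def homeomorphic_imp_continuous_map)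

lemma hchart_inv_cont:
  assumes "hchart T b D f"
  shows "continuous_map (top_of_set (f ` D)) T (inv_into D f)"
proof -
  obtain g where g: "homeomorphic_maps (subtopology T D) (top_of_set (f ` D)) f g"
    using assms unfolding hchart_def homeomorphic_map_maps by blast
  then have cg: "continuous_map (top_of_set (f ` D)) (subtopology T D) g" by (simp add: homeomorphic_maps_def)
  have gf: "g (f p) = p" if "p \<in> D" for p
    using g that hchart_subset[OF assms] by (auto simp: homeomorphic_maps_def)
  have "continuous_map (top_of_set (f ` D)) T g" using cg by (simp add: continuous_map_in_subtopology)
  then show ?thesis
    by (rule continuous_map_eq) (use gf hchart_inj[OF assms] in auto)
qed

lemma hchart_preimage_open:
  assumes "hchart T b D f" "open V"
  shows "openin T {p \<in> D. f p \<in> V}"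
proof -
  have "continuous_map (subtopology T D) euclidean f"
    using hchart_cont[OF assms(1)] by (simp add: continuous_map_in_subtopology)
  from openin_continuous_map_preimage[OF this] assms(2)
  have "openin (subtopology T D) {p \<in> topspace (subtopology T D). f p \<in> V}" by simp
  moreover have "{p \<in> topspace (subtopology T D). f p \<in> V} = {p \<in> D. f p \<in> V}"
    using hchart_subset[OF assms(1)] by auto
  ultimately show ?thesis using openin_trans_full[OF _ hchart_openin[OF assms(1)]] by simp
qed

lemma hchart_image_open:
  assumes "hchart T b D f" "openin T V"
  shows "hs_open b (f ` (D \<inter> V))"
proof -
  have "openin (subtopology T D) (D \<inter> V)" using assms(2) by (auto simp: openin_subtopology)
  moreover have "D \<inter> V \<subseteq> topspace (subtopology T D)" using hchart_subset[OF assms(1)] by auto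
  ultimately have "openin (top_of_set (f ` D)) (f ` (D \<inter> V))"
    using homeomorphic_map_openness[of "subtopology T D" "top_of_set (f ` D)" f] assms(1)
    by (simp add: hchart_def)
  then show ?thesis using assms(1) openin_trans unfolding hchart_def hs_open_def by blast
qed

text \<open>Gives an open interval of times on which a curve stays in a chart, the form in which
  continuity is used together with derivatives.\<close>

lemma curve_cont_iff:
  assumes "open (I :: real set)"
  shows "continuous_map (top_of_set I) T c \<longleftrightarrow> (\<forall>t\<in>I. c t \<in> topspace T \<and>
    (\<forall>V. openin T V \<longrightarrow> c t \<in> V \<longrightarrow> (\<exists>e>0. \<forall>s. \<bar>s - t\<bar> < e \<longrightarrow> s \<in> I \<and> c s \<in> V)))"
proof
  assume c: "continuous_map (top_of_set I) T c"
  show "\<forall>t\<in>I. c t \<in> topspace T \<and>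
    (\<forall>V. openin T V \<longrightarrow> c t \<in> V \<longrightarrow> (\<exists>e>0. \<forall>s. \<bar>s - t\<bar> < e \<longrightarrow> s \<in> I \<and> c s \<in> V))"
  proof (intro ballI conjI allI impI)
    fix t assume t: "t \<in> I"
    show "c t \<in> topspace T" using continuous_map_image_subset_topspace[OF c] t by auto
    fix V assume V: "openin T V" "c t \<in> V"
    have "openin (top_of_set I) {s \<in> I. c s \<in> V}"
      using openin_continuous_map_preimage[OF c V(1)] by simp
    then have "open {s \<in> I. c s \<in> V}" using assms openin_open_eq by blast
    then obtain e where "e > 0" "ball t e \<subseteq> {s \<in> I. c s \<in> V}" using t V(2) openE by blast
    then show "\<exists>e>0. \<forall>s. \<bar>s - t\<bar> < e \<longrightarrow> s \<in> I \<and> c s \<in> V"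
      by (intro exI[of _ e]) (auto simp: subset_iff dist_real_def abs_minus_commute)
  qed
next
  assume c: "\<forall>t\<in>I. c t \<in> topspace T \<and>
    (\<forall>V. openin T V \<longrightarrow> c t \<in> V \<longrightarrow> (\<exists>e>0. \<forall>s. \<bar>s - t\<bar> < e \<longrightarrow> s \<in> I \<and> c s \<in> V))"
  show "continuous_map (top_of_set I) T c"
    unfolding continuous_map_def
  proof (intro conjI allI impI)
    show "c \<in> topspace (top_of_set I) \<rightarrow> topspace T" using c by auto
    fix V assume V: "openin T V"
    have "open {s \<in> I. c s \<in> V}"
      unfolding open_contains_ball
    proof
      fix t assume "t \<in> {s \<in> I. c s \<in> V}"
      then obtain e where "e > 0" "\<forall>s. \<bar>s - t\<bar> < e \<longrightarrow> s \<in> I \<and> c s \<in> V" using c V by blast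
      then show "\<exists>e>0. ball t e \<subseteq> {s \<in> I. c s \<in> V}"
        by (intro exI[of _ e]) (auto simp: subset_iff dist_real_def abs_minus_commute)
    qed
    then show "openin (top_of_set I) {t \<in> topspace (top_of_set I). c t \<in> V}"
      using assms by (simp add: openin_open_eq Collect_conj_eq2)
  qed
qed

section \<open>Integral curves on open sets of times\<close>

lemma has_vector_derivative_chain_within:
  assumes u: "(u has_vector_derivative v) (at t)" and I: "open I" "t \<in> I" "u ` I \<subseteq> S"
    and g: "(g has_derivative D) (at (u t) within S)"
  shows "((g \<circ> u) has_vector_derivative D v) (at t)"
proof -
  have "((g \<circ> u) has_vector_derivative D v) (at t within I)"
    by (rule vector_derivative_diff_chain_within)
      (use u g I in \<open>auto intro: has_vector_derivative_at_within has_derivative_subset\<close>)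
  then show ?thesis using I at_within_open by metis
qed

text \<open>Unlike \<open>integral_curve\<close>, the domain of times is a parameter, since curves
  are first built on short intervals and then extended by gluing.\<close>

definition icurve :: "('a, 'i, 'e::euclidean_space) mfd \<Rightarrow> ('i, 'e) vfield \<Rightarrow> real set \<Rightarrow> (real \<Rightarrow> 'a) \<Rightarrow> bool" where
  "icurve M X I c \<longleftrightarrow> continuous_map (top_of_set I) (topo M) c \<and>
     (\<forall>t\<in>I. \<forall>i\<in>idx M. c t \<in> cdom M i \<longrightarrow>
        ((chart M i \<circ> c) has_vector_derivative X i (chart M i (c t))) (at t))"

lemma icurve_in: "icurve M X I c \<Longrightarrow> t \<in> I \<Longrightarrow> c t \<in> points M"
  unfolding icurve_def points_def using continuous_map_image_subset_topspace by fastforce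

lemma icurve_subset: "icurve M X I c \<Longrightarrow> J \<subseteq> I \<Longrightarrow> icurve M X J c"
  unfolding icurve_def using continuous_map_from_subtopology_mono by (metis subset_iff)

lemma icurve_integral_curve: "integral_curve M X (points M) c \<longleftrightarrow> icurve M X UNIV c"
  by (simp add: integral_curve_def icurve_def points_def)

lemma icurve_localI:
  assumes "open I" and loc: "\<And>t. t \<in> I \<Longrightarrow> \<exists>J c'. open J \<and> t \<in> J \<and> J \<subseteq> I \<and> icurve M X J c' \<and> (\<forall>s\<in>J. c s = c' s)"
  shows "icurve M X I c"
  unfolding icurve_def curve_cont_iff[OF \<open>open I\<close>]
proof (intro conjI ballI allI impI)
  fix t assume "t \<in> I"
  then obtain J c' where J: "open J" "t \<in> J" "J \<subseteq> I" "icurve M X J c'" "\<forall>s\<in>J. c s = c' s" using loc by blast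
  have cc': "c t = c' t" using J by blast
  show "c t \<in> topspace (topo M)" using icurve_in[OF J(4,2)] cc' by (simp add: points_def)
  { fix V assume "openin (topo M) V" "c t \<in> V"
    then obtain e where "e > 0" "\<forall>s. \<bar>s - t\<bar> < e \<longrightarrow> s \<in> J \<and> c' s \<in> V"
      using J(2,4) cc' unfolding icurve_def curve_cont_iff[OF J(1)] by metis
    then show "\<exists>e>0. \<forall>s. \<bar>s - t\<bar> < e \<longrightarrow> s \<in> I \<and> c s \<in> V" using J(3,5) by (intro exI[of _ e]) auto }
  fix i assume "i \<in> idx M" "c t \<in> cdom M i"
  then have "((chart M i \<circ> c') has_vector_derivative X i (chart M i (c t))) (at t)"
    using J(2,4) cc' unfolding icurve_def by auto
  then show "((chart M i \<circ> c) has_vector_derivative X i (chart M i (c t))) (at t)"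
    by (rule has_vector_derivative_transform_within_open[OF _ J(1,2)]) (use J(5) in simp)
qed

lemma icurve_shift:
  assumes "open I" "icurve M X I c"
  shows "icurve M X {t. t + a \<in> I} (\<lambda>t. c (t + a))"
proof -
  have op: "open {t. t + a \<in> I}"
    using open_vimage[OF assms(1), of "\<lambda>t. t + a"] by (simp add: vimage_def continuous_intros)
  show ?thesis
    unfolding icurve_def
  proof (intro conjI ballI impI)
    have "continuous_map (top_of_set {t. t + a \<in> I}) (top_of_set I) (\<lambda>t. t + a)"
      by (auto intro!: continuous_intros)
    from continuous_map_compose[OF this, of "topo M" c]
    show "continuous_map (top_of_set {t. t + a \<in> I}) (topo M) (\<lambda>t. c (t + a))"
      using assms(2) by (simp add: icurve_def o_def)
    fix t i assume "t \<in> {t. t + a \<in> I}" "i \<in> idx M" "c (t + a) \<in> cdom M i"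
    then have 1: "((chart M i \<circ> c) has_vector_derivative X i (chart M i (c (t + a)))) (at (t + a))"
      using assms(2) by (simp add: icurve_def)
    have "((\<lambda>t. t + a) has_vector_derivative 1) (at t)" by (auto intro!: derivative_eq_intros)
    from vector_diff_chain_at[OF this, of "chart M i \<circ> c"] 1
    show "((chart M i \<circ> (\<lambda>t. c (t + a))) has_vector_derivative X i (chart M i (c (t + a)))) (at t)"
      by (simp add: o_def)
  qed
qed

lemma smooth_manifold_hchart:
  assumes "smooth_manifold M" "i \<in> idx M"
  shows "hchart (topo M) (nu M) (cdom M i) (chart M i)"
  using assms by (auto simp: smooth_manifold_def hchart_def hs_open_def coords_def)

lemma smooth_manifold_transition:
  assumes "smooth_manifold M" "i \<in> idx M" "j \<in> idx M"
  shows "smooth_on (chart M i ` (cdom M i \<inter> cdom M j)) (chart M j \<circ> param M i)"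
  using assms by (auto simp: smooth_manifold_def)

lemma smooth_manifold_overlap:
  assumes "smooth_manifold M" "i \<in> idx M" "j \<in> idx M"
  shows "hs_open (nu M) (chart M i ` (cdom M i \<inter> cdom M j))"
  using hchart_image_open[OF smooth_manifold_hchart[OF assms(1,2)]]
    hchart_openin[OF smooth_manifold_hchart[OF assms(1,3)]] by blast

lemma smooth_manifold_chart_exists:
  assumes "smooth_manifold M" "p \<in> points M"
  obtains i where "i \<in> idx M" "p \<in> cdom M i"
  using assms unfolding smooth_manifold_def by blast

section \<open>Flows on compact manifolds with boundary\<close>

text \<open>\<open>compat\<close> says that the local expressions form one vector field. Together
  with compactness, the tangency to the boundary makes its flow complete.\<close>

locale manifold_field =
  fixes M :: "('a, 'i, 'e::euclidean_space) mfd" and X :: "('i, 'e) vfield"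
  assumes mfd: "smooth_manifold M" and compact: "compact_space (topo M)"
    and compat: "\<And>i j p. i \<in> idx M \<Longrightarrow> j \<in> idx M \<Longrightarrow> p \<in> cdom M i \<inter> cdom M j \<Longrightarrow>
      frechet_derivative (chart M j \<circ> param M i) (at (chart M i p) within chart M i ` (cdom M i \<inter> cdom M j))
        (X i (chart M i p)) = X j (chart M j p)"
    and lip: "\<And>i. i \<in> idx M \<Longrightarrow> loc_lip (coords M i) (X i)"
    and tangent: "\<And>i x. i \<in> idx M \<Longrightarrow> x \<in> coords M i \<Longrightarrow> x \<bullet> nu M = 0 \<Longrightarrow> X i x \<bullet> nu M = 0"
begin

lemma hch: "i \<in> idx M \<Longrightarrow> hchart (topo M) (nu M) (cdom M i) (chart M i)"
  by (rule smooth_manifold_hchart[OF mfd])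

lemma param_chart: "i \<in> idx M \<Longrightarrow> p \<in> cdom M i \<Longrightarrow> param M i (chart M i p) = p"
  unfolding param_def using hchart_inj[OF hch] by simp

lemma chart_param: "x \<in> coords M i \<Longrightarrow> chart M i (param M i x) = x"
  unfolding param_def coords_def by (rule f_inv_into_f)

lemma param_in: "x \<in> coords M i \<Longrightarrow> param M i x \<in> cdom M i"
  unfolding param_def coords_def by (rule inv_into_into)

text \<open>Solving in one chart is enough: in every other chart the velocity follows from the chain
  rule for the transition map and \<open>compat\<close>.\<close>

lemma icurve_from_chart:
  assumes i: "i \<in> idx M" and I: "open I" and u: "\<And>t. t \<in> I \<Longrightarrow> u t \<in> coords M i"
    "\<And>t. t \<in> I \<Longrightarrow> (u has_vector_derivative X i (u t)) (at t)"
  shows "icurve M X I (\<lambda>t. param M i (u t))"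
proof -
  have "continuous_on I u"
    using u(2) by (intro continuous_at_imp_continuous_on) (auto dest: has_vector_derivative_continuous)
  then have "continuous_map (top_of_set I) (top_of_set (coords M i)) u"
    using u(1) by (auto simp: continuous_map_in_subtopology)
  from continuous_map_compose[OF this, of "topo M" "param M i"]
  have cont: "continuous_map (top_of_set I) (topo M) (\<lambda>t. param M i (u t))"
    using hchart_inv_cont[OF hch[OF i]] by (simp add: o_def param_def[abs_def] coords_def)
  show ?thesis
    unfolding icurve_def
  proof (intro conjI ballI impI cont)
    fix t j assume t: "t \<in> I" and j: "j \<in> idx M" and tj: "param M i (u t) \<in> cdom M j"
    let ?S = "chart M i ` (cdom M i \<inter> cdom M j)"
    let ?p = "param M i (u t)"
    have p: "?p \<in> cdom M i \<inter> cdom M j" "chart M i ?p = u t"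
      using tj param_in[OF u(1)[OF t]] chart_param[OF u(1)[OF t]] by auto
    have S: "hs_open (nu M) ?S" by (rule smooth_manifold_overlap[OF mfd i j])
    have utS: "u t \<in> ?S" using p by (metis imageI)
    obtain e where e: "e > 0" "\<And>s. \<bar>s - t\<bar> < e \<Longrightarrow> s \<in> I \<and> param M i (u s) \<in> cdom M j"
      using cont t tj hchart_openin[OF hch[OF j]] unfolding curve_cont_iff[OF I] by meson
    have D: "((chart M j \<circ> param M i) has_derivative
        frechet_derivative (chart M j \<circ> param M i) (at (u t) within ?S)) (at (u t) within ?S)"
      by (rule hs_open_has_derivative[OF S smooth_manifold_transition[OF mfd i j] utS])
    have "(((chart M j \<circ> param M i) \<circ> u) has_vector_derivative
        frechet_derivative (chart M j \<circ> param M i) (at (u t) within ?S) (X i (u t))) (at t)"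
    proof (rule has_vector_derivative_chain_within[OF u(2)[OF t] _ _ _ D, of "ball t e"])
      show "u ` ball t e \<subseteq> ?S"
      proof clarify
        fix s assume "s \<in> ball t e"
        then have s: "s \<in> I" "param M i (u s) \<in> cdom M j"
          using e(2)[of s] by (auto simp: dist_real_def abs_minus_commute)
        show "u s \<in> ?S"
          using s param_in[OF u(1)[OF s(1)]] chart_param[OF u(1)[OF s(1)]] by (metis IntI imageI)
      qed
    qed (use e in auto)
    then show "((chart M j \<circ> (\<lambda>t. param M i (u t))) has_vector_derivative X j (chart M j (param M i (u t)))) (at t)"
      using compat[OF i j p(1)] p(2) by (simp add: o_def)
  qed
qed

lemma icurve_unique_local:
  assumes I: "open I" and c: "icurve M X I c" and d: "icurve M X I d" and t: "t \<in> I" "c t = d t"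
  shows "\<exists>e>0. \<forall>s. \<bar>s - t\<bar> < e \<longrightarrow> s \<in> I \<and> c s = d s"
proof -
  obtain i where i: "i \<in> idx M" "c t \<in> cdom M i"
    by (rule smooth_manifold_chart_exists[OF mfd icurve_in[OF c t(1)]])
  let ?x = "chart M i (c t)"
  have x: "?x \<in> coords M i" using i by (simp add: coords_def)
  obtain r L where r: "r > 0" "L \<ge> 0"
    "\<And>y z. y \<in> coords M i \<inter> ball ?x r \<Longrightarrow> z \<in> coords M i \<inter> ball ?x r \<Longrightarrow> norm (X i y - X i z) \<le> L * norm (y - z)"
    using lip[OF i(1)] x unfolding loc_lip_def by meson
  define V where "V = {p \<in> cdom M i. chart M i p \<in> ball ?x r}"
  have V: "openin (topo M) V" "c t \<in> V" "d t \<in> V"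
    using hchart_preimage_open[OF hch[OF i(1)], of "ball ?x r"] i(2) r(1) t(2) by (auto simp: V_def)
  obtain e1 where e1: "e1 > 0" "\<And>s. \<bar>s - t\<bar> < e1 \<Longrightarrow> s \<in> I \<and> c s \<in> V"
    using c t(1) V unfolding icurve_def curve_cont_iff[OF I] by meson
  obtain e2 where e2: "e2 > 0" "\<And>s. \<bar>s - t\<bar> < e2 \<Longrightarrow> s \<in> I \<and> d s \<in> V"
    using d t(1) V unfolding icurve_def curve_cont_iff[OF I] by meson
  \<comment> \<open>Both curves stay in the region of the Lipschitz bound up to and including time
    \<open>a\<close>, and \<open>a * L <= 1/2\<close> as \<open>ode_dependence\<close>
    requires.\<close>
  define a where "a = min (min e1 e2 / 2) (1 / (2 * (L + 1)))"
  have a: "a > 0" "a < e1" "a < e2" using e1(1) e2(1) r(2) by (auto simp: a_def)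
  have "a * (2 * (L + 1)) \<le> 1"
  proof -
    have "a \<le> 1 / (2 * (L + 1))" by (simp add: a_def)
    moreover have "2 * (L + 1) > 0" using r(2) by simp
    ultimately show ?thesis by (metis pos_le_divide_eq)
  qed
  then have aL: "a * L \<le> 1/2" using a(1) by (simp add: algebra_simps)
  have "c s = d s" if s: "\<bar>s - t\<bar> < a" for s
  proof -
    have near: "s' \<in> I \<and> c s' \<in> V \<and> d s' \<in> V" if "\<bar>s' - t\<bar> \<le> a" for s'
      using that e1(2)[of s'] e2(2)[of s'] a by auto
    have "norm ((chart M i \<circ> c) s - (chart M i \<circ> d) s) \<le> 2 * norm ((chart M i \<circ> c) t - (chart M i \<circ> d) t)"
    proof (rule ode_dependence[OF r(2) aL])
      fix s' assume s': "\<bar>s' - t\<bar> \<le> a"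
      have V': "s' \<in> I" "c s' \<in> V" "d s' \<in> V" using near[OF s'] by auto
      show "((chart M i \<circ> c) has_vector_derivative X i (chart M i (c s'))) (at s')"
        "((chart M i \<circ> d) has_vector_derivative X i (chart M i (d s'))) (at s')"
        using c d V' i(1) by (auto simp: icurve_def V_def)
      show "norm (X i (chart M i (c s')) - X i (chart M i (d s'))) \<le> L * norm ((chart M i \<circ> c) s' - (chart M i \<circ> d) s')"
        unfolding o_def by (rule r(3)) (use V' in \<open>auto simp: V_def coords_def\<close>)
    qed (use a s in auto)
    then have "chart M i (c s) = chart M i (d s)" using t(2) by simp
    then show ?thesis
      using near[of s] s hchart_inj[OF hch[OF i(1)]] by (auto simp: V_def inj_on_def)
  qed
  then show ?thesis using a e1(2) by (intro exI[of _ a]) auto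
qed

text \<open>The set of times where the curves agree is open by local uniqueness and closed because
  the space is Hausdorff.\<close>

lemma icurve_unique:
  assumes I: "open I" "connected I" and c: "icurve M X I c" and d: "icurve M X I d"
    and t0: "t0 \<in> I" "c t0 = d t0" and t: "t \<in> I"
  shows "c t = d t"
proof -
  let ?A = "{t \<in> I. c t = d t}"
  have "open ?A"
    unfolding open_contains_ball
  proof
    fix s assume "s \<in> ?A"
    then obtain e where "e > 0" "\<forall>s'. \<bar>s' - s\<bar> < e \<longrightarrow> s' \<in> I \<and> c s' = d s'"
      using icurve_unique_local[OF I(1) c d] by blast
    then show "\<exists>e>0. ball s e \<subseteq> ?A"
      by (intro exI[of _ e]) (auto simp: subset_iff dist_real_def abs_minus_commute)
  qed
  then have "openin (top_of_set I) ?A" using I(1) by (auto simp: openin_open_eq)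
  moreover have "closedin (top_of_set I) ?A"
    using closedin_continuous_maps_eq[of "topo M" "top_of_set I" c d] mfd c d
    by (simp add: smooth_manifold_def icurve_def)
  ultimately have "?A = {} \<or> ?A = I" using I(2) connected_clopen by blast
  then show ?thesis using t0 t by blast
qed

lemma local_flow:
  assumes p: "p \<in> points M"
  shows "\<exists>N h \<theta>. openin (topo M) N \<and> p \<in> N \<and> h > 0 \<and> (\<forall>q\<in>N. icurve M X {-h<..<h} (\<theta> q) \<and> \<theta> q 0 = q) \<and>
    continuous_map (prod_topology (top_of_set {-h<..<h}) (subtopology (topo M) N)) (topo M) (\<lambda>(t, q). \<theta> q t)"
proof -
  obtain i where i: "i \<in> idx M" "p \<in> cdom M i" by (rule smooth_manifold_chart_exists[OF mfd p])
  let ?S = "coords M i"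
  let ?x0 = "chart M i p"
  have S: "hs_open (nu M) ?S" using hchart_hs_open[OF hch[OF i(1)]] by (simp add: coords_def)
  have x0: "?x0 \<in> ?S" using i by (simp add: coords_def)
  obtain r L h where r: "0 < r" "0 < h" "0 \<le> L" "h * L \<le> 1/2"
    and lp: "\<forall>y\<in>?S \<inter> ball ?x0 r. \<forall>z\<in>?S \<inter> ball ?x0 r. norm (X i y - X i z) \<le> L * norm (y - z)"
    and ex: "\<forall>x\<in>?S \<inter> ball ?x0 (r/2). \<exists>u. u 0 = x \<and>
      (\<forall>t. \<bar>t\<bar> < h \<longrightarrow> u t \<in> ?S \<inter> ball ?x0 r \<and> (u has_vector_derivative X i (u t)) (at t))"
  proof -
    have "\<forall>x\<in>?S. x \<bullet> nu M = 0 \<longrightarrow> X i x \<bullet> nu M = 0" using tangent[OF i(1)] by blast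
    from halfspace_local_flow[OF S lip[OF i(1)] this x0] show ?thesis by (elim exE conjE) (rule that)
  qed
  define Q where "Q = ?S \<inter> ball ?x0 (r/2)"
  obtain u where u: "\<And>x. x \<in> Q \<Longrightarrow> u x 0 = x"
    "\<And>x t. x \<in> Q \<Longrightarrow> \<bar>t\<bar> < h \<Longrightarrow> u x t \<in> ?S \<inter> ball ?x0 r"
    "\<And>x t. x \<in> Q \<Longrightarrow> \<bar>t\<bar> < h \<Longrightarrow> (u x has_vector_derivative X i (u x t)) (at t)"
    using bchoice[OF ex] unfolding Q_def by blast
  \<comment> \<open>Lipschitz dependence on the initial point, uniform in time; with continuity in
    time for each fixed \<open>x\<close> it gives joint continuity.\<close>
  have dep: "norm (u x t - u y t) \<le> 2 * norm (x - y)" if "x \<in> Q" "y \<in> Q" "\<bar>t\<bar> < h" for x y t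
  proof -
    have "norm (u x t - u y t) \<le> 2 * norm (u x 0 - u y 0)"
    proof (rule ode_dependence[where a="\<bar>t\<bar>" and L=L])
      have "\<bar>t\<bar> * L \<le> h * L" using that r by (intro mult_right_mono) auto
      then show "\<bar>t\<bar> * L \<le> 1/2" using r by simp
      fix s assume "\<bar>s - 0\<bar> \<le> \<bar>t\<bar>"
      then have s: "\<bar>s\<bar> < h" using that by simp
      show "(u x has_vector_derivative X i (u x s)) (at s)" "(u y has_vector_derivative X i (u y s)) (at s)"
        using u(3) that s by auto
      show "norm (X i (u x s) - X i (u y s)) \<le> L * norm (u x s - u y s)"
        using lp u(2) that s by blast
    qed (use r in auto)
    then show ?thesis using u(1) that by simp
  qed
  let ?I = "{-h<..<h}"
  have contu: "continuous_on (?I \<times> Q) (\<lambda>(t, x). u x t)"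
    unfolding continuous_on_iff
  proof (intro ballI allI impI)
    fix z and e :: real assume z: "z \<in> ?I \<times> Q" and e: "e > 0"
    obtain t x where tx: "z = (t, x)" "\<bar>t\<bar> < h" "x \<in> Q" using z by (cases z) auto
    have "isCont (u x) t" using has_vector_derivative_continuous[OF u(3)[OF tx(3,2)]] .
    then obtain d where d: "d > 0" "\<And>t'. dist t' t < d \<Longrightarrow> dist (u x t') (u x t) < e / 2"
      using e unfolding continuous_at_eps_delta by (metis half_gt_zero)
    show "\<exists>d>0. \<forall>z'\<in>?I \<times> Q. dist z' z < d \<longrightarrow> dist (case z' of (t, x) \<Rightarrow> u x t) (case z of (t, x) \<Rightarrow> u x t) < e"
    proof (intro exI[of _ "min d (e / 4)"] conjI ballI impI)
      fix z' assume z': "z' \<in> ?I \<times> Q" and dz: "dist z' z < min d (e / 4)"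
      obtain t' x' where tx': "z' = (t', x')" "\<bar>t'\<bar> < h" "x' \<in> Q" using z' by (cases z') auto
      have "dist t' t < d" "dist x' x < e / 4"
        using dz dist_fst_le[of z' z] dist_snd_le[of z' z] tx tx' by auto
      then have "dist (u x t') (u x t) < e / 2" "dist (u x' t') (u x t') < e / 2"
        using d(2) dep[OF tx'(3) tx(3) tx'(2)] by (auto simp: dist_norm)
      then show "dist (case z' of (t, x) \<Rightarrow> u x t) (case z of (t, x) \<Rightarrow> u x t) < e"
        using dist_triangle[of "u x' t'" "u x t" "u x t'"] tx tx' by simp
    qed (use d e in auto)
  qed
  define N where "N = {q \<in> cdom M i. chart M i q \<in> ball ?x0 (r/2)}"
  have N: "openin (topo M) N" "p \<in> N"
    using hchart_preimage_open[OF hch[OF i(1)], of "ball ?x0 (r/2)"] i(2) r(1) by (auto simp: N_def)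
  have NQ: "chart M i q \<in> Q" if "q \<in> N" for q using that by (auto simp: N_def Q_def coords_def)
  define \<theta> where "\<theta> q t = param M i (u (chart M i q) t)" for q t
  have "icurve M X ?I (\<theta> q) \<and> \<theta> q 0 = q" if q: "q \<in> N" for q
  proof
    have \<theta>q: "\<theta> q = (\<lambda>t. param M i (u (chart M i q) t))" by (simp add: \<theta>_def fun_eq_iff)
    have "\<bar>t\<bar> < h" if "t \<in> ?I" for t using that by auto
    then show "icurve M X ?I (\<theta> q)"
      unfolding \<theta>q by (intro icurve_from_chart[OF i(1)]) (use u(2,3)[OF NQ[OF q]] in auto)
    show "\<theta> q 0 = q" using u(1)[OF NQ[OF q]] param_chart[OF i(1)] q by (simp add: \<theta>_def N_def)
  qed
  moreover have "continuous_map (prod_topology (top_of_set ?I) (subtopology (topo M) N)) (topo M) (\<lambda>(t, q). \<theta> q t)"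
  proof -
    let ?P = "prod_topology (top_of_set ?I) (subtopology (topo M) N)"
    have ch: "continuous_map (subtopology (topo M) N) euclidean (chart M i)"
    proof -
      have "continuous_map (subtopology (topo M) (cdom M i)) euclidean (chart M i)"
        using hchart_cont[OF hch[OF i(1)]] by (simp add: continuous_map_in_subtopology)
      then show ?thesis by (rule continuous_map_from_subtopology_mono) (auto simp: N_def)
    qed
    have "continuous_map ?P euclideanreal fst"
      by (rule continuous_map_into_fulltopology[OF continuous_map_fst])
    moreover have "continuous_map ?P euclidean (chart M i \<circ> snd)"
      by (rule continuous_map_compose[OF continuous_map_snd ch])
    ultimately have "continuous_map ?P (prod_topology euclideanreal euclidean) (\<lambda>z. (fst z, (chart M i \<circ> snd) z))"
      by (rule continuous_map_pairedI)
    then have 1: "continuous_map ?P (top_of_set (?I \<times> Q)) (\<lambda>z. (fst z, (chart M i \<circ> snd) z))"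
      using NQ by (auto simp: continuous_map_in_subtopology)
    have 2: "continuous_map (top_of_set (?I \<times> Q)) (top_of_set (chart M i ` cdom M i)) (\<lambda>(t, x). u x t)"
    proof -
      have "u x t \<in> chart M i ` cdom M i" if "t \<in> ?I" "x \<in> Q" for t x
        using u(2)[OF that(2), of t] that(1) by (auto simp: coords_def)
      then show ?thesis using contu by (auto simp: continuous_map_in_subtopology)
    qed
    from continuous_map_compose[OF continuous_map_compose[OF 1 2] hchart_inv_cont[OF hch[OF i(1)]]]
    show ?thesis
      by (simp add: o_def case_prod_unfold \<theta>_def param_def[abs_def])
  qed
  ultimately show ?thesis using N r(2) by blast
qed


text \<open>Compactness leaves finitely many local flows, and the least of their lifetimes serves
  all points. Uniqueness makes them agree on overlaps, so they paste to one continuous map.\<close>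

lemma uniform_local_flow:
  "\<exists>h C. h > 0 \<and> (\<forall>q\<in>points M. icurve M X {-h<..<h} (C q) \<and> C q 0 = q) \<and>
    continuous_map (prod_topology (top_of_set {-h<..<h}) (topo M)) (topo M) (\<lambda>(t, q). C q t)"
proof (cases "points M = {}")
  case True
  then have "topo M = trivial_topology" by (simp add: points_def)
  then show ?thesis using True by (intro exI[of _ 1] exI) auto
next
  case ne: False
  obtain N h \<theta> where loc: "\<And>p. p \<in> points M \<Longrightarrow> openin (topo M) (N p) \<and> p \<in> N p \<and> h p > 0 \<and>
    (\<forall>q\<in>N p. icurve M X {-h p<..<h p} (\<theta> p q) \<and> \<theta> p q 0 = q) \<and>
    continuous_map (prod_topology (top_of_set {-h p<..<h p}) (subtopology (topo M) (N p))) (topo M) (\<lambda>(t, q). \<theta> p q t)"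
    using local_flow by metis
  have "\<exists>\<F>. finite \<F> \<and> \<F> \<subseteq> N ` points M \<and> topspace (topo M) \<subseteq> \<Union>\<F>"
    using compact unfolding compact_space_def by (rule compactinD) (use loc in \<open>auto simp: points_def\<close>)
  then obtain P where P: "finite P" "P \<subseteq> points M" "points M \<subseteq> \<Union>(N ` P)"
    by (metis finite_subset_image points_def)
  have P0: "P \<noteq> {}" using P(3) ne by auto
  define k where "k = Min (h ` P)"
  have k: "k > 0" unfolding k_def using P(1,2) P0 loc by (subst Min_gr_iff) auto
  have kh: "k \<le> h p" if "p \<in> P" for p unfolding k_def using P(1) that by simp
  let ?I = "{-k<..<k}"
  have cur: "icurve M X ?I (\<theta> p q)" if "p \<in> P" "q \<in> N p" for p q
  proof (rule icurve_subset[where I="{-h p<..<h p}"])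
    show "icurve M X {-h p<..<h p} (\<theta> p q)" using loc[OF subsetD[OF P(2) that(1)]] that(2) by simp
    show "?I \<subseteq> {-h p<..<h p}" using kh[OF that(1)] by auto
  qed
  have "\<forall>q\<in>points M. \<exists>p\<in>P. q \<in> N p" using P(3) by blast
  then obtain s where s: "\<And>q. q \<in> points M \<Longrightarrow> s q \<in> P \<and> q \<in> N (s q)" by metis
  define C where "C q = \<theta> (s q) q" for q
  have C: "icurve M X ?I (C q) \<and> C q 0 = q" if "q \<in> points M" for q
  proof
    show "icurve M X ?I (C q)" using s[OF that] cur unfolding C_def by blast
    show "C q 0 = q" using loc[OF subsetD[OF P(2)], of "s q"] s[OF that] unfolding C_def by simp
  qed
  have NP: "openin (topo M) (N p)" "N p \<subseteq> points M" if "p \<in> P" for p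
    using loc P(2) that openin_subset unfolding points_def by blast+
  have agree: "C q t = \<theta> p q t" if p: "p \<in> P" "q \<in> N p" and t: "t \<in> ?I" for p q t
  proof (rule icurve_unique[of ?I "C q" "\<theta> p q" 0 t])
    have q: "q \<in> points M" using NP(2) p by blast
    show "icurve M X ?I (C q)" using C[OF q] by blast
    show "icurve M X ?I (\<theta> p q)" by (rule cur[OF p])
    show "C q 0 = \<theta> p q 0" using C[OF q] loc p P(2) by (metis subsetD)
  qed (use k t in auto)
  have "continuous_map (prod_topology (top_of_set ?I) (topo M)) (topo M) (\<lambda>(t, q). C q t)"
  proof (rule pasting_lemma[where I=P and T="\<lambda>p. ?I \<times> N p" and f="\<lambda>p (t, q). \<theta> p q t"])
    fix p assume p: "p \<in> P"
    show "openin (prod_topology (top_of_set ?I) (topo M)) (?I \<times> N p)"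
      using NP(1)[OF p] by (auto simp: openin_prod_Times_iff)
    have "continuous_map (prod_topology (top_of_set {-h p<..<h p}) (subtopology (topo M) (N p))) (topo M) (\<lambda>(t, q). \<theta> p q t)"
      using loc p P(2) by blast
    then have "continuous_map (subtopology (prod_topology euclideanreal (topo M)) ({-h p<..<h p} \<times> N p)) (topo M) (\<lambda>(t, q). \<theta> p q t)"
      by (simp add: subtopology_Times)
    then have "continuous_map (subtopology (prod_topology euclideanreal (topo M)) (?I \<times> N p)) (topo M) (\<lambda>(t, q). \<theta> p q t)"
      by (rule continuous_map_from_subtopology_mono) (use kh[OF p] in auto)
    then show "continuous_map (subtopology (prod_topology (top_of_set ?I) (topo M)) (?I \<times> N p)) (topo M) (\<lambda>(t, q). \<theta> p q t)"
      by (simp add: subtopology_Times subtopology_subtopology)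
  next
    fix p p' x assume "p \<in> P" "p' \<in> P" "x \<in> topspace (prod_topology (top_of_set ?I) (topo M)) \<inter> ?I \<times> N p \<inter> ?I \<times> N p'"
    then show "(case x of (t, q) \<Rightarrow> \<theta> p q t) = (case x of (t, q) \<Rightarrow> \<theta> p' q t)"
      by (cases x) (metis (no_types, lifting) IntD1 IntD2 agree case_prod_conv mem_Sigma_iff)
  next
    fix x assume "x \<in> topspace (prod_topology (top_of_set ?I) (topo M))"
    then obtain t q where x: "x = (t, q)" "t \<in> ?I" "q \<in> points M" by (cases x) (auto simp: points_def)
    then show "\<exists>p. p \<in> P \<and> x \<in> ?I \<times> N p \<and> (case x of (t, q) \<Rightarrow> C q t) = (case x of (t, q) \<Rightarrow> \<theta> p q t)"
      using s[OF x(3)] by (intro exI[of _ "s q"]) (simp add: C_def)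
  qed
  then show ?thesis using k C by blast
qed

lemma icurve_glue:
  assumes I: "open I" "connected I" and J: "open J" "connected J"
    and c: "icurve M X I c" and d: "icurve M X J d" and t0: "t0 \<in> I \<inter> J" "c t0 = d t0" and IJ: "connected (I \<inter> J)"
  shows "icurve M X (I \<union> J) (\<lambda>t. if t \<in> I then c t else d t)"
proof (rule icurve_localI)
  have ag: "c t = d t" if "t \<in> I \<inter> J" for t
    by (rule icurve_unique[of "I \<inter> J" c d t0])
      (use I J IJ t0 that icurve_subset[OF c] icurve_subset[OF d] in auto)
  show "open (I \<union> J)" using I J by auto
  fix t assume t: "t \<in> I \<union> J"
  show "\<exists>K c'. open K \<and> t \<in> K \<and> K \<subseteq> I \<union> J \<and> icurve M X K c' \<and> (\<forall>s\<in>K. (if s \<in> I then c s else d s) = c' s)"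
  proof (cases "t \<in> I")
    case True
    then show ?thesis using I c by (intro exI[of _ I] exI[of _ c]) auto
  next
    case False
    then show ?thesis using t J d ag by (intro exI[of _ J] exI[of _ d]) auto
  qed
qed

text \<open>The existence hypothesis is made for all points at once, and so is the conclusion; the
  lemma can therefore be iterated, multiplying the lifetime by 3/2 each time.\<close>

lemma icurve_extend:
  assumes a: "a > 0" and ex: "\<And>p. p \<in> points M \<Longrightarrow> \<exists>c. icurve M X {-a<..<a} c \<and> c 0 = p" and p: "p \<in> points M"
  shows "\<exists>c. icurve M X {-(3/2 * a)<..<3/2 * a} c \<and> c 0 = p"
proof -
  obtain c where c: "icurve M X {-a<..<a} c" "c 0 = p" using ex[OF p] by blast
  have shift: "\<exists>d. icurve M X {b - a<..<b + a} d \<and> d b = c b" if bI: "b \<in> {-a<..<a}" for b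
  proof -
    obtain d where d: "icurve M X {-a<..<a} d" "d 0 = c b" using ex[OF icurve_in[OF c(1) bI]] by blast
    have "{t. t + (- b) \<in> {-a<..<a}} = {b - a<..<b + a}" by auto
    then show ?thesis using icurve_shift[OF _ d(1), of "-b"] d(2) by (intro exI[of _ "\<lambda>t. d (t + (- b))"]) simp
  qed
  \<comment> \<open>Restarting at \<open>a/2\<close> and at \<open>-a/2\<close> reaches
    \<open>3/2 * a\<close> and \<open>-(3/2 * a)\<close>. The overlaps are intervals, as the
    uniqueness in \<open>icurve_glue\<close> demands.\<close>
  obtain d where d: "icurve M X {a/2 - a<..<a/2 + a} d" "d (a/2) = c (a/2)" using shift[of "a/2"] a by auto
  obtain e where e: "icurve M X {-a/2 - a<..<-a/2 + a} e" "e (-a/2) = c (-a/2)" using shift[of "-a/2"] a by auto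
  let ?f = "\<lambda>t. if t \<in> {-a<..<a} then c t else d t"
  have I1: "{-a<..<a} \<inter> {a/2 - a<..<a/2 + a} = {-a/2<..<a}" "{-a<..<a} \<union> {a/2 - a<..<a/2 + a} = {-a<..<3/2*a}"
    using a by auto
  have f: "icurve M X {-a<..<3/2*a} ?f"
    using icurve_glue[of "{-a<..<a}" "{a/2 - a<..<a/2 + a}" c d "a/2"] c(1) d a
    unfolding I1 by simp
  have I2: "{-a<..<3/2*a} \<inter> {-a/2 - a<..<-a/2 + a} = {-a<..<a/2}" "{-a<..<3/2*a} \<union> {-a/2 - a<..<-a/2 + a} = {-(3/2 * a)<..<3/2 * a}"
    using a by auto
  have fe: "?f (-a/2) = e (-a/2)" using e(2) a by simp
  have "icurve M X {-(3/2 * a)<..<3/2 * a} (\<lambda>t. if t \<in> {-a<..<3/2*a} then ?f t else e t)"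
    using icurve_glue[of "{-a<..<3/2*a}" "{-a/2 - a<..<-a/2 + a}" ?f e "-a/2", OF _ _ _ _ f e(1) _ fe] a
    unfolding I2 by simp
  moreover have "(if 0 \<in> {-a<..<3/2*a} then ?f 0 else e 0) = p" using a c(2) by simp
  ultimately show ?thesis by blast
qed

lemma icurve_bounded_exists:
  assumes p: "p \<in> points M"
  shows "\<exists>c. icurve M X {-a<..<a} c \<and> c 0 = p"
proof -
  obtain h where h: "h > 0" "\<And>q. q \<in> points M \<Longrightarrow> \<exists>c. icurve M X {-h<..<h} c \<and> c 0 = q"
    using uniform_local_flow by blast
  have step: "\<forall>q\<in>points M. \<exists>c. icurve M X {-((3/2)^n * h)<..<(3/2)^n * h} c \<and> c 0 = q" for n
  proof (induction n)
    case (Suc n)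
    have "(3/2)^n * h > 0" using h by simp
    from icurve_extend[OF this] Suc show ?case by (simp add: mult.assoc)
  qed (use h in simp)
  obtain n where "a / h < (3/2)^n" using real_arch_pow[of "3/2" "a / h"] by auto
  then have "a \<le> (3/2)^n * h" using h(1) by (simp add: field_simps)
  then show ?thesis using step[of n] p by (meson greaterThanLessThan_subseteq_greaterThanLessThan icurve_subset neg_le_iff_le)
qed

lemma icurve_exists:
  assumes p: "p \<in> points M"
  shows "\<exists>c. icurve M X UNIV c \<and> c 0 = p"
proof -
  obtain C where C: "\<And>a. icurve M X {-a<..<a} (C a) \<and> C a 0 = p"
    using icurve_bounded_exists[OF p] by metis
  \<comment> \<open>At each time a curve living strictly longer is consulted; by uniqueness the
    choice of its lifetime does not affect the value.\<close>
  define c where "c t = C (\<bar>t\<bar> + 1) t" for t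
  have eq: "c t = C a t" if "\<bar>t\<bar> < a" for a t
  proof -
    define b where "b = min a (\<bar>t\<bar> + 1)"
    have b: "b > 0" "t \<in> {-b<..<b}" "b \<le> a" "b \<le> \<bar>t\<bar> + 1" using that by (auto simp: b_def)
    have "C (\<bar>t\<bar> + 1) t = C a t"
    proof (rule icurve_unique[of "{-b<..<b}" "C (\<bar>t\<bar> + 1)" "C a" 0 t])
      show "icurve M X {-b<..<b} (C (\<bar>t\<bar> + 1))" "icurve M X {-b<..<b} (C a)"
        using b C[of a] C[of "\<bar>t\<bar> + 1"] by (auto elim!: icurve_subset)
    qed (use b C in auto)
    then show ?thesis by (simp add: c_def)
  qed
  have "icurve M X UNIV c"
  proof (rule icurve_localI)
    fix t :: real
    show "\<exists>J c'. open J \<and> t \<in> J \<and> J \<subseteq> UNIV \<and> icurve M X J c' \<and> (\<forall>s\<in>J. c s = c' s)"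
    proof (intro exI conjI ballI)
      show "icurve M X {-(\<bar>t\<bar> + 1)<..<\<bar>t\<bar> + 1} (C (\<bar>t\<bar> + 1))" using C by blast
    qed (use eq in auto)
  qed simp
  moreover have "c 0 = p" using C by (simp add: c_def)
  ultimately show ?thesis by blast
qed

definition phi :: "real \<Rightarrow> 'a \<Rightarrow> 'a" where
  "phi t p = (SOME c. icurve M X UNIV c \<and> c 0 = p) t"

lemma phi_curve: "p \<in> points M \<Longrightarrow> icurve M X UNIV (\<lambda>t. phi t p)"
  and phi_0: "p \<in> points M \<Longrightarrow> phi 0 p = p"
  using someI_ex[OF icurve_exists] unfolding phi_def by (auto simp: eta_contract_eq)

lemma phi_unique: "icurve M X UNIV c \<Longrightarrow> c 0 = p \<Longrightarrow> c t = phi t p"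
  by (rule icurve_unique[of UNIV _ _ 0]) (use icurve_in[of M X UNIV c 0] phi_curve phi_0 in auto)

lemma phi_in: "p \<in> points M \<Longrightarrow> phi t p \<in> points M"
  by (rule icurve_in[OF phi_curve]) auto

lemma phi_add:
  assumes p: "p \<in> points M"
  shows "phi (s + t) p = phi s (phi t p)"
proof -
  have "icurve M X UNIV (\<lambda>s. phi (s + t) p)"
    using icurve_shift[OF _ phi_curve[OF p], of t] by simp
  then show ?thesis by (rule phi_unique) simp
qed

text \<open>For small times this is \<open>uniform_local_flow\<close>. Near an arbitrary time
  \<open>a\<close> the flow is \<open>phi (t - a)\<close> after \<open>phi a\<close>, which reduces
  the claim to continuity of the single map \<open>phi a\<close>.\<close>

lemma phi_cont: "continuous_map (prod_topology euclideanreal (topo M)) (topo M) (\<lambda>(t, q). phi t q)"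
proof -
  obtain h C where h: "h > 0" and C: "\<And>q. q \<in> points M \<Longrightarrow> icurve M X {-h<..<h} (C q) \<and> C q 0 = q"
    and contC: "continuous_map (prod_topology (top_of_set {-h<..<h}) (topo M)) (topo M) (\<lambda>(t, q). C q t)"
    using uniform_local_flow by blast
  let ?I = "{-h<..<h}"
  have phiC: "phi t q = C q t" if "q \<in> points M" "t \<in> ?I" for t q
  proof (rule icurve_unique[of ?I "\<lambda>t. phi t q" "C q" 0 t])
    show "icurve M X ?I (\<lambda>t. phi t q)" by (rule icurve_subset[OF phi_curve]) (use that in auto)
  qed (use that h C phi_0 in auto)
  have contI: "continuous_map (prod_topology (top_of_set ?I) (topo M)) (topo M) (\<lambda>(t, q). phi t q)"
    using contC by (rule continuous_map_eq) (use phiC in \<open>auto simp: points_def\<close>)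
  have small: "continuous_map (topo M) (topo M) (phi t)" if "t \<in> ?I" for t
  proof -
    have "continuous_map (topo M) (prod_topology (top_of_set ?I) (topo M)) (\<lambda>q. (t, q))"
      using that by (simp add: continuous_map_pairedI)
    from continuous_map_compose[OF this contI] show ?thesis by (simp add: o_def)
  qed
  \<comment> \<open>\<open>phi t\<close> is an \<open>n\<close>-fold iterate of
    \<open>phi (t / n)\<close>, and for large \<open>n\<close> the time \<open>t / n\<close> is
    small.\<close>
  have fix_t: "continuous_map (topo M) (topo M) (phi t)" for t
  proof -
    obtain n :: nat where n: "n > 0" "\<bar>t\<bar> / real n < h"
    proof -
      obtain n :: nat where "\<bar>t\<bar> / h < real n" using reals_Archimedean2 by blast
      moreover have "0 \<le> \<bar>t\<bar> / h" using h by simp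
      ultimately have "real n > 0" by linarith
      then show ?thesis using that[of n] \<open>\<bar>t\<bar> / h < real n\<close> h by (simp add: field_simps)
    qed
    define s where "s = t / real n"
    have s: "s \<in> ?I" using n by (auto simp: s_def abs_less_iff divide_less_eq less_divide_eq)
    have pw: "continuous_map (topo M) (topo M) ((phi s) ^^ k)" for k
    proof (induction k)
      case (Suc k)
      have "(phi s) ^^ Suc k = phi s \<circ> (phi s) ^^ k" by simp
      then show ?case using continuous_map_compose[OF Suc small[OF s]] by metis
    qed (simp add: id_def[symmetric])
    have pe: "((phi s) ^^ k) q = phi (real k * s) q" if "q \<in> points M" for k q
    proof (induction k)
      case (Suc k)
      then show ?case using phi_add[OF that, of s "real k * s"] by (simp add: algebra_simps)
    qed (simp add: phi_0[OF that])
    show ?thesis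
      using pw[of n] by (rule continuous_map_eq) (use pe[of _ n] n in \<open>simp add: points_def s_def\<close>)
  qed
  show ?thesis
  proof (rule pasting_lemma[where I=UNIV and T="\<lambda>a. {a - h<..<a + h} \<times> points M" and f="\<lambda>a (t, q). phi t q"])
    fix a :: real
    show "openin (prod_topology euclideanreal (topo M)) ({a - h<..<a + h} \<times> points M)"
      by (auto simp: openin_prod_Times_iff points_def)
    let ?J = "{a - h<..<a + h}"
    have "continuous_map (prod_topology (top_of_set ?J) (topo M)) (prod_topology (top_of_set ?I) (topo M)) (\<lambda>(t, q). (t - a, phi a q))"
    proof -
      have "continuous_map (top_of_set ?J) (top_of_set ?I) (\<lambda>t. t - a)"
        by (auto intro!: continuous_intros)
      from continuous_map_compose[OF continuous_map_fst[of _ "topo M"] this]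
      have 1: "continuous_map (prod_topology (top_of_set ?J) (topo M)) (top_of_set ?I) (\<lambda>z. fst z - a)" by (simp add: o_def)
      from continuous_map_compose[OF continuous_map_snd[of "top_of_set ?J"] fix_t[of a]]
      have 2: "continuous_map (prod_topology (top_of_set ?J) (topo M)) (topo M) (\<lambda>z. phi a (snd z))" by (simp add: o_def)
      show ?thesis using continuous_map_pairedI[OF 1 2] by (simp add: case_prod_unfold)
    qed
    from continuous_map_compose[OF this contI]
    have "continuous_map (prod_topology (top_of_set ?J) (topo M)) (topo M) (\<lambda>(t, q). phi (t - a) (phi a q))"
      by (simp add: o_def case_prod_unfold)
    then have "continuous_map (prod_topology (top_of_set ?J) (topo M)) (topo M) (\<lambda>(t, q). phi t q)"
      by (rule continuous_map_eq) (auto simp: points_def[symmetric] phi_add[symmetric])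
    then show "continuous_map (subtopology (prod_topology euclideanreal (topo M)) (?J \<times> points M)) (topo M) (\<lambda>(t, q). phi t q)"
      by (simp add: subtopology_Times points_def)
  next
    fix x assume x: "x \<in> topspace (prod_topology euclideanreal (topo M))"
    then show "\<exists>a. a \<in> UNIV \<and> x \<in> {a - h<..<a + h} \<times> points M \<and> (case x of (t, q) \<Rightarrow> phi t q) = (case x of (t, q) \<Rightarrow> phi t q)"
      using h by (intro exI[of _ "fst x"]) (auto simp: points_def)
  qed auto
qed

lemma flow_map_phi:
  assumes p: "p \<in> points M"
  shows "flow_map M X (points M) t p = phi t p"
  unfolding flow_map_def icurve_integral_curve
proof (rule the_equality)
  show "\<exists>c. icurve M X UNIV c \<and> c 0 = p \<and> c t = phi t p"
    using phi_curve[OF p] phi_0[OF p] by blast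
  show "q = phi t p" if "\<exists>c. icurve M X UNIV c \<and> c 0 = p \<and> c t = q" for q
    using that phi_unique by blast
qed

end


section \<open>Nondegenerate forms\<close>

lemma linear_scaleR_const: "linear f \<Longrightarrow> linear (\<lambda>x. f x *\<^sub>R b)"
  by (intro linearI) (simp_all add: linear_add linear_cmul scaleR_add_left)

text \<open>\<open>T v\<close> collects the values of the covector \<open>\<omega> v\<close> on the
  basis. Nondegeneracy makes this linear endomorphism injective, hence surjective by
  dimension.\<close>

lemma nondegenerate_solve:
  fixes \<omega> :: "'e::euclidean_space \<Rightarrow> 'e \<Rightarrow> real"
  assumes lin1: "\<And>v. linear (\<lambda>u. \<omega> u v)" and lin2: "\<And>u. linear (\<omega> u)"
    and nd: "\<And>u. (\<And>v. \<omega> u v = 0) \<Longrightarrow> u = 0" and f: "linear f"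
  shows "\<exists>!v. \<forall>u. \<omega> v u = f u"
proof -
  have lexp: "g u = (\<Sum>b\<in>Basis. (u \<bullet> b) * g b)" if g: "linear g" for g :: "'e \<Rightarrow> real" and u
  proof -
    have "g u = g (\<Sum>b\<in>Basis. (u \<bullet> b) *\<^sub>R b)" by (simp only: euclidean_representation)
    also have "\<dots> = (\<Sum>b\<in>Basis. (u \<bullet> b) * g b)"
      by (simp only: linear_sum[OF g] linear_cmul[OF g] real_scaleR_def)
    finally show ?thesis .
  qed
  define T where "T v = (\<Sum>b\<in>Basis. \<omega> v b *\<^sub>R b)" for v
  have "linear T"
    unfolding T_def by (intro linear_compose_sum ballI linear_scaleR_const lin1)
  have Tb: "T v \<bullet> b = \<omega> v b" if "b \<in> Basis" for v b
    unfolding T_def using that by (simp add: inner_sum_left inner_Basis if_distrib sum.delta cong: if_cong)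
  have inj: "inj T"
    unfolding linear_injective_0[OF \<open>linear T\<close>]
  proof (intro allI impI)
    fix v assume "T v = 0"
    then have "\<omega> v b = 0" if "b \<in> Basis" for b using Tb[OF that, of v] by simp
    then have "\<omega> v u = 0" for u using lexp[OF lin2, of v u] by simp
    then show "v = 0" by (rule nd)
  qed
  have "surj T" using linear_injective_imp_surjective[OF \<open>linear T\<close> inj] by simp
  then obtain v where v: "T v = (\<Sum>b\<in>Basis. f b *\<^sub>R b)" by (metis surjD)
  have "\<omega> v b = f b" if "b \<in> Basis" for b
    using Tb[OF that, of v] that unfolding v
    by (simp add: inner_sum_left inner_Basis if_distrib sum.delta cong: if_cong)
  then have "\<omega> v u = f u" for u using lexp[OF lin2, of v u] lexp[OF f, of u] by simp
  moreover have "w = v" if "\<forall>u. \<omega> w u = f u" for w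
  proof -
    have "\<omega> (w - v) u = 0" for u
      using that \<open>\<And>u. \<omega> v u = f u\<close> linear_diff[OF lin1, of w v u] by simp
    then have "w - v = 0" by (rule nd)
    then show ?thesis by simp
  qed
  ultimately show ?thesis by blast
qed

lemma form_frechet_linear:
  fixes \<mu> :: "'e::euclidean_space \<Rightarrow> 'f::euclidean_space \<Rightarrow> real"
  assumes T: "hs_open b T" "x \<in> T" and lin: "\<And>y. y \<in> T \<Longrightarrow> linear (\<mu> y)" and sm: "\<And>u. smooth_on T (\<lambda>y. \<mu> y u)"
  shows "linear (\<lambda>w. frechet_derivative (\<lambda>y. \<mu> y w) (at x within T) z)"
proof -
  have D: "((\<lambda>y. \<mu> y w) has_derivative frechet_derivative (\<lambda>y. \<mu> y w) (at x within T)) (at x within T)" for w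
    by (rule hs_open_has_derivative[OF T(1) sm T(2)])
  show ?thesis
  proof
    fix w1 w2
    have "((\<lambda>y. \<mu> y w1 + \<mu> y w2) has_derivative (\<lambda>z. frechet_derivative (\<lambda>y. \<mu> y w1) (at x within T) z + frechet_derivative (\<lambda>y. \<mu> y w2) (at x within T) z)) (at x within T)"
      by (intro has_derivative_add D)
    then have "((\<lambda>y. \<mu> y (w1 + w2)) has_derivative (\<lambda>z. frechet_derivative (\<lambda>y. \<mu> y w1) (at x within T) z + frechet_derivative (\<lambda>y. \<mu> y w2) (at x within T) z)) (at x within T)"
      by (rule has_derivative_transform_within[OF _ zero_less_one T(2)]) (simp add: linear_add[OF lin])
    from fun_cong[OF hs_open_frechet_eqI[OF T this], of z]
    show "frechet_derivative (\<lambda>y. \<mu> y (w1 + w2)) (at x within T) z = frechet_derivative (\<lambda>y. \<mu> y w1) (at x within T) z + frechet_derivative (\<lambda>y. \<mu> y w2) (at x within T) z" .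
  next
    fix r w
    have "((\<lambda>y. r * \<mu> y w) has_derivative (\<lambda>z. r * frechet_derivative (\<lambda>y. \<mu> y w) (at x within T) z)) (at x within T)"
      by (intro has_derivative_mult_right D)
    then have "((\<lambda>y. \<mu> y (r *\<^sub>R w)) has_derivative (\<lambda>z. r * frechet_derivative (\<lambda>y. \<mu> y w) (at x within T) z)) (at x within T)"
      by (rule has_derivative_transform_within[OF _ zero_less_one T(2)]) (simp add: linear_cmul[OF lin])
    from fun_cong[OF hs_open_frechet_eqI[OF T this], of z]
    show "frechet_derivative (\<lambda>y. \<mu> y (r *\<^sub>R w)) (at x within T) z = r *\<^sub>R frechet_derivative (\<lambda>y. \<mu> y w) (at x within T) z"
      by simp
  qed
qed

lemma loc_lip_finite:
  assumes "finite B" "\<And>b. b \<in> B \<Longrightarrow> loc_lip S (f b)" "x \<in> S"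
  shows "\<exists>r>0. \<exists>L\<ge>0. \<forall>b\<in>B. \<forall>y\<in>S \<inter> ball x r. \<forall>z\<in>S \<inter> ball x r. norm (f b y - f b z) \<le> L * norm (y - z)"
  using assms(1,2)
proof (induction B rule: finite_induct)
  case empty
  then show ?case by (intro exI[of _ 1] conjI exI[of _ 0]) auto
next
  case (insert b B)
  obtain r1 L1 where 1: "r1 > 0" "L1 \<ge> 0" "\<And>c y z. c \<in> B \<Longrightarrow> y\<in>S \<inter> ball x r1 \<Longrightarrow> z\<in>S \<inter> ball x r1 \<Longrightarrow> norm (f c y - f c z) \<le> L1 * norm (y - z)"
    using insert by (metis insertCI)
  have "loc_lip S (f b)" using insert by simp
  then obtain r2 L2 where 2: "r2 > 0" "L2 \<ge> 0" "\<And>y z. y\<in>S \<inter> ball x r2 \<Longrightarrow> z\<in>S \<inter> ball x r2 \<Longrightarrow> norm (f b y - f b z) \<le> L2 * norm (y - z)"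
    using assms(3) unfolding loc_lip_def by meson
  have "norm (f c y - f c z) \<le> (L1 + L2) * norm (y - z)"
    if c: "c \<in> insert b B" and yz: "y \<in> S \<inter> ball x (min r1 r2)" "z \<in> S \<inter> ball x (min r1 r2)" for c y z
  proof (cases "c = b")
    case True
    have "norm (f b y - f b z) \<le> L2 * norm (y - z)" using yz by (intro 2(3)) auto
    also have "\<dots> \<le> (L1 + L2) * norm (y - z)" using 1(2) by (intro mult_right_mono) auto
    finally show ?thesis using True by simp
  next
    case False
    have "norm (f c y - f c z) \<le> L1 * norm (y - z)" using yz c False by (intro 1(3)) auto
    also have "\<dots> \<le> (L1 + L2) * norm (y - z)" using 2(2) by (intro mult_right_mono) auto
    finally show ?thesis .
  qed
  then show ?case using 1(1,2) 2(1,2) by (intro exI[of _ "min r1 r2"] conjI exI[of _ "L1 + L2"]) auto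
qed

text \<open>An injective linear map is bounded below, and the bound survives a small perturbation up
  to a factor 2. This controls the solution \<open>X\<close> and its variation by those of
  \<open>A\<close> and \<open>\<beta>\<close>.\<close>

lemma loc_lip_solution:
  fixes A :: "'e::euclidean_space \<Rightarrow> 'e \<Rightarrow> 'e"
  assumes lin: "\<And>y. y \<in> S \<Longrightarrow> linear (A y)" and inj: "\<And>y v. y \<in> S \<Longrightarrow> A y v = 0 \<Longrightarrow> v = 0"
    and A: "\<And>b. b \<in> Basis \<Longrightarrow> loc_lip S (\<lambda>y. A y b)" and \<beta>: "loc_lip S \<beta>"
    and X: "\<And>y. y \<in> S \<Longrightarrow> A y (X y) = \<beta> y"
  shows "loc_lip S X"
  unfolding loc_lip_def
proof
  fix x assume x: "x \<in> S"
  have "inj (A x)" using linear_injective_0[OF lin[OF x]] inj[OF x] by blast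
  then obtain c where c: "c > 0" "\<And>v. c * norm v \<le> norm (A x v)"
    using linear_inj_bounded_below_pos[OF lin[OF x]] by metis
  obtain r1 L1 where 1: "r1 > 0" "L1 \<ge> 0"
    "\<And>b y z. b \<in> Basis \<Longrightarrow> y\<in>S \<inter> ball x r1 \<Longrightarrow> z\<in>S \<inter> ball x r1 \<Longrightarrow> norm (A y b - A z b) \<le> L1 * norm (y - z)"
    using loc_lip_finite[of Basis S "\<lambda>b y. A y b" x] A x by (metis finite_Basis)
  obtain r2 L2 where 2: "r2 > 0" "L2 \<ge> 0"
    "\<And>y z. y\<in>S \<inter> ball x r2 \<Longrightarrow> z\<in>S \<inter> ball x r2 \<Longrightarrow> norm (\<beta> y - \<beta> z) \<le> L2 * norm (y - z)"
    using \<beta> x unfolding loc_lip_def by meson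
  define L where "L = real DIM('e) * L1"
  have L: "L \<ge> 0" using 1(2) by (simp add: L_def)
  have AA: "norm (A y v - A z v) \<le> L * norm (y - z) * norm v" if yz: "y\<in>S \<inter> ball x r1" "z\<in>S \<inter> ball x r1" for y z v
  proof -
    have exp: "A y v = (\<Sum>b\<in>Basis. (v \<bullet> b) *\<^sub>R A y b)" if "y \<in> S" for y
    proof -
      have "A y v = A y (\<Sum>b\<in>Basis. (v \<bullet> b) *\<^sub>R b)" by (simp only: euclidean_representation)
      also have "\<dots> = (\<Sum>b\<in>Basis. (v \<bullet> b) *\<^sub>R A y b)"
        by (simp only: linear_sum[OF lin[OF that]] linear_cmul[OF lin[OF that]])
      finally show ?thesis .
    qed
    have "A y v - A z v = (\<Sum>b\<in>Basis. (v \<bullet> b) *\<^sub>R (A y b - A z b))"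
      using exp[of y] exp[of z] yz by (simp add: scaleR_diff_right sum_subtractf)
    also have "norm \<dots> \<le> (\<Sum>b\<in>(Basis :: 'e set). norm v * (L1 * norm (y - z)))"
    proof (rule sum_norm_le)
      fix b :: 'e assume b: "b \<in> Basis"
      show "norm ((v \<bullet> b) *\<^sub>R (A y b - A z b)) \<le> norm v * (L1 * norm (y - z))"
        unfolding norm_scaleR using Basis_le_norm[OF b, of v] 1(3)[OF b yz] by (intro mult_mono) auto
    qed
    also have "\<dots> = L * norm (y - z) * norm v" by (simp add: L_def)
    finally show ?thesis .
  qed
  \<comment> \<open>Within this radius \<open>A y\<close> differs from \<open>A x\<close> by at most
    \<open>c / 2\<close> in operator norm, leaving the lower bound \<open>c / 2\<close>.\<close>
  define r where "r = min (min r1 r2) (c / (2 * (L + 1)))"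
  have r: "r > 0" "r \<le> r1" "r \<le> r2" using 1(1) 2(1) c(1) L by (auto simp: r_def)
  have Lr: "L * r \<le> c / 2"
  proof -
    have "r \<le> c / (2 * (L + 1))" by (simp add: r_def)
    then have "r * (2 * (L + 1)) \<le> c" using L by (subst (asm) pos_le_divide_eq) auto
    then show ?thesis using r(1) by (simp add: algebra_simps)
  qed
  have below: "c / 2 * norm v \<le> norm (A y v)" if y: "y \<in> S \<inter> ball x r" for y v
  proof -
    have "norm (A x v - A y v) \<le> L * norm (x - y) * norm v" using y x r by (intro AA) auto
    also have "\<dots> \<le> L * r * norm v"
      using y L by (intro mult_right_mono mult_left_mono) (auto simp: dist_norm)
    also have "\<dots> \<le> c / 2 * norm v" using Lr by (intro mult_right_mono) auto
    finally have "norm (A x v - A y v) \<le> c / 2 * norm v" .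
    then show ?thesis using c(2)[of v] norm_triangle_ineq2[of "A x v" "A y v"] by linarith
  qed
  define B where "B = norm (\<beta> x) + L2 * r"
  have \<beta>B: "norm (\<beta> y) \<le> B" if y: "y \<in> S \<inter> ball x r" for y
  proof -
    have "norm (\<beta> y - \<beta> x) \<le> L2 * norm (y - x)" using y x r by (intro 2(3)) auto
    also have "\<dots> \<le> L2 * r" using y 2(2) by (intro mult_left_mono) (auto simp: dist_norm norm_minus_commute)
    finally show ?thesis using norm_triangle_ineq2[of "\<beta> y" "\<beta> x"] by (simp add: B_def)
  qed
  have XB: "norm (X y) \<le> 2 * B / c" if y: "y \<in> S \<inter> ball x r" for y
    using below[OF y, of "X y"] \<beta>B[OF y] X[of y] y c(1) by (simp add: field_simps)
  define K where "K = 2 / c * (L2 + L * (2 * B / c))"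
  have B0: "0 \<le> B" using 2(2) r(1) by (simp add: B_def)
  have "norm (X y - X z) \<le> K * norm (y - z)" if y: "y \<in> S \<inter> ball x r" and z: "z \<in> S \<inter> ball x r" for y z
  proof -
    \<comment> \<open>Subtracting the two systems and adding the mixed term \<open>A y (X z)\<close>
      separates the variation of the right-hand side from that of the coefficients.\<close>
    have "A y (X y - X z) = (\<beta> y - \<beta> z) - (A y (X z) - A z (X z))"
      using X[of y] X[of z] y z by (simp add: linear_diff[OF lin])
    then have "c / 2 * norm (X y - X z) \<le> norm (\<beta> y - \<beta> z) + norm (A y (X z) - A z (X z))"
      using below[OF y, of "X y - X z"] norm_triangle_ineq4[of "\<beta> y - \<beta> z" "A y (X z) - A z (X z)"] by simp
    also have "\<dots> \<le> L2 * norm (y - z) + L * norm (y - z) * (2 * B / c)"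
    proof (rule add_mono)
      show "norm (\<beta> y - \<beta> z) \<le> L2 * norm (y - z)" using y z r by (intro 2(3)) auto
      have "norm (A y (X z) - A z (X z)) \<le> L * norm (y - z) * norm (X z)" using y z r by (intro AA) auto
      also have "\<dots> \<le> L * norm (y - z) * (2 * B / c)" using XB[OF z] L by (intro mult_left_mono) auto
      finally show "norm (A y (X z) - A z (X z)) \<le> L * norm (y - z) * (2 * B / c)" .
    qed
    also have "\<dots> = c / 2 * (K * norm (y - z))" using c(1) by (simp add: K_def algebra_simps)
    finally show ?thesis using c(1) by simp
  qed
  moreover have "K \<ge> 0" using c(1) 2(2) L B0 by (simp add: K_def)
  ultimately show "\<exists>r>0. \<exists>L\<ge>0. \<forall>y\<in>S \<inter> ball x r. \<forall>z\<in>S \<inter> ball x r. norm (X y - X z) \<le> L * norm (y - z)"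
    using r(1) by blast
qed

lemma loc_lip_continuous_on:
  assumes "loc_lip S f"
  shows "continuous_on S f"
  unfolding continuous_on_iff
proof (intro ballI allI impI)
  fix x and e :: real assume x: "x \<in> S" and e: "e > 0"
  obtain r L where r: "r > 0" "L \<ge> 0" "\<And>y z. y\<in>S \<inter> ball x r \<Longrightarrow> z\<in>S \<inter> ball x r \<Longrightarrow> norm (f y - f z) \<le> L * norm (y - z)"
    using assms x unfolding loc_lip_def by meson
  show "\<exists>d>0. \<forall>y\<in>S. dist y x < d \<longrightarrow> dist (f y) (f x) < e"
  proof (intro exI[of _ "min r (e / (L + 1))"] conjI ballI impI)
    fix y assume y: "y \<in> S" "dist y x < min r (e / (L + 1))"
    have "norm (f y - f x) \<le> L * norm (y - x)" using y x r by (intro r(3)) (auto simp: dist_commute)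
    also have "\<dots> \<le> (L + 1) * dist y x" by (simp add: dist_norm algebra_simps)
    also have "\<dots> < e"
    proof -
      have "dist y x < e / (L + 1)" using y(2) by simp
      then have "dist y x * (L + 1) < e" using r(2) by (subst (asm) pos_less_divide_eq) auto
      then show ?thesis by (simp add: mult.commute)
    qed
    finally show "dist (f y) (f x) < e" by (simp add: dist_norm)
  qed (use r e in auto)
qed

text \<open>The set \<open>T\<close> is arbitrary, so derivatives within it need not be unique. For
  this reason \<open>B\<close> is taken from a local extension of \<open>h\<close>, and only its
  being a left inverse is asserted.\<close>

lemma left_inverse_deriv:
  fixes g :: "'d::euclidean_space \<Rightarrow> 'e::euclidean_space" and h :: "'e \<Rightarrow> 'd"
  assumes S: "hs_open b S" and g: "smooth_on S g" "g ` S \<subseteq> T" and h: "smooth_on T h" and x: "x \<in> S"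
    and hg: "\<And>y. y \<in> S \<Longrightarrow> h (g y) = y"
  shows "\<exists>B. (h has_derivative B) (at (g x) within T) \<and> (\<forall>v. B (frechet_derivative g (at x within S) v) = v)"
proof -
  have gx: "g x \<in> T" using g x by blast
  obtain U h' where U: "open U" "g x \<in> U" "\<forall>k. C_diff k U h'" "\<forall>y\<in>T. y \<in> U \<longrightarrow> h' y = h y"
    using smooth_onD[OF h gx] by blast
  let ?B = "frechet_derivative h' (at (g x))"
  have "(h' has_derivative ?B) (at (g x))" using C_diff_has_derivative U by blast
  then have B': "(h' has_derivative ?B) (at (g x) within T)" by (rule has_derivative_at_withinI)
  obtain d where d: "d > 0" "ball (g x) d \<subseteq> U" using openE[OF U(1,2)] by metis
  have B: "(h has_derivative ?B) (at (g x) within T)"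
  proof (rule has_derivative_transform_within[OF B' d(1) gx])
    fix z assume "z \<in> T" "dist z (g x) < d"
    then show "h' z = h z" using d U(4) by (auto simp: dist_commute)
  qed
  have "((\<lambda>y. h (g y)) has_derivative (\<lambda>v. ?B (frechet_derivative g (at x within S) v))) (at x within S)"
    by (rule has_derivative_in_compose[OF hs_open_has_derivative[OF S g(1) x] has_derivative_subset[OF B g(2)]])
  then have "((\<lambda>y. y) has_derivative (\<lambda>v. ?B (frechet_derivative g (at x within S) v))) (at x within S)"
    by (rule has_derivative_transform_within[OF _ zero_less_one x]) (use hg in simp)
  then have "(\<lambda>v. ?B (frechet_derivative g (at x within S) v)) = (\<lambda>v. v)"
    using hs_open_deriv_unique[OF S x] has_derivative_ident by blast
  then show ?thesis using B by (metis (no_types, lifting))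
qed

lemma left_inverse_deriv_surj:
  fixes A B :: "'e::euclidean_space \<Rightarrow> 'e"
  assumes "linear A" "\<And>v. B (A v) = v"
  shows "surj A" "A v = 0 \<longleftrightarrow> v = 0"
proof -
  have "inj A" using assms(2) by (metis injI)
  then show "surj A" using linear_injective_imp_surjective[OF assms(1)] by simp
  show "A v = 0 \<longleftrightarrow> v = 0" using assms by (metis linear_0)
qed

lemma hs_interior_min:
  fixes \<phi> :: "'e::euclidean_space \<Rightarrow> real"
  assumes S: "hs_open b S" "x \<in> S" "x \<bullet> b \<noteq> 0" and D: "(\<phi> has_derivative D) (at x within S)"
    and min: "\<And>y. y \<in> S \<Longrightarrow> \<phi> x \<le> \<phi> y"
  shows "D u = 0"
proof -
  have "x \<in> halfspace b" using hs_open_halfspace[OF S(1)] S(2) by blast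
  then have xpos: "x \<bullet> b > 0" using S(3) by (simp add: halfspace_def)
  obtain r where r: "r > 0" "ball x r \<inter> halfspace b \<subseteq> S" by (rule hs_open_ball[OF S(1,2)])
  define O' where "O' = ball x r \<inter> {y. b \<bullet> y > 0}"
  have "open O'" unfolding O'_def by (intro open_Int open_ball open_halfspace_gt)
  then have O': "open O'" "x \<in> O'" "O' \<subseteq> S"
    using r xpos by (auto simp: O'_def halfspace_def inner_commute)
  have "(\<phi> has_derivative D) (at x within O')" by (rule has_derivative_subset[OF D O'(3)])
  then have "(\<phi> has_derivative D) (at x)" using O' at_within_open by metis
  then have "D = (\<lambda>v. 0)"
    by (rule differential_zero_maxmin[OF O'(2,1)]) (use O'(3) min in blast)
  then show ?thesis by simp
qed

text \<open>Since the function is zero along the hyperplane, its derivative kills all tangent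
  directions and is determined by its value on \<open>b\<close>.\<close>

lemma hs_boundary_functional:
  fixes \<phi> :: "'e::euclidean_space \<Rightarrow> real"
  assumes S: "hs_open b S" "x \<in> S" "x \<bullet> b = 0" and D: "(\<phi> has_derivative D) (at x within S)"
    and zero: "\<And>y. y \<in> S \<Longrightarrow> y \<bullet> b = 0 \<Longrightarrow> \<phi> y = 0"
  shows "\<exists>c. \<forall>u. D u = c * (u \<bullet> b)"
proof -
  have b0: "b \<noteq> 0" using S(1) by (simp add: hs_open_def)
  have tang: "D u = 0" if u: "u \<bullet> b = 0" for u
  proof -
    obtain r where r: "r > 0" "ball x r \<inter> halfspace b \<subseteq> S" by (rule hs_open_ball[OF S(1,2)])
    define d where "d = r / (norm u + 1)"
    have d: "d > 0" using r by (simp add: d_def add_nonneg_pos)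
    have inc: "x + t *\<^sub>R u \<in> S \<and> (x + t *\<^sub>R u) \<bullet> b = 0" if t: "t \<in> {-d<..<d}" for t
    proof -
      have e0: "(x + t *\<^sub>R u) \<bullet> b = 0" using S(3) u by (simp add: inner_add_left)
      have "\<bar>t\<bar> < d" using t by auto
      then have "\<bar>t\<bar> * (norm u + 1) < r"
        unfolding d_def by (subst (asm) pos_less_divide_eq) (auto simp: add_nonneg_pos)
      moreover have "\<bar>t\<bar> * norm u \<le> \<bar>t\<bar> * (norm u + 1)" by (intro mult_left_mono) auto
      ultimately have "x + t *\<^sub>R u \<in> ball x r" by (simp add: dist_norm)
      then show ?thesis using r e0 by (auto simp: halfspace_def)
    qed
    have "((\<lambda>t. x + t *\<^sub>R u) has_vector_derivative u) (at 0)" by (auto intro!: derivative_eq_intros)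
    then have "(\<phi> \<circ> (\<lambda>t. x + t *\<^sub>R u) has_vector_derivative D u) (at 0)"
    proof (rule has_vector_derivative_chain_within[of _ _ _ "{-d<..<d}" S])
      have e: "x + 0 *\<^sub>R u = x" by simp
      show "(\<phi> has_derivative D) (at (x + 0 *\<^sub>R u) within S)" unfolding e by (rule D)
      show "(\<lambda>t. x + t *\<^sub>R u) ` {-d<..<d} \<subseteq> S" using inc by blast
    qed (use d in auto)
    moreover have "(\<phi> \<circ> (\<lambda>t. x + t *\<^sub>R u) has_vector_derivative 0) (at 0)"
    proof (rule has_vector_derivative_transform_within_open[of "\<lambda>_. 0" _ _ "{-d<..<d}"])
      show "0 = (\<phi> \<circ> (\<lambda>t. x + t *\<^sub>R u)) t" if "t \<in> {-d<..<d}" for t using zero inc[OF that] by simp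
    qed (use d in auto)
    ultimately show ?thesis using vector_derivative_unique_at by blast
  qed
  have lin: "linear D" using D has_derivative_linear by blast
  have "D u = D b / (b \<bullet> b) * (u \<bullet> b)" for u
  proof -
    define s where "s = (u \<bullet> b) / (b \<bullet> b)"
    have "(u - s *\<^sub>R b) \<bullet> b = 0" using b0 by (simp add: s_def inner_diff_left)
    then have "D (u - s *\<^sub>R b) = 0" by (rule tang)
    then have "D u = s * D b" using linear_diff[OF lin, of u "s *\<^sub>R b"] linear_cmul[OF lin, of s b] by simp
    then show ?thesis by (simp add: s_def)
  qed
  then show ?thesis by blast
qed

lemma dform_self: "dform M lam i x u u = 0"
  by (simp add: dform_def)

section \<open>The Hamiltonian flow on a Liouville domain\<close>

lemma continuous_map_from_charts:
  assumes M: "smooth_manifold M" and f: "\<And>i. i \<in> idx M \<Longrightarrow> continuous_on (coords M i) (f \<circ> param M i)"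
  shows "continuous_map (topo M) euclideanreal f"
proof (rule continuous_map_realI)
  fix p and e :: real assume p: "p \<in> topspace (topo M)" and e: "e > 0"
  obtain i where i: "i \<in> idx M" "p \<in> cdom M i"
    by (rule smooth_manifold_chart_exists[OF M, of p]) (use p in \<open>simp add: points_def\<close>)
  have h: "hchart (topo M) (nu M) (cdom M i) (chart M i)" by (rule smooth_manifold_hchart[OF M i(1)])
  have pc: "param M i (chart M i q) = q" if "q \<in> cdom M i" for q
    unfolding param_def using hchart_inj[OF h] that by simp
  have "chart M i p \<in> coords M i" using i by (simp add: coords_def)
  then obtain d where d: "d > 0" "\<forall>y\<in>coords M i. dist y (chart M i p) < d \<longrightarrow>
      dist ((f \<circ> param M i) y) ((f \<circ> param M i) (chart M i p)) < e"
    using f[OF i(1)] e unfolding continuous_on_iff by blast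
  show "\<exists>U. openin (topo M) U \<and> p \<in> U \<and> (\<forall>q\<in>U. \<bar>f q - f p\<bar> < e)"
  proof (intro exI conjI ballI)
    show "openin (topo M) {q \<in> cdom M i. chart M i q \<in> ball (chart M i p) d}"
      by (rule hchart_preimage_open[OF h]) simp
    fix q assume q: "q \<in> {q \<in> cdom M i. chart M i q \<in> ball (chart M i p) d}"
    then have "chart M i q \<in> coords M i" "dist (chart M i q) (chart M i p) < d"
      by (auto simp: coords_def dist_commute)
    then show "\<bar>f q - f p\<bar> < e" using d(2) pc q i(2) by (auto simp: dist_real_def)
  qed (use i d in auto)
qed

locale liouville_ham =
  fixes W :: "('a, 'i, 'e::euclidean_space) mfd" and lam :: "('i, 'e) form1" and H :: "'a \<Rightarrow> real"
  assumes dom: "liouville_domain W lam" and adm: "admissible W lam H"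
begin

abbreviation X :: "('i, 'e) vfield" where "X \<equiv> ham_field W lam H"

abbreviation dH :: "'i \<Rightarrow> 'e \<Rightarrow> 'e \<Rightarrow> real" where
  "dH i x \<equiv> frechet_derivative (H \<circ> param W i) (at x within coords W i)"

abbreviation om :: "'i \<Rightarrow> 'e \<Rightarrow> 'e \<Rightarrow> 'e \<Rightarrow> real" where "om \<equiv> dform W lam"

lemma smW: "smooth_manifold W" and cpW: "compact_space (topo W)" and ofW: "one_form W lam"
  using dom by (auto simp: liouville_domain_def)

lemma om_nondeg: "i \<in> idx W \<Longrightarrow> x \<in> coords W i \<Longrightarrow> (\<And>v. om i x u v = 0) \<Longrightarrow> u = 0"
  using dom by (auto simp: liouville_domain_def)

lemma hchW: "i \<in> idx W \<Longrightarrow> hchart (topo W) (nu W) (cdom W i) (chart W i)"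
  by (rule smooth_manifold_hchart[OF smW])

lemma pchW: "i \<in> idx W \<Longrightarrow> p \<in> cdom W i \<Longrightarrow> param W i (chart W i p) = p"
  unfolding param_def using hchart_inj[OF hchW] by simp

lemma chpW: "x \<in> coords W i \<Longrightarrow> chart W i (param W i x) = x"
  unfolding param_def coords_def by (rule f_inv_into_f)

lemma parW: "x \<in> coords W i \<Longrightarrow> param W i x \<in> cdom W i"
  unfolding param_def coords_def by (rule inv_into_into)

lemma coW: "p \<in> cdom W i \<Longrightarrow> chart W i p \<in> coords W i"
  by (simp add: coords_def)

lemma cdW: "i \<in> idx W \<Longrightarrow> p \<in> cdom W i \<Longrightarrow> p \<in> points W"
  using hchart_subset[OF hchW] by (auto simp: points_def)

lemma hoW: "i \<in> idx W \<Longrightarrow> hs_open (nu W) (coords W i)"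
  using hchart_hs_open[OF hchW] by (simp add: coords_def)

lemma lam_lin: "i \<in> idx W \<Longrightarrow> x \<in> coords W i \<Longrightarrow> linear (lam i x)"
  and lam_smooth: "i \<in> idx W \<Longrightarrow> smooth_on (coords W i) (\<lambda>x. lam i x u)"
  using ofW by (auto simp: one_form_def)

lemma H_smooth: "i \<in> idx W \<Longrightarrow> smooth_on (coords W i) (H \<circ> param W i)"
  and H_boundary: "p \<in> boundary W \<Longrightarrow> H p = 0"
  and tau_pos: "p \<in> points W \<Longrightarrow> tau W lam H p > 0"
  using adm by (auto simp: admissible_def smooth_fun_def)

lemma dH_deriv: "i \<in> idx W \<Longrightarrow> x \<in> coords W i \<Longrightarrow> ((H \<circ> param W i) has_derivative dH i x) (at x within coords W i)"
  by (rule hs_open_has_derivative[OF hoW H_smooth])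

lemma dH_linear: "i \<in> idx W \<Longrightarrow> x \<in> coords W i \<Longrightarrow> linear (dH i x)"
  using dH_deriv has_derivative_linear by blast

lemma om_linear:
  assumes i: "i \<in> idx W" and x: "x \<in> coords W i"
  shows "linear (\<lambda>u. om i x u v)" "linear (om i x u)"
proof -
  have 1: "linear (\<lambda>w. frechet_derivative (\<lambda>y. lam i y w) (at x within coords W i) z)" for z
    by (rule form_frechet_linear[OF hoW[OF i] x lam_lin[OF i] lam_smooth[OF i]])
  have 2: "linear (frechet_derivative (\<lambda>y. lam i y w) (at x within coords W i))" for w
    using hs_open_has_derivative[OF hoW[OF i] lam_smooth[OF i] x] has_derivative_linear by blast
  show "linear (\<lambda>u. om i x u v)" "linear (om i x u)"
    unfolding dform_def by (intro linear_compose_sub 1 2)+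
qed

lemma X_exists: "i \<in> idx W \<Longrightarrow> x \<in> coords W i \<Longrightarrow> \<exists>!v. \<forall>u. om i x v u = dH i x u"
  by (rule nondegenerate_solve[OF om_linear om_nondeg dH_linear])

lemma X_eq: "i \<in> idx W \<Longrightarrow> x \<in> coords W i \<Longrightarrow> om i x (X i x) u = dH i x u"
  using theI'[OF X_exists] unfolding ham_field_def by blast

lemma X_unique: "i \<in> idx W \<Longrightarrow> x \<in> coords W i \<Longrightarrow> (\<And>u. om i x v u = dH i x u) \<Longrightarrow> v = X i x"
  using X_exists X_eq by blast

lemma X_loc_lip:
  assumes i: "i \<in> idx W"
  shows "loc_lip (coords W i) (X i)"
\<comment> \<open>The equations \<open>om i x (X i x) b = dH i x b\<close> for \<open>b\<close> in
  \<open>Basis\<close> form a linear system whose coefficients and right-hand side are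
  smooth.\<close>
proof (rule loc_lip_solution[where A="\<lambda>x v. \<Sum>b\<in>Basis. om i x v b *\<^sub>R b" and \<beta>="\<lambda>x. \<Sum>b\<in>Basis. dH i x b *\<^sub>R b"])
  fix x assume x: "x \<in> coords W i"
  show "linear (\<lambda>v. \<Sum>b\<in>Basis. om i x v b *\<^sub>R b)"
    by (intro linear_compose_sum ballI linear_scaleR_const om_linear(1)[OF i x])
  show "(\<Sum>b\<in>Basis. om i x (X i x) b *\<^sub>R b) = (\<Sum>b\<in>Basis. dH i x b *\<^sub>R b)"
    using X_eq[OF i x] by simp
  fix v assume z: "(\<Sum>b\<in>Basis. om i x v b *\<^sub>R b) = 0"
  have b: "om i x v b = 0" if "b \<in> Basis" for b
  proof -
    have "(\<Sum>b\<in>Basis. om i x v b *\<^sub>R b) \<bullet> b = om i x v b"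
      using that by (simp add: inner_sum_left inner_Basis if_distrib sum.delta cong: if_cong)
    then show ?thesis using z by simp
  qed
  have "om i x v u = 0" for u
  proof -
    have "om i x v u = om i x v (\<Sum>b\<in>Basis. (u \<bullet> b) *\<^sub>R b)" by (simp only: euclidean_representation)
    also have "\<dots> = 0" using b by (simp add: linear_sum[OF om_linear(2)[OF i x]] linear_cmul[OF om_linear(2)[OF i x]])
    finally show ?thesis .
  qed
  then show "v = 0" by (rule om_nondeg[OF i x])
next
  have sm: "smooth_on (coords W i) (\<lambda>x. om i x u v)" for u v
  proof -
    have "smooth_on (coords W i) (\<lambda>x. frechet_derivative (\<lambda>y. lam i y v) (at x within coords W i) u +
       (-1) *\<^sub>R frechet_derivative (\<lambda>y. lam i y u) (at x within coords W i) v)"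
      by (intro smooth_on_add smooth_on_scaleR smooth_on_const smooth_on_frechet[OF hoW[OF i] lam_smooth[OF i]])
    then show ?thesis by (simp add: dform_def)
  qed
  show "loc_lip (coords W i) (\<lambda>x. \<Sum>b'\<in>Basis. om i x b b' *\<^sub>R b')" for b
    by (intro smooth_on_loc_lip smooth_on_sum smooth_on_scaleR smooth_on_const sm)
  show "loc_lip (coords W i) (\<lambda>x. \<Sum>b\<in>Basis. dH i x b *\<^sub>R b)"
    by (intro smooth_on_loc_lip smooth_on_sum smooth_on_scaleR smooth_on_const
        smooth_on_frechet[OF hoW[OF i] H_smooth[OF i]])
qed

abbreviation tr :: "'i \<Rightarrow> 'i \<Rightarrow> 'e \<Rightarrow> 'e \<Rightarrow> 'e" where
  "tr i j x \<equiv> frechet_derivative (chart W j \<circ> param W i) (at x within chart W i ` (cdom W i \<inter> cdom W j))"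

lemma lam_compat:
  assumes "i \<in> idx W" "j \<in> idx W" "p \<in> cdom W i \<inter> cdom W j"
  shows "lam i (chart W i p) u = lam j (chart W j p) (tr i j (chart W i p) u)"
  using ofW assms unfolding one_form_def by blast

text \<open>The form and \<open>dH\<close> are natural under changes of charts. The Hamiltonian
  field is natural because it is the unique solution of an equation between them.\<close>

lemma transition:
  assumes i: "i \<in> idx W" and j: "j \<in> idx W" and p: "p \<in> cdom W i \<inter> cdom W j"
  defines "x \<equiv> chart W i p" and "A \<equiv> tr i j (chart W i p)"
  shows "surj A" "om i x u v = om j (chart W j p) (A u) (A v)" "dH i x u = dH j (chart W j p) (A u)"
    "A (X i x) = X j (chart W j p)"
proof -
  let ?S = "chart W i ` (cdom W i \<inter> cdom W j)" and ?S' = "chart W j ` (cdom W i \<inter> cdom W j)"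
  let ?g = "chart W j \<circ> param W i"
  have S: "hs_open (nu W) ?S" by (rule smooth_manifold_overlap[OF smW i j])
  have xS: "x \<in> ?S" using p by (simp add: x_def)
  have Sc: "?S \<subseteq> coords W i" by (auto simp: coords_def)
  have gx: "?g x = chart W j p" using pchW[OF i] p by (simp add: x_def)
  have g: "smooth_on ?S ?g" by (rule smooth_manifold_transition[OF smW i j])
  have gS: "?g ` ?S \<subseteq> ?S'" using pchW[OF i] by auto
  then have gS2: "?g ` ?S \<subseteq> coords W j" by (auto simp: coords_def)
  have h: "smooth_on ?S' (chart W i \<circ> param W j)"
    using smooth_manifold_transition[OF smW j i] by (simp add: Int_commute)
  have hg: "(chart W i \<circ> param W j) (?g y) = y" if "y \<in> ?S" for y
    using that pchW[OF i] pchW[OF j] by auto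
  have A: "A = frechet_derivative ?g (at x within ?S)" by (simp add: A_def x_def)
  have linA: "linear A"
    unfolding A using hs_open_has_derivative[OF S g xS] has_derivative_linear by blast
  obtain B where "\<forall>v. B (A v) = v"
    using left_inverse_deriv[OF S g gS h xS hg] unfolding A by blast
  then show sA: "surj A" using left_inverse_deriv_surj[OF linA] by blast
  have xc: "x \<in> coords W i" using xS Sc by blast
  have restr: "frechet_derivative f (at x within ?S) = frechet_derivative f (at x within coords W i)"
    if "smooth_on (coords W i) f" for f :: "'e \<Rightarrow> real"
    by (rule hs_open_frechet_Int[OF hoW[OF i] S Sc that xS])
  have lc: "lam i y u = lam j (?g y) (frechet_derivative ?g (at y within ?S) u)" if "y \<in> ?S" for y u
    using that lam_compat[OF i j] pchW[OF i] by auto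
  show om: "om i x u v = om j (chart W j p) (A u) (A v)" for u v
    using dform_pullback[OF S hoW[OF j] g gS2 xS lam_lin[OF j] lam_smooth[OF j], of "lam i" v u] lc
    unfolding dform_def restr[OF lam_smooth[OF i]] A[symmetric] gx by simp
  show dHeq: "dH i x u = dH j (chart W j p) (A u)" for u
  proof -
    have gxj: "?g x \<in> coords W j" using gS2 xS by blast
    have "((\<lambda>y. (H \<circ> param W j) (?g y)) has_derivative (\<lambda>v. dH j (?g x) (A v))) (at x within ?S)"
      unfolding A by (rule has_derivative_in_compose[OF hs_open_has_derivative[OF S g xS] has_derivative_subset[OF dH_deriv[OF j gxj] gS2]])
    then have "((H \<circ> param W i) has_derivative (\<lambda>v. dH j (?g x) (A v))) (at x within ?S)"
      by (rule has_derivative_transform_within[OF _ zero_less_one xS]) (use pchW[OF i] pchW[OF j] in auto)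
    from fun_cong[OF hs_open_frechet_eqI[OF S xS this], of u]
    show ?thesis unfolding restr[OF H_smooth[OF i]] gx .
  qed
  show "A (X i x) = X j (chart W j p)"
  proof (rule X_unique[OF j])
    show "chart W j p \<in> coords W j" using p by (simp add: coords_def)
    fix w
    \<comment> \<open>Surjectivity of \<open>A\<close> is what allows the equation in chart
      \<open>j\<close> to be tested only on transported vectors.\<close>
    obtain u where w: "w = A u" using sA by (metis surjD)
    show "om j (chart W j p) (A (X i x)) w = dH j (chart W j p) w"
      unfolding w om[symmetric] dHeq[symmetric] by (rule X_eq[OF i xc])
  qed
qed

text \<open>\<open>tau\<close> is evaluated in the chart selected by \<open>chart_at\<close>;
  covariance of \<open>lam\<close> and of the field frees it from that selection.\<close>

lemma tau_chart:
  assumes i: "i \<in> idx W" and p: "p \<in> cdom W i"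
  shows "tau W lam H p = lam i (chart W i p) (X i (chart W i p)) + H p"
proof -
  let ?j = "chart_at W p"
  have j: "?j \<in> idx W \<and> p \<in> cdom W ?j" unfolding chart_at_def by (rule someI[of _ i]) (use i p in blast)
  have pp: "p \<in> cdom W i \<inter> cdom W ?j" using j p by blast
  have "lam i (chart W i p) (X i (chart W i p)) = lam ?j (chart W ?j p) (X ?j (chart W ?j p))"
    using lam_compat[OF i conjunct1[OF j] pp] transition(4)[OF i conjunct1[OF j] pp] by simp
  then show ?thesis by (simp add: tau_def Let_def)
qed

section \<open>Consequences of the positivity of \<open>tau\<close>: \<open>H\<close> vanishes
  exactly on the boundary\<close>

lemma X_zero: "i \<in> idx W \<Longrightarrow> x \<in> coords W i \<Longrightarrow> (\<And>u. dH i x u = 0) \<Longrightarrow> X i x = 0"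
  using X_unique[of i x 0] linear_0[OF om_linear(1)] by simp

lemma H_cont: "continuous_map (topo W) euclideanreal H"
  by (rule continuous_map_from_charts[OF smW smooth_on_continuous_on[OF H_smooth]])

text \<open>At a minimum in the interior of a chart \<open>dH\<close> is zero, hence so is the
  Hamiltonian vector, and \<open>tau\<close> reduces to \<open>H p\<close>.\<close>

lemma interior_critical:
  assumes i: "i \<in> idx W" "p \<in> cdom W i" and int: "chart W i p \<bullet> nu W \<noteq> 0"
    and min: "\<And>q. q \<in> points W \<Longrightarrow> H p \<le> H q"
  shows "H p > 0"
proof -
  let ?x = "chart W i p"
  have x: "?x \<in> coords W i" by (rule coW[OF i(2)])
  have "dH i ?x u = 0" for u
  proof (rule hs_interior_min[OF hoW[OF i(1)] x int dH_deriv[OF i(1) x]])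
    fix y assume "y \<in> coords W i"
    then show "(H \<circ> param W i) ?x \<le> (H \<circ> param W i) y"
      using min[OF cdW[OF i(1) parW]] pchW[OF i] by simp
  qed
  then have "X i ?x = 0" using X_zero[OF i(1) x] by simp
  then have "tau W lam H p = H p" using tau_chart[OF i] linear_0[OF lam_lin[OF i(1) x]] by simp
  then show ?thesis using tau_pos[OF cdW[OF i]] by simp
qed

lemma H_min: assumes "p \<in> points W" shows "\<exists>p0\<in>points W. \<forall>q\<in>points W. H p0 \<le> H q"
proof -
  have "compactin euclideanreal (H ` topspace (topo W))"
    using cpW unfolding compact_space_def by (rule image_compactin[OF _ H_cont])
  then have "compact (H ` points W)" by (simp add: points_def)
  then obtain y where "y \<in> H ` points W" "\<forall>z\<in>H ` points W. y \<le> z"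
    using compact_attains_inf[of "H ` points W"] assms by blast
  then show ?thesis by blast
qed

lemma H_nonneg: assumes "p \<in> points W" shows "0 \<le> H p"
proof -
  obtain p0 where p0: "p0 \<in> points W" "\<And>q. q \<in> points W \<Longrightarrow> H p0 \<le> H q" using H_min[OF assms] by blast
  have "0 \<le> H p0"
  proof (cases "p0 \<in> boundary W")
    case False
    obtain i where i: "i \<in> idx W" "p0 \<in> cdom W i" by (rule smooth_manifold_chart_exists[OF smW p0(1)])
    then have "chart W i p0 \<bullet> nu W \<noteq> 0" using False p0(1) by (auto simp: boundary_def)
    from interior_critical[OF i this p0(2)] show ?thesis by simp
  qed (simp add: H_boundary)
  then show ?thesis using p0(2)[OF assms] by simp
qed

text \<open>\<open>boundary\<close> asks for the hyperplane in some chart. A zero of the nonnegative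
  \<open>H\<close> is a minimum, so it lies on the hyperplane in every chart around it.\<close>

lemma boundary_chart: assumes "i \<in> idx W" "p \<in> cdom W i" "H p = 0" shows "chart W i p \<bullet> nu W = 0"
  using interior_critical[OF assms(1,2)] H_nonneg assms(3) by fastforce

lemma boundary_iff: assumes p: "p \<in> points W" shows "p \<in> boundary W \<longleftrightarrow> H p = 0"
proof
  assume H0: "H p = 0"
  obtain i where i: "i \<in> idx W" "p \<in> cdom W i" by (rule smooth_manifold_chart_exists[OF smW p])
  then show "p \<in> boundary W" using boundary_chart[OF i H0] p by (auto simp: boundary_def)
qed (rule H_boundary)

text \<open>If \<open>c\<close> were 0, the Hamiltonian vector and with it \<open>tau\<close> would
  vanish. Tangency then follows by inserting the Hamiltonian vector into \<open>dH\<close>, which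
  gives \<open>om (X) (X) = 0\<close>.\<close>

lemma dH_boundary:
  assumes i: "i \<in> idx W" and x: "x \<in> coords W i" "x \<bullet> nu W = 0"
  shows "\<exists>c\<noteq>0. \<forall>u. dH i x u = c * (u \<bullet> nu W)" "X i x \<bullet> nu W = 0"
proof -
  let ?b = "nu W"
  have b0: "?b \<noteq> 0" using hoW[OF i] by (simp add: hs_open_def)
  have bd: "param W i y \<in> boundary W" if "y \<in> coords W i" "y \<bullet> ?b = 0" for y
    using cdW[OF i parW[OF that(1)]] i parW[OF that(1)] chpW[OF that(1)] that(2) unfolding boundary_def by auto
  obtain c where c: "\<And>u. dH i x u = c * (u \<bullet> ?b)"
    using hs_boundary_functional[OF hoW[OF i] x dH_deriv[OF i x(1)]] bd H_boundary by (metis o_apply)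
  have c0: "c \<noteq> 0"
  proof
    assume "c = 0"
    then have "X i x = 0" using c by (intro X_zero[OF i x(1)]) simp
    moreover have "tau W lam H (param W i x) = lam i x (X i x) + 0"
      using tau_chart[OF i parW[OF x(1)]] chpW[OF x(1)] bd[OF x] H_boundary by simp
    ultimately have "tau W lam H (param W i x) = 0" using linear_0[OF lam_lin[OF i x(1)]] by simp
    then show False using tau_pos[OF cdW[OF i parW[OF x(1)]]] by simp
  qed
  show "\<exists>c\<noteq>0. \<forall>u. dH i x u = c * (u \<bullet> nu W)" using c c0 by blast
  have "c * (X i x \<bullet> ?b) = om i x (X i x) (X i x)" using X_eq[OF i x(1)] c by metis
  then show "X i x \<bullet> nu W = 0" using c0 by (simp add: dform_self)
qed

sublocale manifold_field W X
proof
  show "smooth_manifold W" "compact_space (topo W)" by (rule smW cpW)+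
  show "tr i j (chart W i p) (X i (chart W i p)) = X j (chart W j p)"
    if "i \<in> idx W" "j \<in> idx W" "p \<in> cdom W i \<inter> cdom W j" for i j p
    by (rule transition(4)[OF that])
  show "loc_lip (coords W i) (X i)" if "i \<in> idx W" for i by (rule X_loc_lip[OF that])
  show "X i x \<bullet> nu W = 0" if "i \<in> idx W" "x \<in> coords W i" "x \<bullet> nu W = 0" for i x
    by (rule dH_boundary(2)[OF that])
qed

section \<open>Continuity of \<open>tau\<close> and conservation of \<open>H\<close> along the
  flow\<close>

lemma tau_cont: "continuous_map (topo W) euclideanreal (tau W lam H)"
proof (rule continuous_map_from_charts[OF smW])
  fix i assume i: "i \<in> idx W"
  have exp: "lam i x v = (\<Sum>b\<in>Basis. (v \<bullet> b) * lam i x b)" if "x \<in> coords W i" for x v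
  proof -
    have "lam i x v = lam i x (\<Sum>b\<in>Basis. (v \<bullet> b) *\<^sub>R b)" by (simp only: euclidean_representation)
    also have "\<dots> = (\<Sum>b\<in>Basis. (v \<bullet> b) * lam i x b)"
      by (simp only: linear_sum[OF lam_lin[OF i that]] linear_cmul[OF lam_lin[OF i that]] real_scaleR_def)
    finally show ?thesis .
  qed
  have "continuous_on (coords W i) (\<lambda>x. (\<Sum>b\<in>Basis. (X i x \<bullet> b) * lam i x b) + (H \<circ> param W i) x)"
    by (intro continuous_intros loc_lip_continuous_on[OF X_loc_lip[OF i]] smooth_on_continuous_on[OF lam_smooth[OF i]]
        smooth_on_continuous_on[OF H_smooth[OF i]])
  then show "continuous_on (coords W i) (tau W lam H \<circ> param W i)"
  proof (rule continuous_on_eq)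
    fix x assume x: "x \<in> coords W i"
    show "(\<Sum>b\<in>Basis. (X i x \<bullet> b) * lam i x b) + (H \<circ> param W i) x = (tau W lam H \<circ> param W i) x"
      using tau_chart[OF i parW[OF x]] chpW[OF x] exp[OF x, of "X i x"] by simp
  qed
qed

lemma H_curve_deriv:
  assumes c: "continuous_map euclideanreal (topo W) c" and i: "i \<in> idx W" "c t \<in> cdom W i"
    and v: "((chart W i \<circ> c) has_vector_derivative v) (at t)"
  shows "((\<lambda>t. H (c t)) has_real_derivative dH i (chart W i (c t)) v) (at t)"
proof -
  have "\<forall>t\<in>UNIV. \<forall>V. openin (topo W) V \<longrightarrow> c t \<in> V \<longrightarrow> (\<exists>e>0. \<forall>s. \<bar>s - t\<bar> < e \<longrightarrow> s \<in> UNIV \<and> c s \<in> V)"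
    using c curve_cont_iff[of UNIV "topo W" c] by simp
  from this[rule_format, OF UNIV_I hchart_openin[OF hchW[OF i(1)]] i(2)]
  obtain e where e: "e > 0" "\<And>s. \<bar>s - t\<bar> < e \<Longrightarrow> c s \<in> cdom W i" by blast
  have eb: "c s \<in> cdom W i" if "s \<in> ball t e" for s
    by (rule e(2)) (use that in \<open>simp add: dist_real_def abs_minus_commute\<close>)
  have "((H \<circ> param W i) \<circ> (chart W i \<circ> c) has_vector_derivative dH i (chart W i (c t)) v) (at t)"
  proof (rule has_vector_derivative_chain_within[OF v, of "ball t e" "coords W i"])
    show "((H \<circ> param W i) has_derivative dH i (chart W i (c t))) (at ((chart W i \<circ> c) t) within coords W i)"
      unfolding o_apply[of "chart W i" c] by (rule dH_deriv[OF i(1) coW[OF i(2)]])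
    show "(chart W i \<circ> c) ` ball t e \<subseteq> coords W i" using eb coW by fastforce
  qed (use e(1) in auto)
  then have "((\<lambda>t. H (c t)) has_vector_derivative dH i (chart W i (c t)) v) (at t)"
  proof (rule has_vector_derivative_transform_within_open[of _ _ _ "ball t e"])
    fix s assume "s \<in> ball t e"
    from pchW[OF i(1) eb[OF this]] show "((H \<circ> param W i) \<circ> (chart W i \<circ> c)) s = H (c s)" by simp
  qed (use e(1) in auto)
  then show ?thesis by (simp add: has_real_derivative_iff_has_vector_derivative)
qed

text \<open>Conservation of energy. It makes the boundary of \<open>W\<close>, and later the
  hypersurface \<open>F = 0\<close>, invariant.\<close>

lemma H_phi: assumes p: "p \<in> points W" shows "H (phi t p) = H p"
proof -
  have "((\<lambda>t. H (phi t p)) has_real_derivative 0) (at t)" for t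
  proof -
    obtain i where i: "i \<in> idx W" "phi t p \<in> cdom W i" by (rule smooth_manifold_chart_exists[OF smW phi_in[OF p]])
    have c: "continuous_map euclideanreal (topo W) (\<lambda>t. phi t p)"
      "((chart W i \<circ> (\<lambda>t. phi t p)) has_vector_derivative X i (chart W i (phi t p))) (at t)"
      using phi_curve[OF p] i by (auto simp: icurve_def)
    have "dH i (chart W i (phi t p)) (X i (chart W i (phi t p))) = 0"
      using X_eq[OF i(1) coW[OF i(2)]] dform_self by metis
    then show ?thesis using H_curve_deriv[OF c(1) i c(2)] by simp
  qed
  then have "H (phi t p) = H (phi 0 p)" by (intro DERIV_isconst_all) auto
  then show ?thesis using phi_0[OF p] by simp
qed

lemma ham_entropy_phi: "ham_entropy W lam H = top_entropy (topo W) (phi 1)"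
  unfolding ham_entropy_def ham_time1_def
  by (rule top_entropy_cong) (use flow_map_phi phi_in in \<open>auto simp: points_def\<close>)

end


section \<open>Reeb vector fields as rescaled Hamiltonian vector fields\<close>

text \<open>\<open>A\<close> is the derivative of a change of charts and \<open>Y\<close> the
  Hamiltonian vector of the function with differential \<open>F\<close>. Restricted to the kernel of
  \<open>F\<close>, the form is degenerate exactly along \<open>Y\<close>, and \<open>l\<close>
  fixes the multiple. With \<open>A\<close> the identity it serves \<open>W\<close>, with
  \<open>A\<close> general it serves the tube.\<close>

lemma reeb_vector:
  fixes A :: "'e::euclidean_space \<Rightarrow> 'e" and \<omega> :: "'e \<Rightarrow> 'e \<Rightarrow> real"
  assumes A: "linear A" "surj A" "inj A"
    and \<omega>: "\<And>v. linear (\<lambda>u. \<omega> u v)" "\<And>u. linear (\<omega> u)" "\<And>u. \<omega> u u = 0" "\<And>u. (\<And>v. \<omega> u v = 0) \<Longrightarrow> u = 0"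
    and Y: "\<And>u. \<omega> Y u = F u" and l: "linear l" "l Y = \<tau>" "\<tau> > 0"
    and c: "c \<noteq> 0" "\<And>u. F (A u) = c * (u \<bullet> b)" and b: "b \<noteq> 0"
  shows "A (THE v. v \<bullet> b = 0 \<and> l (A v) = 1 \<and> (\<forall>u. u \<bullet> b = 0 \<longrightarrow> \<omega> (A v) (A u) = 0)) = inverse \<tau> *\<^sub>R Y"
proof -
  obtain v0 where v0: "A v0 = inverse \<tau> *\<^sub>R Y" using A(2) by (metis surjD)
  have om0: "\<omega> (A v0) w = inverse \<tau> * F w" for w
    unfolding v0 using linear_cmul[OF \<omega>(1), of "inverse \<tau>" Y w] Y by simp
  have v0b: "v0 \<bullet> b = 0"
  proof -
    have "c * (v0 \<bullet> b) = F (A v0)" using c(2) by simp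
    also have "\<dots> = \<omega> Y (inverse \<tau> *\<^sub>R Y)" unfolding v0 Y ..
    also have "\<dots> = inverse \<tau> *\<^sub>R \<omega> Y Y" by (rule linear_cmul[OF \<omega>(2)])
    finally show ?thesis using \<omega>(3) c(1) by simp
  qed
  have P: "v0 \<bullet> b = 0 \<and> l (A v0) = 1 \<and> (\<forall>u. u \<bullet> b = 0 \<longrightarrow> \<omega> (A v0) (A u) = 0)"
    using v0b om0 c(2) l by (simp add: v0 linear_cmul[OF l(1)])
  have uniq: "v = v0" if v: "v \<bullet> b = 0 \<and> l (A v) = 1 \<and> (\<forall>u. u \<bullet> b = 0 \<longrightarrow> \<omega> (A v) (A u) = 0)" for v
  proof -
    have Fb: "F (A b) \<noteq> 0" using c b by simp
    \<comment> \<open>A covector that vanishes on the hyperplane is a multiple of \<open>F\<close>;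
      the multiple is read off on \<open>b\<close>, which is transverse to the hyperplane.\<close>
    define k where "k = \<omega> (A v) (A b) / F (A b)"
    have kF: "\<omega> (A v) w = k * F w" for w
    proof -
      obtain u where w: "w = A u" using A(2) by (metis surjD)
      define s where "s = (u \<bullet> b) / (b \<bullet> b)"
      define u0 where "u0 = u - s *\<^sub>R b"
      have "u0 \<bullet> b = 0" using b by (simp add: u0_def s_def inner_diff_left)
      then have "\<omega> (A v) (A u0) = 0" using v by blast
      moreover have "A u = A u0 + s *\<^sub>R A b"
        using linear_add[OF A(1), of u0 "s *\<^sub>R b"] linear_cmul[OF A(1), of s b] by (simp add: u0_def)
      ultimately have "\<omega> (A v) (A u) = s * \<omega> (A v) (A b)"
        by (simp add: linear_add[OF \<omega>(2)] linear_cmul[OF \<omega>(2)])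
      also have "\<dots> = k * (s * F (A b))" using Fb by (simp add: k_def)
      also have "s * F (A b) = F (A u)" using b by (simp add: c(2) s_def)
      finally show ?thesis by (simp add: w)
    qed
    have "\<omega> (A v - k *\<^sub>R Y) w = 0" for w
      using linear_diff[OF \<omega>(1), of "A v" "k *\<^sub>R Y" w] linear_cmul[OF \<omega>(1), of k Y w] kF Y by simp
    then have "A v - k *\<^sub>R Y = 0" by (rule \<omega>(4))
    then have Av: "A v = k *\<^sub>R Y" by simp
    then have "k * \<tau> = 1" using v linear_cmul[OF l(1), of k Y] l(2) by simp
    then have "k = inverse \<tau>" using l(3) by (simp add: field_simps)
    then have "A v = A v0" using Av v0 by simp
    then show ?thesis using A(3) by (simp add: inj_eq)
  qed
  have "(THE v. v \<bullet> b = 0 \<and> l (A v) = 1 \<and> (\<forall>u. u \<bullet> b = 0 \<longrightarrow> \<omega> (A v) (A u) = 0)) = v0"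
    by (rule the_equality, rule P, erule uniq)
  then show ?thesis using v0 by simp
qed

text \<open>The lower bound on the derivative makes \<open>s\<close> a bijection of the line with a
  Lipschitz inverse; this supplies the continuity that the derivative rule for inverse functions
  asks for.\<close>

lemma real_clock_inverse:
  fixes s g :: "real \<Rightarrow> real"
  assumes der: "\<And>t. (s has_real_derivative g t) (at t)" and a: "a > 0" "\<And>t. a \<le> g t" and s0: "s 0 = 0"
  shows "\<exists>r. (\<forall>t. r (s t) = t) \<and> (\<forall>x. s (r x) = x) \<and> (\<forall>x. (r has_real_derivative inverse (g (r x))) (at x))"
proof -
  have diff: "a * (t' - t) \<le> s t' - s t" if le: "t \<le> t'" for t t'
  proof (cases "t = t'")
    case False
    then have "t < t'" using le by simp
    then obtain u where "s t' - s t = (t' - t) * g u" using MVT2[of t t' s g] der by blast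
    then show ?thesis using mult_right_mono[OF a(2)[of u], of "t' - t"] le by (simp add: mult.commute)
  qed simp
  have adiff: "a * \<bar>t' - t\<bar> \<le> \<bar>s t' - s t\<bar>" for t t'
    using diff[of t t'] diff[of t' t] mult_nonneg_nonneg[of a "t' - t"] mult_nonneg_nonneg[of a "t - t'"] a(1)
    by (cases "t \<le> t'") (auto simp: abs_if)
  have inj: "t = t'" if "s t = s t'" for t t'
    using adiff[of t' t] that a(1) by (simp add: mult_le_0_iff)
  have "\<exists>t. s t = x" for x
  proof -
    define b where "b = \<bar>x\<bar> / a"
    have b: "0 \<le> b" "a * b = \<bar>x\<bar>" using a(1) by (auto simp: b_def)
    have "\<exists>t\<ge>-b. t \<le> b \<and> s t = x"
    proof (rule IVT')
      show "s (-b) \<le> x" using diff[of "-b" 0] b s0 by simp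
      show "x \<le> s b" using diff[of 0 b] b s0 by simp
      show "continuous_on {-b..b} s" using der by (intro continuous_at_imp_continuous_on) (auto intro: DERIV_isCont)
    qed (use b in simp)
    then show ?thesis by blast
  qed
  then obtain r where r: "\<And>x. s (r x) = x" by metis
  have rs: "r (s t) = t" for t using inj r by blast
  have "isCont r x" for x
    unfolding continuous_at_eps_delta
  proof (intro allI impI)
    fix e :: real assume e: "e > 0"
    show "\<exists>d>0. \<forall>y. dist y x < d \<longrightarrow> dist (r y) (r x) < e"
    proof (intro exI[of _ "a * e"] conjI allI impI)
      fix y assume "dist y x < a * e"
      then have "a * \<bar>r y - r x\<bar> < a * e" using adiff[of "r y" "r x"] r by (simp add: dist_real_def)
      then show "dist (r y) (r x) < e" using a(1) by (simp add: dist_real_def)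
    qed (use a e in auto)
  qed
  then have "(r has_real_derivative inverse (g (r x))) (at x)" for x
    by (intro DERIV_inverse_function[where f=s and a="x - 1" and b="x + 1"])
      (use der a r less_le_trans[OF a(1) a(2)] in \<open>auto simp: less_imp_neq[symmetric]\<close>)
  then show ?thesis using r rs by blast
qed

context liouville_ham
begin

abbreviation tauW :: "'a \<Rightarrow> real" where "tauW \<equiv> tau W lam H"

text \<open>For the uniqueness of Reeb curves: \<open>tau\<close> is read off along the given curve,
  so its clock \<open>s\<close> is an ordinary integral. The bound by \<open>M\<close> makes
  \<open>s\<close> run through all real times, and its inverse turns the curve into an orbit of the
  Hamiltonian flow.\<close>

lemma scaled_curve_phi:
  assumes c: "continuous_map euclideanreal (topo W) c"
    and der: "\<And>t i. i \<in> idx W \<Longrightarrow> c t \<in> cdom W i \<Longrightarrow>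
      ((chart W i \<circ> c) has_vector_derivative inverse (tauW (c t)) *\<^sub>R X i (chart W i (c t))) (at t)"
    and M: "M > 0" "\<And>p. p \<in> points W \<Longrightarrow> tauW p \<le> M"
  shows "\<exists>s. s 0 = 0 \<and> (\<forall>t. (s has_real_derivative inverse (tauW (c t))) (at t)) \<and> (\<forall>t. c t = phi (s t) (c 0))"
proof -
  have cin: "c t \<in> points W" for t
    using continuous_map_image_subset_topspace[OF c] by (auto simp: points_def)
  define g where "g t = inverse (tauW (c t))" for t
  have "continuous_on UNIV (\<lambda>t. tauW (c t))"
    using continuous_map_compose[OF c tau_cont] by (simp add: o_def)
  moreover have tp: "tauW (c t) > 0" for t by (rule tau_pos[OF cin])
  ultimately have contg: "continuous_on UNIV g"
    unfolding g_def by (intro continuous_on_inverse) (auto simp: less_imp_neq[symmetric])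
  define s where "s t = integral {0..t} g - integral {t..0} g" for t
  have ds: "(s has_real_derivative g t) (at t)" for t
    unfolding s_def by (rule antiderivative_real[OF contg])
  have s0: "s 0 = 0" by (simp add: s_def)
  have gM: "inverse M \<le> g t" for t
    unfolding g_def using tp M(2)[OF cin] by (intro le_imp_inverse_le)
  obtain r where r: "\<forall>t. r (s t) = t" "\<forall>x. s (r x) = x" "\<forall>x. (r has_real_derivative inverse (g (r x))) (at x)"
    using real_clock_inverse[of s g "inverse M", OF ds _ gM s0] M(1) by auto
  have r0: "r 0 = 0" using r(1) s0 by metis
  have "icurve W X UNIV (\<lambda>x. c (r x))"
    unfolding icurve_def
  proof (intro conjI ballI impI)
    have "isCont r x" for x using r(3) DERIV_isCont by blast
    then have "continuous_map euclideanreal euclideanreal r" by (simp add: continuous_at_imp_continuous_on)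
    from continuous_map_compose[OF this c]
    show "continuous_map (top_of_set UNIV) (topo W) (\<lambda>x. c (r x))" by (simp add: o_def)
    fix x i assume i: "i \<in> idx W" "c (r x) \<in> cdom W i"
    have "(r has_vector_derivative inverse (g (r x))) (at x)"
      using r(3) by (simp add: has_real_derivative_iff_has_vector_derivative)
    from vector_diff_chain_at[OF this der[OF i]]
    show "((chart W i \<circ> (\<lambda>x. c (r x))) has_vector_derivative X i (chart W i (c (r x)))) (at x)"
      using tp[of "r x"] by (simp add: o_def g_def)
  qed
  then have "c (r x) = phi x (c 0)" for x by (rule phi_unique) (simp add: r0)
  then have "c t = phi (s t) (c 0)" for t using r(1) by metis
  then show ?thesis using s0 ds unfolding g_def by blast
qed

lemma scaled_phi_deriv:
  assumes p: "p \<in> points W" and s: "(s has_real_derivative d) (at t)" and i: "i \<in> idx W" "phi (s t) p \<in> cdom W i"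
  shows "((chart W i \<circ> (\<lambda>t. phi (s t) p)) has_vector_derivative d *\<^sub>R X i (chart W i (phi (s t) p))) (at t)"
proof -
  have "((chart W i \<circ> (\<lambda>t. phi t p)) has_vector_derivative X i (chart W i (phi (s t) p))) (at (s t))"
    using phi_curve[OF p] i by (simp add: icurve_def)
  moreover have "(s has_vector_derivative d) (at t)" using s by (simp add: has_real_derivative_iff_has_vector_derivative)
  ultimately show ?thesis using vector_diff_chain_at[of s d t] by (simp add: o_def)
qed

lemma reeb_field_boundary:
  assumes i: "i \<in> idx W" and p: "p \<in> cdom W i" "H p = 0"
  shows "reeb_field W lam i (chart W i p) = inverse (tauW p) *\<^sub>R X i (chart W i p)"
proof -
  let ?x = "chart W i p"
  have x: "?x \<in> coords W i" by (rule coW[OF p(1)])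
  have pW: "p \<in> points W" by (rule cdW[OF i p(1)])
  have "?x \<bullet> nu W = 0" by (rule boundary_chart[OF i p])
  then obtain c where c: "c \<noteq> 0" "\<forall>u. dH i ?x u = c * (u \<bullet> nu W)" using dH_boundary(1)[OF i x] by blast
  have t: "lam i ?x (X i ?x) = tauW p" using tau_chart[OF i p(1)] p(2) by simp
  have "(\<lambda>v. v) (THE v. v \<bullet> nu W = 0 \<and> lam i ?x ((\<lambda>v. v) v) = 1 \<and>
      (\<forall>u. u \<bullet> nu W = 0 \<longrightarrow> om i ?x ((\<lambda>v. v) v) ((\<lambda>v. v) u) = 0)) = inverse (tauW p) *\<^sub>R X i ?x"
  proof (rule reeb_vector)
    show "om i ?x (X i ?x) u = dH i ?x u" for u by (rule X_eq[OF i x])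
    show "dH i ?x u = c * (u \<bullet> nu W)" for u using c(2) by blast
    show "nu W \<noteq> 0" using hoW[OF i] by (simp add: hs_open_def)
  qed (use om_linear[OF i x] om_nondeg[OF i x] dform_self lam_lin[OF i x] t tau_pos[OF pW] c(1) in
      \<open>auto simp: linear_iff inj_def surj_def\<close>)
  then show ?thesis by (simp add: reeb_field_def)
qed

lemma boundary_closed: "closedin (topo W) (boundary W)"
proof -
  have "closedin (topo W) {p \<in> topspace (topo W). H p \<in> {0}}"
    by (rule closedin_continuous_map_preimage[OF H_cont]) simp
  moreover have "{p \<in> topspace (topo W). H p \<in> {0}} = boundary W"
    using boundary_iff unfolding points_def[symmetric] by (auto simp: boundary_def)
  ultimately show ?thesis by simp
qed

lemma reeb_entropy_boundary_le:
  assumes m: "0 < m" "0 < M" "\<And>p. p \<in> points W \<Longrightarrow> m \<le> tauW p" "\<And>p. p \<in> points W \<Longrightarrow> tauW p \<le> M"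
  shows "ereal m * reeb_entropy W lam \<le> ham_entropy W lam H"
proof -
  let ?B = "subtopology (topo W) (boundary W)"
  have bW: "boundary W \<subseteq> points W" by (auto simp: boundary_def)
  have topB: "topspace ?B = boundary W" using bW by (auto simp: points_def)
  have phiB: "phi t p \<in> boundary W" if "p \<in> boundary W" for t p
    using that bW boundary_iff[of p] boundary_iff[of "phi t p"] H_phi[of p t] phi_in[of p t] by auto
  interpret B: time_change ?B phi tauW m M
  proof
    show "compact_space ?B" using closedin_compact_space[OF cpW boundary_closed] by (rule compact_space_subtopology)
    have "continuous_map (subtopology (prod_topology euclideanreal (topo W)) (UNIV \<times> boundary W)) (topo W) (\<lambda>(t, x). phi t x)"
      by (rule continuous_map_from_subtopology[OF phi_cont])
    then show "continuous_map (prod_topology euclideanreal ?B) ?B (\<lambda>(t, x). phi t x)"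
      using phiB bW by (auto simp: subtopology_Times continuous_map_in_subtopology)
    show "continuous_map ?B euclideanreal tauW" by (rule continuous_map_from_subtopology[OF tau_cont])
  qed (use m bW phi_0 phi_add topB in auto)
  have eq: "flow_map W (reeb_field W lam) (boundary W) t p = B.changed t p" if p: "p \<in> boundary W" for t p
    unfolding flow_map_def
  proof (rule the_equality)
    have pB: "p \<in> topspace ?B" and pW: "p \<in> points W" using p topB bW by auto
    have HB: "H q = 0" if "q \<in> boundary W" for q by (rule H_boundary[OF that])
    show "\<exists>c. integral_curve W (reeb_field W lam) (boundary W) c \<and> c 0 = p \<and> c t = B.changed t p"
    proof (intro exI[of _ "\<lambda>t. B.changed t p"] conjI)
      show "integral_curve W (reeb_field W lam) (boundary W) (\<lambda>t. B.changed t p)"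
        unfolding integral_curve_def
      proof (intro conjI allI ballI impI)
        show "continuous_map euclideanreal ?B (\<lambda>t. B.changed t p)" by (rule continuous_map_flow_orbit[OF B.changed_cont pB])
        fix t i assume i: "i \<in> idx W" "B.changed t p \<in> cdom W i"
        have "B.changed t p \<in> boundary W" using B.changed_in[OF pB] topB by blast
        then show "((chart W i \<circ> (\<lambda>t. B.changed t p)) has_vector_derivative reeb_field W lam i (chart W i (B.changed t p))) (at t)"
          using scaled_phi_deriv[OF pW B.inv_clock_deriv[OF pB], of i t] i reeb_field_boundary[OF i HB]
          unfolding B.changed_def by simp
      qed
      show "B.changed 0 p = p" by (rule B.changed_0[OF pB])
    qed simp
    fix q assume "\<exists>c. integral_curve W (reeb_field W lam) (boundary W) c \<and> c 0 = p \<and> c t = q"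
    then obtain c where c: "integral_curve W (reeb_field W lam) (boundary W) c" "c 0 = p" "c t = q" by blast
    have cc: "continuous_map euclideanreal ?B c" using c(1) by (simp add: integral_curve_def)
    have cB: "c t \<in> boundary W" for t using continuous_map_image_subset_topspace[OF cc] topB by auto
    have "continuous_map euclideanreal (topo W) c" using cc by (simp add: continuous_map_in_subtopology)
    moreover have "((chart W i \<circ> c) has_vector_derivative inverse (tauW (c t)) *\<^sub>R X i (chart W i (c t))) (at t)"
      if "i \<in> idx W" "c t \<in> cdom W i" for t i
      using c(1) that reeb_field_boundary[OF that HB[OF cB]] unfolding integral_curve_def by metis
    \<comment> \<open>A Reeb curve is an orbit of \<open>phi\<close> with some clock
      \<open>s\<close>, and \<open>s\<close> solves the scalar equation that characterises
      \<open>B.inv_clock\<close>.\<close>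
    ultimately obtain s where s: "s 0 = 0" "\<forall>t. (s has_real_derivative inverse (tauW (c t))) (at t)" "\<forall>t. c t = phi (s t) (c 0)"
      using scaled_curve_phi[OF _ _ m(2,4)] by blast
    have "s t = B.inv_clock t p"
      by (rule B.inv_clock_unique[where s=s, OF pB s(1)]) (use s c(2) in metis)
    then show "q = B.changed t p" using s(3) c(2,3) unfolding B.changed_def by metis
  qed
  have "reeb_entropy W lam = top_entropy ?B (B.changed 1)"
    unfolding reeb_entropy_def reeb_time1_def
    by (rule top_entropy_cong) (use eq B.changed_in topB in auto)
  then have "ereal m * reeb_entropy W lam \<le> top_entropy ?B (phi 1)" using B.entropy_changed_le by simp
  also have "\<dots> \<le> top_entropy (topo W) (phi 1)"
    by (rule top_entropy_closed_subset[OF cpW boundary_closed]) (use phi_in phiB in \<open>auto simp: points_def\<close>)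
  finally show ?thesis by (simp add: ham_entropy_phi)
qed

end


section \<open>Iterated tubes\<close>

text \<open>The standard complex structure; the differential of the radial form on the complex
  factors is \<open>Jmult u \<bullet> w\<close>.\<close>

definition Jmult :: "complex^'n::finite \<Rightarrow> complex^'n" where
  "Jmult z = (\<chi> k. \<i> * z $ k)"

lemma sum_Im_cnj:
  fixes z w :: "complex^'n::finite"
  shows "(\<Sum>k\<in>UNIV. Im (cnj (z $ k) * (w $ k))) = Jmult z \<bullet> w"
  unfolding Jmult_def inner_vec_def by (rule sum.cong) (simp_all add: inner_complex_def)

lemma sum_cmod_sq: "(\<Sum>k\<in>UNIV. (cmod (z $ k))\<^sup>2) = z \<bullet> (z :: complex^'n::finite)"
  by (simp add: inner_vec_def dot_square_norm)

lemma Jmult_linear: "linear Jmult"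
  by (intro linearI) (simp_all add: Jmult_def vec_eq_iff algebra_simps)

lemma Jmult_antisym: "Jmult z \<bullet> w = - (Jmult w \<bullet> z)"
  by (simp add: Jmult_def inner_vec_def inner_complex_def algebra_simps sum_negf[symmetric] sum_subtractf)

lemma Jmult_self: "Jmult z \<bullet> z = 0"
  using Jmult_antisym[of z z] by simp

lemma Jmult_Jmult: "Jmult (Jmult z) = - z"
  by (simp add: Jmult_def vec_eq_iff)

lemma Jmult_inner: "Jmult z \<bullet> Jmult w = z \<bullet> w"
  using Jmult_antisym[of "Jmult z" w] Jmult_antisym[of z "Jmult w"]
  by (simp add: Jmult_Jmult inner_commute)

lemma times_Cn_simps [simp]:
  "topo (times_Cn W) = prod_topology (topo W) euclidean" "idx (times_Cn W) = idx W"
  "cdom (times_Cn W) i = cdom W i \<times> UNIV"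
  "nu (times_Cn W) = (nu W, 0)"
  by (simp_all add: times_Cn_def)

lemma halfspace_times: "halfspace (b, 0) = halfspace b \<times> UNIV"
  by (auto simp: halfspace_def inner_prod_def)

lemma hs_open_times: "hs_open b S \<Longrightarrow> hs_open (b, 0) (S \<times> UNIV)"
  unfolding hs_open_def halfspace_times
  by (auto simp: openin_Times zero_prod_def)

lemma times_Cn_form_simp: "times_Cn_form lam i (x, z) (u, w) = lam i x u + 1/2 * (Jmult z \<bullet> w)"
  by (simp only: times_Cn_form_def case_prod_conv sum_Im_cnj)

text \<open>Near \<open>x\<close> a relatively open \<open>S\<close> agrees with every
  \<open>R\<close> between \<open>S\<close> and the half-space. Derivatives within a chart image are
  thus unchanged when the image is cut down to an overlap.\<close>

lemma at_within_hs_open: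
  assumes S: "hs_open b S" and R: "S \<subseteq> R" "R \<subseteq> halfspace b" and x: "x \<in> S"
  shows "at x within S = at x within R"
proof -
  obtain T where T: "open T" "S = halfspace b \<inter> T" using S unfolding hs_open_def openin_open by blast
  show ?thesis
    by (rule at_within_nhd[of x T]) (use T x R in auto)
qed

section \<open>The function \<open>F\<close> defining the tube, and its Hamiltonian field in product
  charts\<close>

locale liouville_tube = liouville_ham W lam H
  for W :: "('a, 'i, 'e::euclidean_space) mfd" and lam :: "('i, 'e) form1" and H :: "'a \<Rightarrow> real" +
  fixes N :: "'n::finite itself"
begin

abbreviation V :: "('a \<times> (complex^'n), 'i, 'e \<times> (complex^'n)) mfd" where "V \<equiv> times_Cn W"
abbreviation mu :: "('i, 'e \<times> (complex^'n)) form1" where "mu \<equiv> times_Cn_form lam"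
abbreviation S :: "('a \<times> (complex^'n)) set" where "S \<equiv> tube_set W H"
abbreviation D2 :: "'i \<Rightarrow> ('a \<times> (complex^'n)) set" where "D2 i \<equiv> cdom W i \<times> UNIV"
abbreviation T2 :: "('a \<times> (complex^'n)) topology" where "T2 \<equiv> prod_topology (topo W) euclidean"
abbreviation nu2 :: "'e \<times> (complex^'n)" where "nu2 \<equiv> (nu W, 0)"

definition F :: "'a \<times> (complex^'n) \<Rightarrow> real" where
  "F q = H (fst q) - pi * (snd q \<bullet> snd q)"

text \<open>The Hamiltonian vector of \<open>F\<close> with respect to \<open>om2\<close>, as
  \<open>XF_eq\<close> confirms; its second component generates the rotation of period 1.\<close>

definition XF :: "'i \<Rightarrow> 'e \<times> (complex^'n) \<Rightarrow> 'e \<times> (complex^'n)" where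
  "XF i y = (X i (fst y), (2 * pi) *\<^sub>R Jmult (snd y))"

definition Fc :: "'i \<Rightarrow> 'e \<times> (complex^'n) \<Rightarrow> real" where
  "Fc i y = H (param W i (fst y)) - pi * (snd y \<bullet> snd y)"

definition dF :: "'i \<Rightarrow> 'e \<times> (complex^'n) \<Rightarrow> 'e \<times> (complex^'n) \<Rightarrow> real" where
  "dF i y v = dH i (fst y) (fst v) - 2 * pi * (snd y \<bullet> snd v)"

definition om2 :: "'i \<Rightarrow> 'e \<times> (complex^'n) \<Rightarrow> 'e \<times> (complex^'n) \<Rightarrow> 'e \<times> (complex^'n) \<Rightarrow> real" where
  "om2 i y u v = om i (fst y) (fst u) (fst v) + Jmult (snd u) \<bullet> snd v"

lemma nu2_pos: "nu W \<noteq> 0" "nu2 \<noteq> 0" "norm nu2 > 0" "nu2 \<bullet> nu2 > 0"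
proof -
  show n: "nu W \<noteq> 0" using smW by (simp add: smooth_manifold_def)
  then show n2: "nu2 \<noteq> 0" by (simp add: zero_prod_def)
  show "norm nu2 > 0" using n2 by (simp only: zero_less_norm_iff not_False_eq_True)
  show "nu2 \<bullet> nu2 > 0" using n by (simp add: inner_prod_def)
qed

lemma S_iff: "q \<in> S \<longleftrightarrow> fst q \<in> points W \<and> 0 \<le> F q"
  by (cases q) (simp add: tube_set_def F_def sum_cmod_sq)

lemma S_sub: "S \<subseteq> topspace T2"
  by (auto simp: S_iff points_def)

lemma F_cont: "continuous_map T2 euclideanreal F"
proof -
  have 1: "continuous_map T2 euclideanreal (\<lambda>q. H (fst q))"
    using continuous_map_compose[OF continuous_map_fst H_cont] by (simp add: o_def)
  have "continuous_map euclidean euclideanreal (\<lambda>z::complex^'n. z \<bullet> z)"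
    by (simp add: continuous_intros)
  from continuous_map_compose[OF continuous_map_snd this]
  have 2: "continuous_map T2 euclideanreal (\<lambda>q. snd q \<bullet> snd q)" by (simp add: o_def)
  show ?thesis unfolding F_def by (intro continuous_map_diff continuous_map_real_mult 1 2) simp
qed

lemma chartV: "chart V i q = (chart W i (fst q), snd q)"
  by (cases q) (simp add: times_Cn_def)

lemma coordsV: "coords V i = coords W i \<times> UNIV"
  by (force simp: coords_def chartV image_iff)

lemma hoV: "i \<in> idx W \<Longrightarrow> hs_open nu2 (coords V i)"
  unfolding coordsV by (rule hs_open_times[OF hoW])

lemma injV: "i \<in> idx W \<Longrightarrow> inj_on (chart V i) (D2 i)"
  using hchart_inj[OF hchW] by (force simp: inj_on_def chartV)

lemma paramV:
  assumes i: "i \<in> idx W" and q: "q \<in> D2 i"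
  shows "param V i (chart V i q) = q"
  using injV[OF i] q by (simp add: param_def)

lemma hchV:
  assumes i: "i \<in> idx W"
  shows "hchart T2 nu2 (D2 i) (chart V i)"
  unfolding hchart_def
proof (intro conjI)
  show "openin T2 (D2 i)" using hchart_openin[OF hchW[OF i]] by (simp add: openin_prod_Times_iff)
  show "hs_open nu2 (chart V i ` D2 i)" using hoV[OF i] by (simp add: coords_def)
  obtain g where "homeomorphic_maps (subtopology (topo W) (cdom W i)) (top_of_set (coords W i)) (chart W i) g"
    using hchW[OF i] unfolding hchart_def homeomorphic_map_maps coords_def by blast
  moreover have "homeomorphic_maps euclidean euclidean (\<lambda>z::complex^'n. z) (\<lambda>z. z)"
    by (simp add: homeomorphic_maps_def)
  ultimately have "homeomorphic_maps (prod_topology (subtopology (topo W) (cdom W i)) (euclidean :: (complex^'n) topology))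
      (prod_topology (top_of_set (coords W i)) euclidean) (\<lambda>(x, y). (chart W i x, y)) (\<lambda>(x, y). (g x, y))"
    by (simp add: homeomorphic_maps_prod)
  then have "homeomorphic_map (prod_topology (subtopology (topo W) (cdom W i)) (euclidean :: (complex^'n) topology))
      (prod_topology (top_of_set (coords W i)) euclidean) (\<lambda>(x, y). (chart W i x, y))"
    using homeomorphic_map_maps by blast
  moreover have "prod_topology (subtopology (topo W) (cdom W i)) (euclidean :: (complex^'n) topology) = subtopology T2 (D2 i)"
    using subtopology_Times[of "topo W" "euclidean :: (complex^'n) topology" "cdom W i" UNIV] by simp
  moreover have "prod_topology (top_of_set (coords W i)) (euclidean :: (complex^'n) topology) = top_of_set (chart V i ` D2 i)"
    using subtopology_Times[of euclidean "euclidean :: (complex^'n) topology" "coords W i" UNIV] coordsV[of i]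
    by (simp add: coords_def)
  moreover have "(\<lambda>(x, y). (chart W i x, y)) = chart V i" by (auto simp: chartV)
  ultimately show "homeomorphic_map (subtopology T2 (D2 i)) (top_of_set (chart V i ` D2 i)) (chart V i)"
    by simp
qed

lemma D2_cover: assumes "fst q \<in> points W" obtains i where "i \<in> idx W" "q \<in> D2 i"
proof -
  obtain i where "i \<in> idx W" "fst q \<in> cdom W i" by (rule smooth_manifold_chart_exists[OF smW assms])
  then show ?thesis using that by (cases q) auto
qed

lemma Fc_chart: "i \<in> idx W \<Longrightarrow> q \<in> D2 i \<Longrightarrow> Fc i (chart V i q) = F q"
  using pchW by (auto simp: Fc_def F_def chartV)

lemma mu_linear: "i \<in> idx W \<Longrightarrow> y \<in> coords V i \<Longrightarrow> linear (mu i y)"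
proof -
  assume i: "i \<in> idx W" and y: "y \<in> coords V i"
  obtain x z where xz: "y = (x, z)" "x \<in> coords W i" using y by (cases y) (auto simp: coordsV)
  note l = lam_lin[OF i xz(2)]
  show ?thesis
    by (rule linearI) (auto simp: xz(1) times_Cn_form_simp linear_add[OF l] linear_cmul[OF l] inner_add_right algebra_simps)
qed

lemma mu_smooth:
  assumes i: "i \<in> idx W"
  shows "smooth_on (coords V i) (\<lambda>y. mu i y u)"
proof -
  obtain u1 w where u: "u = (u1, w)" by (cases u)
  have "bounded_linear (\<lambda>y::'e \<times> (complex^'n). 1/2 * (Jmult (snd y) \<bullet> w))"
    by (intro bounded_linear_const_mult bounded_linear_inner_left_comp
        bounded_linear_compose[OF linear_conv_bounded_linear[THEN iffD1, OF Jmult_linear]] bounded_linear_snd)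
  then have "smooth_on (coords V i) (\<lambda>y. (\<lambda>x. lam i x u1) (fst y) + 1/2 * (Jmult (snd y) \<bullet> w))"
    by (intro smooth_on_add smooth_on_compose[OF lam_smooth[OF i]] smooth_on_bounded_linear bounded_linear_fst)
      (auto simp: coordsV)
  moreover have "(\<lambda>x. lam i x u1) (fst y) + 1/2 * (Jmult (snd y) \<bullet> w) = mu i y u" for y
    by (cases y) (simp add: u times_Cn_form_simp)
  ultimately show ?thesis by simp
qed

lemma Fc_smooth:
  assumes i: "i \<in> idx W"
  shows "smooth_on (coords V i) (Fc i)"
proof -
  have "smooth_on (coords V i) (\<lambda>y. (H \<circ> param W i) (fst y) + (-pi) *\<^sub>R (\<Sum>b\<in>Basis. (snd y \<bullet> b) *\<^sub>R (snd y \<bullet> b)))"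
    by (intro smooth_on_add smooth_on_compose[OF H_smooth[OF i]] smooth_on_bounded_linear bounded_linear_fst
        smooth_on_scaleR smooth_on_sum smooth_on_const bounded_linear_inner_left_comp bounded_linear_snd)
      (auto simp: coordsV)
  moreover have "(H \<circ> param W i) (fst y) + (-pi) *\<^sub>R (\<Sum>b\<in>Basis. (snd y \<bullet> b) *\<^sub>R (snd y \<bullet> b)) = Fc i y" for y
    by (simp add: Fc_def euclidean_inner[of "snd y" "snd y"])
  ultimately show ?thesis by simp
qed

lemma Fc_deriv:
  assumes i: "i \<in> idx W" and y: "y \<in> coords V i"
  shows "(Fc i has_derivative dF i y) (at y within coords V i)"
proof -
  have fy: "fst y \<in> coords W i" using y by (auto simp: coordsV)
  have im: "fst ` coords V i \<subseteq> coords W i" by (auto simp: coordsV)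
  have "((\<lambda>y. (H \<circ> param W i) (fst y)) has_derivative (\<lambda>v. dH i (fst y) (fst v))) (at y within coords V i)"
    by (rule has_derivative_in_compose[OF has_derivative_fst[OF has_derivative_ident] has_derivative_subset[OF dH_deriv[OF i fy] im]])
  moreover have "((\<lambda>y. snd y \<bullet> snd y) has_derivative (\<lambda>v. snd y \<bullet> snd v + snd v \<bullet> snd y)) (at y within coords V i)"
    by (intro has_derivative_inner has_derivative_snd has_derivative_ident)
  ultimately have "((\<lambda>y. (H \<circ> param W i) (fst y) - pi * (snd y \<bullet> snd y)) has_derivative
      (\<lambda>v. dH i (fst y) (fst v) - pi * (snd y \<bullet> snd v + snd v \<bullet> snd y))) (at y within coords V i)"
    by (intro has_derivative_diff has_derivative_mult_right)
  then show ?thesis unfolding Fc_def dF_def by (simp add: inner_commute algebra_simps)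
qed

lemma mu_deriv:
  assumes i: "i \<in> idx W" and y: "y \<in> coords V i"
  shows "frechet_derivative (\<lambda>y. mu i y v) (at y within coords V i) u =
    frechet_derivative (\<lambda>x. lam i x (fst v)) (at (fst y) within coords W i) (fst u) + 1/2 * (Jmult (snd u) \<bullet> snd v)"
proof -
  have fy: "fst y \<in> coords W i" using y by (auto simp: coordsV)
  have im: "fst ` coords V i \<subseteq> coords W i" by (auto simp: coordsV)
  have J: "((\<lambda>y::'e \<times> (complex^'n). Jmult (snd y)) has_derivative (\<lambda>v. Jmult (snd v))) (at y within coords V i)"
    by (intro bounded_linear.has_derivative[OF linear_conv_bounded_linear[THEN iffD1, OF Jmult_linear]] has_derivative_snd has_derivative_ident)
  have L: "((\<lambda>y. (\<lambda>x. lam i x (fst v)) (fst y)) has_derivative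
      (\<lambda>u. frechet_derivative (\<lambda>x. lam i x (fst v)) (at (fst y) within coords W i) (fst u))) (at y within coords V i)"
    by (rule has_derivative_in_compose[OF has_derivative_fst[OF has_derivative_ident]
          has_derivative_subset[OF hs_open_has_derivative[OF hoW[OF i] lam_smooth[OF i] fy] im]])
  have "((\<lambda>y. lam i (fst y) (fst v) + 1/2 * (Jmult (snd y) \<bullet> snd v)) has_derivative
     (\<lambda>u. frechet_derivative (\<lambda>x. lam i x (fst v)) (at (fst y) within coords W i) (fst u) + 1/2 * (Jmult (snd u) \<bullet> snd v))) (at y within coords V i)"
    by (intro has_derivative_add has_derivative_mult_right has_derivative_inner_left J L)
  moreover have "lam i (fst y) (fst v) + 1/2 * (Jmult (snd y) \<bullet> snd v) = mu i y v" for y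
    using times_Cn_form_simp[of lam i "fst y" "snd y" "fst v" "snd v"] by simp
  ultimately have "((\<lambda>y. mu i y v) has_derivative
     (\<lambda>u. frechet_derivative (\<lambda>x. lam i x (fst v)) (at (fst y) within coords W i) (fst u) + 1/2 * (Jmult (snd u) \<bullet> snd v))) (at y within coords V i)"
    by simp
  from fun_cong[OF hs_open_frechet_eqI[OF hoV[OF i] y this], of u] show ?thesis .
qed

lemma dform_mu:
  assumes i: "i \<in> idx W" and y: "y \<in> coords V i"
  shows "dform V mu i y u v = om2 i y u v"
  unfolding dform_def om2_def mu_deriv[OF i y]
  using Jmult_antisym[of "snd v" "snd u"] by simp

lemma om2_linear:
  assumes i: "i \<in> idx W" and y: "y \<in> coords V i"
  shows "linear (\<lambda>u. om2 i y u v)" "linear (om2 i y u)"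
proof -
  have fy: "fst y \<in> coords W i" using y by (auto simp: coordsV)
  note l = om_linear[OF i fy]
  show "linear (\<lambda>u. om2 i y u v)"
    by (rule linearI) (auto simp: om2_def linear_add[OF l(1)] linear_cmul[OF l(1)] linear_add[OF Jmult_linear] linear_cmul[OF Jmult_linear] inner_add_left algebra_simps)
  show "linear (om2 i y u)"
    by (rule linearI) (auto simp: om2_def linear_add[OF l(2)] linear_cmul[OF l(2)] inner_add_right algebra_simps)
qed

lemma om2_nondeg:
  assumes i: "i \<in> idx W" and y: "y \<in> coords V i" and z: "\<And>v. om2 i y u v = 0"
  shows "u = 0"
proof -
  have fy: "fst y \<in> coords W i" using y by (auto simp: coordsV)
  have "om i (fst y) (fst u) v = 0" for v using z[of "(v, 0)"] by (simp add: om2_def)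
  then have "fst u = 0" by (rule om_nondeg[OF i fy])
  moreover have "Jmult (snd u) \<bullet> Jmult (snd u) = 0"
    using z[of "(0, Jmult (snd u))"] linear_0[OF om_linear(2)[OF i fy]] by (simp add: om2_def)
  then have "snd u = 0" by (simp add: Jmult_inner)
  ultimately show ?thesis by (simp add: prod_eq_iff)
qed

lemma XF_eq: "i \<in> idx W \<Longrightarrow> y \<in> coords V i \<Longrightarrow> om2 i y (XF i y) v = dF i y v"
  using X_eq[of i "fst y" "fst v"]
  by (auto simp: om2_def XF_def dF_def coordsV linear_cmul[OF Jmult_linear] Jmult_Jmult)

lemma mu_XF:
  assumes i: "i \<in> idx W" and q: "q \<in> D2 i" and F0: "F q = 0"
  shows "mu i (chart V i q) (XF i (chart V i q)) = tauW (fst q)"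
proof -
  have q1: "fst q \<in> cdom W i" using q by auto
  show ?thesis
    using F0 unfolding chartV XF_def times_Cn_form_simp tau_chart[OF i q1] F_def
    by (simp add: Jmult_inner)
qed

text \<open>0 is a regular value: if \<open>dF\<close> vanished, so would \<open>XF\<close> by
  nondegeneracy, and then also \<open>tau\<close>, which is the value of the primitive on
  \<open>XF\<close>.\<close>

lemma dF_nonzero:
  assumes i: "i \<in> idx W" and q: "q \<in> D2 i" and F0: "F q = 0" and z: "\<And>v. dF i (chart V i q) v = 0"
  shows False
proof -
  let ?y = "chart V i q"
  have y: "?y \<in> coords V i" using q by (auto simp: coords_def)
  have "XF i ?y = 0" by (rule om2_nondeg[OF i y]) (simp add: XF_eq[OF i y] z)
  then have "tauW (fst q) = 0" using mu_XF[OF i q F0] linear_0[OF mu_linear[OF i y]] by simp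
  moreover have "fst q \<in> points W" using q cdW[OF i] by auto
  ultimately show False using tau_pos by force
qed

section \<open>An arbitrary chart of the tube compared with the product charts\<close>

lemma tchart:
  assumes "(U, f) \<in> induced_charts V S"
  shows "hchart (subtopology T2 S) nu2 U f" "U \<subseteq> S"
proof -
  have 1: "openin (subtopology T2 S) U" "openin (top_of_set (halfspace nu2)) (f ` U)"
     "homeomorphic_map (subtopology T2 U) (top_of_set (f ` U)) f"
    using assms by (auto simp: induced_charts_def)
  show US: "U \<subseteq> S" using openin_subset[OF 1(1)] by auto
  then have "subtopology (subtopology T2 S) U = subtopology T2 U"
    by (simp add: subtopology_subtopology Int_absorb1)
  then show "hchart (subtopology T2 S) nu2 U f" using 1 nu2_pos(2) by (simp add: hchart_def hs_open_def)
qed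

text \<open>The overlap appears as \<open>Si i\<close> in the tube chart and as \<open>Ki i\<close>
  in the product chart. \<open>Si i\<close> is relatively open in a half-space, so \<open>Ai\<close>
  is a unique derivative; \<open>Ki i\<close> is an open part of the tube, which may be curved, and
  for \<open>ki\<close> only a left inverse of \<open>Ai\<close> is extracted.\<close>

context
  fixes U :: "('a \<times> (complex^'n)) set" and f :: "'a \<times> (complex^'n) \<Rightarrow> 'e \<times> (complex^'n)"
  assumes UF: "(U, f) \<in> induced_charts V S"
begin

abbreviation Si where "Si i \<equiv> f ` (U \<inter> D2 i)"
abbreviation gi where "gi i \<equiv> chart V i \<circ> inv_into U f"
abbreviation Ki where "Ki i \<equiv> chart V i ` (U \<inter> D2 i)"
abbreviation ki where "ki i \<equiv> f \<circ> param V i"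
abbreviation Ai where "Ai i y \<equiv> frechet_derivative (gi i) (at y within Si i)"

lemma finj: "inj_on f U"
  by (rule hchart_inj[OF tchart(1)[OF UF]])

lemma finv: "q \<in> U \<Longrightarrow> inv_into U f (f q) = q"
  using finj by simp

lemma Si_open: "i \<in> idx W \<Longrightarrow> hs_open nu2 (Si i)"
proof -
  assume i: "i \<in> idx W"
  have "openin (subtopology T2 S) (D2 i \<inter> S)"
    using hchart_openin[OF hchV[OF i]] by (auto simp: openin_subtopology)
  from hchart_image_open[OF tchart(1)[OF UF] this]
  have "hs_open nu2 (f ` (U \<inter> (D2 i \<inter> S)))" .
  moreover have "U \<inter> (D2 i \<inter> S) = U \<inter> D2 i" using tchart(2)[OF UF] by blast
  ultimately show "hs_open nu2 (Si i)" by simp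
qed

lemma gi_smooth: "i \<in> idx W \<Longrightarrow> smooth_on (Si i) (gi i)"
  and ki_smooth: "i \<in> idx W \<Longrightarrow> smooth_on (Ki i) (ki i)"
  using UF by (auto simp: induced_charts_def)

lemma gi_image: "gi i ` Si i \<subseteq> Ki i" "Ki i \<subseteq> coords V i"
  using finv by (auto simp: coords_def)

lemma ki_gi: "i \<in> idx W \<Longrightarrow> y \<in> Si i \<Longrightarrow> ki i (gi i y) = y"
  using finv paramV by auto

lemma gi_f: "q \<in> U \<Longrightarrow> gi i (f q) = chart V i q"
  by (simp add: finv)

lemma Ai_facts:
  assumes i: "i \<in> idx W" and y: "y \<in> Si i"
  shows "(gi i has_derivative Ai i y) (at y within Si i)" "linear (Ai i y)" "surj (Ai i y)" "inj (Ai i y)"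
    "\<exists>B. (ki i has_derivative B) (at (gi i y) within Ki i) \<and> (\<forall>v. B (Ai i y v) = v)"
proof -
  show 1: "(gi i has_derivative Ai i y) (at y within Si i)"
    by (rule hs_open_has_derivative[OF Si_open[OF i] gi_smooth[OF i] y])
  then show lin: "linear (Ai i y)" by (rule has_derivative_linear)
  show 2: "\<exists>B. (ki i has_derivative B) (at (gi i y) within Ki i) \<and> (\<forall>v. B (Ai i y v) = v)"
    by (rule left_inverse_deriv[OF Si_open[OF i] gi_smooth[OF i] gi_image(1) ki_smooth[OF i] y ki_gi[OF i]])
  then obtain B where B: "\<forall>v. B (Ai i y v) = v" by blast
  show "surj (Ai i y)" using left_inverse_deriv_surj[OF lin] B by blast
  show "inj (Ai i y)" using B by (metis injI)
qed

text \<open>\<open>induced_form\<close> computes in the product chart that \<open>chart_at\<close>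
  selects. Any other product chart gives the same value, since \<open>lam\<close> is covariant and
  the complex coordinates are common to all product charts.\<close>

lemma form_chart:
  assumes i: "i \<in> idx W" and y: "y \<in> Si i"
  shows "induced_form V mu (U, f) y u = mu i (gi i y) (Ai i y u)"
proof -
  obtain q where q: "q \<in> U" "q \<in> D2 i" "y = f q" using y by auto
  define j where "j = chart_at V q"
  have "j \<in> idx V \<and> q \<in> cdom V j"
    unfolding j_def chart_at_def by (rule someI[of _ i]) (use i q(2) in simp)
  then have j: "j \<in> idx W" "q \<in> D2 j" by simp_all
  have yj: "y \<in> Si j" using q j by auto
  define Sij where "Sij = f ` (U \<inter> D2 i \<inter> D2 j)"
  have "openin (subtopology T2 S) ((D2 i \<inter> D2 j) \<inter> S)"
    using hchart_openin[OF hchV[OF i]] hchart_openin[OF hchV[OF j(1)]] by (auto simp: openin_subtopology)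
  from hchart_image_open[OF tchart(1)[OF UF] this]
  have "hs_open nu2 (f ` (U \<inter> ((D2 i \<inter> D2 j) \<inter> S)))" .
  moreover have "U \<inter> ((D2 i \<inter> D2 j) \<inter> S) = U \<inter> D2 i \<inter> D2 j" using tchart(2)[OF UF] by blast
  ultimately have Sij: "hs_open nu2 Sij" by (simp add: Sij_def)
  have ySij: "y \<in> Sij" using q j by (auto simp: Sij_def)
  have sub: "Sij \<subseteq> Si i" "Sij \<subseteq> Si j" by (auto simp: Sij_def)
  let ?O = "chart W i ` (cdom W i \<inter> cdom W j)"
  let ?w = "fst q"
  have w: "?w \<in> cdom W i \<inter> cdom W j" using q j by auto
  have O': "hs_open (nu W) ?O" by (rule smooth_manifold_overlap[OF smW i j(1)])
  have gy: "gi i y = (chart W i ?w, snd q)" using q gi_f chartV by metis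
  have Dtr: "((chart W j \<circ> param W i) has_derivative tr i j (chart W i ?w)) (at (chart W i ?w) within ?O)"
    by (rule hs_open_has_derivative[OF O' smooth_manifold_transition[OF smW i j(1)]]) (use w in blast)
  have im: "fst ` gi i ` Sij \<subseteq> ?O"
  proof -
    have "fst (gi i (f p)) \<in> ?O" if "p \<in> U \<inter> D2 i \<inter> D2 j" for p
      using that gi_f[of p i] by (auto simp: chartV)
    then show ?thesis by (auto simp: Sij_def)
  qed
  have Dg: "(gi i has_derivative Ai i y) (at y within Sij)"
    by (rule has_derivative_subset[OF Ai_facts(1)[OF i y] sub(1)])
  have D1: "((\<lambda>y. fst (gi i y)) has_derivative (\<lambda>u. fst (Ai i y u))) (at y within Sij)" by (rule has_derivative_fst[OF Dg])
  have D2': "((\<lambda>y. snd (gi i y)) has_derivative (\<lambda>u. snd (Ai i y u))) (at y within Sij)" by (rule has_derivative_snd[OF Dg])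
  have fgy: "fst (gi i y) = chart W i ?w" using gy by simp
  have im': "(\<lambda>y. fst (gi i y)) ` Sij \<subseteq> ?O" using im by (simp add: image_image)
  have "((\<lambda>y. (chart W j \<circ> param W i) (fst (gi i y))) has_derivative (\<lambda>u. tr i j (chart W i ?w) (fst (Ai i y u)))) (at y within Sij)"
  proof (rule has_derivative_in_compose[OF D1])
    show "((chart W j \<circ> param W i) has_derivative tr i j (chart W i ?w)) (at (fst (gi i y)) within (\<lambda>y. fst (gi i y)) ` Sij)"
      unfolding fgy by (rule has_derivative_subset[OF Dtr im'])
  qed
  then have "((\<lambda>y. ((chart W j \<circ> param W i) (fst (gi i y)), snd (gi i y))) has_derivative
      (\<lambda>u. (tr i j (chart W i ?w) (fst (Ai i y u)), snd (Ai i y u)))) (at y within Sij)"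
    by (rule has_derivative_Pair[OF _ D2'])
  then have "(gi j has_derivative (\<lambda>u. (tr i j (chart W i ?w) (fst (Ai i y u)), snd (Ai i y u)))) (at y within Sij)"
  proof (rule has_derivative_transform_within[OF _ zero_less_one ySij])
    fix y' assume "y' \<in> Sij"
    then obtain p where p: "p \<in> U" "p \<in> D2 i" "y' = f p" unfolding Sij_def by blast
    then show "((chart W j \<circ> param W i) (fst (gi i y')), snd (gi i y')) = gi j y'"
      using gi_f[OF p(1), of i] gi_f[OF p(1), of j] pchW[OF i, of "fst p"] by (auto simp: chartV)
  qed
  from hs_open_frechet_eqI[OF Sij ySij this]
  have "Ai j y = (\<lambda>u. (tr i j (chart W i ?w) (fst (Ai i y u)), snd (Ai i y u)))"
    unfolding hs_open_frechet_Int[OF Si_open[OF j(1)] Sij sub(2) gi_smooth[OF j(1)] ySij] .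
  then have Aj: "Ai j y u = (tr i j (chart W i ?w) (fst (Ai i y u)), snd (Ai i y u))" by simp
  have "induced_form V mu (U, f) y u = mu j (chart V j q) (Ai j y u)"
    using q(1,3) finv by (simp add: induced_form_def Let_def j_def)
  also have "\<dots> = lam j (chart W j ?w) (tr i j (chart W i ?w) (fst (Ai i y u))) + 1/2 * (Jmult (snd q) \<bullet> snd (Ai i y u))"
    unfolding Aj chartV times_Cn_form_simp ..
  also have "\<dots> = lam i (chart W i ?w) (fst (Ai i y u)) + 1/2 * (Jmult (snd q) \<bullet> snd (Ai i y u))"
    using lam_compat[OF i j(1) w] by simp
  also have "\<dots> = mu i (gi i y) (Ai i y u)"
    unfolding gy using times_Cn_form_simp[of lam i "chart W i ?w" "snd q" "fst (Ai i y u)" "snd (Ai i y u)"] by simp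
  finally show ?thesis .
qed

lemma dform_chart:
  assumes i: "i \<in> idx W" and y: "y \<in> Si i"
  shows "dform (tube N W H) (tube_form N W lam) (U, f) y u v = om2 i (gi i y) (Ai i y u) (Ai i y v)"
proof -
  have im: "gi i ` Si i \<subseteq> coords V i" using gi_image by blast
  then have gy: "gi i y \<in> coords V i" using y by blast
  have "at y within Si i = at y within f ` U"
    by (rule at_within_hs_open[OF Si_open[OF i] _ _ y])
      (use hs_open_halfspace[OF hchart_hs_open[OF tchart(1)[OF UF]]] in auto)
  then have at: "at y within coords (tube N W H) (U, f) = at y within Si i"
    by (simp add: coords_def tube_def induced_domain_def)
  have "dform (tube N W H) (tube_form N W lam) (U, f) y u v = dform V mu i (gi i y) (Ai i y u) (Ai i y v)"
    unfolding dform_def at tube_form_def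
    by (rule dform_pullback[OF Si_open[OF i] hoV[OF i] gi_smooth[OF i] im y mu_linear[OF i] mu_smooth[OF i] form_chart[OF i]])
  then show ?thesis using dform_mu[OF i gy] by simp
qed

lemma Fgi_deriv:
  assumes i: "i \<in> idx W" and y: "y \<in> Si i"
  shows "((\<lambda>y. Fc i (gi i y)) has_derivative (\<lambda>u. dF i (gi i y) (Ai i y u))) (at y within Si i)"
proof -
  have gy: "gi i y \<in> coords V i" and im: "gi i ` Si i \<subseteq> coords V i" using gi_image y by blast+
  show ?thesis
    by (rule has_derivative_in_compose[OF Ai_facts(1)[OF i y] has_derivative_subset[OF Fc_deriv[OF i gy] im]])
qed

lemma Fgi: "i \<in> idx W \<Longrightarrow> q \<in> U \<inter> D2 i \<Longrightarrow> Fc i (gi i (f q)) = F q"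
  using gi_f Fc_chart by simp

text \<open>\<open>F\<close> is nonnegative on the tube, so a zero is a minimum of \<open>F\<close>
  in chart coordinates. Off the hyperplane its derivative would vanish there, contrary to
  regularity.\<close>

lemma F_zero_imp_boundary:
  assumes q: "q \<in> U" and F0: "F q = 0"
  shows "f q \<bullet> nu2 = 0"
proof (rule ccontr)
  assume ne: "f q \<bullet> nu2 \<noteq> 0"
  have "fst q \<in> points W" using q tchart(2)[OF UF] S_iff by blast
  then obtain i where i: "i \<in> idx W" "q \<in> D2 i" by (rule D2_cover)
  have y: "f q \<in> Si i" using q i by blast
  have "dF i (gi i (f q)) (Ai i (f q) u) = 0" for u
  proof (rule hs_interior_min[OF Si_open[OF i(1)] y ne Fgi_deriv[OF i(1) y]])
    fix y' assume "y' \<in> Si i"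
    then obtain p where p: "p \<in> U \<inter> D2 i" "y' = f p" by blast
    have "0 \<le> F p" using p tchart(2)[OF UF] S_iff by blast
    then show "Fc i (gi i (f q)) \<le> Fc i (gi i y')"
      using Fgi[OF i(1), of q] Fgi[OF i(1) p(1)] q i(2) F0 p(2) by simp
  qed
  then have "dF i (chart V i q) v = 0" for v
    using Ai_facts(3)[OF i(1) y] gi_f[OF q] by (metis surjD)
  then show False by (rule dF_nonzero[OF i F0])
qed

text \<open>Where \<open>F\<close> is positive, so is \<open>H\<close>, and a neighbourhood in the
  tube is open in Euclidean space. By invariance of domain its image under the chart is open as well
  and cannot reach the edge of the half-space.\<close>

lemma boundary_imp_F_zero:
  assumes q: "q \<in> U" and b: "f q \<bullet> nu2 = 0"
  shows "F q = 0"
proof (rule ccontr)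
  assume "F q \<noteq> 0"
  then have Fq: "F q > 0" and qW: "fst q \<in> points W" using q tchart(2)[OF UF] S_iff[of q] by force+
  obtain i where i: "i \<in> idx W" "q \<in> D2 i" using qW by (rule D2_cover)
  obtain O' where O': "openin T2 O'" "U = O' \<inter> S"
    using hchart_openin[OF tchart(1)[OF UF]] unfolding openin_subtopology by blast
  \<comment> \<open>On \<open>R\<close> the constraint \<open>0 <= F\<close> holds strictly, so
    \<open>R\<close> is open in the product and lies in \<open>U\<close>; positivity of
    \<open>H\<close> also keeps it away from the boundary of \<open>W\<close>.\<close>
  define R where "R = {p \<in> topspace T2. F p \<in> {0<..}} \<inter> O'"
  have opR: "openin T2 R"
    unfolding R_def by (intro openin_Int openin_continuous_map_preimage[OF F_cont] O'(1)) simp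
  have RU: "D2 i \<inter> R \<subseteq> U \<inter> D2 i"
    unfolding O'(2) R_def by (auto simp: S_iff points_def)
  let ?Q = "chart V i ` (D2 i \<inter> R)"
  have hsQ: "hs_open nu2 ?Q" by (rule hchart_image_open[OF hchV[OF i(1)] opR])
  have qR: "q \<in> D2 i \<inter> R"
  proof -
    have "q \<in> S" "q \<in> O'" using q O'(2) by blast+
    then have "q \<in> topspace T2" using S_sub by blast
    then have "q \<in> R" unfolding R_def using \<open>q \<in> O'\<close> Fq by (intro IntI CollectI conjI) simp_all
    then show ?thesis using i(2) by simp
  qed
  have pos: "y \<bullet> nu2 > 0" if yQ: "y \<in> ?Q" for y
  proof -
    obtain p where p: "y = chart V i p" "p \<in> D2 i \<inter> R" using yQ by (rule imageE)
    have pW: "fst p \<in> cdom W i" using p(2) by auto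
    have "F p > 0" using p(2) by (simp add: R_def)
    moreover have "0 \<le> pi * (snd p \<bullet> snd p)" by simp
    ultimately have Hp: "H (fst p) > 0" unfolding F_def by linarith
    have "chart W i (fst p) \<bullet> nu W \<noteq> 0"
    proof
      assume "chart W i (fst p) \<bullet> nu W = 0"
      then have "fst p \<in> boundary W" using i(1) pW cdW[OF i(1) pW] unfolding boundary_def by blast
      then show False using H_boundary Hp by force
    qed
    moreover have "chart W i (fst p) \<in> halfspace (nu W)" using hs_open_halfspace[OF hoW[OF i(1)]] coW[OF pW] by blast
    ultimately show ?thesis using p(1) by (simp add: chartV inner_prod_def halfspace_def)
  qed
  have opQ: "open ?Q"
  proof -
    obtain T where T: "open T" "?Q = halfspace nu2 \<inter> T" using hsQ unfolding hs_open_def openin_open by blast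
    have "?Q = {y. nu2 \<bullet> y > 0} \<inter> T"
    proof
      show "?Q \<subseteq> {y. nu2 \<bullet> y > 0} \<inter> T" using pos T(2) by (auto simp: inner_commute[of nu2])
      show "{y. nu2 \<bullet> y > 0} \<inter> T \<subseteq> ?Q" unfolding T(2) by (auto simp: halfspace_def inner_commute[of nu2])
    qed
    moreover have "open ({y. nu2 \<bullet> y > 0} \<inter> T)" by (intro open_Int open_halfspace_gt T(1))
    ultimately show ?thesis by simp
  qed
  have QK: "?Q \<subseteq> Ki i" using RU by blast
  have kp: "ki i (chart V i p) = f p" if "p \<in> U \<inter> D2 i" for p using that paramV[OF i(1)] by simp
  have "open (ki i ` ?Q)"
  proof (rule invariance_of_domain[OF _ opQ])
    show "continuous_on ?Q (ki i)" using smooth_on_continuous_on[OF ki_smooth[OF i(1)]] QK by (rule continuous_on_subset)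
    show "inj_on (ki i) ?Q"
    proof (rule inj_onI)
      fix a c assume "a \<in> ?Q" "c \<in> ?Q" and eq: "ki i a = ki i c"
      then obtain p p' where p: "p \<in> U \<inter> D2 i" "a = chart V i p" "p' \<in> U \<inter> D2 i" "c = chart V i p'" using RU by blast
      then have "f p = f p'" using eq kp by simp
      then show "a = c" using p finj by (simp add: inj_on_eq_iff)
    qed
  qed
  moreover have "f q \<in> ki i ` ?Q"
    by (rule image_eqI[OF _ imageI[OF qR]]) (rule kp[OF subsetD[OF RU qR], symmetric])
  ultimately obtain e where e: "e > 0" "ball (f q) e \<subseteq> ki i ` ?Q" using openE by metis
  have fU: "ki i ` ?Q \<subseteq> halfspace nu2"
  proof -
    have "ki i ` ?Q \<subseteq> f ` U"
    proof (intro image_subsetI)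
      fix a assume "a \<in> ?Q"
      then obtain p where "a = chart V i p" "p \<in> D2 i \<inter> R" by (rule imageE)
      then show "ki i a \<in> f ` U" using kp RU by blast
    qed
    then show ?thesis using hs_open_halfspace[OF hchart_hs_open[OF tchart(1)[OF UF]]] by blast
  qed
  note n0 = nu2_pos(3)
  \<comment> \<open>A step of length \<open>e / 2\<close> from the hyperplane in the outward
    direction: still in the ball, but outside the half-space.\<close>
  define y where "y = f q - (e / (2 * norm nu2)) *\<^sub>R nu2"
  have "dist (f q) y = e / 2" using e(1) n0 by (simp add: y_def dist_norm)
  then have "y \<in> ball (f q) e" using e(1) by simp
  then have "y \<in> halfspace nu2" using e(2) fU by blast
  then have "0 \<le> y \<bullet> nu2" by (simp add: halfspace_def)
  moreover have "y \<bullet> nu2 = - (e / (2 * norm nu2)) * (nu2 \<bullet> nu2)" using b unfolding y_def inner_diff_left by simp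
  moreover have "(e / (2 * norm nu2)) * (nu2 \<bullet> nu2) > 0" using e(1) n0 nu2_pos(4) by (intro mult_pos_pos divide_pos_pos)  simp_all
  ultimately show False by simp
qed

text \<open>In coordinates of the tube chart \<open>F\<close> vanishes on the hyperplane, so its
  differential is a nonzero multiple of the conormal, and \<open>reeb_vector\<close> applies with
  \<open>A = Ai i (f q)\<close>.\<close>

lemma reeb_chart:
  assumes i: "i \<in> idx W" and q: "q \<in> U \<inter> D2 i" and F0: "F q = 0"
  shows "Ai i (f q) (reeb_field (tube N W H) (tube_form N W lam) (U, f) (f q)) =
    inverse (tauW (fst q)) *\<^sub>R XF i (chart V i q)"
proof -
  have qU: "q \<in> U" and qD: "q \<in> D2 i" using q by auto
  have y: "f q \<in> Si i" using q by blast
  have cy: "chart V i q \<in> coords V i" using qD by (auto simp: coords_def)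
  have nu: "nu (tube N W H) = nu2" by (simp add: tube_def induced_domain_def)
  have "\<exists>c. \<forall>u. dF i (gi i (f q)) (Ai i (f q) u) = c * (u \<bullet> nu2)"
  proof (rule hs_boundary_functional[OF Si_open[OF i] y F_zero_imp_boundary[OF qU F0] Fgi_deriv[OF i y]])
    fix y' assume "y' \<in> Si i" "y' \<bullet> nu2 = 0"
    then obtain p where p: "p \<in> U \<inter> D2 i" "y' = f p" "f p \<bullet> nu2 = 0" by blast
    then show "Fc i (gi i y') = 0" using Fgi[OF i p(1)] boundary_imp_F_zero by simp
  qed
  then obtain c where c: "\<And>u. dF i (chart V i q) (Ai i (f q) u) = c * (u \<bullet> nu2)" unfolding gi_f[OF qU] by blast
  have c0: "c \<noteq> 0"
  proof
    assume "c = 0"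
    then have "dF i (chart V i q) v = 0" for v using c Ai_facts(3)[OF i y] by (metis mult_zero_left surjD)
    then show False by (rule dF_nonzero[OF i qD F0])
  qed
  have form: "tube_form N W lam (U, f) (f q) v = mu i (chart V i q) (Ai i (f q) v)" for v
    using form_chart[OF i y] gi_f[OF qU] by (simp add: tube_form_def)
  have "Ai i (f q) (THE v. v \<bullet> nu2 = 0 \<and> mu i (chart V i q) (Ai i (f q) v) = 1 \<and>
      (\<forall>u. u \<bullet> nu2 = 0 \<longrightarrow> om2 i (chart V i q) (Ai i (f q) v) (Ai i (f q) u) = 0)) = inverse (tauW (fst q)) *\<^sub>R XF i (chart V i q)"
  proof (rule reeb_vector[OF Ai_facts(2-4)[OF i y] om2_linear[OF i cy] _ om2_nondeg[OF i cy] XF_eq[OF i cy] mu_linear[OF i cy] mu_XF[OF i qD F0] _ c0 c])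
    show "om2 i (chart V i q) u u = 0" for u by (simp add: om2_def dform_self Jmult_self)
    show "tauW (fst q) > 0" using tau_pos cdW[OF i] qD by auto
    show "nu2 \<noteq> 0" by (rule nu2_pos)
  qed
  then show ?thesis
    unfolding reeb_field_def nu form dform_chart[OF i y] gi_f[OF qU] .
qed

end

end


section \<open>Boundary charts of the tube\<close>

lemma smooth_on_transform: "smooth_on S g \<Longrightarrow> (\<And>x. x \<in> S \<Longrightarrow> g x = f x) \<Longrightarrow> smooth_on S f"
  using smooth_on_cong by blast

text \<open>Moving each point along the fixed direction \<open>c\<close> makes \<open>\<phi>\<close>
  the normal coordinate. The conclusion is offered for all small radii because the caller shrinks
  the ball further.\<close>

lemma straighten:
  fixes \<phi> :: "'e::euclidean_space \<Rightarrow> real"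
  assumes U: "open U" "y0 \<in> U" and \<phi>: "\<And>k. C_diff k U \<phi>"
    and c: "c \<bullet> b \<noteq> 0" "frechet_derivative \<phi> (at y0) c > 0"
  shows "\<exists>r0>0. \<forall>r. 0 < r \<longrightarrow> r \<le> r0 \<longrightarrow> ball y0 r \<subseteq> U \<and> (\<exists>f g. (\<forall>k. C_diff k (ball y0 r) f) \<and>
    open (f ` ball y0 r) \<and> (\<forall>k. C_diff k (f ` ball y0 r) g) \<and>
    (\<forall>y\<in>ball y0 r. g (f y) = y) \<and> (\<forall>y\<in>ball y0 r. f y \<bullet> b = \<phi> y))"
proof -
  let ?D = "\<lambda>y. frechet_derivative \<phi> (at y)"
  have "C_diff (Suc 0) U \<phi>" by (rule \<phi>)
  then have "continuous_on U (\<lambda>y. ?D y c)" by simp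
  then have "isCont (\<lambda>y. ?D y c) y0" using U continuous_on_eq_continuous_at by blast
  then obtain d where d: "d > 0" "\<And>y. dist y y0 < d \<Longrightarrow> dist (?D y c) (?D y0 c) < ?D y0 c"
    using c(2) unfolding continuous_at_eps_delta by metis
  obtain e where e: "e > 0" "ball y0 e \<subseteq> U" using openE[OF U] by metis
  have "ball y0 r \<subseteq> U \<and> (\<exists>f g. (\<forall>k. C_diff k (ball y0 r) f) \<and>
    open (f ` ball y0 r) \<and> (\<forall>k. C_diff k (f ` ball y0 r) g) \<and>
    (\<forall>y\<in>ball y0 r. g (f y) = y) \<and> (\<forall>y\<in>ball y0 r. f y \<bullet> b = \<phi> y))" if r: "0 < r" "r \<le> min d e" for r
  proof
    let ?B = "ball y0 r"
    show BU: "?B \<subseteq> U" using e r by auto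
    have Dc: "?D y c > 0" if "y \<in> ?B" for y
    proof -
      have "dist (?D y c) (?D y0 c) < ?D y0 c" using that r by (intro d(2)) (auto simp: dist_commute)
      then show ?thesis by (simp add: dist_real_def abs_less_iff)
    qed
    have CB: "C_diff k ?B \<phi>" for k using \<phi> BU by (rule C_diff_subset)
    have D: "(\<phi> has_derivative ?D y) (at y)" if "y \<in> ?B" for y
      by (rule C_diff_has_derivative[OF \<phi> U(1)]) (use that BU in blast)
    have linD: "linear (?D y)" if "y \<in> ?B" for y using D[OF that] has_derivative_linear by blast
    define f where "f y = y + ((\<phi> y - y \<bullet> b) * inverse (c \<bullet> b)) *\<^sub>R c" for y
    have fb: "f y \<bullet> b = \<phi> y" for y using c(1) by (simp add: f_def inner_add_left mult.assoc)
    have Cf: "C_diff k ?B f" for k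
    proof -
      have "C_diff k ?B (\<lambda>y. y + ((\<phi> y + (-1) *\<^sub>R (y \<bullet> b)) *\<^sub>R inverse (c \<bullet> b)) *\<^sub>R c)"
        by (intro C_diff_add C_diff_scaleR C_diff_const CB open_ball C_diff_bounded_linear
            bounded_linear_ident bounded_linear_inner_left)
      then show ?thesis by (simp add: f_def[abs_def])
    qed
    \<comment> \<open>Two points with equal image differ by a multiple of \<open>c\<close> and have
      equal \<open>\<phi>\<close>, whereas \<open>\<phi>\<close> increases strictly along
      \<open>c\<close> inside the ball.\<close>
    have inj: "inj_on f ?B"
    proof (rule inj_onI)
      fix y y' assume y: "y \<in> ?B" "y' \<in> ?B" and eq: "f y = f y'"
      define s where "s = ((\<phi> y - y \<bullet> b) - (\<phi> y' - y' \<bullet> b)) * inverse (c \<bullet> b)"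
      have y': "y' = y + s *\<^sub>R c" using eq by (simp add: f_def s_def algebra_simps)
      have \<phi>eq: "\<phi> y = \<phi> y'" using fb[of y] fb[of y'] eq by simp
      have seg: "y + (t * s) *\<^sub>R c \<in> ?B" if "0 \<le> t" "t \<le> 1" for t
      proof -
        have "(1 - t) *\<^sub>R y + t *\<^sub>R y' \<in> ?B" using that y by (intro convexD[OF convex_ball]) auto
        then show ?thesis by (simp add: y' algebra_simps)
      qed
      have "\<exists>t>0. t < 1 \<and> \<phi> (y + (1 * s) *\<^sub>R c) - \<phi> (y + (0 * s) *\<^sub>R c) = (1 - 0) * (s * ?D (y + (t * s) *\<^sub>R c) c)"
      proof (rule MVT2[of 0 1 "\<lambda>t. \<phi> (y + (t * s) *\<^sub>R c)"], simp)
        fix t :: real assume t: "0 \<le> t" "t \<le> 1"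
        have "((\<lambda>t. y + (t * s) *\<^sub>R c) has_derivative (\<lambda>h. (h * s) *\<^sub>R c)) (at t)"
          by (auto intro!: derivative_eq_intros)
        from has_derivative_compose[OF this D[OF seg[OF t]]]
        show "((\<lambda>t. \<phi> (y + (t * s) *\<^sub>R c)) has_real_derivative s * ?D (y + (t * s) *\<^sub>R c) c) (at t)"
          by (simp add: has_field_derivative_def linear_cmul[OF linD[OF seg[OF t]]] mult_commute_abs mult.assoc mult.left_commute)
      qed
      then obtain t where t: "0 < t" "t < 1" "\<phi> y' - \<phi> y = s * ?D (y + (t * s) *\<^sub>R c) c" using y' by auto
      have "?D (y + (t * s) *\<^sub>R c) c > 0" using Dc[OF seg[of t]] t by simp
      then have "s = 0" using t(3) \<phi>eq by simp
      then show "y = y'" using y' by simp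
    qed
    have contf: "continuous_on ?B f" using C_diff_continuous_on[OF Cf] .
    let ?V = "f ` ?B"
    have V: "open ?V" by (rule invariance_of_domain[OF contf open_ball inj])
    define g where "g = inv_into ?B f"
    have gf: "g (f y) = y" if "y \<in> ?B" for y unfolding g_def using inj that by simp
    have gB: "g v \<in> ?B" and fg: "f (g v) = v" if "v \<in> ?V" for v using that gf by auto
    have contg: "continuous_on ?V g"
      by (rule continuous_on_inverse_open[OF open_ball contf]) (use gf in auto)
    \<comment> \<open>The derivative of \<open>f\<close> changes a vector only by a multiple of
      \<open>c\<close>; its inverse is of the same kind, with the multiple determined by
      \<open>?D (g v) c\<close>, which is positive.\<close>
    define g' where "g' v w = w + ((w \<bullet> b - ?D (g v) w) * inverse (?D (g v) c)) *\<^sub>R c" for v w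
    have Dg: "(g has_derivative g' v) (at v)" if v: "v \<in> ?V" for v
    proof -
      let ?y = "g v"
      have y: "?y \<in> ?B" by (rule gB[OF v])
      let ?f' = "\<lambda>w. w + ((?D ?y w - w \<bullet> b) * inverse (c \<bullet> b)) *\<^sub>R c"
      show ?thesis
      proof (rule has_derivative_inverse_basic[where f = f and T = ?V])
        show "(f has_derivative ?f') (at ?y)"
          unfolding f_def[abs_def]
          by (intro has_derivative_add has_derivative_ident has_derivative_scaleR_left has_derivative_mult_left
              has_derivative_diff D[OF y] has_derivative_inner_left)
        have "linear (g' v)"
          unfolding g'_def
          by (rule linearI) (auto simp: linear_add[OF linD[OF y]] linear_cmul[OF linD[OF y]] inner_add_left algebra_simps)
        then show "bounded_linear (g' v)" by (simp add: linear_conv_bounded_linear)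
        show "g' v \<circ> ?f' = id"
        proof
          fix w
          define \<alpha> where "\<alpha> = (?D ?y w - w \<bullet> b) * inverse (c \<bullet> b)"
          have a: "\<alpha> * (c \<bullet> b) = ?D ?y w - w \<bullet> b" using c(1) by (simp add: \<alpha>_def)
          have "(w + \<alpha> *\<^sub>R c) \<bullet> b - ?D ?y (w + \<alpha> *\<^sub>R c) = - \<alpha> * ?D ?y c"
            using a by (simp add: inner_add_left linear_add[OF linD[OF y]] linear_cmul[OF linD[OF y]])
          then have "g' v (w + \<alpha> *\<^sub>R c) = w" using Dc[OF y] by (simp add: g'_def)
          then show "(g' v \<circ> ?f') w = id w" by (simp add: \<alpha>_def)
        qed
        show "isCont g v" using contg V v continuous_on_eq_continuous_at by blast
      qed (use V v fg in auto)
    qed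
    have Cg: "C_diff k ?V g" for k
    proof (induction k)
      case 0
      then show ?case using contg by simp
    next
      \<comment> \<open>The derivative \<open>g' v\<close> depends on \<open>v\<close> only through
        \<open>g v\<close>, so \<open>k\<close> derivatives of \<open>g\<close> yield
        \<open>k\<close> derivatives of \<open>g'\<close>, one more for \<open>g\<close>.\<close>
      case (Suc k)
      have CD: "C_diff k ?V (\<lambda>v. ?D (g v) w)" for w
      proof (rule C_diff_compose[OF V open_ball _ _ Suc])
        show "g ` ?V \<subseteq> ?B" using gB by blast
        show "C_diff k ?B (\<lambda>y. ?D y w)" using CB[of "Suc k"] by simp
      qed
      show ?case
      proof (rule C_diff_SucI[OF V Dg])
        fix w
        have "C_diff k ?V (\<lambda>v. w + ((w \<bullet> b + (-1) *\<^sub>R ?D (g v) w) *\<^sub>R inverse (?D (g v) c)) *\<^sub>R c)"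
          by (intro C_diff_add C_diff_scaleR C_diff_const C_diff_inverse CD V) (use Dc[OF gB] in force)
        then show "C_diff k ?V (\<lambda>v. g' v w)" by (simp add: g'_def)
      qed
    qed
    show "\<exists>f g. (\<forall>k. C_diff k ?B f) \<and> open (f ` ?B) \<and> (\<forall>k. C_diff k (f ` ?B) g) \<and>
      (\<forall>y\<in>?B. g (f y) = y) \<and> (\<forall>y\<in>?B. f y \<bullet> b = \<phi> y)"
      using Cf V Cg gf fb by (intro exI[of _ f] exI[of _ g]) blast
  qed
  then show ?thesis using d(1) e(1) by (intro exI[of _ "min d e"]) auto
qed

context liouville_tube
begin

lemma transitionV:
  assumes i: "i \<in> idx W" and j: "j \<in> idx W"
  shows "smooth_on (chart V i ` (D2 i \<inter> D2 j)) (chart V j \<circ> param V i)"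
proof -
  have "fst ` chart V i ` (D2 i \<inter> D2 j) \<subseteq> chart W i ` (cdom W i \<inter> cdom W j)" by (auto simp: chartV)
  then have "smooth_on (chart V i ` (D2 i \<inter> D2 j)) (\<lambda>y. (chart W j \<circ> param W i) (fst y))"
    by (rule smooth_on_compose[OF smooth_manifold_transition[OF smW i j] smooth_on_bounded_linear[OF bounded_linear_fst]])
  then have "smooth_on (chart V i ` (D2 i \<inter> D2 j)) (\<lambda>y. ((chart W j \<circ> param W i) (fst y), snd y))"
    by (rule smooth_on_Pair[OF _ smooth_on_bounded_linear[OF bounded_linear_snd]])
  moreover have "((chart W j \<circ> param W i) (fst y), snd y) = (chart V j \<circ> param V i) y"
    if y: "y \<in> chart V i ` (D2 i \<inter> D2 j)" for y
  proof -
    obtain q where q: "y = chart V i q" "q \<in> D2 i \<inter> D2 j" by (rule imageE[OF y])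
    have qi: "q \<in> D2 i" using q(2) by (rule IntD1)
    have "fst q \<in> cdom W i" using qi by (simp only: mem_Times_iff)
    from pchW[OF i this] have "((chart W j \<circ> param W i) (fst y), snd y) = chart V j q" by (simp add: chartV q(1))
    then show ?thesis by (simp only: q(1) paramV[OF i qi] o_apply)
  qed
  ultimately show ?thesis by (rule smooth_on_transform)
qed

text \<open>At a point over \<open>boundary W\<close> the function \<open>F\<close> increases in the inward direction and is nonpositive on the
  boundary hyperplane. Hence near such a point the tube is the superlevel set of any smooth extension of \<open>F\<close>.\<close>

lemma superlevel_local:
  assumes i: "i \<in> idx W" and q: "q \<in> D2 i" and F0: "F q = 0"
    and U: "open U" "chart V i q \<in> U" and G: "\<And>k. C_diff k U G" "\<And>y. y \<in> coords V i \<Longrightarrow> y \<in> U \<Longrightarrow> G y = Fc i y"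
  shows "\<exists>r>0. \<forall>y\<in>ball (chart V i q) r. 0 \<le> G y \<longrightarrow> y \<in> coords V i"
proof -
  let ?y0 = "chart V i q"
  let ?D = "\<lambda>y. frechet_derivative G (at y)"
  have y0: "?y0 \<in> coords V i" using q by (auto simp: coords_def)
  have qW: "fst q \<in> cdom W i" using q by auto
  obtain r1 where r1: "r1 > 0" "ball ?y0 r1 \<inter> halfspace nu2 \<subseteq> coords V i" by (rule hs_open_ball[OF hoV[OF i] y0])
  have y0h: "?y0 \<in> halfspace nu2" using hs_open_halfspace[OF hoV[OF i]] y0 by blast
  note n0 = nu2_pos(4)
  show ?thesis
  proof (cases "?y0 \<bullet> nu2 = 0")
    case False
    then have "?y0 \<in> {y. nu2 \<bullet> y > 0}" using y0h by (auto simp: halfspace_def inner_commute[of nu2])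
    then obtain r2 where r2: "r2 > 0" "ball ?y0 r2 \<subseteq> {y. nu2 \<bullet> y > 0}" using openE[OF open_halfspace_gt] by metis
    have "y \<in> coords V i" if "y \<in> ball ?y0 (min r1 r2)" for y
    proof -
      have "y \<in> ball ?y0 r1" "y \<in> ball ?y0 r2" using that by auto
      then show ?thesis using r1(2) r2(2) by (force simp: halfspace_def inner_commute[of nu2])
    qed
    then show ?thesis using r1(1) r2(1) by (intro exI[of _ "min r1 r2"]) auto
  next
    case True
    let ?x = "chart W i (fst q)"
    have x: "?x \<in> coords W i" by (rule coW[OF qW])
    have xb: "?x \<bullet> nu W = 0" using True by (simp add: chartV inner_prod_def)
    have Hb: "H (param W i x') = 0" if "x' \<in> coords W i" "x' \<bullet> nu W = 0" for x'
    proof -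
      have "param W i x' \<in> boundary W"
        using i cdW[OF i parW[OF that(1)]] parW[OF that(1)] chpW[OF that(1)] that(2) unfolding boundary_def by auto
      then show ?thesis by (rule H_boundary)
    qed
    have "H (fst q) = 0" using Hb[OF x xb] pchW[OF i qW] by simp
    \<comment> \<open>\<open>H\<close> vanishes over the boundary, so \<open>F = 0\<close> forces
      \<open>z = 0\<close>. Moving from there along \<open>nu2\<close> leaves \<open>F\<close> equal
      to \<open>H\<close>, which is nonnegative; this decides the sign of the normal
      derivative.\<close>
    then have z0: "snd q = 0" using F0 by (simp add: F_def)
    obtain c where c: "c \<noteq> 0" "\<forall>u. dH i ?x u = c * (u \<bullet> nu W)" using dH_boundary(1)[OF i x xb] by blast
    have G1: "C_diff (Suc 0) U G" by (rule G(1))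
    have DG: "(G has_derivative ?D y) (at y)" if "y \<in> U" for y by (rule C_diff_has_derivative[OF G1 U(1) that])
    have linD: "linear (?D y)" if "y \<in> U" for y using DG[OF that] has_derivative_linear by blast
    have Dy0: "?D ?y0 = dF i ?y0"
    proof -
      have 1: "(G has_derivative ?D ?y0) (at ?y0 within coords V i)" using DG[OF U(2)] has_derivative_at_withinI by blast
      obtain d where d: "d > 0" "ball ?y0 d \<subseteq> U" using openE[OF U] by metis
      have "(Fc i has_derivative ?D ?y0) (at ?y0 within coords V i)"
      proof (rule has_derivative_transform_within[OF 1 d(1) y0])
        fix y assume "y \<in> coords V i" "dist y ?y0 < d"
        then have "y \<in> U" using subsetD[OF d(2), of y] by (simp add: dist_commute)
        then show "G y = Fc i y" by (rule G(2)[OF \<open>y \<in> coords V i\<close>])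
      qed
      then show ?thesis using hs_open_deriv_unique[OF hoV[OF i] y0] Fc_deriv[OF i y0] by blast
    qed
    have "?D ?y0 nu2 = c * (nu W \<bullet> nu W)"
      unfolding Dy0 dF_def using c(2) by (simp add: chartV)
    moreover have nW: "nu W \<bullet> nu W \<noteq> 0" using nu2_pos(1) by simp
    ultimately have ne: "?D ?y0 nu2 \<noteq> 0" using c(1) by simp
    have line: "((\<lambda>t. G (y + t *\<^sub>R nu2)) has_real_derivative ?D (y + t *\<^sub>R nu2) nu2) (at t)" if "y + t *\<^sub>R nu2 \<in> U" for y t
    proof -
      have "((\<lambda>t. y + t *\<^sub>R nu2) has_derivative (\<lambda>h. h *\<^sub>R nu2)) (at t)" by (auto intro!: derivative_eq_intros)
      from has_derivative_compose[OF this DG[OF that]] show ?thesis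
        unfolding has_field_derivative_def linear_cmul[OF linD[OF that]] by (simp add: mult_commute_abs)
    qed
    have pos: "?D ?y0 nu2 > 0"
    proof (rule ccontr)
      assume "\<not> ?D ?y0 nu2 > 0"
      then have neg: "?D ?y0 nu2 < 0" using ne by simp
      have y00: "?y0 + 0 *\<^sub>R nu2 = ?y0" by (simp only: scaleR_zero_left add_0_right)
      have "((\<lambda>t. G (?y0 + t *\<^sub>R nu2)) has_real_derivative ?D ?y0 nu2) (at 0)"
        by (rule line[of ?y0 0, unfolded y00, OF U(2)])
      from DERIV_neg_dec_right[OF this neg] obtain d where d: "d > 0" "\<forall>h>0. h < d \<longrightarrow> G (?y0 + (0 + h) *\<^sub>R nu2) < G (?y0 + 0 *\<^sub>R nu2)" by blast
      obtain e where e: "e > 0" "ball ?y0 e \<subseteq> U" using openE[OF U] by metis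
      define h where "h = min (d / 2) (min r1 e / (2 * norm nu2))"
      note nn = nu2_pos(3)
      have h: "h > 0" "h < d" using d(1) r1(1) e(1) nn by (auto simp: h_def)
      have "h * norm nu2 \<le> min r1 e / (2 * norm nu2) * norm nu2" by (intro mult_right_mono) (auto simp: h_def)
      also have "\<dots> = min r1 e / 2" using nn by simp
      also have "\<dots> < min r1 e" using r1(1) e(1) by linarith
      finally have hb: "?y0 + h *\<^sub>R nu2 \<in> ball ?y0 r1" "?y0 + h *\<^sub>R nu2 \<in> ball ?y0 e"
        using h(1) by (auto simp: dist_norm)
      have "(?y0 + h *\<^sub>R nu2) \<bullet> nu2 = h * (nu2 \<bullet> nu2)" using True by (simp add: inner_add_left)
      then have "?y0 + h *\<^sub>R nu2 \<in> halfspace nu2" using h(1) n0 by (simp add: halfspace_def)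
      then have yc: "?y0 + h *\<^sub>R nu2 \<in> coords V i" using r1(2) hb(1) by blast
      then have "G (?y0 + h *\<^sub>R nu2) = Fc i (?y0 + h *\<^sub>R nu2)" using G(2) hb(2) e(2) by blast
      also have "\<dots> = H (param W i (fst (?y0 + h *\<^sub>R nu2)))" using z0 by (simp add: Fc_def chartV)
      also have "\<dots> \<ge> 0" using yc unfolding coordsV by (intro H_nonneg cdW[OF i parW]) (simp only: mem_Times_iff)
      finally have "0 \<le> G (?y0 + h *\<^sub>R nu2)" .
      moreover have "G ?y0 = 0" using G(2)[OF y0 U(2)] Fc_chart[OF i q] F0 by simp
      moreover have "G (?y0 + h *\<^sub>R nu2) < G ?y0" using d(2)[rule_format, OF h] by (simp only: y00 add_0)
      ultimately show False by (simp only: not_less[symmetric])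
    qed
    have "continuous_on U (\<lambda>y. ?D y nu2)" using G1 by simp
    then have "isCont (\<lambda>y. ?D y nu2) ?y0" using U continuous_on_eq_continuous_at by blast
    then obtain d where d: "d > 0" "\<And>y. dist y ?y0 < d \<Longrightarrow> dist (?D y nu2) (?D ?y0 nu2) < ?D ?y0 nu2"
      using pos unfolding continuous_at_eps_delta by metis
    obtain e where e: "e > 0" "ball ?y0 e \<subseteq> U" using openE[OF U] by metis
    define r where "r = min (min d e) r1"
    have r: "r > 0" "r \<le> d" "r \<le> e" "r \<le> r1" using d(1) e(1) r1(1) by (auto simp: r_def)
    have Dpos: "?D y nu2 > 0" if "y \<in> ball ?y0 r" for y
    proof -
      have "dist (?D y nu2) (?D ?y0 nu2) < ?D ?y0 nu2" using that r by (intro d(2)) (auto simp: dist_commute)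
      then show ?thesis by (simp add: dist_real_def abs_less_iff)
    qed
    note scaleR_Pair [simp del]
    have BU: "ball ?y0 r \<subseteq> U" using subset_ball[OF r(3)] e(2) by (rule subset_trans)
    have "y \<in> coords V i" if y: "y \<in> ball ?y0 r" and Gy: "0 \<le> G y" for y
    proof (rule ccontr)
      assume nc: "y \<notin> coords V i"
      have "y \<in> ball ?y0 r1" using y r by auto
      then have "y \<notin> halfspace nu2" using nc r1(2) by blast
      then have yn: "y \<bullet> nu2 < 0" by (simp add: halfspace_def)
      \<comment> \<open>\<open>y'\<close> is the foot of \<open>y\<close> on the hyperplane, by
        Pythagoras no farther from the centre. There \<open>G\<close> is at most 0, and it increases
        strictly from \<open>y\<close> to \<open>y'\<close>, so \<open>G y\<close> would be
        negative.\<close>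
      define s where "s = - (y \<bullet> nu2) / (nu2 \<bullet> nu2)"
      have s: "s > 0" unfolding s_def by (rule divide_pos_pos[OF _ n0]) (simp only: neg_0_less_iff_less yn)
      define y' where "y' = y + s *\<^sub>R nu2"
      have cancel: "- a / b * b = - a" if "b > 0" for a b :: real using that by simp
      have y'0: "y' \<bullet> nu2 = 0"
        unfolding y'_def s_def inner_add_left inner_scaleR_left cancel[OF n0] by (rule add.right_inverse)
      have "norm (y - ?y0) ^ 2 = norm (y' - ?y0) ^ 2 + norm (s *\<^sub>R nu2) ^ 2"
      proof -
        have "(y' - ?y0) \<bullet> (s *\<^sub>R nu2) = 0" using y'0 True by (simp add: inner_diff_left)
        moreover have "y - ?y0 = (y' - ?y0) + - (s *\<^sub>R nu2)" by (simp add: y'_def)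
        moreover have "norm (a + - b) ^ 2 = norm a ^ 2 + norm b ^ 2" if "a \<bullet> b = 0" for a b :: "'e \<times> (complex^'n)"
          using norm_add_Pythagorean[of a "- b"] that by (simp add: orthogonal_def)
        ultimately show ?thesis by (simp only:)
      qed
      then have "norm (y' - ?y0) ^ 2 \<le> norm (y - ?y0) ^ 2" by simp
      then have "norm (y' - ?y0) \<le> norm (y - ?y0)" by (rule power2_le_imp_le) simp
      then have y'B: "y' \<in> ball ?y0 r" using y by (simp add: dist_norm norm_minus_commute)
      have "y' \<in> halfspace nu2" using y'0 by (simp add: halfspace_def)
      then have y'c: "y' \<in> coords V i" using y'B r r1(2) by auto
      have "G y' = Fc i y'" by (rule G(2)[OF y'c subsetD[OF BU y'B]])
      also have "\<dots> = - pi * (snd y' \<bullet> snd y')"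
        using Hb[of "fst y'"] y'c y'0 by (auto simp: Fc_def coordsV inner_prod_def)
      also have "\<dots> \<le> 0" by simp
      finally have Gy': "G y' \<le> 0" .
      have seg: "y + t *\<^sub>R nu2 \<in> ball ?y0 r" if "0 \<le> t" "t \<le> s" for t
      proof -
        have "(1 - t / s) *\<^sub>R y + (t / s) *\<^sub>R y' \<in> ball ?y0 r"
          using that s y y'B by (intro convexD[OF convex_ball]) (auto simp: divide_le_eq_1)
        moreover have "(1 - t / s) *\<^sub>R y + (t / s) *\<^sub>R y' = y + t *\<^sub>R nu2"
          using s by (simp add: y'_def algebra_simps)
        ultimately show ?thesis by simp
      qed
      have segU: "y + t *\<^sub>R nu2 \<in> U" if "0 \<le> t" "t \<le> s" for t by (rule subsetD[OF BU seg[OF that]])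
      have "\<exists>t>0. t < s \<and> G (y + s *\<^sub>R nu2) - G (y + 0 *\<^sub>R nu2) = (s - 0) * ?D (y + t *\<^sub>R nu2) nu2"
        by (rule MVT2[OF s]) (use line segU in blast)
      then obtain t where "0 < t" "t < s" "G y' - G y = s * ?D (y + t *\<^sub>R nu2) nu2"
        unfolding y'_def scaleR_zero_left add_0_right diff_zero by blast
      moreover from this have "s * ?D (y + t *\<^sub>R nu2) nu2 > 0" using s Dpos[OF seg[of t]] by simp
      ultimately show False using Gy Gy' by simp
    qed
    then show ?thesis using r(1) by blast
  qed
qed

text \<open>A smooth extension \<open>G\<close> of \<open>F\<close> is straightened, as
  \<open>F\<close> itself may live on one side only. \<open>superlevel_local\<close> ensures that
  all nearby points with \<open>0 <= G\<close> belong to the tube, so the chart image is an open set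
  cut by the half-space and not a smaller piece.\<close>

lemma tube_chart_exists:
  assumes qS: "q \<in> S" and F0: "F q = 0"
  shows "\<exists>U f. (U, f) \<in> induced_charts V S \<and> q \<in> U"
proof -
  have "fst q \<in> points W" using qS S_iff by blast
  then obtain i where i: "i \<in> idx W" and q: "q \<in> D2 i" by (rule D2_cover)
  let ?y0 = "chart V i q"
  have y0: "?y0 \<in> coords V i" using q by (auto simp: coords_def)
  obtain U0 G where U0: "open U0" "?y0 \<in> U0" and G: "\<And>k. C_diff k U0 G" "\<And>y. y \<in> coords V i \<Longrightarrow> y \<in> U0 \<Longrightarrow> G y = Fc i y"
    using smooth_onD[OF Fc_smooth[OF i] y0] by blast
  let ?D = "frechet_derivative G (at ?y0)"
  have G1: "C_diff (Suc 0) U0 G" by (rule G(1))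
  have DG: "(G has_derivative ?D) (at ?y0)" by (rule C_diff_has_derivative[OF G1 U0])
  have linD: "linear ?D" using DG has_derivative_linear by blast
  have Dy0: "?D = dF i ?y0"
  proof -
    have 1: "(G has_derivative ?D) (at ?y0 within coords V i)" using DG has_derivative_at_withinI by blast
    obtain d where d: "d > 0" "ball ?y0 d \<subseteq> U0" using openE[OF U0] by metis
    have "(Fc i has_derivative ?D) (at ?y0 within coords V i)"
    proof (rule has_derivative_transform_within[OF 1 d(1) y0])
      fix y assume "y \<in> coords V i" "dist y ?y0 < d"
      then have "y \<in> U0" using subsetD[OF d(2), of y] by (simp add: dist_commute)
      then show "G y = Fc i y" by (rule G(2)[OF \<open>y \<in> coords V i\<close>])
    qed
    then show ?thesis using hs_open_deriv_unique[OF hoV[OF i] y0] Fc_deriv[OF i y0] by blast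
  qed
  have n0: "nu2 \<bullet> nu2 \<noteq> 0" using nu2_pos(4) by (rule less_imp_neq[symmetric])
  \<comment> \<open>\<open>c\<close> has to be transverse both to the model hyperplane and to the
    level set of \<open>G\<close>. One of \<open>nu2\<close>, \<open>v\<close> and
    \<open>nu2 + v\<close> is transverse to both, and the sign is adjusted afterwards.\<close>
  have "\<exists>c. c \<bullet> nu2 \<noteq> 0 \<and> ?D c > 0"
  proof -
    obtain v where v: "?D v \<noteq> 0" using dF_nonzero[OF i q F0] unfolding Dy0 by blast
    have "\<exists>c. c \<bullet> nu2 \<noteq> 0 \<and> ?D c \<noteq> 0"
    proof (cases "?D nu2 = 0")
      case True
      show ?thesis
      proof (cases "v \<bullet> nu2 = 0")
        case vn: True
        have "(nu2 + v) \<bullet> nu2 \<noteq> 0" using n0 vn by (simp add: inner_add_left)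
        moreover have "?D (nu2 + v) \<noteq> 0" using linear_add[OF linD, of nu2 v] True v by simp
        ultimately show ?thesis by blast
      qed (use v in blast)
    qed (use n0 in blast)
    then obtain c where c: "c \<bullet> nu2 \<noteq> 0" "?D c \<noteq> 0" by blast
    show ?thesis
    proof (cases "?D c > 0")
      case False
      then have "?D (- c) > 0" using linear_neg[OF linD, of c] c(2) by simp
      moreover have "(- c) \<bullet> nu2 \<noteq> 0" using c(1) by simp
      ultimately show ?thesis by blast
    qed (use c in blast)
  qed
  then obtain c where c: "c \<bullet> nu2 \<noteq> 0" "?D c > 0" by blast
  obtain r0 where r0: "r0 > 0" and str: "\<And>r. 0 < r \<Longrightarrow> r \<le> r0 \<Longrightarrow> ball ?y0 r \<subseteq> U0 \<and> (\<exists>f g. (\<forall>k. C_diff k (ball ?y0 r) f) \<and>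
    open (f ` ball ?y0 r) \<and> (\<forall>k. C_diff k (f ` ball ?y0 r) g) \<and>
    (\<forall>y\<in>ball ?y0 r. g (f y) = y) \<and> (\<forall>y\<in>ball ?y0 r. f y \<bullet> nu2 = G y))"
    using straighten[OF U0 G(1) c] by blast
  obtain r1 where r1: "r1 > 0" "\<And>y. y \<in> ball ?y0 r1 \<Longrightarrow> 0 \<le> G y \<Longrightarrow> y \<in> coords V i"
    using superlevel_local[OF i q F0 U0 G] by blast
  define r where "r = min r0 r1"
  have r: "0 < r" "r \<le> r0" "r \<le> r1" using r0 r1(1) by (auto simp: r_def)
  let ?B = "ball ?y0 r"
  obtain f0 g0 where f0: "\<And>k. C_diff k ?B f0" "open (f0 ` ?B)" "\<And>y. y \<in> ?B \<Longrightarrow> f0 y \<bullet> nu2 = G y"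
    and g0: "\<And>k. C_diff k (f0 ` ?B) g0" "\<And>y. y \<in> ?B \<Longrightarrow> g0 (f0 y) = y" and BU: "?B \<subseteq> U0"
    using str[OF r(1,2)] by blast
  define P where "P = {p \<in> D2 i. chart V i p \<in> ?B}"
  define U where "U = P \<inter> S"
  define f where "f p = f0 (chart V i p)" for p
  have P: "openin T2 P" unfolding P_def by (rule hchart_preimage_open[OF hchV[OF i] open_ball])
  have US: "U \<subseteq> S" "U \<subseteq> D2 i" and UB: "\<And>p. p \<in> U \<Longrightarrow> chart V i p \<in> ?B" by (auto simp: U_def P_def)
  have Gch: "G (chart V i p) = F p" if p: "p \<in> D2 i" "chart V i p \<in> ?B" for p
  proof -
    have "chart V i p \<in> coords V i" using p by (auto simp: coords_def)
    from G(2)[OF this subsetD[OF BU p(2)]] show ?thesis by (simp only: Fc_chart[OF i p(1)])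
  qed
  have fU: "f ` U = f0 ` ?B \<inter> halfspace nu2"
  proof
    show "f ` U \<subseteq> f0 ` ?B \<inter> halfspace nu2"
    proof (rule image_subsetI)
      fix p assume p: "p \<in> U"
      have B: "chart V i p \<in> ?B" and pD: "p \<in> D2 i" and pS: "p \<in> S" using p US UB by blast+
      have "f p \<bullet> nu2 = F p" unfolding f_def using f0(3)[OF B] Gch[OF pD B] by simp
      then show "f p \<in> f0 ` ?B \<inter> halfspace nu2" using pS B S_iff by (auto simp: f_def halfspace_def)
    qed
    show "f0 ` ?B \<inter> halfspace nu2 \<subseteq> f ` U"
    proof
      fix v assume "v \<in> f0 ` ?B \<inter> halfspace nu2"
      then obtain y where y: "y \<in> ?B" "v = f0 y" "0 \<le> G y" using f0(3) by (auto simp: halfspace_def)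
      have "y \<in> coords V i" using r1(2)[of y] y(1,3) r(3) by auto
      then obtain p where p: "p \<in> D2 i" "y = chart V i p" by (auto simp: coords_def)
      have "F p \<ge> 0" using Gch[OF p(1)] p(2) y by simp
      moreover have "fst p \<in> points W" using p(1) cdW[OF i] by auto
      ultimately have "p \<in> S" by (simp add: S_iff)
      then show "v \<in> f ` U" using p y by (auto simp: U_def P_def f_def)
    qed
  qed
  have g0f: "g0 (f p) = chart V i p" if "p \<in> U" for p unfolding f_def using g0(2) UB that by blast
  have pg: "param V i (g0 (f p)) = p" if p: "p \<in> U" for p
    using g0f[OF p] paramV[OF i] US(2) p by auto
  have finj: "inj_on f U" using pg by (metis inj_onI)
  have UT: "U \<subseteq> topspace T2" using US(1) S_sub by blast
  have hom: "homeomorphic_map (subtopology T2 U) (top_of_set (f ` U)) f"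
    unfolding homeomorphic_map_maps
  proof
    show "homeomorphic_maps (subtopology T2 U) (top_of_set (f ` U)) f (\<lambda>v. param V i (g0 v))"
      unfolding homeomorphic_maps_def
    proof (intro conjI)
      have "continuous_map (subtopology T2 (D2 i)) euclidean (chart V i)"
        using hchart_cont[OF hchV[OF i]] by (simp add: continuous_map_in_subtopology)
      then have "continuous_map (subtopology T2 U) euclidean (chart V i)"
        by (rule continuous_map_from_subtopology_mono[OF _ US(2)])
      then have "continuous_map (subtopology T2 U) (top_of_set ?B) (chart V i)"
        using UB by (auto simp: continuous_map_in_subtopology)
      moreover have "continuous_map (top_of_set ?B) euclidean f0" using C_diff_continuous_on[OF f0(1)] by simp
      ultimately have "continuous_map (subtopology T2 U) euclidean (f0 \<circ> chart V i)" by (rule continuous_map_compose)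
      then show "continuous_map (subtopology T2 U) (top_of_set (f ` U)) f"
        by (auto simp: continuous_map_in_subtopology f_def[abs_def] o_def)
      have "continuous_on (f ` U) g0" by (rule continuous_on_subset[OF C_diff_continuous_on[OF g0(1)]]) (use fU in blast)
      moreover have "g0 ` f ` U \<subseteq> chart V i ` D2 i" using g0f US(2) by auto
      ultimately have "continuous_map (top_of_set (f ` U)) (top_of_set (chart V i ` D2 i)) g0"
        by (auto simp: continuous_map_in_subtopology)
      from continuous_map_compose[OF this hchart_inv_cont[OF hchV[OF i]]]
      have "continuous_map (top_of_set (f ` U)) T2 (\<lambda>v. param V i (g0 v))" by (simp add: o_def param_def)
      then show "continuous_map (top_of_set (f ` U)) (subtopology T2 U) (\<lambda>v. param V i (g0 v))"
        using pg by (auto simp: continuous_map_in_subtopology)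
    qed (use pg UT in auto)
  qed
  have inv: "inv_into U f (f p) = p" if "p \<in> U" for p using finj that by simp
  have "(U, f) \<in> induced_charts V S"
    unfolding induced_charts_def
  proof (simp only: mem_Collect_eq case_prod_conv times_Cn_simps, intro conjI ballI hom)
    show "openin (subtopology T2 S) U" unfolding U_def using P by (auto simp: openin_subtopology)
    show "openin (top_of_set (halfspace nu2)) (f ` U)" unfolding fU using f0(2) by (auto simp: openin_open)
    fix j assume j: "j \<in> idx W"
    show "smooth_on (chart V j ` (U \<inter> D2 j)) (f \<circ> param V j)"
    proof -
      have sub: "chart V j ` (U \<inter> D2 j) \<subseteq> chart V j ` (D2 j \<inter> D2 i)" using US(2) by blast
      have tr: "(chart V i \<circ> param V j) (chart V j p) = chart V i p" if "p \<in> D2 j" for p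
        using paramV[OF j that] by simp
      have "smooth_on (chart V j ` (U \<inter> D2 j)) (\<lambda>y. f0 ((chart V i \<circ> param V j) y))"
        by (rule smooth_on_compose[OF smooth_onI_open[OF open_ball f0(1)] smooth_on_subset[OF transitionV[OF j i] sub]])
          (use UB tr in auto)
      moreover have "f0 ((chart V i \<circ> param V j) y) = (f \<circ> param V j) y" for y by (simp add: f_def)
      ultimately show ?thesis by (rule smooth_on_transform)
    qed
    show "smooth_on (f ` (U \<inter> D2 j)) (chart V j \<circ> inv_into U f)"
    proof -
      have "smooth_on (f ` (U \<inter> D2 j)) (\<lambda>v. (chart V j \<circ> param V i) (g0 v))"
      proof (rule smooth_on_compose[OF transitionV[OF i j]])
        show "smooth_on (f ` (U \<inter> D2 j)) g0"
          by (rule smooth_on_subset[OF smooth_onI_open[OF f0(2) g0(1)]]) (use fU in blast)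
        show "g0 ` f ` (U \<inter> D2 j) \<subseteq> chart V i ` (D2 i \<inter> D2 j)" using g0f US(2) by auto
      qed
      moreover have "(chart V j \<circ> param V i) (g0 v) = (chart V j \<circ> inv_into U f) v" if "v \<in> f ` (U \<inter> D2 j)" for v
        using that inv pg by auto
      ultimately show ?thesis by (rule smooth_on_transform)
    qed
  qed
  moreover have "q \<in> U" using qS q r(1) by (simp add: U_def P_def)
  ultimately show ?thesis by blast
qed

section \<open>The boundary of the tube is the hypersurface \<open>F = 0\<close>\<close>

abbreviation TB :: "('a \<times> (complex^'n), ('a \<times> (complex^'n)) set \<times> ('a \<times> (complex^'n) \<Rightarrow> 'e \<times> (complex^'n)), 'e \<times> (complex^'n)) mfd"
  where "TB \<equiv> tube N W H"
abbreviation tf where "tf \<equiv> tube_form N W lam"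

definition Sig :: "('a \<times> (complex^'n)) set" where
  "Sig = {q. fst q \<in> points W \<and> F q = 0}"

lemma tube_simps: "topo TB = subtopology T2 S" "idx TB = induced_charts V S" "cdom TB = fst" "chart TB = snd" "nu TB = nu2"
  by (simp_all add: tube_def induced_domain_def)

lemma boundary_tube: "boundary TB = Sig"
proof
  show "boundary TB \<subseteq> Sig"
  proof
    fix q assume "q \<in> boundary TB"
    then obtain U f where Uf: "(U, f) \<in> induced_charts V S" "q \<in> U" "f q \<bullet> nu2 = 0"
      unfolding boundary_def tube_simps by auto
    then have "F q = 0" "q \<in> S" using boundary_imp_F_zero[OF Uf] tchart(2)[OF Uf(1)] by blast+
    then show "q \<in> Sig" by (simp add: Sig_def S_iff)
  qed
  show "Sig \<subseteq> boundary TB"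
  proof
    fix q assume q: "q \<in> Sig"
    then have qS: "q \<in> S" and F0: "F q = 0" by (auto simp: Sig_def S_iff)
    obtain U f where Uf: "(U, f) \<in> induced_charts V S" "q \<in> U" using tube_chart_exists[OF qS F0] by blast
    have "f q \<bullet> nu2 = 0" by (rule F_zero_imp_boundary[OF Uf F0])
    moreover have "q \<in> points TB" using qS S_sub by (auto simp: points_def tube_simps)
    ultimately show "q \<in> boundary TB" using Uf unfolding boundary_def tube_simps by force
  qed
qed

lemma Sig_sub: "Sig \<subseteq> S" "Sig \<subseteq> topspace T2"
  by (auto simp: Sig_def S_iff points_def)

lemma subtop_Sig: "subtopology (topo TB) (boundary TB) = subtopology T2 Sig"
  unfolding boundary_tube tube_simps subtopology_subtopology using Sig_sub(1) by (simp add: Int_absorb1)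

end


section \<open>The Reeb flow on the boundary of the tube\<close>

definition rot :: "real \<Rightarrow> complex^'n::finite \<Rightarrow> complex^'n" where
  "rot t z = cos (2 * pi * t) *\<^sub>R z + sin (2 * pi * t) *\<^sub>R Jmult z"

lemma Jmult_rot: "Jmult (rot t z) = cos (2 * pi * t) *\<^sub>R Jmult z - sin (2 * pi * t) *\<^sub>R z"
  by (simp add: rot_def linear_add[OF Jmult_linear] linear_cmul[OF Jmult_linear] Jmult_Jmult)

lemma rot_0: "rot 0 z = z"
  by (simp add: rot_def)

lemma rot_1: "rot 1 z = z"
  by (simp add: rot_def)

lemma rot_add: "rot (s + t) z = rot s (rot t z)"
  unfolding rot_def[of s "rot t z"] Jmult_rot
  by (simp add: rot_def distrib_left cos_add sin_add algebra_simps)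

lemma rot_inner: "rot t z \<bullet> rot t z = z \<bullet> z"
proof -
  have "rot t z \<bullet> rot t z = cos (2 * pi * t) * (cos (2 * pi * t) * (z \<bullet> z)) + sin (2 * pi * t) * (sin (2 * pi * t) * (z \<bullet> z))"
    by (simp add: rot_def inner_add_left inner_add_right inner_commute[of z "Jmult z"] Jmult_self Jmult_inner)
  also have "\<dots> = ((cos (2 * pi * t))\<^sup>2 + (sin (2 * pi * t))\<^sup>2) * (z \<bullet> z)"
    by (simp only: power2_eq_square distrib_right mult.assoc)
  also have "\<dots> = z \<bullet> z" by (simp only: sin_cos_squared_add2 mult_1)
  finally show ?thesis .
qed

lemma Jmult_bounded_linear: "bounded_linear Jmult"
  using Jmult_linear by (simp add: linear_conv_bounded_linear)

lemma rot_continuous: "continuous_on UNIV (\<lambda>(t, z :: complex^'n::finite). rot t z)"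
  unfolding rot_def case_prod_unfold
  by (intro continuous_intros bounded_linear.continuous_on[OF Jmult_bounded_linear])

lemma cos_sin_deriv:
  assumes "(s has_real_derivative d) (at t)"
  shows "((\<lambda>t. cos (2 * pi * s t)) has_real_derivative - sin (2 * pi * s t) * (2 * pi * d)) (at t)"
    "((\<lambda>t. sin (2 * pi * s t)) has_real_derivative cos (2 * pi * s t) * (2 * pi * d)) (at t)"
  using assms by (auto intro!: derivative_eq_intros)

lemma rot_deriv:
  assumes s: "(s has_real_derivative d) (at t)"
  shows "((\<lambda>t. rot (s t) z) has_vector_derivative d *\<^sub>R ((2 * pi) *\<^sub>R Jmult (rot (s t) z))) (at t)"
proof -
  have "((\<lambda>t. cos (2 * pi * s t) *\<^sub>R z + sin (2 * pi * s t) *\<^sub>R Jmult z) has_vector_derivative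
     (cos (2 * pi * s t) *\<^sub>R 0 + (- sin (2 * pi * s t) * (2 * pi * d)) *\<^sub>R z) +
     (sin (2 * pi * s t) *\<^sub>R 0 + (cos (2 * pi * s t) * (2 * pi * d)) *\<^sub>R Jmult z)) (at t)"
    by (intro has_vector_derivative_add has_vector_derivative_scaleR cos_sin_deriv[OF s] has_vector_derivative_const)
  moreover have "(cos (2 * pi * s t) *\<^sub>R 0 + (- sin (2 * pi * s t) * (2 * pi * d)) *\<^sub>R z) +
     (sin (2 * pi * s t) *\<^sub>R 0 + (cos (2 * pi * s t) * (2 * pi * d)) *\<^sub>R Jmult z) = d *\<^sub>R ((2 * pi) *\<^sub>R Jmult (rot (s t) z))"
    unfolding Jmult_rot by (simp add: scaleR_diff_right mult_ac)
  ultimately have "((\<lambda>t. cos (2 * pi * s t) *\<^sub>R z + sin (2 * pi * s t) *\<^sub>R Jmult z) has_vector_derivative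
     d *\<^sub>R ((2 * pi) *\<^sub>R Jmult (rot (s t) z))) (at t)" by (simp only:)
  then show ?thesis by (simp only: rot_def)
qed

text \<open>Rotating the solution back by its own clock gives a constant.\<close>

lemma rot_solution:
  fixes z :: "real \<Rightarrow> complex^'n::finite"
  assumes z: "\<And>t. (z has_vector_derivative d t *\<^sub>R ((2 * pi) *\<^sub>R Jmult (z t))) (at t)"
    and s: "\<And>t. (s has_real_derivative d t) (at t)" "s 0 = 0"
  shows "z t = rot (s t) (z 0)"
proof -
  let ?c = "\<lambda>t. cos (2 * pi * s t)" and ?n = "\<lambda>t. sin (2 * pi * s t)"
  define v where "v t = ?c t *\<^sub>R z t - ?n t *\<^sub>R Jmult (z t)" for t
  have "(v has_vector_derivative 0) (at t)" for t
  proof -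
    have J: "((\<lambda>t. Jmult (z t)) has_vector_derivative Jmult (d t *\<^sub>R ((2 * pi) *\<^sub>R Jmult (z t)))) (at t)"
      by (rule bounded_linear.has_vector_derivative[OF Jmult_bounded_linear z])
    have "(v has_vector_derivative
      (?c t *\<^sub>R (d t *\<^sub>R ((2 * pi) *\<^sub>R Jmult (z t))) + (- ?n t * (2 * pi * d t)) *\<^sub>R z t) -
      (?n t *\<^sub>R Jmult (d t *\<^sub>R ((2 * pi) *\<^sub>R Jmult (z t))) + (?c t * (2 * pi * d t)) *\<^sub>R Jmult (z t))) (at t)"
      unfolding v_def[abs_def]
      by (intro has_vector_derivative_diff has_vector_derivative_scaleR cos_sin_deriv[OF s(1)] z J)
    moreover have "(?c t *\<^sub>R (d t *\<^sub>R ((2 * pi) *\<^sub>R Jmult (z t))) + (- ?n t * (2 * pi * d t)) *\<^sub>R z t) -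
      (?n t *\<^sub>R Jmult (d t *\<^sub>R ((2 * pi) *\<^sub>R Jmult (z t))) + (?c t * (2 * pi * d t)) *\<^sub>R Jmult (z t)) = 0"
      by (simp add: linear_cmul[OF Jmult_linear] Jmult_Jmult mult.commute mult.left_commute)
    ultimately show ?thesis by simp
  qed
  then have "\<exists>c. \<forall>t. v t = c"
    by (rule has_vector_derivative_zero_constant[OF convex_UNIV]) blast
  then have v: "v t = v 0" by metis
  have "v 0 = z 0" using s(2) by (simp add: v_def)
  moreover have "v t = rot (- s t) (z t)" by (simp add: v_def rot_def)
  ultimately have "rot (s t) (z 0) = rot (s t) (rot (- s t) (z t))" using v by simp
  then show ?thesis using rot_add[of "s t" "- s t" "z t"] by (simp add: rot_0)
qed

section \<open>The product flow on the hypersurface \<open>F = 0\<close>\<close>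

context liouville_tube
begin

definition Phi :: "real \<Rightarrow> 'a \<times> (complex^'n) \<Rightarrow> 'a \<times> (complex^'n)" where
  "Phi t q = (phi t (fst q), rot t (snd q))"

lemma Phi_Sig: "q \<in> Sig \<Longrightarrow> Phi t q \<in> Sig"
  by (auto simp: Sig_def Phi_def F_def H_phi phi_in rot_inner)

lemma Sig_closed: "closedin T2 Sig"
proof -
  have "closedin T2 {q \<in> topspace T2. F q \<in> {0}}"
    by (rule closedin_continuous_map_preimage[OF F_cont]) simp
  moreover have "{q \<in> topspace T2. F q \<in> {0}} = Sig" by (auto simp: Sig_def points_def)
  ultimately show ?thesis by simp
qed

text \<open>\<open>H\<close> is bounded by compactness of \<open>W\<close>, hence so are the fibres.
  The ball provides both the compactness of \<open>Sig\<close> and the compact fibre set for the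
  entropy bound.\<close>

lemma Sig_bounded: "\<exists>R. Sig \<subseteq> points W \<times> cball 0 R"
proof -
  have "compactin euclideanreal (H ` topspace (topo W))"
    using cpW unfolding compact_space_def by (rule image_compactin[OF _ H_cont])
  then have "bounded (H ` points W)" by (simp add: points_def compact_imp_bounded)
  then obtain C where C: "\<And>p. p \<in> points W \<Longrightarrow> \<bar>H p\<bar> \<le> C" unfolding bounded_iff by auto
  have "Sig \<subseteq> points W \<times> cball 0 (sqrt (C / pi))"
  proof
    fix q assume q: "q \<in> Sig"
    then have qW: "fst q \<in> points W" and e: "pi * (snd q \<bullet> snd q) = H (fst q)" by (auto simp: Sig_def F_def)
    then have "pi * (snd q \<bullet> snd q) \<le> C" using C[OF qW] by linarith
    then have "(norm (snd q))\<^sup>2 \<le> C / pi" by (simp add: power2_norm_eq_inner field_simps)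
    then have "norm (snd q) \<le> sqrt (C / pi)" by (rule real_le_rsqrt)
    then show "q \<in> points W \<times> cball 0 (sqrt (C / pi))" using qW by (cases q) simp
  qed
  then show ?thesis by blast
qed

lemma Sig_compact: "compactin T2 Sig"
proof -
  obtain R where R: "Sig \<subseteq> points W \<times> cball 0 R" using Sig_bounded by blast
  have "compactin T2 (points W \<times> cball 0 R)"
    using cpW by (auto simp: compactin_Times compact_space_def points_def)
  then show ?thesis by (rule closed_compactin[OF _ R Sig_closed])
qed

lemma Phi_cont: "continuous_map (prod_topology euclideanreal T2) T2 (\<lambda>(t, q). Phi t q)"
proof -
  let ?P = "prod_topology euclideanreal T2"
  have f: "continuous_map ?P euclideanreal fst" by (rule continuous_map_fst)
  have 1: "continuous_map ?P (topo W) (\<lambda>x. fst (snd x))"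
    using continuous_map_compose[OF continuous_map_snd continuous_map_fst] by (simp add: o_def)
  have 2: "continuous_map ?P euclidean (\<lambda>x. snd (snd x))"
    using continuous_map_compose[OF continuous_map_snd continuous_map_snd] by (simp add: o_def)
  have "continuous_map ?P (topo W) (\<lambda>x. phi (fst x) (fst (snd x)))"
    using continuous_map_compose[OF continuous_map_pairedI[OF f 1] phi_cont] by (simp add: o_def)
  moreover have "continuous_map (prod_topology euclideanreal euclidean) euclidean (\<lambda>(t, z :: complex^'n). rot t z)"
    using rot_continuous by simp
  from continuous_map_compose[OF continuous_map_pairedI[OF f 2] this]
  have "continuous_map ?P euclidean (\<lambda>x. rot (fst x) (snd (snd x)))" by (simp add: o_def)
  ultimately have "continuous_map ?P T2 (\<lambda>x. (phi (fst x) (fst (snd x)), rot (fst x) (snd (snd x))))"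
    by (rule continuous_map_pairedI)
  then show ?thesis by (simp add: Phi_def case_prod_unfold)
qed

lemma chart_curve_local:
  assumes UF: "(U, f) \<in> induced_charts V S" and i: "i \<in> idx W"
    and c: "continuous_map euclideanreal (subtopology T2 Sig) c" and ct: "c t \<in> U \<inter> D2 i"
  shows "\<exists>e>0. \<forall>s\<in>ball t e. c s \<in> U \<inter> D2 i"
proof -
  have "continuous_map euclideanreal (subtopology T2 S) c"
    using c Sig_sub(1) by (auto simp: continuous_map_in_subtopology)
  then have *: "\<forall>t\<in>UNIV. c t \<in> topspace (subtopology T2 S) \<and>
      (\<forall>O'. openin (subtopology T2 S) O' \<longrightarrow> c t \<in> O' \<longrightarrow> (\<exists>e>0. \<forall>s. \<bar>s - t\<bar> < e \<longrightarrow> s \<in> UNIV \<and> c s \<in> O'))"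
    using curve_cont_iff[of UNIV "subtopology T2 S" c] by simp
  have "openin (subtopology T2 S) (D2 i \<inter> S)"
    using hchart_openin[OF hchV[OF i]] by (auto simp: openin_subtopology)
  then have op: "openin (subtopology T2 S) (U \<inter> (D2 i \<inter> S))"
    by (rule openin_Int[OF hchart_openin[OF tchart(1)[OF UF]]])
  have "c t \<in> U \<inter> (D2 i \<inter> S)" using ct tchart(2)[OF UF] by blast
  from conjunct2[OF bspec[OF * UNIV_I], rule_format, OF op this]
  obtain e where e: "e > 0" "\<And>s. \<bar>s - t\<bar> < e \<Longrightarrow> c s \<in> U \<inter> (D2 i \<inter> S)" by blast
  have "c s \<in> U \<inter> D2 i" if "s \<in> ball t e" for s
  proof -
    have "\<bar>s - t\<bar> < e" using that by (simp add: dist_real_def abs_minus_commute)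
    from e(2)[OF this] show ?thesis by (simp only: Int_iff)
  qed
  then show ?thesis using e(1) by (intro exI[of _ e] conjI ballI)
qed

text \<open>Both implications are chain rules: one with \<open>Ai\<close>, which carries the Reeb
  vector to the rescaled \<open>XF\<close>, the other with a left inverse of \<open>Ai\<close> found
  on the product side.\<close>

lemma reeb_curve_iff:
  assumes UF: "(U, f) \<in> induced_charts V S" and i: "i \<in> idx W"
    and c: "continuous_map euclideanreal (subtopology T2 Sig) c" and ct: "c t \<in> U \<inter> D2 i"
  shows "((f \<circ> c) has_vector_derivative reeb_field TB tf (U, f) (f (c t))) (at t) \<longleftrightarrow>
    ((chart V i \<circ> c) has_vector_derivative inverse (tauW (fst (c t))) *\<^sub>R XF i (chart V i (c t))) (at t)"
proof -
  obtain e where e: "e > 0" "\<And>s. s \<in> ball t e \<Longrightarrow> c s \<in> U \<inter> D2 i" using chart_curve_local[OF assms] by blast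
  have cS: "c t \<in> Sig" using continuous_map_image_subset_topspace[OF c] by auto
  then have F0: "F (c t) = 0" by (simp add: Sig_def)
  have ctU: "c t \<in> U" and y: "f (c t) \<in> f ` (U \<inter> D2 i)" using ct by auto
  have t: "t \<in> ball t e" using e(1) by simp
  let ?A = "frechet_derivative (chart V i \<circ> inv_into U f) (at (f (c t)) within f ` (U \<inter> D2 i))"
  let ?R = "reeb_field TB tf (U, f) (f (c t))" and ?Y = "inverse (tauW (fst (c t))) *\<^sub>R XF i (chart V i (c t))"
  have AR: "?A ?R = ?Y" by (rule reeb_chart[OF UF i ct F0])
  show ?thesis
  proof
    assume D: "((f \<circ> c) has_vector_derivative ?R) (at t)"
    have "(((chart V i \<circ> inv_into U f) \<circ> (f \<circ> c)) has_vector_derivative ?A ?R) (at t)"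
    proof (rule has_vector_derivative_chain_within[OF D open_ball t])
      show "(f \<circ> c) ` ball t e \<subseteq> f ` (U \<inter> D2 i)" using e(2) by force
      show "((chart V i \<circ> inv_into U f) has_derivative ?A) (at ((f \<circ> c) t) within f ` (U \<inter> D2 i))"
        using Ai_facts(1)[OF UF i y] by simp
    qed
    then have "((chart V i \<circ> c) has_vector_derivative ?A ?R) (at t)"
    proof (rule has_vector_derivative_transform_within_open[OF _ open_ball t])
      fix s assume "s \<in> ball t e"
      then have "c s \<in> U" using e(2) by blast
      then show "((chart V i \<circ> inv_into U f) \<circ> (f \<circ> c)) s = (chart V i \<circ> c) s" using finv[OF UF] by simp
    qed
    then show "((chart V i \<circ> c) has_vector_derivative ?Y) (at t)" unfolding AR .
  next
    assume D: "((chart V i \<circ> c) has_vector_derivative ?Y) (at t)"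
    obtain B where B: "((f \<circ> param V i) has_derivative B) (at ((chart V i \<circ> inv_into U f) (f (c t))) within chart V i ` (U \<inter> D2 i))"
      "\<forall>v. B (?A v) = v" using Ai_facts(5)[OF UF i y] by blast
    have gc: "(chart V i \<circ> inv_into U f) (f (c t)) = chart V i (c t)" by (rule gi_f[OF UF ctU])
    have "(((f \<circ> param V i) \<circ> (chart V i \<circ> c)) has_vector_derivative B ?Y) (at t)"
    proof (rule has_vector_derivative_chain_within[OF D open_ball t])
      show "(chart V i \<circ> c) ` ball t e \<subseteq> chart V i ` (U \<inter> D2 i)" using e(2) by force
      show "((f \<circ> param V i) has_derivative B) (at ((chart V i \<circ> c) t) within chart V i ` (U \<inter> D2 i))"
        using B(1) unfolding gc by simp
    qed
    then have "((f \<circ> c) has_vector_derivative B ?Y) (at t)"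
    proof (rule has_vector_derivative_transform_within_open[OF _ open_ball t])
      fix s assume "s \<in> ball t e"
      then have "c s \<in> D2 i" using e(2) by blast
      then show "((f \<circ> param V i) \<circ> (chart V i \<circ> c)) s = (f \<circ> c) s" using paramV[OF i] by simp
    qed
    moreover have "B ?Y = ?R" using B(2) AR by metis
    ultimately show "((f \<circ> c) has_vector_derivative ?R) (at t)" by simp
  qed
qed

text \<open>Trades the charts of the tube for product charts, where the components in
  \<open>W\<close> and in the complex factors separate. Existence of tube charts along
  \<open>Sig\<close> is needed for the forward direction.\<close>

lemma tube_integral_curve_iff:
  "integral_curve TB (reeb_field TB tf) (boundary TB) c \<longleftrightarrow>
    continuous_map euclideanreal (subtopology T2 Sig) c \<and>
    (\<forall>t. \<forall>i\<in>idx W. c t \<in> D2 i \<longrightarrow>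
      ((chart V i \<circ> c) has_vector_derivative inverse (tauW (fst (c t))) *\<^sub>R XF i (chart V i (c t))) (at t))"
proof (cases "continuous_map euclideanreal (subtopology T2 Sig) c")
  case c: True
  have cS: "c t \<in> Sig" for t using continuous_map_image_subset_topspace[OF c] by auto
  have eq: "integral_curve TB (reeb_field TB tf) (boundary TB) c \<longleftrightarrow>
    (\<forall>t. \<forall>k\<in>induced_charts V S. c t \<in> fst k \<longrightarrow> ((snd k \<circ> c) has_vector_derivative reeb_field TB tf k (snd k (c t))) (at t))"
    unfolding integral_curve_def subtop_Sig unfolding tube_simps by (simp only: c simp_thms)
  show ?thesis
    unfolding eq
  proof (intro iffI conjI allI ballI impI c)
    fix t i assume *: "\<forall>t. \<forall>k\<in>induced_charts V S. c t \<in> fst k \<longrightarrow> ((snd k \<circ> c) has_vector_derivative reeb_field TB tf k (snd k (c t))) (at t)"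
      and i: "i \<in> idx W" "c t \<in> D2 i"
    have "c t \<in> S" "F (c t) = 0" using cS[of t] by (auto simp: Sig_def S_iff)
    then obtain U f where Uf: "(U, f) \<in> induced_charts V S" "c t \<in> U" using tube_chart_exists by blast
    have "c t \<in> U \<inter> D2 i" using Uf(2) i(2) by blast
    from iffD1[OF reeb_curve_iff[OF Uf(1) i(1) c this]]
    show "((chart V i \<circ> c) has_vector_derivative inverse (tauW (fst (c t))) *\<^sub>R XF i (chart V i (c t))) (at t)"
      using bspec[OF spec[OF *, of t] Uf(1)] Uf(2) by (simp only: fst_conv snd_conv simp_thms)
  next
    fix t k assume *: "continuous_map euclideanreal (subtopology T2 Sig) c \<and>
      (\<forall>t. \<forall>i\<in>idx W. c t \<in> D2 i \<longrightarrow>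
      ((chart V i \<circ> c) has_vector_derivative inverse (tauW (fst (c t))) *\<^sub>R XF i (chart V i (c t))) (at t))"
      and k: "k \<in> induced_charts V S" "c t \<in> fst k"
    obtain U f where Uf: "k = (U, f)" by (cases k)
    have "fst (c t) \<in> points W" using cS[of t] by (simp add: Sig_def)
    then obtain i where i: "i \<in> idx W" "c t \<in> D2 i" by (rule D2_cover)
    have "c t \<in> U \<inter> D2 i" using k(2) Uf i(2) by simp
    from iffD2[OF reeb_curve_iff[OF k(1)[unfolded Uf] i(1) c this]]
    show "((snd k \<circ> c) has_vector_derivative reeb_field TB tf k (snd k (c t))) (at t)"
      using conjunct2[OF *, rule_format, OF i] unfolding Uf snd_conv by blast
  qed
next
  case False
  then show ?thesis unfolding integral_curve_def subtop_Sig by blast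
qed

lemma Phi_entropy: "top_entropy (subtopology T2 Sig) (Phi 1) = ham_entropy W lam H"
proof (rule antisym)
  obtain R where R: "Sig \<subseteq> points W \<times> cball 0 R" using Sig_bounded by blast
  have "top_entropy (subtopology T2 Sig) (Phi 1) \<le> top_entropy (topo W) (phi 1)"
  proof (rule top_entropy_fibre_identity[OF cpW _ Sig_closed, of "cball 0 R"])
    show "compactin euclidean (cball 0 R :: (complex^'n) set)" by simp
    show "Sig \<subseteq> UNIV \<times> cball 0 R" using R by auto
    show "phi 1 x \<in> topspace (topo W)" if "x \<in> topspace (topo W)" for x using phi_in that by (simp add: points_def)
    show "Phi 1 (x, z) = (phi 1 x, z) \<and> (phi 1 x, z) \<in> Sig" if "(x, z) \<in> Sig" for x z
      using Phi_Sig[OF that, of 1] by (simp add: Phi_def rot_1)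
  qed
  then show "top_entropy (subtopology T2 Sig) (Phi 1) \<le> ham_entropy W lam H" by (simp add: ham_entropy_phi)
  have topS: "topspace (subtopology T2 Sig) = Sig" using Sig_sub(2) by auto
  have "top_entropy (topo W) (phi 1) \<le> top_entropy (subtopology T2 Sig) (Phi 1)"
  proof (rule top_entropy_factor[where p=fst])
    show "compact_space (subtopology T2 Sig)" by (rule compact_space_subtopology[OF Sig_compact])
    show "continuous_map (subtopology T2 Sig) (topo W) fst"
      by (rule continuous_map_from_subtopology[OF continuous_map_fst])
    show "fst ` topspace (subtopology T2 Sig) = topspace (topo W)"
    proof
      show "fst ` topspace (subtopology T2 Sig) \<subseteq> topspace (topo W)" by auto
      show "topspace (topo W) \<subseteq> fst ` topspace (subtopology T2 Sig)"
      proof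
        fix w assume "w \<in> topspace (topo W)"
        then have w: "w \<in> points W" by (simp add: points_def)
        \<comment> \<open>The fibre over \<open>w\<close> is a sphere of squared radius
          \<open>H w / pi\<close>. It is nonempty because \<open>H w\<close> is nonnegative and at
          least one complex coordinate is present.\<close>
        obtain b :: "complex^'n" where b: "b \<in> Basis" using nonempty_Basis by blast
        define z where "z = sqrt (H w / pi) *\<^sub>R b"
        have "z \<bullet> z = H w / pi" using H_nonneg[OF w] b by (simp add: z_def)
        then have "(w, z) \<in> Sig" using w by (simp add: Sig_def F_def)
        then show "w \<in> fst ` topspace (subtopology T2 Sig)" unfolding topS by force
      qed
    qed
  qed (use Phi_Sig topS in \<open>auto simp: Phi_def\<close>)
  then show "ham_entropy W lam H \<le> top_entropy (subtopology T2 Sig) (Phi 1)" by (simp add: ham_entropy_phi)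
qed

lemma reeb_entropy_tube:
  assumes m: "0 < m" "0 < M" "\<And>p. p \<in> points W \<Longrightarrow> m \<le> tauW p" "\<And>p. p \<in> points W \<Longrightarrow> tauW p \<le> M"
  shows "ereal m * reeb_entropy TB tf \<le> ham_entropy W lam H" "ham_entropy W lam H \<le> ereal M * reeb_entropy TB tf"
proof -
  let ?B = "subtopology T2 Sig"
  have topB: "topspace ?B = Sig" using Sig_sub(2) by auto
  have SW: "fst q \<in> points W" if "q \<in> Sig" for q using that by (simp add: Sig_def)
  interpret B: time_change ?B Phi "\<lambda>q. tauW (fst q)" m M
  proof
    show "compact_space ?B" by (rule compact_space_subtopology[OF Sig_compact])
    have "continuous_map (subtopology (prod_topology euclideanreal T2) (UNIV \<times> Sig)) T2 (\<lambda>(t, x). Phi t x)"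
      by (rule continuous_map_from_subtopology[OF Phi_cont])
    then show "continuous_map (prod_topology euclideanreal ?B) ?B (\<lambda>(t, x). Phi t x)"
      using Phi_Sig by (auto simp: subtopology_Times continuous_map_in_subtopology)
    show "continuous_map ?B euclideanreal (\<lambda>q. tauW (fst q))"
      using continuous_map_from_subtopology[OF continuous_map_compose[OF continuous_map_fst tau_cont]] by (simp add: o_def)
    show "Phi 0 x = x" if "x \<in> topspace ?B" for x
      using that topB SW phi_0 by (simp add: Phi_def rot_0)
    show "Phi (s + t) x = Phi s (Phi t x)" if "x \<in> topspace ?B" for x s t
      using that topB SW phi_add by (simp add: Phi_def rot_add)
  qed (use m topB SW in auto)
  have eq: "flow_map TB (reeb_field TB tf) (boundary TB) t p = B.changed t p" if p: "p \<in> Sig" for t p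
    unfolding flow_map_def
  proof (rule the_equality)
    have pB: "p \<in> topspace ?B" using p topB by simp
    have pW: "fst p \<in> points W" by (rule SW[OF p])
    show "\<exists>c. integral_curve TB (reeb_field TB tf) (boundary TB) c \<and> c 0 = p \<and> c t = B.changed t p"
    proof (intro exI[of _ "\<lambda>t. B.changed t p"] conjI)
      show "integral_curve TB (reeb_field TB tf) (boundary TB) (\<lambda>t. B.changed t p)"
        unfolding tube_integral_curve_iff
      proof (intro conjI allI ballI impI)
        show "continuous_map euclideanreal ?B (\<lambda>t. B.changed t p)" by (rule continuous_map_flow_orbit[OF B.changed_cont pB])
        fix t i assume i: "i \<in> idx W" "B.changed t p \<in> D2 i"
        let ?d = "inverse (tauW (fst (B.changed t p)))"
        have s: "((\<lambda>t. B.inv_clock t p) has_real_derivative ?d) (at t)" by (rule B.inv_clock_deriv[OF pB])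
        have ch: "B.changed t p = (phi (B.inv_clock t p) (fst p), rot (B.inv_clock t p) (snd p))" for t
          by (simp add: B.changed_def Phi_def)
        have "phi (B.inv_clock t p) (fst p) \<in> cdom W i" using i(2) unfolding ch by simp
        from scaled_phi_deriv[OF pW s i(1) this]
        have 1: "((\<lambda>t. chart W i (phi (B.inv_clock t p) (fst p))) has_vector_derivative
          ?d *\<^sub>R X i (chart W i (phi (B.inv_clock t p) (fst p)))) (at t)" by (simp add: o_def)
        have "((\<lambda>t. (chart W i (phi (B.inv_clock t p) (fst p)), rot (B.inv_clock t p) (snd p))) has_vector_derivative
          (?d *\<^sub>R X i (chart W i (phi (B.inv_clock t p) (fst p))), ?d *\<^sub>R ((2 * pi) *\<^sub>R Jmult (rot (B.inv_clock t p) (snd p))))) (at t)"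
          by (rule has_vector_derivative_Pair[OF 1 rot_deriv[OF s]])
        moreover have "(?d *\<^sub>R X i (chart W i (phi (B.inv_clock t p) (fst p))), ?d *\<^sub>R ((2 * pi) *\<^sub>R Jmult (rot (B.inv_clock t p) (snd p)))) =
           ?d *\<^sub>R XF i (chart V i (B.changed t p))" by (simp add: XF_def chartV ch)
        moreover have "(\<lambda>t. (chart W i (phi (B.inv_clock t p) (fst p)), rot (B.inv_clock t p) (snd p))) = chart V i \<circ> (\<lambda>t. B.changed t p)"
          by (simp add: fun_eq_iff chartV ch)
        ultimately show "((chart V i \<circ> (\<lambda>t. B.changed t p)) has_vector_derivative ?d *\<^sub>R XF i (chart V i (B.changed t p))) (at t)"
          by (simp only:)
      qed
      show "B.changed 0 p = p" by (rule B.changed_0[OF pB])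
    qed simp
    fix q assume "\<exists>c. integral_curve TB (reeb_field TB tf) (boundary TB) c \<and> c 0 = p \<and> c t = q"
    then obtain c where c: "integral_curve TB (reeb_field TB tf) (boundary TB) c" "c 0 = p" "c t = q" by blast
    have cc: "continuous_map euclideanreal ?B c" using c(1) by (simp add: tube_integral_curve_iff)
    have cS: "c t \<in> Sig" for t using continuous_map_image_subset_topspace[OF cc] topB by auto
    have "continuous_map euclideanreal T2 c" using cc by (simp add: continuous_map_in_subtopology)
    from continuous_map_compose[OF this continuous_map_fst]
    have cf: "continuous_map euclideanreal (topo W) (\<lambda>t. fst (c t))" by (simp add: o_def)
    have der: "((\<lambda>t. (chart W i (fst (c t)), snd (c t))) has_vector_derivative
       (inverse (tauW (fst (c t))) *\<^sub>R X i (chart W i (fst (c t))), inverse (tauW (fst (c t))) *\<^sub>R ((2 * pi) *\<^sub>R Jmult (snd (c t))))) (at t)"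
      if i: "i \<in> idx W" "c t \<in> D2 i" for t i
    proof -
      have "((chart V i \<circ> c) has_vector_derivative inverse (tauW (fst (c t))) *\<^sub>R XF i (chart V i (c t))) (at t)"
        by (rule conjunct2[OF c(1)[unfolded tube_integral_curve_iff], rule_format, OF i])
      moreover have "chart V i \<circ> c = (\<lambda>t. (chart W i (fst (c t)), snd (c t)))" by (simp add: fun_eq_iff chartV)
      ultimately show ?thesis by (simp add: XF_def chartV)
    qed
    have dW: "((chart W i \<circ> (\<lambda>t. fst (c t))) has_vector_derivative inverse (tauW (fst (c t))) *\<^sub>R X i (chart W i (fst (c t)))) (at t)"
      if i: "i \<in> idx W" "fst (c t) \<in> cdom W i" for t i
    proof -
      have "c t \<in> D2 i" using i(2) by (cases "c t") simp
      from bounded_linear.has_vector_derivative[OF bounded_linear_fst der[OF i(1) this]] show ?thesis by (simp add: o_def)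
    qed
    \<comment> \<open>The component in \<open>W\<close> determines the clock \<open>s\<close>. The
      complex component then solves a linear rotation equation with the same clock, so the whole
      curve is a reparametrised orbit of \<open>Phi\<close>.\<close>
    obtain s where s: "s 0 = 0" "\<forall>t. (s has_real_derivative inverse (tauW (fst (c t)))) (at t)" "\<forall>t. fst (c t) = phi (s t) (fst (c 0))"
      using scaled_curve_phi[OF cf dW m(2,4)] by blast
    have dz: "((\<lambda>t. snd (c t)) has_vector_derivative inverse (tauW (fst (c t))) *\<^sub>R ((2 * pi) *\<^sub>R Jmult (snd (c t)))) (at t)" for t
    proof -
      obtain i where i: "i \<in> idx W" "c t \<in> D2 i" by (rule D2_cover[OF SW[OF cS]])
      from bounded_linear.has_vector_derivative[OF bounded_linear_snd der[OF i]] show ?thesis by simp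
    qed
    have z: "snd (c t) = rot (s t) (snd (c 0))" for t
      by (rule rot_solution[where z = "\<lambda>t. snd (c t)" and s = s and t = t, OF dz s(2)[rule_format] s(1)])
    have cP: "c t = Phi (s t) p" for t
      by (rule prod_eqI) (simp_all only: Phi_def fst_conv snd_conv s(3)[rule_format, of t] z[of t] c(2))
    have "s t = B.inv_clock t p"
      by (rule B.inv_clock_unique[where s = s and t = t, OF pB s(1)]) (simp only: cP[symmetric] s(2))
    then show "q = B.changed t p" using cP[of t] c(3) unfolding B.changed_def by simp
  qed
  have "reeb_entropy TB tf = top_entropy ?B (B.changed 1)"
    unfolding reeb_entropy_def reeb_time1_def subtop_Sig
    by (rule top_entropy_cong) (use eq B.changed_in topB in auto)
  then show "ereal m * reeb_entropy TB tf \<le> ham_entropy W lam H" "ham_entropy W lam H \<le> ereal M * reeb_entropy TB tf"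
    using B.entropy_changed_le B.entropy_le_changed by (simp_all add: Phi_entropy)
qed

lemma reeb_entropy_tube_empty:
  assumes "points W = {}"
  shows "reeb_entropy TB tf = 0"
  unfolding reeb_entropy_def subtop_Sig
  by (rule top_entropy_empty) (use assms in \<open>simp add: Sig_def\<close>)

lemma ham_entropy_empty: "points W = {} \<Longrightarrow> ham_entropy W lam H = 0"
  unfolding ham_entropy_def by (rule top_entropy_empty) (simp add: points_def)

lemma reeb_entropy_empty: "points W = {} \<Longrightarrow> reeb_entropy W lam = 0"
  unfolding reeb_entropy_def by (rule top_entropy_empty) (simp add: points_def)

end

theorem corollary1p18:
  fixes W :: "('a, 'i, 'e::euclidean_space) mfd"
    and lam :: "('i, 'e) form1"
    and H :: "'a \<Rightarrow> real"
  assumes "liouville_domain W lam"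
    and "admissible W lam H"
  shows "ereal (INF p\<in>points W. tau W lam H p)
           * reeb_entropy (tube TYPE('n::finite) W H) (tube_form TYPE('n) W lam)
         \<le> ham_entropy W lam H
       \<and> ham_entropy W lam H
         \<le> ereal (SUP p\<in>points W. tau W lam H p)
           * reeb_entropy (tube TYPE('n) W H) (tube_form TYPE('n) W lam)
       \<and> (reeb_entropy W lam > 0
          \<longrightarrow> reeb_entropy (tube TYPE('n) W H) (tube_form TYPE('n) W lam) > 0)"
proof -
  interpret liouville_tube W lam H "TYPE('n)"
    by unfold_locales (rule assms)+
  show ?thesis
  proof (cases "points W = {}")
    \<comment> \<open>The infimum and supremum are then taken over the empty set and carry no
      information, but all the entropies are 0.\<close>
    case True
    then show ?thesis
      by (simp add: reeb_entropy_tube_empty ham_entropy_empty reeb_entropy_empty)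
  next
    case False
    have "compactin euclideanreal (tauW ` topspace (topo W))"
      using cpW unfolding compact_space_def by (rule image_compactin[OF _ tau_cont])
    then have cp: "compact (tauW ` points W)" by (simp add: points_def)
    have bdd: "bdd_below (tauW ` points W)" "bdd_above (tauW ` points W)"
      by (rule bounded_imp_bdd_below[OF compact_imp_bounded[OF cp]], rule bounded_imp_bdd_above[OF compact_imp_bounded[OF cp]])
    define m where "m = (INF p\<in>points W. tauW p)"
    define M where "M = (SUP p\<in>points W. tauW p)"
    have mM: "m \<le> tauW p" "tauW p \<le> M" if "p \<in> points W" for p
      using that bdd unfolding m_def M_def by (auto intro: cINF_lower cSUP_upper)
    \<comment> \<open>The minimum is attained, so pointwise positivity of \<open>tau\<close> passes
      to the infimum.\<close>
    obtain y where y: "y \<in> tauW ` points W" "\<forall>z\<in>tauW ` points W. y \<le> z"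
      using compact_attains_inf[OF cp] False by blast
    have "y \<le> m" unfolding m_def using False y(2) by (intro cINF_greatest) auto
    moreover have "y > 0" using y(1) tau_pos by auto
    ultimately have m0: "m > 0" by simp
    obtain p where "p \<in> points W" using False by blast
    then have M0: "M > 0" using mM[of p] m0 by simp
    note tube = reeb_entropy_tube[OF m0 M0 mM]
    have "reeb_entropy TB tf > 0" if pos: "reeb_entropy W lam > 0"
    proof (rule ccontr)
      assume "\<not> reeb_entropy TB tf > 0"
      then have "reeb_entropy TB tf \<le> 0" by simp
      \<comment> \<open>Finiteness of \<open>M\<close> matters here: vanishing entropy on the tube
        passes through the upper bound to \<open>H\<close>, and from there to the boundary of
        \<open>W\<close>.\<close>
      then have "ereal M * reeb_entropy TB tf \<le> ereal M * 0" using M0 by (intro ereal_mult_left_mono) auto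
      then have "ham_entropy W lam H \<le> 0" using tube(2) by simp
      then have "ereal m * reeb_entropy W lam \<le> 0" using reeb_entropy_boundary_le[OF m0 M0 mM] by simp
      moreover have "ereal m * reeb_entropy W lam > 0" using m0 pos by (simp add: ereal_zero_less_0_iff)
      ultimately show False by simp
    qed
    then show ?thesis using tube unfolding m_def M_def by blast
  qed
qed

end
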